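(* Let $p$ be a prime and let $G$ and $H$ be finite groups with $G\simeq_p H$ (that is, $G$ and $H$ are $p$-locally equivalent). Then for every $n\ge 0$ there are isomorphisms $H_n(G;\mathbb{F}_p)\cong H_n(H;\mathbb{F}_p)$ and $H^n(G;\mathbb{F}_p)\cong H^n(H;\mathbb{F}_p)$ of $\mathbb{F}_p$-vector spaces, and there is an isomorphism $H^*(G;\mathbb{F}_p)\cong H^*(H;\mathbb{F}_p)$ of graded $\mathbb{F}_p$-algebras. In other words, the homology groups, the cohomology groups and the cohomology ring with coefficients in $\mathbb{F}_p$ are $p$-local invariants.
   Context: Let $G$ be a finite group and $P,Q\le G$. A homomorphism $f\colon P\to Q$ is a $G$-subconjugation if there is $g\in G$ with $f(x)=gxg^{-1}$ for all $x\in P$. Finite groups $G$ and $H$ are $p$-locally equivalent, written $G\simeq_p H$, if there is a group isomorphism $\alpha\colon S\to R$ between some Sylow $p$-subgroup $S$ of $G$ and some Sylow $p$-subgroup $R$ of $H$ such that for all subgroups $P,Q\le S$ and every homomorphism $f\colon P\to Q$: $f$ is a $G$-subconjugation if and only if $\alpha f\alpha^{-1}\colon\alpha(P)\to\alpha(Q)$ is an $H$-subconjugation. A $p$-local invariant is an assignment sending $p$-locally equivalent finite groups to isomorphic objects. Group homology and cohomology with coefficients in the field $\mathbb{F}_p$ with $p$ elements are $H_n(G;\mathbb{F}_p)=\mathrm{Tor}_n^{\mathbb{Z}G}(\mathbb{Z},\mathbb{F}_p)$ and $H^n(G;\mathbb{F}_p)=\mathrm{Ext}^n_{\mathbb{Z}G}(\mathbb{Z},\mathbb{F}_p)$,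 where $\mathbb{Z}$ and $\mathbb{F}_p$ carry the trivial $G$-action. These are $\mathbb{F}_p$-vector spaces, and $H^*(G;\mathbb{F}_p)=\bigoplus_{n\ge0}H^n(G;\mathbb{F}_p)$ is a graded $\mathbb{F}_p$-algebra under the cup product. *)

theory Defs
  imports
    "HOL-Algebra.Free_Abelian_Groups"
    "HOL-Algebra.IntRing"
    "HOL-Number_Theory.Residues"
begin

section \<open>\<open>p\<close>-local equivalence of finite groups\<close>

definition sylow_subgroup :: "nat \<Rightarrow> ('a, 'x) monoid_scheme \<Rightarrow> 'a set \<Rightarrow> bool" where
  "sylow_subgroup p G S \<longleftrightarrow> subgroup S G \<and> card S = p ^ multiplicity p (order G)"

definition subconjugation ::
    "('a, 'x) monoid_scheme \<Rightarrow> 'a set \<Rightarrow> 'a set \<Rightarrow> ('a \<Rightarrow> 'a) \<Rightarrow> bool" where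
  "subconjugation G P Q f \<longleftrightarrow>
     f \<in> hom (G\<lparr>carrier := P\<rparr>) (G\<lparr>carrier := Q\<rparr>) \<and>
     (\<exists>g\<in>carrier G. \<forall>x\<in>P. f x = g \<otimes>\<^bsub>G\<^esub> x \<otimes>\<^bsub>G\<^esub> inv\<^bsub>G\<^esub> g)"

definition p_locally_equivalent ::
    "nat \<Rightarrow> ('a, 'x) monoid_scheme \<Rightarrow> ('b, 'y) monoid_scheme \<Rightarrow> bool" where
  "p_locally_equivalent p G H \<longleftrightarrow>
     (\<exists>S R \<alpha>. sylow_subgroup p G S \<and> sylow_subgroup p H R \<and>
        \<alpha> \<in> iso (G\<lparr>carrier := S\<rparr>) (H\<lparr>carrier := R\<rparr>) \<and>
        (\<forall>P Q f. subgroup P (G\<lparr>carrier := S\<rparr>) \<and> subgroup Q (G\<lparr>carrier := S\<rparr>) \<and>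
                 f \<in> hom (G\<lparr>carrier := P\<rparr>) (G\<lparr>carrier := Q\<rparr>) \<longrightarrow>
           (subconjugation G P Q f \<longleftrightarrow>
            subconjugation H (\<alpha> ` P) (\<alpha> ` Q) (\<lambda>y. \<alpha> (f (inv_into S \<alpha> y))))))"


section \<open>Modules over a ring that need not be commutative\<close>

text \<open>
  The library locale \<^locale>\<open>module\<close> requires a commutative ring of scalars, which group rings
  are not; the record type is reused. The fields \<open>mult\<close> and \<open>one\<close> of that record are
  irrelevant for modules and left undefined below. A right \<open>R\<close>-module is a left
  \<open>op_ring R\<close>-module, that is, \<open>r \<odot> x\<close> stands for \<open>x r\<close>.
\<close>

locale lmodule = R?: ring R + M?: abelian_group M
  for R :: "('r, 'x) ring_scheme" (structure) and M :: "('r, 'm, 'y) module_scheme" (structure) +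
  assumes lsmult_closed [simp, intro]:
      "\<lbrakk>a \<in> carrier R; x \<in> carrier M\<rbrakk> \<Longrightarrow> a \<odot>\<^bsub>M\<^esub> x \<in> carrier M"
    and lsmult_l_distr:
      "\<lbrakk>a \<in> carrier R; b \<in> carrier R; x \<in> carrier M\<rbrakk> \<Longrightarrow>
       (a \<oplus> b) \<odot>\<^bsub>M\<^esub> x = a \<odot>\<^bsub>M\<^esub> x \<oplus>\<^bsub>M\<^esub> b \<odot>\<^bsub>M\<^esub> x"
    and lsmult_r_distr:
      "\<lbrakk>a \<in> carrier R; x \<in> carrier M; y \<in> carrier M\<rbrakk> \<Longrightarrow>
       a \<odot>\<^bsub>M\<^esub> (x \<oplus>\<^bsub>M\<^esub> y) = a \<odot>\<^bsub>M\<^esub> x \<oplus>\<^bsub>M\<^esub> a \<odot>\<^bsub>M\<^esub> y"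
    and lsmult_assoc:
      "\<lbrakk>a \<in> carrier R; b \<in> carrier R; x \<in> carrier M\<rbrakk> \<Longrightarrow>
       (a \<otimes> b) \<odot>\<^bsub>M\<^esub> x = a \<odot>\<^bsub>M\<^esub> (b \<odot>\<^bsub>M\<^esub> x)"
    and lsmult_one [simp]:
      "x \<in> carrier M \<Longrightarrow> \<one> \<odot>\<^bsub>M\<^esub> x = x"

definition op_ring :: "('r, 'x) ring_scheme \<Rightarrow> ('r, 'x) ring_scheme" where
  "op_ring R = R\<lparr>monoid.mult := \<lambda>x y. y \<otimes>\<^bsub>R\<^esub> x\<rparr>"

definition lmod_hom ::
    "('r, 'x) ring_scheme \<Rightarrow> ('r, 'm) module \<Rightarrow> ('r, 'n) module \<Rightarrow> ('m \<Rightarrow> 'n) set" where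
  "lmod_hom R M N =
     {f \<in> carrier M \<rightarrow> carrier N.
        (\<forall>x\<in>carrier M. \<forall>y\<in>carrier M. f (x \<oplus>\<^bsub>M\<^esub> y) = f x \<oplus>\<^bsub>N\<^esub> f y) \<and>
        (\<forall>r\<in>carrier R. \<forall>x\<in>carrier M. f (r \<odot>\<^bsub>M\<^esub> x) = r \<odot>\<^bsub>N\<^esub> f x)}"

definition isomorphic_modules ::
    "('r, 'x) ring_scheme \<Rightarrow> ('r, 'm) module \<Rightarrow> ('r, 'n) module \<Rightarrow> bool" where
  "isomorphic_modules R M N \<longleftrightarrow>
     (\<exists>f \<in> lmod_hom R M N. bij_betw f (carrier M) (carrier N))"

definition quotient_module :: "('k, 'm) module \<Rightarrow> 'm set \<Rightarrow> ('k, 'm set) module" where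
  "quotient_module M N =
     \<lparr>carrier = a_rcosets\<^bsub>M\<^esub> N, monoid.mult = undefined, one = undefined,
      zero = N, add = (\<lambda>U V. U <+>\<^bsub>M\<^esub> V),
      smult = (\<lambda>k U. \<Union>x\<in>U. N +>\<^bsub>M\<^esub> (k \<odot>\<^bsub>M\<^esub> x))\<rparr>"

definition free_on :: "('r, 'x) ring_scheme \<Rightarrow> ('r, 'm) module \<Rightarrow> 'm set \<Rightarrow> bool" where
  "free_on R M B \<longleftrightarrow> B \<subseteq> carrier M \<and>
     (\<forall>x\<in>carrier M. \<exists>!c. c \<in> B \<rightarrow>\<^sub>E carrier R \<and> finite {b \<in> B. c b \<noteq> \<zero>\<^bsub>R\<^esub>} \<and>
        x = (\<Oplus>\<^bsub>M\<^esub>b\<in>{b \<in> B. c b \<noteq> \<zero>\<^bsub>R\<^esub>}. c b \<odot>\<^bsub>M\<^esub> b))"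

text \<open>
  A free resolution \<open>\<dots> \<longrightarrow> P 2 \<longrightarrow> P 1 \<longrightarrow> P 0 \<longrightarrow> A \<longrightarrow> 0\<close>, where \<open>d n\<close> maps \<open>P (Suc n)\<close> to \<open>P n\<close>.
\<close>

definition free_resolution ::
    "('r, 'x) ring_scheme \<Rightarrow> (nat \<Rightarrow> ('r, 'm) module) \<Rightarrow> (nat \<Rightarrow> 'm \<Rightarrow> 'm) \<Rightarrow>
     ('m \<Rightarrow> 'a) \<Rightarrow> ('r, 'a) module \<Rightarrow> bool" where
  "free_resolution R P d \<epsilon> A \<longleftrightarrow>
     lmodule R A \<and> (\<forall>n. lmodule R (P n) \<and> (\<exists>B. free_on R (P n) B)) \<and>
     (\<forall>n. d n \<in> lmod_hom R (P (Suc n)) (P n)) \<and> \<epsilon> \<in> lmod_hom R (P 0) A \<and>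
     \<epsilon> ` carrier (P 0) = carrier A \<and>
     d 0 ` carrier (P 1) = {x \<in> carrier (P 0). \<epsilon> x = \<zero>\<^bsub>A\<^esub>} \<and>
     (\<forall>n. d (Suc n) ` carrier (P (Suc (Suc n))) =
          {x \<in> carrier (P (Suc n)). d n x = \<zero>\<^bsub>P n\<^esub>})"


section \<open>Tensor products, Hom, Tor and Ext\<close>

text \<open>
  The tensor product of a right \<open>R\<close>-module \<open>M\<close> and a left \<open>R\<close>-module \<open>N\<close> is the free abelian group
  on \<open>M \<times> N\<close> modulo bilinearity. Scalars \<open>k\<close> acting on \<open>N\<close> by \<open>R\<close>-linear maps \<open>s k\<close> act on it
  by \<open>k (x \<otimes> y) = x \<otimes> s k y\<close>; the action is written down before passing to the quotient.
\<close>

definition tensor_pairs ::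
    "('r, 'm) module \<Rightarrow> ('r, 'n) module \<Rightarrow> ('k \<Rightarrow> 'n \<Rightarrow> 'n) \<Rightarrow> ('k, ('m \<times> 'n) \<Rightarrow>\<^sub>0 int) module" where
  "tensor_pairs M N s =
     \<lparr>carrier = {c. Poly_Mapping.keys c \<subseteq> carrier M \<times> carrier N},
      monoid.mult = undefined, one = undefined, zero = 0, add = (+),
      smult = (\<lambda>k. frag_extend (\<lambda>(x, y). frag_of (x, s k y)))\<rparr>"

definition tensor_relations ::
    "('r, 'x) ring_scheme \<Rightarrow> ('r, 'm) module \<Rightarrow> ('r, 'n) module \<Rightarrow> (('m \<times> 'n) \<Rightarrow>\<^sub>0 int) set" where
  "tensor_relations R M N = generate (free_Abelian_group (carrier M \<times> carrier N))
     ({frag_of (x \<oplus>\<^bsub>M\<^esub> x', y) - frag_of (x, y) - frag_of (x', y) | x x' y.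
         x \<in> carrier M \<and> x' \<in> carrier M \<and> y \<in> carrier N} \<union>
      {frag_of (x, y \<oplus>\<^bsub>N\<^esub> y') - frag_of (x, y) - frag_of (x, y') | x y y'.
         x \<in> carrier M \<and> y \<in> carrier N \<and> y' \<in> carrier N} \<union>
      {frag_of (r \<odot>\<^bsub>M\<^esub> x, y) - frag_of (x, r \<odot>\<^bsub>N\<^esub> y) | r x y.
         r \<in> carrier R \<and> x \<in> carrier M \<and> y \<in> carrier N})"

definition tensor_module ::
    "('r, 'x) ring_scheme \<Rightarrow> ('r, 'm) module \<Rightarrow> ('r, 'n) module \<Rightarrow> ('k \<Rightarrow> 'n \<Rightarrow> 'n) \<Rightarrow>
     ('k, (('m \<times> 'n) \<Rightarrow>\<^sub>0 int) set) module" where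
  "tensor_module R M N s = quotient_module (tensor_pairs M N s) (tensor_relations R M N)"

text \<open>The map \<open>f \<otimes> id\<close> into \<open>M' \<otimes> N\<close>.\<close>

definition tensor_map ::
    "('r, 'x) ring_scheme \<Rightarrow> ('r, 'm') module \<Rightarrow> ('r, 'n) module \<Rightarrow> ('k \<Rightarrow> 'n \<Rightarrow> 'n) \<Rightarrow> ('m \<Rightarrow> 'm') \<Rightarrow>
     (('m \<times> 'n) \<Rightarrow>\<^sub>0 int) set \<Rightarrow> (('m' \<times> 'n) \<Rightarrow>\<^sub>0 int) set" where
  "tensor_map R M' N s f U =
     (\<Union>c\<in>U. tensor_relations R M' N +>\<^bsub>tensor_pairs M' N s\<^esub>
              frag_extend (\<lambda>(x, y). frag_of (f x, y)) c)"

definition hom_module ::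
    "('r, 'x) ring_scheme \<Rightarrow> ('r, 'm) module \<Rightarrow> ('r, 'n) module \<Rightarrow> ('k \<Rightarrow> 'n \<Rightarrow> 'n) \<Rightarrow>
     ('k, 'm \<Rightarrow> 'n) module" where
  "hom_module R M N s =
     \<lparr>carrier = lmod_hom R M N \<inter> extensional (carrier M), monoid.mult = undefined, one = undefined,
      zero = (\<lambda>x\<in>carrier M. \<zero>\<^bsub>N\<^esub>), add = (\<lambda>f g. \<lambda>x\<in>carrier M. f x \<oplus>\<^bsub>N\<^esub> g x),
      smult = (\<lambda>k f. \<lambda>x\<in>carrier M. s k (f x))\<rparr>"

text \<open>
  Homology of a chain complex with \<open>d n\<close> mapping \<open>C (Suc n)\<close> to \<open>C n\<close>, and cohomology of a cochain
  complex with \<open>d n\<close> mapping \<open>C n\<close> to \<open>C (Suc n)\<close>.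
\<close>

definition cycles :: "(nat \<Rightarrow> ('k, 'm) module) \<Rightarrow> (nat \<Rightarrow> 'm \<Rightarrow> 'm) \<Rightarrow> nat \<Rightarrow> 'm set" where
  "cycles C d n = (case n of 0 \<Rightarrow> carrier (C 0) | Suc m \<Rightarrow> {x \<in> carrier (C n). d m x = \<zero>\<^bsub>C m\<^esub>})"

definition chain_homology ::
    "(nat \<Rightarrow> ('k, 'm) module) \<Rightarrow> (nat \<Rightarrow> 'm \<Rightarrow> 'm) \<Rightarrow> nat \<Rightarrow> ('k, 'm set) module" where
  "chain_homology C d n =
     quotient_module ((C n)\<lparr>carrier := cycles C d n\<rparr>) (d n ` carrier (C (Suc n)))"

definition cocycles :: "(nat \<Rightarrow> ('k, 'm) module) \<Rightarrow> (nat \<Rightarrow> 'm \<Rightarrow> 'm) \<Rightarrow> nat \<Rightarrow> 'm set" where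
  "cocycles C d n = {x \<in> carrier (C n). d n x = \<zero>\<^bsub>C (Suc n)\<^esub>}"

definition coboundaries :: "(nat \<Rightarrow> ('k, 'm) module) \<Rightarrow> (nat \<Rightarrow> 'm \<Rightarrow> 'm) \<Rightarrow> nat \<Rightarrow> 'm set" where
  "coboundaries C d n = (case n of 0 \<Rightarrow> {\<zero>\<^bsub>C 0\<^esub>} | Suc m \<Rightarrow> d m ` carrier (C m))"

definition cochain_cohomology ::
    "(nat \<Rightarrow> ('k, 'm) module) \<Rightarrow> (nat \<Rightarrow> 'm \<Rightarrow> 'm) \<Rightarrow> nat \<Rightarrow> ('k, 'm set) module" where
  "cochain_cohomology C d n =
     quotient_module ((C n)\<lparr>carrier := cocycles C d n\<rparr>) (coboundaries C d n)"

text \<open>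
  \<open>Tor\<^sub>n\<^sup>R(A, N)\<close> and \<open>Ext\<^sup>n\<^sub>R(A, N)\<close> computed from a projective resolution \<open>(P, d)\<close> of \<open>A\<close> by right,
  respectively left, \<open>R\<close>-modules, with the scalar action \<open>s\<close> inherited from \<open>N\<close>.
\<close>

definition Tor_module ::
    "('r, 'x) ring_scheme \<Rightarrow> (nat \<Rightarrow> ('r, 'm) module) \<Rightarrow> (nat \<Rightarrow> 'm \<Rightarrow> 'm) \<Rightarrow>
     ('r, 'n) module \<Rightarrow> ('k \<Rightarrow> 'n \<Rightarrow> 'n) \<Rightarrow> nat \<Rightarrow> ('k, (('m \<times> 'n) \<Rightarrow>\<^sub>0 int) set set) module" where
  "Tor_module R P d N s =
     chain_homology (\<lambda>n. tensor_module R (P n) N s) (\<lambda>n. tensor_map R (P n) N s (d n))"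

definition hom_complex ::
    "('r, 'x) ring_scheme \<Rightarrow> (nat \<Rightarrow> ('r, 'm) module) \<Rightarrow>
     ('r, 'n) module \<Rightarrow> ('k \<Rightarrow> 'n \<Rightarrow> 'n) \<Rightarrow> nat \<Rightarrow> ('k, 'm \<Rightarrow> 'n) module" where
  "hom_complex R P N s n = hom_module R (P n) N s"

definition hom_differential ::
    "(nat \<Rightarrow> ('r, 'm) module) \<Rightarrow> (nat \<Rightarrow> 'm \<Rightarrow> 'm) \<Rightarrow> nat \<Rightarrow> ('m \<Rightarrow> 'n) \<Rightarrow> 'm \<Rightarrow> 'n" where
  "hom_differential P d n f = (\<lambda>x\<in>carrier (P (Suc n)). f (d n x))"

definition Ext_module ::
    "('r, 'x) ring_scheme \<Rightarrow> (nat \<Rightarrow> ('r, 'm) module) \<Rightarrow> (nat \<Rightarrow> 'm \<Rightarrow> 'm) \<Rightarrow>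
     ('r, 'n) module \<Rightarrow> ('k \<Rightarrow> 'n \<Rightarrow> 'n) \<Rightarrow> nat \<Rightarrow> ('k, ('m \<Rightarrow> 'n) set) module" where
  "Ext_module R P d N s = cochain_cohomology (hom_complex R P N s) (hom_differential P d)"


section \<open>The integral group ring and the standard resolution\<close>

definition group_ring :: "('a, 'x) monoid_scheme \<Rightarrow> ('a \<Rightarrow>\<^sub>0 int) ring" where
  "group_ring G =
     \<lparr>carrier = {a. Poly_Mapping.keys a \<subseteq> carrier G},
      monoid.mult = (\<lambda>a b. frag_extend (\<lambda>x. frag_extend (\<lambda>y. frag_of (x \<otimes>\<^bsub>G\<^esub> y)) b) a),
      one = frag_of \<one>\<^bsub>G\<^esub>, zero = 0, add = (+)\<rparr>"

definition augmentation :: "('a \<Rightarrow>\<^sub>0 int) \<Rightarrow> int" where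
  "augmentation a = (\<Sum>x\<in>Poly_Mapping.keys a. Poly_Mapping.lookup a x)"

text \<open>
  An abelian group with trivial \<open>G\<close>-action; since the action is trivial this describes it both as
  a left and as a right \<open>\<int>G\<close>-module.
\<close>

definition trivial_module :: "'b ring \<Rightarrow> ('a \<Rightarrow>\<^sub>0 int, 'b) module" where
  "trivial_module A =
     \<lparr>carrier = carrier A, monoid.mult = monoid.mult A, one = one A, zero = zero A, add = add A,
      smult = (\<lambda>a x. [augmentation a] \<cdot>\<^bsub>A\<^esub> x)\<rparr>"

text \<open>
  The standard (homogeneous bar) resolution \<open>F\<^sub>n = \<int>[G\<^sup>n\<^sup>+\<^sup>1]\<close> with \<open>G\<close> acting diagonally, by left
  respectively by right multiplication. See \<open>free_resolution_std_left\<close> and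
  \<open>free_resolution_std_right\<close> below.
\<close>

definition std_left :: "('a, 'x) monoid_scheme \<Rightarrow> nat \<Rightarrow> ('a \<Rightarrow>\<^sub>0 int, 'a list \<Rightarrow>\<^sub>0 int) module" where
  "std_left G n =
     \<lparr>carrier = {c. Poly_Mapping.keys c \<subseteq> {xs. length xs = Suc n \<and> set xs \<subseteq> carrier G}},
      monoid.mult = undefined, one = undefined, zero = 0, add = (+),
      smult = (\<lambda>a c. frag_extend (\<lambda>g. frag_extend (\<lambda>xs. frag_of (map (\<lambda>x. g \<otimes>\<^bsub>G\<^esub> x) xs)) c) a)\<rparr>"

definition std_right :: "('a, 'x) monoid_scheme \<Rightarrow> nat \<Rightarrow> ('a \<Rightarrow>\<^sub>0 int, 'a list \<Rightarrow>\<^sub>0 int) module" where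
  "std_right G n =
     \<lparr>carrier = {c. Poly_Mapping.keys c \<subseteq> {xs. length xs = Suc n \<and> set xs \<subseteq> carrier G}},
      monoid.mult = undefined, one = undefined, zero = 0, add = (+),
      smult = (\<lambda>a c. frag_extend (\<lambda>g. frag_extend (\<lambda>xs. frag_of (map (\<lambda>x. x \<otimes>\<^bsub>G\<^esub> g) xs)) c) a)\<rparr>"

definition std_diff :: "nat \<Rightarrow> ('a list \<Rightarrow>\<^sub>0 int) \<Rightarrow> 'a list \<Rightarrow>\<^sub>0 int" where
  "std_diff n =
     frag_extend (\<lambda>xs. \<Sum>i\<le>Suc n. frag_cmul ((-1) ^ i) (frag_of (take i xs @ drop (Suc i) xs)))"


subsection \<open>The standard resolution is a free resolution\<close>

lemma frag_extend_fun_add: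
  "frag_extend (\<lambda>x. f x + g x) c = frag_extend f c + frag_extend g c"
  by (simp add: frag_extend_def frag_cmul_distrib2 sum.distrib)

lemma frag_extend_fun_diff:
  "frag_extend (\<lambda>x. f x - g x) c = frag_extend f c - frag_extend g c"
  using frag_extend_fun_add [of "\<lambda>x. f x - g x" g c] by simp

lemma frag_extend_fun_zero [simp]: "frag_extend (\<lambda>x. 0) c = 0"
  by (simp add: frag_extend_def)

lemma frag_extend_swap:
  "frag_extend (\<lambda>x. frag_extend (\<lambda>y. f x y) b) a = frag_extend (\<lambda>y. frag_extend (\<lambda>x. f x y) a) b"
  by (induction a rule: frag_induction [OF subset_UNIV])
     (simp_all add: frag_extend_diff frag_extend_fun_diff)

lemma frag_extend_id: "frag_extend frag_of c = c"
  by (metis frag_expansion)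

lemma keys_frag_extend_subset:
  assumes "Poly_Mapping.keys c \<subseteq> A" and "\<And>x. x \<in> A \<Longrightarrow> Poly_Mapping.keys (f x) \<subseteq> B"
  shows "Poly_Mapping.keys (frag_extend f c) \<subseteq> B"
  using keys_frag_extend [of f c] assms by blast

lemma augmentation_altdef: "augmentation c = Poly_Mapping.lookup (frag_extend (\<lambda>_. frag_of ()) c) ()"
proof -
  have "Poly_Mapping.lookup (\<Sum>i\<in>I. frag_cmul (Poly_Mapping.lookup c i) (frag_of ())) () =
        (\<Sum>i\<in>I. Poly_Mapping.lookup c i)" if "finite I" for I
    using that by (induction I) (simp_all add: lookup_add)
  then show ?thesis
    by (simp add: augmentation_def frag_extend_def)
qed

lemma augmentation_zero [simp]: "augmentation 0 = 0"
  by (simp add: augmentation_def)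

lemma augmentation_of [simp]: "augmentation (frag_of x) = 1"
  by (simp add: augmentation_altdef)

lemma augmentation_diff: "augmentation (a - b) = augmentation a - augmentation b"
  by (simp add: augmentation_altdef frag_extend_diff lookup_minus)

lemma augmentation_add: "augmentation (a + b) = augmentation a + augmentation b"
  by (simp add: augmentation_altdef frag_extend_add lookup_add)

lemma augmentation_cmul: "augmentation (frag_cmul k a) = k * augmentation a"
  by (simp add: augmentation_altdef frag_extend_cmul)

lemma abelian_group_frag:
  fixes R :: "('a \<Rightarrow>\<^sub>0 int, 'x) ring_scheme"
  assumes "carrier R = {c. Poly_Mapping.keys c \<subseteq> A}" "\<zero>\<^bsub>R\<^esub> = 0" "add R = (+)"
  shows "abelian_group R"
proof (rule abelian_groupI)
  fix x y assume "x \<in> carrier R" "y \<in> carrier R"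
  then show "x \<oplus>\<^bsub>R\<^esub> y \<in> carrier R"
    using Poly_Mapping.keys_add [of x y] assms by auto
next
  fix x assume "x \<in> carrier R"
  then have "- x \<in> carrier R" "- x \<oplus>\<^bsub>R\<^esub> x = \<zero>\<^bsub>R\<^esub>"
    using assms by auto
  then show "\<exists>y\<in>carrier R. y \<oplus>\<^bsub>R\<^esub> x = \<zero>\<^bsub>R\<^esub>" by blast
qed (use assms in \<open>auto simp: add_ac\<close>)

lemma finsum_frag:
  fixes R :: "('a \<Rightarrow>\<^sub>0 int, 'x) ring_scheme"
  assumes "carrier R = {c. Poly_Mapping.keys c \<subseteq> A}" "\<zero>\<^bsub>R\<^esub> = 0" "add R = (+)"
    and "finite I" "\<And>i. i \<in> I \<Longrightarrow> Poly_Mapping.keys (f i) \<subseteq> A"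
  shows "finsum R f I = sum f I"
proof -
  interpret abelian_group R using assms(1-3) by (rule abelian_group_frag)
  show ?thesis using assms(4,5)
  proof (induction I)
    case (insert i I)
    then have "f \<in> I \<rightarrow> carrier R" "f i \<in> carrier R"
      by (auto simp: assms(1))
    with insert show ?case
      by (simp add: assms(3))
  qed (simp add: assms(2))
qed

lemma frag_bilinear_closed:
  assumes "Poly_Mapping.keys a \<subseteq> A" "Poly_Mapping.keys b \<subseteq> B"
    and "\<And>x y. x \<in> A \<Longrightarrow> y \<in> B \<Longrightarrow> f x y \<in> C"
  shows "Poly_Mapping.keys (frag_extend (\<lambda>x. frag_extend (\<lambda>y. frag_of (f x y)) b) a) \<subseteq> C"
  using assms by (intro keys_frag_extend_subset [of _ A] keys_frag_extend_subset [of _ B]) auto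

lemma frag_bilinear_assoc:
  assumes "Poly_Mapping.keys a \<subseteq> A" "Poly_Mapping.keys b \<subseteq> B" "Poly_Mapping.keys c \<subseteq> C"
    and "\<And>x y z. x \<in> A \<Longrightarrow> y \<in> B \<Longrightarrow> z \<in> C \<Longrightarrow> f (g x y) z = h x (k y z)"
  shows "frag_extend (\<lambda>w. frag_extend (\<lambda>z. frag_of (f w z)) c)
           (frag_extend (\<lambda>x. frag_extend (\<lambda>y. frag_of (g x y)) b) a) =
         frag_extend (\<lambda>x. frag_extend (\<lambda>w. frag_of (h x w))
           (frag_extend (\<lambda>y. frag_extend (\<lambda>z. frag_of (k y z)) c) b)) a"
  using assms(1)
proof (induction a rule: frag_induction)
  case (one x)
  show ?case using assms(2)
  proof (induction b rule: frag_induction)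
    case (one y)
    show ?case using assms(3)
    proof (induction c rule: frag_induction)
      case (one z)
      with \<open>x \<in> A\<close> \<open>y \<in> B\<close> show ?case by (simp add: assms(4))
    qed (simp_all add: frag_extend_diff)
  qed (simp_all add: frag_extend_diff)
qed (simp_all add: frag_extend_diff)

context group
begin

lemma ring_group_ring: "ring (group_ring G)"
proof (rule ringI)
  show "abelian_group (group_ring G)"
    by (rule abelian_group_frag [of _ "carrier G"]) (simp_all add: group_ring_def)
  show "monoid (group_ring G)"
  proof (rule monoidI)
    fix x y z assume "x \<in> carrier (group_ring G)" "y \<in> carrier (group_ring G)" "z \<in> carrier (group_ring G)"
    then show "x \<otimes>\<^bsub>group_ring G\<^esub> y \<otimes>\<^bsub>group_ring G\<^esub> z = x \<otimes>\<^bsub>group_ring G\<^esub> (y \<otimes>\<^bsub>group_ring G\<^esub> z)"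
      unfolding group_ring_def
      by simp (rule frag_bilinear_assoc [of _ "carrier G" _ "carrier G" _ "carrier G"]; simp add: m_assoc)
  next
    fix x assume "x \<in> carrier (group_ring G)"
    then have x: "Poly_Mapping.keys x \<subseteq> carrier G" by (simp add: group_ring_def)
    then have "frag_extend (\<lambda>y. frag_of (\<one> \<otimes> y)) x = frag_extend frag_of x"
         "frag_extend (\<lambda>y. frag_of (y \<otimes> \<one>)) x = frag_extend frag_of x"
      by (intro frag_extend_eq; force)+
    then show "\<one>\<^bsub>group_ring G\<^esub> \<otimes>\<^bsub>group_ring G\<^esub> x = x" "x \<otimes>\<^bsub>group_ring G\<^esub> \<one>\<^bsub>group_ring G\<^esub> = x"
      by (simp_all add: group_ring_def frag_extend_id)
  next
    fix x y assume "x \<in> carrier (group_ring G)" "y \<in> carrier (group_ring G)"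
    then show "x \<otimes>\<^bsub>group_ring G\<^esub> y \<in> carrier (group_ring G)"
      unfolding group_ring_def
      by simp (rule frag_bilinear_closed [of _ "carrier G" _ "carrier G"]; simp)
  qed (simp add: group_ring_def)
qed (simp_all add: group_ring_def frag_extend_add frag_extend_fun_add)

lemma lmodule_std_left: "lmodule (group_ring G) (std_left G n)"
proof -
  interpret R: ring "group_ring G" by (rule ring_group_ring)
  interpret M: abelian_group "std_left G n"
    by (rule abelian_group_frag [of _ "{xs. length xs = Suc n \<and> set xs \<subseteq> carrier G}"])
       (simp_all add: std_left_def)
  show ?thesis
  proof
    fix a c assume "a \<in> carrier (group_ring G)" "c \<in> carrier (std_left G n)"
    then show "a \<odot>\<^bsub>std_left G n\<^esub> c \<in> carrier (std_left G n)"
      unfolding std_left_def group_ring_def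
      by simp (rule frag_bilinear_closed [of _ "carrier G" _ "{xs. length xs = Suc n \<and> set xs \<subseteq> carrier G}"];
          auto)
  next
    fix a b c assume "a \<in> carrier (group_ring G)" "b \<in> carrier (group_ring G)" "c \<in> carrier (std_left G n)"
    then show "(a \<otimes>\<^bsub>group_ring G\<^esub> b) \<odot>\<^bsub>std_left G n\<^esub> c = a \<odot>\<^bsub>std_left G n\<^esub> (b \<odot>\<^bsub>std_left G n\<^esub> c)"
      unfolding std_left_def group_ring_def
      by simp (rule frag_bilinear_assoc [of _ "carrier G" _ "carrier G" _ "{xs. length xs = Suc n \<and> set xs \<subseteq> carrier G}"];
          auto simp: m_assoc subset_iff)
  next
    fix c assume "c \<in> carrier (std_left G n)"
    then have c: "Poly_Mapping.keys c \<subseteq> {xs. length xs = Suc n \<and> set xs \<subseteq> carrier G}"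
      by (simp add: std_left_def)
    have "frag_extend (\<lambda>xs. frag_of (map (\<lambda>x. \<one> \<otimes> x) xs)) c = frag_extend frag_of c"
    proof (rule frag_extend_eq)
      fix xs assume "xs \<in> Poly_Mapping.keys c"
      then have "set xs \<subseteq> carrier G" using c by auto
      then have "map (\<lambda>x. \<one> \<otimes> x) xs = xs" by (intro map_idI) auto
      then show "frag_of (map (\<lambda>x. \<one> \<otimes> x) xs) = frag_of xs" by simp
    qed
    then show "\<one>\<^bsub>group_ring G\<^esub> \<odot>\<^bsub>std_left G n\<^esub> c = c"
      by (simp add: std_left_def group_ring_def frag_extend_id)
  qed (simp_all add: std_left_def group_ring_def frag_extend_add frag_extend_fun_add)
qed

end

subsubsection \<open>Exactness\<close>

text \<open>All boundary maps at once, including the augmentation as the boundary of lists of length 1.\<close>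

definition list_boundary :: "'a list \<Rightarrow> 'a list \<Rightarrow>\<^sub>0 int" where
  "list_boundary xs = (\<Sum>i<length xs. frag_cmul ((-1) ^ i) (frag_of (take i xs @ drop (Suc i) xs)))"

abbreviation cone :: "'a \<Rightarrow> ('a list \<Rightarrow>\<^sub>0 int) \<Rightarrow> ('a list \<Rightarrow>\<^sub>0 int)" where
  "cone x \<equiv> frag_extend (\<lambda>xs. frag_of (x # xs))"

lemma list_boundary_Nil [simp]: "list_boundary [] = 0"
  by (simp add: list_boundary_def)

lemma list_boundary_Cons: "list_boundary (x # xs) = frag_of xs - cone x (list_boundary xs)"
  by (simp add: list_boundary_def sum.lessThan_Suc_shift frag_extend_sum frag_extend_cmul o_def
      sum_negf [symmetric] del: sum.lessThan_Suc)

lemma boundary_cone: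
  "frag_extend list_boundary (cone x c) = c - cone x (frag_extend list_boundary c)"
  by (induction c rule: frag_induction [OF subset_UNIV])
     (simp_all add: frag_extend_diff list_boundary_Cons)

lemma boundary_boundary: "frag_extend list_boundary (frag_extend list_boundary c) = 0"
proof (induction c rule: frag_induction [OF subset_UNIV])
  case (2 xs)
  show ?case
    by simp (induction xs, simp_all add: list_boundary_Cons frag_extend_diff boundary_cone)
qed (simp_all add: frag_extend_diff)

lemma std_diff_eq:
  assumes "Poly_Mapping.keys c \<subseteq> {xs. length xs = Suc (Suc n) \<and> set xs \<subseteq> A}"
  shows "std_diff n c = frag_extend list_boundary c"
  unfolding std_diff_def
  by (rule frag_extend_eq) (use assms in \<open>auto simp: list_boundary_def lessThan_Suc_atMost\<close>)

lemma augmentation_eq: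
  assumes "Poly_Mapping.keys c \<subseteq> {xs. length xs = Suc 0 \<and> set xs \<subseteq> A}"
  shows "frag_extend list_boundary c = frag_cmul (augmentation c) (frag_of [])"
  using assms
proof (induction c rule: frag_induction)
  case (one xs)
  then show ?case by (auto simp: length_Suc_conv list_boundary_Cons)
qed (simp_all add: frag_extend_diff augmentation_diff frag_cmul_diff_distrib)

lemma list_boundary_closed:
  assumes "set xs \<subseteq> A"
  shows "Poly_Mapping.keys (list_boundary xs) \<subseteq> {ys. length ys = length xs - 1 \<and> set ys \<subseteq> A}"
proof
  fix ys assume "ys \<in> Poly_Mapping.keys (list_boundary xs)"
  then obtain i where i: "i < length xs"
      "ys \<in> Poly_Mapping.keys (frag_cmul ((-1) ^ i) (frag_of (take i xs @ drop (Suc i) xs)))"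
    unfolding list_boundary_def using Poly_Mapping.keys_sum [of "\<lambda>i. frag_cmul ((-1) ^ i) (frag_of (take i xs @ drop (Suc i) xs))" "{..<length xs}"]
    by blast
  then have "ys = take i xs @ drop (Suc i) xs" by auto
  with i(1) assms show "ys \<in> {ys. length ys = length xs - 1 \<and> set ys \<subseteq> A}"
    by (auto dest: in_set_takeD in_set_dropD)
qed

lemma boundary_closed:
  assumes "Poly_Mapping.keys c \<subseteq> {xs. length xs = Suc n \<and> set xs \<subseteq> A}"
  shows "Poly_Mapping.keys (frag_extend list_boundary c) \<subseteq> {xs. length xs = n \<and> set xs \<subseteq> A}"
proof (rule keys_frag_extend_subset [OF assms])
  fix xs assume "xs \<in> {xs. length xs = Suc n \<and> set xs \<subseteq> A}"
  then show "Poly_Mapping.keys (list_boundary xs) \<subseteq> {xs. length xs = n \<and> set xs \<subseteq> A}"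
    using list_boundary_closed [of xs A] by auto
qed

lemma boundary_exact:
  assumes "Poly_Mapping.keys c \<subseteq> {xs. length xs = n \<and> set xs \<subseteq> A}" "x \<in> A"
    and "frag_extend list_boundary c = 0"
  shows "\<exists>b. Poly_Mapping.keys b \<subseteq> {xs. length xs = Suc n \<and> set xs \<subseteq> A} \<and> frag_extend list_boundary b = c"
proof (intro exI conjI)
  show "Poly_Mapping.keys (cone x c) \<subseteq> {xs. length xs = Suc n \<and> set xs \<subseteq> A}"
    by (rule keys_frag_extend_subset [OF assms(1)]) (use assms(2) in auto)
  show "frag_extend list_boundary (cone x c) = c"
    by (simp add: boundary_cone assms(3))
qed

lemma list_boundary_map: "list_boundary (map f xs) = frag_extend (\<lambda>xs. frag_of (map f xs)) (list_boundary xs)"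
  by (simp add: list_boundary_def frag_extend_sum frag_extend_cmul o_def take_map drop_map)

lemma boundary_equivariant:
  "frag_extend list_boundary (frag_extend (\<lambda>g. frag_extend (\<lambda>xs. frag_of (map (f g) xs)) c) a) =
   frag_extend (\<lambda>g. frag_extend (\<lambda>xs. frag_of (map (f g) xs)) (frag_extend list_boundary c)) a"
proof (induction a rule: frag_induction [OF subset_UNIV])
  case (2 g)
  show ?case
    by (induction c rule: frag_induction [OF subset_UNIV])
       (simp_all add: frag_extend_diff list_boundary_map)
qed (simp_all add: frag_extend_diff)

lemma augmentation_bilinear:
  "augmentation (frag_extend (\<lambda>x. frag_extend (\<lambda>y. frag_of (f x y)) b) a) = augmentation a * augmentation b"
proof (induction a rule: frag_induction [OF subset_UNIV])
  case (2 x)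
  show ?case
    by (induction b rule: frag_induction [OF subset_UNIV])
       (simp_all add: frag_extend_diff augmentation_diff)
qed (simp_all add: frag_extend_diff augmentation_diff left_diff_distrib)

lemma int_ring_add_pow: "[(k::int)] \<cdot>\<^bsub>\<Z>\<^esub> x = k * x"
proof -
  interpret A: group "add_monoid \<Z>" using abelian_group.a_group [OF int.abelian_group_axioms] .
  have add: "[(a + b)] \<cdot>\<^bsub>\<Z>\<^esub> x = [a] \<cdot>\<^bsub>\<Z>\<^esub> x + [b] \<cdot>\<^bsub>\<Z>\<^esub> x" for a b :: int
    using A.int_pow_mult [of x a b] by (simp add: add_pow_def)
  have one: "[(1::int)] \<cdot>\<^bsub>\<Z>\<^esub> x = x"
    using A.int_pow_1 [of x] by (simp add: add_pow_def)
  show ?thesis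
  proof (induction k rule: int_induct [where k = 0])
    case base
    show ?case using int_pow_0 [of "add_monoid \<Z>" x] by (simp add: add_pow_def)
  next
    case (step1 i)
    then show ?case using add [of i 1] one by (simp add: algebra_simps)
  next
    case (step2 i)
    then show ?case using add [of "i - 1" 1] one by (simp add: algebra_simps)
  qed
qed


subsubsection \<open>Freeness and the main facts\<close>

context group
begin

definition simplices :: "nat \<Rightarrow> 'a list set" where
  "simplices n = {xs. length xs = Suc n \<and> set xs \<subseteq> carrier G}"

definition normalized :: "'a list \<Rightarrow> 'a list" where
  "normalized xs = map (\<lambda>x. inv (hd xs) \<otimes> x) xs"

lemma simplices_nonempty: "xs \<in> simplices n \<Longrightarrow> xs \<noteq> []"
  by (auto simp: simplices_def)

lemma hd_simplices: "xs \<in> simplices n \<Longrightarrow> hd xs \<in> carrier G"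
  using simplices_nonempty hd_in_set unfolding simplices_def by blast

lemma translate_simplices: "xs \<in> simplices n \<Longrightarrow> g \<in> carrier G \<Longrightarrow> map (\<lambda>x. g \<otimes> x) xs \<in> simplices n"
  by (auto simp: simplices_def)

lemma normalized_simplices: "xs \<in> simplices n \<Longrightarrow> normalized xs \<in> simplices n"
  unfolding normalized_def by (simp add: translate_simplices hd_simplices)

lemma hd_normalized: "xs \<in> simplices n \<Longrightarrow> hd (normalized xs) = \<one>"
  using simplices_nonempty hd_simplices by (simp add: normalized_def hd_map)

lemma translate_normalized:
  assumes "xs \<in> simplices n" shows "map (\<lambda>x. hd xs \<otimes> x) (normalized xs) = xs"
proof -
  have "hd xs \<otimes> (inv (hd xs) \<otimes> x) = x" if "x \<in> set xs" for x
    using that assms hd_simplices [OF assms]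
    by (auto simp: simplices_def m_assoc [symmetric] subset_iff)
  then show ?thesis
    by (simp add: normalized_def o_def map_idI)
qed

lemma normalized_translate:
  assumes "xs \<in> simplices n" "hd xs = \<one>" "g \<in> carrier G"
  shows "normalized (map (\<lambda>x. g \<otimes> x) xs) = xs" "hd (map (\<lambda>x. g \<otimes> x) xs) = g"
proof -
  show hd: "hd (map (\<lambda>x. g \<otimes> x) xs) = g"
    using assms simplices_nonempty by (simp add: hd_map)
  have "inv g \<otimes> (g \<otimes> x) = x" if "x \<in> set xs" for x
    using that assms by (auto simp: simplices_def m_assoc [symmetric] subset_iff)
  then show "normalized (map (\<lambda>x. g \<otimes> x) xs) = xs"
    unfolding normalized_def hd by (simp add: o_def map_idI)
qed

lemma carrier_std_left: "carrier (std_left G n) = {c. Poly_Mapping.keys c \<subseteq> simplices n}"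
  by (simp add: std_left_def simplices_def)

lemma lookup_smult_normalized:
  assumes "Poly_Mapping.keys a \<subseteq> carrier G" "xs \<in> simplices n" "hd xs = \<one>" "zs \<in> simplices n"
  shows "Poly_Mapping.lookup (a \<odot>\<^bsub>std_left G n\<^esub> frag_of xs) zs =
         (if xs = normalized zs then Poly_Mapping.lookup a (hd zs) else 0)"
proof -
  have "Poly_Mapping.lookup (frag_extend (\<lambda>g. frag_of (map (\<lambda>x. g \<otimes> x) xs)) a) zs =
        (if xs = normalized zs then Poly_Mapping.lookup a (hd zs) else 0)"
    using assms(1)
  proof (induction a rule: frag_induction)
    case (one g)
    have "zs = map (\<lambda>x. g \<otimes> x) xs \<longleftrightarrow> xs = normalized zs \<and> hd zs = g"
      using normalized_translate [OF assms(2,3) one] translate_normalized [OF assms(4)] by metis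
    then show ?case by auto
  qed (auto simp: frag_extend_diff lookup_minus)
  then show ?thesis by (simp add: std_left_def)
qed

lemma lookup_combination:
  assumes c: "c \<in> B \<rightarrow>\<^sub>E carrier (group_ring G)" "finite {b \<in> B. c b \<noteq> 0}"
    and B: "B = frag_of ` {xs \<in> simplices n. hd xs = \<one>}" and zs: "zs \<in> simplices n"
  shows "Poly_Mapping.lookup (\<Oplus>\<^bsub>std_left G n\<^esub>b\<in>{b \<in> B. c b \<noteq> 0}. c b \<odot>\<^bsub>std_left G n\<^esub> b) zs =
         Poly_Mapping.lookup (c (frag_of (normalized zs))) (hd zs)"
proof -
  interpret M: lmodule "group_ring G" "std_left G n" by (rule lmodule_std_left)
  have cB: "Poly_Mapping.keys (c b) \<subseteq> carrier G" if "b \<in> B" for b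
    using c(1) that by (auto simp: group_ring_def PiE_iff)
  have closed: "c b \<odot>\<^bsub>std_left G n\<^esub> b \<in> carrier (std_left G n)" if "b \<in> B" for b
    using c(1) that by (intro M.lsmult_closed) (auto simp: B carrier_std_left)
  have "(\<Oplus>\<^bsub>std_left G n\<^esub>b\<in>{b \<in> B. c b \<noteq> 0}. c b \<odot>\<^bsub>std_left G n\<^esub> b) =
        (\<Sum>b\<in>{b \<in> B. c b \<noteq> 0}. c b \<odot>\<^bsub>std_left G n\<^esub> b)"
    using closed c(2) carrier_std_left
    by (intro finsum_frag [of _ "simplices n"]) (auto simp: std_left_def simplices_def)
  then have "Poly_Mapping.lookup (\<Oplus>\<^bsub>std_left G n\<^esub>b\<in>{b \<in> B. c b \<noteq> 0}. c b \<odot>\<^bsub>std_left G n\<^esub> b) zs =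
        (\<Sum>b\<in>{b \<in> B. c b \<noteq> 0}. Poly_Mapping.lookup (c b \<odot>\<^bsub>std_left G n\<^esub> b) zs)"
    by (simp add: lookup_sum)
  also have "\<dots> = (\<Sum>b\<in>{b \<in> B. c b \<noteq> 0}.
      if b = frag_of (normalized zs) then Poly_Mapping.lookup (c b) (hd zs) else 0)"
  proof (rule sum.cong [OF refl])
    fix b assume b: "b \<in> {b \<in> B. c b \<noteq> 0}"
    then obtain xs where xs: "b = frag_of xs" "xs \<in> simplices n" "hd xs = \<one>" by (auto simp: B)
    have "Poly_Mapping.keys (c b) \<subseteq> carrier G" using b cB by blast
    from lookup_smult_normalized [OF this xs(2,3) zs]
    show "Poly_Mapping.lookup (c b \<odot>\<^bsub>std_left G n\<^esub> b) zs =
        (if b = frag_of (normalized zs) then Poly_Mapping.lookup (c b) (hd zs) else 0)"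
      by (simp add: xs(1) frag_of_eq)
  qed
  also have "\<dots> = (if frag_of (normalized zs) \<in> {b \<in> B. c b \<noteq> 0}
      then Poly_Mapping.lookup (c (frag_of (normalized zs))) (hd zs) else 0)"
    by (rule sum.delta) (rule c(2))
  also have "\<dots> = Poly_Mapping.lookup (c (frag_of (normalized zs))) (hd zs)"
    using normalized_simplices [OF zs] hd_normalized [OF zs] by (auto simp: B)
  finally show ?thesis .
qed

lemma free_std_left: "free_on (group_ring G) (std_left G n) (frag_of ` {xs \<in> simplices n. hd xs = \<one>})"
proof -
  define B where "B = (frag_of ` {xs \<in> simplices n. hd xs = \<one>} :: ('a list \<Rightarrow>\<^sub>0 int) set)"
  interpret M: lmodule "group_ring G" "std_left G n" by (rule lmodule_std_left)
  have zero: "\<zero>\<^bsub>group_ring G\<^esub> = 0" by (simp add: group_ring_def)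
  have "\<exists>!c. c \<in> B \<rightarrow>\<^sub>E carrier (group_ring G) \<and> finite {b \<in> B. c b \<noteq> 0} \<and>
        x = (\<Oplus>\<^bsub>std_left G n\<^esub>b\<in>{b \<in> B. c b \<noteq> 0}. c b \<odot>\<^bsub>std_left G n\<^esub> b)"
    if x: "x \<in> carrier (std_left G n)" for x
  proof (rule ex_ex1I)
    define c where "c = (\<lambda>b\<in>B. frag_extend
      (\<lambda>zs. if frag_of (normalized zs) = b then frag_of (hd zs) else 0) x)"
    have keys: "Poly_Mapping.keys x \<subseteq> simplices n" using x by (simp add: carrier_std_left)
    have c: "c \<in> B \<rightarrow>\<^sub>E carrier (group_ring G)"
    proof (rule PiE_I)
      fix b assume "b \<in> B"
      moreover have "Poly_Mapping.keys (frag_extend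
          (\<lambda>zs. if frag_of (normalized zs) = b then frag_of (hd zs) else 0) x) \<subseteq> carrier G"
        by (rule keys_frag_extend_subset [OF keys]) (auto dest: hd_simplices)
      ultimately show "c b \<in> carrier (group_ring G)"
        by (simp add: c_def group_ring_def)
    qed (simp add: c_def)
    have "{b \<in> B. c b \<noteq> 0} \<subseteq> (\<lambda>zs. frag_of (normalized zs)) ` Poly_Mapping.keys x"
    proof
      fix b assume b: "b \<in> {b \<in> B. c b \<noteq> 0}"
      show "b \<in> (\<lambda>zs. frag_of (normalized zs)) ` Poly_Mapping.keys x"
      proof (rule ccontr)
        assume "b \<notin> (\<lambda>zs. frag_of (normalized zs)) ` Poly_Mapping.keys x"
        then have "frag_extend (\<lambda>zs. if frag_of (normalized zs) = b then frag_of (hd zs) else 0) x = 0"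
          by (intro frag_extend_eq_0) auto
        with b show False by (auto simp: c_def)
      qed
    qed
    then have fin: "finite {b \<in> B. c b \<noteq> 0}"
      by (rule finite_subset) simp
    have "c b \<odot>\<^bsub>std_left G n\<^esub> b \<in> carrier (std_left G n)" if "b \<in> B" for b
      using c that by (intro M.lsmult_closed) (auto simp: B_def carrier_std_left)
    then have closed: "(\<Oplus>\<^bsub>std_left G n\<^esub>b\<in>{b \<in> B. c b \<noteq> 0}. c b \<odot>\<^bsub>std_left G n\<^esub> b) \<in> carrier (std_left G n)"
      by (intro M.finsum_closed) auto
    have "x = (\<Oplus>\<^bsub>std_left G n\<^esub>b\<in>{b \<in> B. c b \<noteq> 0}. c b \<odot>\<^bsub>std_left G n\<^esub> b)"
    proof (rule poly_mapping_eqI)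
      fix zs
      show "Poly_Mapping.lookup x zs =
            Poly_Mapping.lookup (\<Oplus>\<^bsub>std_left G n\<^esub>b\<in>{b \<in> B. c b \<noteq> 0}. c b \<odot>\<^bsub>std_left G n\<^esub> b) zs"
      proof (cases "zs \<in> simplices n")
        case True
        have "Poly_Mapping.lookup (frag_extend
            (\<lambda>ys. if frag_of (normalized ys) = (frag_of (normalized zs) :: 'a list \<Rightarrow>\<^sub>0 int)
                  then frag_of (hd ys) else 0) x) (hd zs) = Poly_Mapping.lookup x zs"
          using keys
        proof (induction x rule: frag_induction)
          case (one ys)
          have "ys = zs" if "normalized ys = normalized zs" "hd ys = hd zs"
            using translate_normalized [OF one] translate_normalized [OF True] that by metis
          then show ?case by (cases "ys = zs") (auto simp: frag_of_eq)
        qed (simp_all add: frag_extend_diff lookup_minus)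
        moreover have "frag_of (normalized zs) \<in> B"
          using normalized_simplices [OF True] hd_normalized [OF True] by (auto simp: B_def)
        ultimately show ?thesis
          using lookup_combination [OF c fin B_def True] by (simp add: c_def)
      next
        case False
        then show ?thesis using keys closed
          by (metis (no_types, lifting) carrier_std_left mem_Collect_eq not_in_keys_iff_lookup_eq_zero subsetD)
      qed
    qed
    with c fin show "\<exists>c. c \<in> B \<rightarrow>\<^sub>E carrier (group_ring G) \<and> finite {b \<in> B. c b \<noteq> 0} \<and>
        x = (\<Oplus>\<^bsub>std_left G n\<^esub>b\<in>{b \<in> B. c b \<noteq> 0}. c b \<odot>\<^bsub>std_left G n\<^esub> b)"
      by blast
  next
    fix c c'
    assume c: "c \<in> B \<rightarrow>\<^sub>E carrier (group_ring G) \<and> finite {b \<in> B. c b \<noteq> 0} \<and>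
        x = (\<Oplus>\<^bsub>std_left G n\<^esub>b\<in>{b \<in> B. c b \<noteq> 0}. c b \<odot>\<^bsub>std_left G n\<^esub> b)"
      and c': "c' \<in> B \<rightarrow>\<^sub>E carrier (group_ring G) \<and> finite {b \<in> B. c' b \<noteq> 0} \<and>
        x = (\<Oplus>\<^bsub>std_left G n\<^esub>b\<in>{b \<in> B. c' b \<noteq> 0}. c' b \<odot>\<^bsub>std_left G n\<^esub> b)"
    show "c = c'"
    proof (rule PiE_ext)
      show "c \<in> B \<rightarrow>\<^sub>E carrier (group_ring G)" "c' \<in> B \<rightarrow>\<^sub>E carrier (group_ring G)"
        using c c' by blast+
      fix b assume b: "b \<in> B"
      then obtain xs where xs: "b = frag_of xs" "xs \<in> simplices n" "hd xs = \<one>" by (auto simp: B_def)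
      show "c b = c' b"
      proof (rule poly_mapping_eqI)
        fix g
        show "Poly_Mapping.lookup (c b) g = Poly_Mapping.lookup (c' b) g"
        proof (cases "g \<in> carrier G")
          case True
          note N = normalized_translate [OF xs(2,3) True]
          have "Poly_Mapping.lookup x (map (\<lambda>x. g \<otimes> x) xs) = Poly_Mapping.lookup (c b) g"
            using lookup_combination [OF _ _ B_def translate_simplices [OF xs(2) True], of c] c N xs(1)
            by simp
          moreover have "Poly_Mapping.lookup x (map (\<lambda>x. g \<otimes> x) xs) = Poly_Mapping.lookup (c' b) g"
            using lookup_combination [OF _ _ B_def translate_simplices [OF xs(2) True], of c'] c' N xs(1)
            by simp
          ultimately show ?thesis by simp
        next
          case False
          have "Poly_Mapping.keys (c b) \<subseteq> carrier G" "Poly_Mapping.keys (c' b) \<subseteq> carrier G"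
            using c c' b by (auto simp: group_ring_def PiE_iff)
          with False show ?thesis
            by (metis not_in_keys_iff_lookup_eq_zero subsetD)
        qed
      qed
    qed
  qed
  moreover have "B \<subseteq> carrier (std_left G n)"
    by (auto simp: B_def carrier_std_left)
  ultimately show ?thesis
    unfolding free_on_def zero B_def [symmetric] by blast
qed

lemma free_resolution_std_left:
  "free_resolution (group_ring G) (std_left G) std_diff augmentation (trivial_module \<Z>)"
proof -
  interpret R: ring "group_ring G" by (rule ring_group_ring)
  interpret Z: abelian_group "trivial_module \<Z> :: ('a \<Rightarrow>\<^sub>0 int, int) module"
    by (rule abelian_groupI) (auto simp: trivial_module_def intro: exI [of _ "- x" for x :: int])
  have carrier: "carrier (std_left G n) = {c. Poly_Mapping.keys c \<subseteq> {xs. length xs = Suc n \<and> set xs \<subseteq> carrier G}}" for n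
    by (simp add: std_left_def)
  have diff: "std_diff n c = frag_extend list_boundary c" if "c \<in> carrier (std_left G (Suc n))" for n c
    using that std_diff_eq by (auto simp: carrier)
  have aug: "augmentation c = 0 \<longleftrightarrow> frag_extend list_boundary c = 0" if "c \<in> carrier (std_left G 0)" for c
    using that augmentation_eq [of c "carrier G"] by (simp add: carrier)
  have smult: "a \<odot>\<^bsub>std_left G n\<^esub> c = frag_extend (\<lambda>g. frag_extend (\<lambda>xs. frag_of (map (\<lambda>x. g \<otimes> x) xs)) c) a" for a c n
    by (simp add: std_left_def)
  have ops: "x \<oplus>\<^bsub>std_left G n\<^esub> y = x + y" "\<zero>\<^bsub>std_left G n\<^esub> = 0" for x y n
    by (simp_all add: std_left_def)
  have closed: "std_diff n c \<in> carrier (std_left G n)" if "c \<in> carrier (std_left G (Suc n))" for n c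
    using that boundary_closed [of c "Suc n" "carrier G"] by (simp add: diff carrier)
  have exact: "\<exists>b \<in> carrier (std_left G (Suc n)). std_diff n b = c"
    if "c \<in> carrier (std_left G n)" "frag_extend list_boundary c = 0" for n c
    using that boundary_exact [of c "Suc n" "carrier G" \<one>] diff [of _ n] by (auto simp: carrier)
  have lmZ: "lmodule (group_ring G) (trivial_module \<Z> :: ('a \<Rightarrow>\<^sub>0 int, int) module)"
    by unfold_locales
       (simp_all add: trivial_module_def group_ring_def int_ring_add_pow augmentation_add
          augmentation_bilinear algebra_simps)
  have hom: "std_diff n \<in> lmod_hom (group_ring G) (std_left G (Suc n)) (std_left G n)" for n
  proof -
    interpret M: lmodule "group_ring G" "std_left G (Suc n)" by (rule lmodule_std_left)
    show ?thesis
      unfolding lmod_hom_def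
    proof (intro CollectI conjI ballI Pi_I)
      fix x y assume "x \<in> carrier (std_left G (Suc n))" "y \<in> carrier (std_left G (Suc n))"
      then show "std_diff n (x \<oplus>\<^bsub>std_left G (Suc n)\<^esub> y) = std_diff n x \<oplus>\<^bsub>std_left G n\<^esub> std_diff n y"
        using M.a_closed [of x y] by (simp add: diff ops frag_extend_add)
    next
      fix r x assume "r \<in> carrier (group_ring G)" "x \<in> carrier (std_left G (Suc n))"
      then show "std_diff n (r \<odot>\<^bsub>std_left G (Suc n)\<^esub> x) = r \<odot>\<^bsub>std_left G n\<^esub> std_diff n x"
        using M.lsmult_closed [of r x] by (simp add: diff) (simp add: smult boundary_equivariant)
    qed (rule closed)
  qed
  have hom0: "augmentation \<in> lmod_hom (group_ring G) (std_left G 0) (trivial_module \<Z>)"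
    by (simp add: lmod_hom_def trivial_module_def int_ring_add_pow ops smult augmentation_add
        augmentation_bilinear)
  have "k \<in> augmentation ` carrier (std_left G 0)" for k
  proof
    show "k = augmentation (frag_cmul k (frag_of [\<one>]))" by (simp add: augmentation_cmul)
    show "frag_cmul k (frag_of [\<one>]) \<in> carrier (std_left G 0)"
      using keys_cmul [of k "frag_of [\<one>]"] by (auto simp: carrier)
  qed
  then have surj: "augmentation ` carrier (std_left G 0) = carrier (trivial_module \<Z> :: ('a \<Rightarrow>\<^sub>0 int, int) module)"
    by (auto simp: trivial_module_def)
  have exact0: "std_diff 0 ` carrier (std_left G 1) =
      {x \<in> carrier (std_left G 0). augmentation x = \<zero>\<^bsub>(trivial_module \<Z> :: ('a \<Rightarrow>\<^sub>0 int, int) module)\<^esub>}"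
  proof -
    have "augmentation (std_diff 0 c) = 0" if "c \<in> carrier (std_left G (Suc 0))" for c
      using closed [OF that] by (simp add: aug diff [OF that] boundary_boundary)
    moreover have "c \<in> std_diff 0 ` carrier (std_left G 1)"
      if "c \<in> carrier (std_left G 0)" "augmentation c = 0" for c
      using exact [OF that(1)] that by (auto simp: aug)
    ultimately show ?thesis
      using closed [of _ 0] by (auto simp: trivial_module_def)
  qed
  have exactS: "std_diff (Suc n) ` carrier (std_left G (Suc (Suc n))) =
      {x \<in> carrier (std_left G (Suc n)). std_diff n x = \<zero>\<^bsub>std_left G n\<^esub>}" for n
  proof -
    have "std_diff n (std_diff (Suc n) c) = 0" if "c \<in> carrier (std_left G (Suc (Suc n)))" for c
      using diff [OF closed [OF that]] by (simp add: diff [OF that] boundary_boundary)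
    moreover have "c \<in> std_diff (Suc n) ` carrier (std_left G (Suc (Suc n)))"
      if "c \<in> carrier (std_left G (Suc n))" "std_diff n c = 0" for c
      using exact [OF that(1)] that by (auto simp: diff)
    ultimately show ?thesis
      using closed [of _ "Suc n"] by (auto simp: ops)
  qed
  show ?thesis
    unfolding free_resolution_def
    using lmZ lmodule_std_left free_std_left hom hom0 surj exact0 exactS by blast
qed

lemma free_resolution_std_right:
  "free_resolution (op_ring (group_ring G)) (std_right G) std_diff augmentation (trivial_module \<Z>)"
proof -
  define G' where "G' = G\<lparr>monoid.mult := \<lambda>x y. y \<otimes> x\<rparr>"
  have "group G'"
  proof (rule groupI)
    fix x assume "x \<in> carrier G'"
    then have "inv x \<in> carrier G'" "inv x \<otimes>\<^bsub>G'\<^esub> x = \<one>\<^bsub>G'\<^esub>" by (simp_all add: G'_def)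
    then show "\<exists>y\<in>carrier G'. y \<otimes>\<^bsub>G'\<^esub> x = \<one>\<^bsub>G'\<^esub>" by blast
  qed (simp_all add: G'_def m_assoc)
  moreover have "op_ring (group_ring G) = group_ring G'"
    by (simp add: op_ring_def group_ring_def G'_def frag_extend_swap [where f = "\<lambda>x y. frag_of (x \<otimes> y)"])
  moreover have "std_right G = std_left G'"
    by (simp add: fun_eq_iff std_right_def std_left_def G'_def)
  ultimately show ?thesis
    using group.free_resolution_std_left [of G'] by simp
qed

end


section \<open>Homology, cohomology and the cohomology algebra with coefficients in \<open>\<F>\<^sub>p\<close>\<close>

abbreviation Fp :: "nat \<Rightarrow> int ring" where
  "Fp p \<equiv> residue_ring (int p)"

definition group_homology ::
    "nat \<Rightarrow> ('a, 'x) monoid_scheme \<Rightarrow> nat \<Rightarrow>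
     (int, ((('a list \<Rightarrow>\<^sub>0 int) \<times> int) \<Rightarrow>\<^sub>0 int) set set) module" where
  "group_homology p G =
     Tor_module (group_ring G) (std_right G) std_diff (trivial_module (Fp p)) (monoid.mult (Fp p))"

definition group_cohomology ::
    "nat \<Rightarrow> ('a, 'x) monoid_scheme \<Rightarrow> nat \<Rightarrow> (int, (('a list \<Rightarrow>\<^sub>0 int) \<Rightarrow> int) set) module" where
  "group_cohomology p G =
     Ext_module (group_ring G) (std_left G) std_diff (trivial_module (Fp p)) (monoid.mult (Fp p))"

abbreviation group_cochains ::
    "nat \<Rightarrow> ('a, 'x) monoid_scheme \<Rightarrow> nat \<Rightarrow> (int, ('a list \<Rightarrow>\<^sub>0 int) \<Rightarrow> int) module" where
  "group_cochains p G \<equiv>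
     hom_complex (group_ring G) (std_left G) (trivial_module (Fp p)) (monoid.mult (Fp p))"

abbreviation group_coboundaries ::
    "nat \<Rightarrow> ('a, 'x) monoid_scheme \<Rightarrow> nat \<Rightarrow> (('a list \<Rightarrow>\<^sub>0 int) \<Rightarrow> int) set" where
  "group_coboundaries p G \<equiv>
     coboundaries (group_cochains p G) (hom_differential (std_left G) std_diff)"

text \<open>
  The cup product of cochains is \<open>f \<otimes> g\<close> composed with the Alexander-Whitney diagonal
  \<open>(x\<^sub>0,\<dots>,x\<^sub>m\<^sub>+\<^sub>n) \<mapsto> (x\<^sub>0,\<dots>,x\<^sub>m) \<otimes> (x\<^sub>m,\<dots>,x\<^sub>m\<^sub>+\<^sub>n)\<close> of the standard resolution and the multiplication
  of \<open>\<F>\<^sub>p\<close>.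
\<close>

definition cup_cochain ::
    "nat \<Rightarrow> ('a, 'x) monoid_scheme \<Rightarrow> nat \<Rightarrow> nat \<Rightarrow>
     (('a list \<Rightarrow>\<^sub>0 int) \<Rightarrow> int) \<Rightarrow> (('a list \<Rightarrow>\<^sub>0 int) \<Rightarrow> int) \<Rightarrow> ('a list \<Rightarrow>\<^sub>0 int) \<Rightarrow> int" where
  "cup_cochain p G m n f g =
     (\<lambda>c\<in>carrier (std_left G (m + n)).
        \<Oplus>\<^bsub>Fp p\<^esub>xs\<in>Poly_Mapping.keys c. [Poly_Mapping.lookup c xs] \<cdot>\<^bsub>Fp p\<^esub>
          (f (frag_of (take (Suc m) xs)) \<otimes>\<^bsub>Fp p\<^esub> g (frag_of (drop m xs))))"

definition cup_product ::
    "nat \<Rightarrow> ('a, 'x) monoid_scheme \<Rightarrow> nat \<Rightarrow> nat \<Rightarrow>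
     (('a list \<Rightarrow>\<^sub>0 int) \<Rightarrow> int) set \<Rightarrow> (('a list \<Rightarrow>\<^sub>0 int) \<Rightarrow> int) set \<Rightarrow>
     (('a list \<Rightarrow>\<^sub>0 int) \<Rightarrow> int) set" where
  "cup_product p G m n U V =
     (\<Union>f\<in>U. \<Union>g\<in>V.
        group_coboundaries p G (m + n) +>\<^bsub>group_cochains p G (m + n)\<^esub> cup_cochain p G m n f g)"

definition cohomology_unit ::
    "nat \<Rightarrow> ('a, 'x) monoid_scheme \<Rightarrow> (('a list \<Rightarrow>\<^sub>0 int) \<Rightarrow> int) set" where
  "cohomology_unit p G =
     group_coboundaries p G 0 +>\<^bsub>group_cochains p G 0\<^esub>
       (\<lambda>c\<in>carrier (std_left G 0). [augmentation c] \<cdot>\<^bsub>Fp p\<^esub> \<one>\<^bsub>Fp p\<^esub>)"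

text \<open>
  The direct sum of the cohomology groups, an element being the family of its homogeneous
  components. The record type of modules doubles as that of algebras.
\<close>

definition cohomology_algebra ::
    "nat \<Rightarrow> ('a, 'x) monoid_scheme \<Rightarrow> (int, nat \<Rightarrow> (('a list \<Rightarrow>\<^sub>0 int) \<Rightarrow> int) set) module" where
  "cohomology_algebra p G =
     \<lparr>carrier = {x. (\<forall>n. x n \<in> carrier (group_cohomology p G n)) \<and>
                    finite {n. x n \<noteq> \<zero>\<^bsub>group_cohomology p G n\<^esub>}},
      monoid.mult = (\<lambda>x y n. \<Oplus>\<^bsub>group_cohomology p G n\<^esub>i\<in>{..n}. cup_product p G i (n - i) (x i) (y (n - i))),
      one = (\<lambda>n. if n = 0 then cohomology_unit p G else \<zero>\<^bsub>group_cohomology p G n\<^esub>),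
      zero = (\<lambda>n. \<zero>\<^bsub>group_cohomology p G n\<^esub>),
      add = (\<lambda>x y n. x n \<oplus>\<^bsub>group_cohomology p G n\<^esub> y n),
      smult = (\<lambda>k x n. k \<odot>\<^bsub>group_cohomology p G n\<^esub> x n)\<rparr>"

definition homogeneous :: "('k, nat \<Rightarrow> 'm) module \<Rightarrow> nat \<Rightarrow> (nat \<Rightarrow> 'm) set" where
  "homogeneous A n = {x \<in> carrier A. \<forall>m. m \<noteq> n \<longrightarrow> x m = \<zero>\<^bsub>A\<^esub> m}"

definition isomorphic_graded_algebras ::
    "('k, 'x) ring_scheme \<Rightarrow> ('k, nat \<Rightarrow> 'm) module \<Rightarrow> ('k, nat \<Rightarrow> 'n) module \<Rightarrow> bool" where
  "isomorphic_graded_algebras K A B \<longleftrightarrow>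
     (\<exists>\<phi> \<in> ring_iso A B.
        (\<forall>k\<in>carrier K. \<forall>x\<in>carrier A. \<phi> (k \<odot>\<^bsub>A\<^esub> x) = k \<odot>\<^bsub>B\<^esub> \<phi> x) \<and>
        (\<forall>n. \<phi> ` homogeneous A n = homogeneous B n))"

end

theory Submission
  imports Defs
begin

text \<open>
  The cohomology of \<open>G\<close> is computed by \<open>G\<close>-invariant functions on tuples of elements of \<open>G\<close>, that of a
  Sylow subgroup \<open>S\<close> by \<open>S\<close>-invariant functions on tuples of elements of \<open>S\<close>. Since the index of \<open>S\<close>
  is prime to \<open>p\<close>, transfer shows that restriction to \<open>S\<close> is injective in cohomology with image the
  stable classes, those \<open>\<phi>\<close> whose pullbacks along any two \<open>G\<close>-subconjugations \<open>P \<rightarrow> S\<close> agree in the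
  cohomology of \<open>P\<close>. Stability only depends on the fusion in \<open>S\<close>, so an isomorphism of Sylow
  subgroups that preserves fusion matches the stable classes of \<open>G\<close> and \<open>H\<close>, and it respects cup
  products because these restrict. All homotopies needed between equivariant maps are instances of one
  prism operator. Homology is defined by right modules, hence dual to the cohomology of the opposite
  group; its dimension is therefore determined, and finite \<open>\<F>\<^sub>p\<close>-modules of equal cardinality are
  isomorphic.
\<close>


subsection \<open>Quotients of modules\<close>

text \<open>The usual proof that every stable class is a restriction goes through the double coset
  formula, hence through transfers from many subgroups. Cochains avoid it: the difference between a
  translate and the original cocycle has a primitive invariant under the stabiliser of a coset, and
  transporting one primitive along each orbit gives a family whose sum is invariant under all of
  \<open>S\<close>.

  A subgroup \<open>P\<close> acts freely on itself and on \<open>G\<close>, so its cohomology can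
  be computed from tuples in either set. Fusion is visible on the first, transfer needs the second,
  and a \<open>P\<close>-equivariant map from \<open>G\<close> to \<open>P\<close> passes between
  them. This is why cochains carry an acting group and a vertex set separately.

  A cocycle of \<open>S\<close> has no preferred extension to \<open>G\<close>, so cocycles of
  \<open>G\<close> and \<open>H\<close> are matched by a relation, agreement in the cohomology of
  \<open>S\<close>, and the isomorphism is read off from the relation.

  The duality behind the treatment of homology is the identification of invariant cochains with
  functionals on the standard resolution tensored with \<open>Fp p\<close>.\<close>

locale module_quotient = abelian_group M for M :: "('k, 'm) module" (structure) +
  fixes N :: "'m set" and K :: "'k set"
  assumes N: "additive_subgroup N M"
    and smult_closed: "\<lbrakk>k \<in> K; x \<in> carrier M\<rbrakk> \<Longrightarrow> k \<odot>\<^bsub>M\<^esub> x \<in> carrier M"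
    and smult_add: "\<lbrakk>k \<in> K; x \<in> carrier M; y \<in> carrier M\<rbrakk> \<Longrightarrow> k \<odot>\<^bsub>M\<^esub> (x \<oplus> y) = k \<odot>\<^bsub>M\<^esub> x \<oplus> k \<odot>\<^bsub>M\<^esub> y"
    and smult_N: "\<lbrakk>k \<in> K; x \<in> N\<rbrakk> \<Longrightarrow> k \<odot>\<^bsub>M\<^esub> x \<in> N"
begin

sublocale abelian_subgroup N M
  using N abelian_group_axioms by (rule abelian_subgroupI3)

lemma coset_eq_iff:
  assumes "x \<in> carrier M" "y \<in> carrier M"
  shows "N +> x = N +> y \<longleftrightarrow> x \<ominus> y \<in> N"
proof
  assume "N +> x = N +> y"
  then have "x \<in> N +> y" using a_rcos_self [OF assms(1)] by simp
  then show "x \<ominus> y \<in> N" using a_rcos_module assms by (simp add: a_minus_def)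
next
  assume "x \<ominus> y \<in> N"
  then have "x \<in> N +> y" using a_rcos_module assms by (simp add: a_minus_def)
  then show "N +> x = N +> y" using a_repr_independence' assms by simp
qed

lemma carrier_quotient: "carrier (quotient_module M N) = {N +> x | x. x \<in> carrier M}"
  by (auto simp: quotient_module_def A_RCOSETS_def')

lemma coset_in_quotient: "x \<in> carrier M \<Longrightarrow> N +> x \<in> carrier (quotient_module M N)"
  by (auto simp: carrier_quotient)

lemma add_quotient:
  "\<lbrakk>x \<in> carrier M; y \<in> carrier M\<rbrakk> \<Longrightarrow> (N +> x) \<oplus>\<^bsub>quotient_module M N\<^esub> (N +> y) = N +> (x \<oplus> y)"
  by (simp add: quotient_module_def a_rcos_sum)

lemma zero_quotient: "\<zero>\<^bsub>quotient_module M N\<^esub> = N +> \<zero>"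
  by (simp add: quotient_module_def a_subset)

text \<open>The union in \<open>quotient_module\<close> collapses because a scalar acts additively
  and preserves \<open>N\<close>, so it maps a coset into a single coset. The locale asks for laws
  in the vector argument only: on the formal sums of \<open>tensor_pairs\<close> the action is not
  additive in the scalar and becomes so only in the quotient.\<close>

lemma smult_quotient:
  assumes "k \<in> K" "x \<in> carrier M"
  shows "k \<odot>\<^bsub>quotient_module M N\<^esub> (N +> x) = N +> (k \<odot>\<^bsub>M\<^esub> x)"
proof -
  have "N +> (k \<odot>\<^bsub>M\<^esub> y) = N +> (k \<odot>\<^bsub>M\<^esub> x)" if "y \<in> N +> x" for y
  proof -
    obtain n where n: "n \<in> N" "y = n \<oplus> x" using \<open>y \<in> N +> x\<close> by (auto simp: a_r_coset_def')
    have "k \<odot>\<^bsub>M\<^esub> y = k \<odot>\<^bsub>M\<^esub> n \<oplus> k \<odot>\<^bsub>M\<^esub> x" using n assms a_subset smult_add by auto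
    moreover have "k \<odot>\<^bsub>M\<^esub> n \<in> N" using smult_N assms n by blast
    ultimately have "k \<odot>\<^bsub>M\<^esub> y \<in> N +> (k \<odot>\<^bsub>M\<^esub> x)" by (auto simp: a_r_coset_def')
    then show ?thesis using a_repr_independence' smult_closed [OF assms] by blast
  qed
  then have "(\<Union>y\<in>N +> x. N +> (k \<odot>\<^bsub>M\<^esub> y)) = (\<Union>y\<in>N +> x. N +> (k \<odot>\<^bsub>M\<^esub> x))"
    by (rule SUP_cong [OF refl])
  also have "\<dots> = N +> (k \<odot>\<^bsub>M\<^esub> x)"
    using a_rcos_self [OF assms(2)] by auto
  finally have "(\<Union>y\<in>N +> x. N +> (k \<odot>\<^bsub>M\<^esub> y)) = N +> (k \<odot>\<^bsub>M\<^esub> x)" .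
  then show ?thesis by (simp add: quotient_module_def)
qed

lemma abelian_group_quotient: "abelian_group (quotient_module M N)"
proof (rule abelian_groupI)
  show "\<zero>\<^bsub>quotient_module M N\<^esub> \<in> carrier (quotient_module M N)"
    unfolding zero_quotient by (rule coset_in_quotient) simp
next
  fix U assume "U \<in> carrier (quotient_module M N)"
  then obtain x where x: "x \<in> carrier M" "U = N +> x" by (auto simp: carrier_quotient)
  then show "\<zero>\<^bsub>quotient_module M N\<^esub> \<oplus>\<^bsub>quotient_module M N\<^esub> U = U"
    by (simp add: zero_quotient add_quotient)
  have "(N +> \<ominus> x) \<oplus>\<^bsub>quotient_module M N\<^esub> U = \<zero>\<^bsub>quotient_module M N\<^esub>"
    using x by (simp add: zero_quotient add_quotient l_neg)
  then show "\<exists>V\<in>carrier (quotient_module M N). V \<oplus>\<^bsub>quotient_module M N\<^esub> U = \<zero>\<^bsub>quotient_module M N\<^esub>"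
    using x coset_in_quotient [of "\<ominus> x"] by auto
qed (auto simp: carrier_quotient add_quotient a_ac intro: a_closed)

end

text \<open>Totality of \<open>T\<close> on both sides gives a map and its surjectivity. Additivity
  together with \<open>zero\<close> shows that two elements agree modulo \<open>N1\<close> exactly
  when their partners agree modulo \<open>N2\<close>, which is well-definedness and injectivity at
  once. A relation is used because neither of two corresponding cocycles determines the
  other.\<close>

lemma quotient_correspondence:
  fixes M1 :: "('k, 'm) module" and M2 :: "('k, 'n) module" and R :: "('k, 'x) ring_scheme"
  assumes 1: "module_quotient M1 N1 (carrier R)" and 2: "module_quotient M2 N2 (carrier R)"
    and T1: "\<And>x. x \<in> carrier M1 \<Longrightarrow> \<exists>y\<in>carrier M2. T x y"
    and T2: "\<And>y. y \<in> carrier M2 \<Longrightarrow> \<exists>x\<in>carrier M1. T x y"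
    and add: "\<And>x x' y y'. \<lbrakk>x \<in> carrier M1; x' \<in> carrier M1; y \<in> carrier M2; y' \<in> carrier M2; T x y; T x' y'\<rbrakk> \<Longrightarrow>
      T (x \<oplus>\<^bsub>M1\<^esub> x') (y \<oplus>\<^bsub>M2\<^esub> y')"
    and smult: "\<And>k x y. \<lbrakk>k \<in> carrier R; x \<in> carrier M1; y \<in> carrier M2; T x y\<rbrakk> \<Longrightarrow> T (k \<odot>\<^bsub>M1\<^esub> x) (k \<odot>\<^bsub>M2\<^esub> y)"
    and zero: "\<And>x y. \<lbrakk>x \<in> carrier M1; y \<in> carrier M2; T x y\<rbrakk> \<Longrightarrow> x \<in> N1 \<longleftrightarrow> y \<in> N2"
  obtains \<Phi> where "\<Phi> \<in> lmod_hom R (quotient_module M1 N1) (quotient_module M2 N2)"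
    "bij_betw \<Phi> (carrier (quotient_module M1 N1)) (carrier (quotient_module M2 N2))"
    "\<forall>x\<in>carrier M1. \<forall>y\<in>carrier M2. T x y \<longrightarrow> \<Phi> (N1 +>\<^bsub>M1\<^esub> x) = N2 +>\<^bsub>M2\<^esub> y"
proof -
  interpret Q1: module_quotient M1 N1 "carrier R" by (rule 1)
  interpret Q2: module_quotient M2 N2 "carrier R" by (rule 2)
  have eq_iff: "N1 +>\<^bsub>M1\<^esub> x = N1 +>\<^bsub>M1\<^esub> x' \<longleftrightarrow> N2 +>\<^bsub>M2\<^esub> y = N2 +>\<^bsub>M2\<^esub> y'"
    if x: "x \<in> carrier M1" "x' \<in> carrier M1" and y: "y \<in> carrier M2" "y' \<in> carrier M2"
      and T: "T x y" "T x' y'" for x x' y y'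
  proof -
    \<comment> \<open>\<open>T\<close> is not assumed to respect negatives, so any partner
      \<open>z\<close> of the negative of \<open>x'\<close> is taken. It is the negative of
      \<open>y'\<close> modulo \<open>N2\<close>, because \<open>y'\<close> plus \<open>z\<close> is
      a partner of zero.\<close>
    obtain z where z: "z \<in> carrier M2" "T (\<ominus>\<^bsub>M1\<^esub> x') z" using T1 [of "\<ominus>\<^bsub>M1\<^esub> x'"] x by auto
    have "x' \<oplus>\<^bsub>M1\<^esub> \<ominus>\<^bsub>M1\<^esub> x' \<in> N1 \<longleftrightarrow> y' \<oplus>\<^bsub>M2\<^esub> z \<in> N2"
      using x y z by (intro zero add T) auto
    then have n: "y' \<oplus>\<^bsub>M2\<^esub> z \<in> N2" using x by (simp add: Q1.r_neg)
    have "N1 +>\<^bsub>M1\<^esub> x = N1 +>\<^bsub>M1\<^esub> x' \<longleftrightarrow> x \<oplus>\<^bsub>M1\<^esub> \<ominus>\<^bsub>M1\<^esub> x' \<in> N1"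
      using x by (simp add: Q1.coset_eq_iff a_minus_def)
    also have "\<dots> \<longleftrightarrow> y \<oplus>\<^bsub>M2\<^esub> z \<in> N2"
      using x y z by (intro zero add T) auto
    also have "\<dots> \<longleftrightarrow> y \<ominus>\<^bsub>M2\<^esub> y' \<in> N2"
    proof -
      have e: "y \<oplus>\<^bsub>M2\<^esub> z = (y \<ominus>\<^bsub>M2\<^esub> y') \<oplus>\<^bsub>M2\<^esub> (y' \<oplus>\<^bsub>M2\<^esub> z)"
        using y z by (simp add: a_minus_def Q2.a_assoc Q2.r_neg1)
      have "y \<ominus>\<^bsub>M2\<^esub> y' = (y \<oplus>\<^bsub>M2\<^esub> z) \<oplus>\<^bsub>M2\<^esub> \<ominus>\<^bsub>M2\<^esub> (y' \<oplus>\<^bsub>M2\<^esub> z)"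
        unfolding e using y z by (simp add: a_minus_def Q2.a_assoc Q2.r_neg)
      with e show ?thesis
        using n Q2.a_inv_closed Q2.additive_subgroup_axioms
        by (metis additive_subgroup.a_closed)
    qed
    also have "\<dots> \<longleftrightarrow> N2 +>\<^bsub>M2\<^esub> y = N2 +>\<^bsub>M2\<^esub> y'"
      using y by (simp add: Q2.coset_eq_iff)
    finally show ?thesis .
  qed
  define \<Phi> where "\<Phi> U = (SOME V. \<exists>x\<in>carrier M1. \<exists>y\<in>carrier M2. U = N1 +>\<^bsub>M1\<^esub> x \<and> V = N2 +>\<^bsub>M2\<^esub> y \<and> T x y)" for U
  have \<Phi>: "\<Phi> (N1 +>\<^bsub>M1\<^esub> x) = N2 +>\<^bsub>M2\<^esub> y" if "x \<in> carrier M1" "y \<in> carrier M2" "T x y" for x y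
    unfolding \<Phi>_def by (rule some_equality) (use that eq_iff in blast)+
  show thesis
  proof (rule that [of \<Phi>])
    show "bij_betw \<Phi> (carrier (quotient_module M1 N1)) (carrier (quotient_module M2 N2))"
    proof (rule bij_betw_imageI)
      show "inj_on \<Phi> (carrier (quotient_module M1 N1))"
      proof (rule inj_onI)
        fix U V assume U: "U \<in> carrier (quotient_module M1 N1)" and V: "V \<in> carrier (quotient_module M1 N1)"
          and eq: "\<Phi> U = \<Phi> V"
        obtain x where x: "x \<in> carrier M1" "U = N1 +>\<^bsub>M1\<^esub> x" using U by (auto simp: Q1.carrier_quotient)
        obtain x' where x': "x' \<in> carrier M1" "V = N1 +>\<^bsub>M1\<^esub> x'" using V by (auto simp: Q1.carrier_quotient)
        obtain y y' where "y \<in> carrier M2" "T x y" "y' \<in> carrier M2" "T x' y'" using T1 x x' by meson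
        then show "U = V" using eq eq_iff \<Phi> x x' by metis
      qed
      show "\<Phi> ` carrier (quotient_module M1 N1) = carrier (quotient_module M2 N2)"
      proof (intro equalityI subsetI)
        fix V assume "V \<in> \<Phi> ` carrier (quotient_module M1 N1)"
        then obtain x where x: "x \<in> carrier M1" "V = \<Phi> (N1 +>\<^bsub>M1\<^esub> x)" by (auto simp: Q1.carrier_quotient)
        then show "V \<in> carrier (quotient_module M2 N2)"
          using T1 \<Phi> Q2.coset_in_quotient by metis
      next
        fix V assume "V \<in> carrier (quotient_module M2 N2)"
        then obtain y where y: "y \<in> carrier M2" "V = N2 +>\<^bsub>M2\<^esub> y" by (auto simp: Q2.carrier_quotient)
        then obtain x where "x \<in> carrier M1" "T x y" using T2 by blast
        then show "V \<in> \<Phi> ` carrier (quotient_module M1 N1)"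
          using \<Phi> y Q1.coset_in_quotient by (metis image_eqI)
      qed
    qed
    then have closed: "\<Phi> \<in> carrier (quotient_module M1 N1) \<rightarrow> carrier (quotient_module M2 N2)"
      by (auto simp: bij_betw_def)
    show "\<Phi> \<in> lmod_hom R (quotient_module M1 N1) (quotient_module M2 N2)"
      unfolding lmod_hom_def
    proof (intro CollectI conjI ballI)
      fix U V assume "U \<in> carrier (quotient_module M1 N1)" "V \<in> carrier (quotient_module M1 N1)"
      then obtain x x' where x: "x \<in> carrier M1" "U = N1 +>\<^bsub>M1\<^esub> x" "x' \<in> carrier M1" "V = N1 +>\<^bsub>M1\<^esub> x'"
        by (auto simp: Q1.carrier_quotient)
      then obtain y y' where y: "y \<in> carrier M2" "T x y" "y' \<in> carrier M2" "T x' y'" using T1 by meson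
      have "\<Phi> (N1 +>\<^bsub>M1\<^esub> (x \<oplus>\<^bsub>M1\<^esub> x')) = N2 +>\<^bsub>M2\<^esub> (y \<oplus>\<^bsub>M2\<^esub> y')"
        using x y by (intro \<Phi> add) auto
      then show "\<Phi> (U \<oplus>\<^bsub>quotient_module M1 N1\<^esub> V) = \<Phi> U \<oplus>\<^bsub>quotient_module M2 N2\<^esub> \<Phi> V"
        using x y \<Phi> by (simp add: Q1.add_quotient Q2.add_quotient)
    next
      fix k U assume k: "k \<in> carrier R" and "U \<in> carrier (quotient_module M1 N1)"
      then obtain x where x: "x \<in> carrier M1" "U = N1 +>\<^bsub>M1\<^esub> x"
        by (auto simp: Q1.carrier_quotient)
      then obtain y where y: "y \<in> carrier M2" "T x y" using T1 by meson
      have "\<Phi> (N1 +>\<^bsub>M1\<^esub> (k \<odot>\<^bsub>M1\<^esub> x)) = N2 +>\<^bsub>M2\<^esub> (k \<odot>\<^bsub>M2\<^esub> y)"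
        using x y k by (intro \<Phi> smult Q1.smult_closed Q2.smult_closed) auto
      then show "\<Phi> (k \<odot>\<^bsub>quotient_module M1 N1\<^esub> U) = k \<odot>\<^bsub>quotient_module M2 N2\<^esub> \<Phi> U"
        using x y k \<Phi> by (simp add: Q1.smult_quotient Q2.smult_quotient)
    qed (rule closed)
  qed (use \<Phi> in blast)
qed


subsection \<open>Cochains modulo an integer\<close>

text \<open>The Kronecker pairing of a cochain with a chain. Integer values make its formal
  identities exact; congruences enter only where invariance or the cocycle condition is
  used.\<close>

definition pairing :: "('b \<Rightarrow> int) \<Rightarrow> ('b \<Rightarrow>\<^sub>0 int) \<Rightarrow> int" where
  "pairing \<phi> c = (\<Sum>x\<in>Poly_Mapping.keys c. Poly_Mapping.lookup c x * \<phi> x)"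

text \<open>Expressing the sum over \<open>Poly_Mapping.keys\<close> through
  \<open>frag_extend\<close> and \<open>augmentation\<close> hands over their linearity, so that
  supports of different chains never have to be compared.\<close>

lemma pairing_eq_augmentation:
  "pairing \<phi> c = augmentation (frag_extend (\<lambda>x. frag_cmul (\<phi> x) (frag_of ())) c)"
proof -
  have "augmentation (\<Sum>x\<in>I. frag_cmul (f x) (frag_cmul (\<phi> x) (frag_of ()))) = (\<Sum>x\<in>I. f x * \<phi> x)"
    if "finite I" for I and f :: "_ \<Rightarrow> int"
    using that by (induction I) (simp_all add: augmentation_add augmentation_cmul)
  then show ?thesis
    by (simp add: pairing_def frag_extend_def)
qed

lemma pairing_zero [simp]: "pairing \<phi> 0 = 0"
  by (simp add: pairing_def)

lemma pairing_of [simp]: "pairing \<phi> (frag_of x) = \<phi> x"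
  by (simp add: pairing_eq_augmentation augmentation_cmul)

lemma pairing_diff: "pairing \<phi> (a - b) = pairing \<phi> a - pairing \<phi> b"
  by (simp add: pairing_eq_augmentation frag_extend_diff augmentation_diff)

lemma pairing_add: "pairing \<phi> (a + b) = pairing \<phi> a + pairing \<phi> b"
  by (simp add: pairing_eq_augmentation frag_extend_add augmentation_add)

lemma pairing_cmul: "pairing \<phi> (frag_cmul k a) = k * pairing \<phi> a"
  by (simp add: pairing_eq_augmentation frag_extend_cmul augmentation_cmul)

lemma pairing_extend: "pairing \<phi> (frag_extend T c) = pairing (\<lambda>x. pairing \<phi> (T x)) c"
  by (induction c rule: frag_induction [OF subset_UNIV]) (simp_all add: frag_extend_diff pairing_diff)

lemma pairing_cong:
  assumes "\<And>x. x \<in> Poly_Mapping.keys c \<Longrightarrow> [\<phi> x = \<psi> x] (mod m)"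
  shows "[pairing \<phi> c = pairing \<psi> c] (mod m)"
  unfolding pairing_def using assms by (intro cong_sum cong_mult) auto

lemma pairing_fun_add: "pairing (\<lambda>x. \<phi> x + \<psi> x) c = pairing \<phi> c + pairing \<psi> c"
  by (simp add: pairing_def sum.distrib distrib_left)

lemma pairing_fun_cmul: "pairing (\<lambda>x. k * \<phi> x) c = k * pairing \<phi> c"
  by (simp add: pairing_def sum_distrib_left mult.left_commute)

lemma pairing_fun_cmul': "pairing (\<lambda>x. \<phi> x * k) c = pairing \<phi> c * k"
  by (simp add: pairing_def sum_distrib_right mult.assoc)

lemma pairing_fun_zero [simp]: "pairing (\<lambda>x. 0) c = 0"
  by (simp add: pairing_def)

lemma pairing_fun_sum: "pairing (\<lambda>x. \<Sum>i\<in>I. \<phi> i x) c = (\<Sum>i\<in>I. pairing (\<phi> i) c)"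
  unfolding pairing_def sum_distrib_left by (rule sum.swap)

lemma pairing_fun_cong:
  assumes "\<And>x. x \<in> Poly_Mapping.keys c \<Longrightarrow> \<phi> x = \<psi> x"
  shows "pairing \<phi> c = pairing \<psi> c"
  unfolding pairing_def using assms by (intro sum.cong) auto

text \<open>
  Cochains are integer valued and only considered modulo \<open>m\<close>; \<open>l\<close> is the length of the argument
  lists, that is, the degree plus one. The condition \<open>\<psi> [] = 0\<close> makes the cohomology unreduced
  in degree 0.
\<close>

definition invariant_cochain ::
    "int \<Rightarrow> ('a, 'x) monoid_scheme \<Rightarrow> 'a set \<Rightarrow> 'a set \<Rightarrow> ('a list \<Rightarrow> int) \<Rightarrow> bool" where
  "invariant_cochain m G P X \<phi> \<longleftrightarrow>
     (\<forall>g\<in>P. \<forall>xs\<in>lists X. [\<phi> (map (\<lambda>x. g \<otimes>\<^bsub>G\<^esub> x) xs) = \<phi> xs] (mod m))"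

text \<open>\<open>P\<close> is the acting group and \<open>X\<close> the set of vertices. They are
  separate because the cohomology of a subgroup \<open>P\<close> is computed from tuples in
  \<open>P\<close> as well as from tuples in the ambient group. A cochain is a function on lists of
  every length; its class depends on its values in length \<open>l\<close>.\<close>

definition is_cocycle ::
    "int \<Rightarrow> ('a, 'x) monoid_scheme \<Rightarrow> 'a set \<Rightarrow> 'a set \<Rightarrow> nat \<Rightarrow> ('a list \<Rightarrow> int) \<Rightarrow> bool" where
  "is_cocycle m G P X l \<phi> \<longleftrightarrow> invariant_cochain m G P X \<phi> \<and>
     (\<forall>xs\<in>lists X. length xs = Suc l \<longrightarrow> [pairing \<phi> (list_boundary xs) = 0] (mod m))"

definition is_coboundary ::
    "int \<Rightarrow> ('a, 'x) monoid_scheme \<Rightarrow> 'a set \<Rightarrow> 'a set \<Rightarrow> nat \<Rightarrow> ('a list \<Rightarrow> int) \<Rightarrow> bool" where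
  "is_coboundary m G P X l \<phi> \<longleftrightarrow> (\<exists>\<psi>. invariant_cochain m G P X \<psi> \<and> [\<psi> [] = 0] (mod m) \<and>
     (\<forall>xs\<in>lists X. length xs = l \<longrightarrow> [\<phi> xs = pairing \<psi> (list_boundary xs)] (mod m)))"

lemma invariant_cochainD:
  "\<lbrakk>invariant_cochain m G P X \<phi>; g \<in> P; xs \<in> lists X\<rbrakk> \<Longrightarrow> [\<phi> (map (\<lambda>x. g \<otimes>\<^bsub>G\<^esub> x) xs) = \<phi> xs] (mod m)"
  by (simp add: invariant_cochain_def)

lemma is_cocycleD:
  assumes "is_cocycle m G P X l \<phi>"
  shows "invariant_cochain m G P X \<phi>"
    and "\<lbrakk>xs \<in> lists X; length xs = Suc l\<rbrakk> \<Longrightarrow> [pairing \<phi> (list_boundary xs) = 0] (mod m)"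
  using assms by (auto simp: is_cocycle_def)

lemma is_coboundaryE:
  assumes "is_coboundary m G P X l \<phi>"
  obtains \<psi> where "invariant_cochain m G P X \<psi>" "[\<psi> [] = 0] (mod m)"
    "\<And>xs. \<lbrakk>xs \<in> lists X; length xs = l\<rbrakk> \<Longrightarrow> [\<phi> xs = pairing \<psi> (list_boundary xs)] (mod m)"
  using assms unfolding is_coboundary_def by blast

lemma is_coboundaryI:
  assumes "invariant_cochain m G P X \<psi>" "[\<psi> [] = 0] (mod m)"
    "\<And>xs. \<lbrakk>xs \<in> lists X; length xs = l\<rbrakk> \<Longrightarrow> [\<phi> xs = pairing \<psi> (list_boundary xs)] (mod m)"
  shows "is_coboundary m G P X l \<phi>"
  using assms unfolding is_coboundary_def by blast

lemma map_in_lists: "\<lbrakk>f \<in> X \<rightarrow> Y; xs \<in> lists X\<rbrakk> \<Longrightarrow> map f xs \<in> lists Y"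
  by (auto simp: Pi_iff)

lemma invariant_cochain_add:
  "\<lbrakk>invariant_cochain m G P X \<phi>; invariant_cochain m G P X \<psi>\<rbrakk> \<Longrightarrow>
   invariant_cochain m G P X (\<lambda>xs. \<phi> xs + \<psi> xs)"
  by (simp add: invariant_cochain_def cong_add)

lemma invariant_cochain_cmul:
  "invariant_cochain m G P X \<phi> \<Longrightarrow> invariant_cochain m G P X (\<lambda>xs. k * \<phi> xs)"
  by (simp add: invariant_cochain_def cong_scalar_left)

lemma is_cocycle_add:
  assumes "is_cocycle m G P X l \<phi>" "is_cocycle m G P X l \<psi>"
  shows "is_cocycle m G P X l (\<lambda>xs. \<phi> xs + \<psi> xs)"
  unfolding is_cocycle_def
proof (intro conjI ballI impI)
  fix xs assume "xs \<in> lists X" "length xs = Suc l"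
  then show "[pairing (\<lambda>xs. \<phi> xs + \<psi> xs) (list_boundary xs) = 0] (mod m)"
    using cong_add [OF is_cocycleD(2) [OF assms(1)] is_cocycleD(2) [OF assms(2)]]
    by (simp add: pairing_fun_add)
qed (intro invariant_cochain_add is_cocycleD(1) [OF assms(1)] is_cocycleD(1) [OF assms(2)])

lemma is_cocycle_cmul:
  assumes "is_cocycle m G P X l \<phi>"
  shows "is_cocycle m G P X l (\<lambda>xs. k * \<phi> xs)"
  unfolding is_cocycle_def
proof (intro conjI ballI impI)
  fix xs assume "xs \<in> lists X" "length xs = Suc l"
  then show "[pairing (\<lambda>xs. k * \<phi> xs) (list_boundary xs) = 0] (mod m)"
    using cong_scalar_left [OF is_cocycleD(2) [OF assms], of xs k] by (simp add: pairing_fun_cmul)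
qed (intro invariant_cochain_cmul is_cocycleD(1) [OF assms])

lemma is_cocycle_diff:
  assumes "is_cocycle m G P X l \<phi>" "is_cocycle m G P X l \<psi>"
  shows "is_cocycle m G P X l (\<lambda>xs. \<phi> xs - \<psi> xs)"
  using is_cocycle_add [OF assms(1) is_cocycle_cmul [OF assms(2), of "- 1"]] by simp

lemma is_coboundary_add:
  assumes "is_coboundary m G P X l \<phi>" "is_coboundary m G P X l \<psi>"
  shows "is_coboundary m G P X l (\<lambda>xs. \<phi> xs + \<psi> xs)"
proof -
  obtain a where a: "invariant_cochain m G P X a" "[a [] = 0] (mod m)"
    "\<And>xs. \<lbrakk>xs \<in> lists X; length xs = l\<rbrakk> \<Longrightarrow> [\<phi> xs = pairing a (list_boundary xs)] (mod m)"
    using assms(1) by (rule is_coboundaryE) blast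
  obtain b where b: "invariant_cochain m G P X b" "[b [] = 0] (mod m)"
    "\<And>xs. \<lbrakk>xs \<in> lists X; length xs = l\<rbrakk> \<Longrightarrow> [\<psi> xs = pairing b (list_boundary xs)] (mod m)"
    using assms(2) by (rule is_coboundaryE) blast
  show ?thesis
  proof (rule is_coboundaryI)
    show "invariant_cochain m G P X (\<lambda>xs. a xs + b xs)" using a b by (intro invariant_cochain_add)
    show "[a [] + b [] = 0] (mod m)" using cong_add [OF a(2) b(2)] by simp
  qed (use a b in \<open>simp add: pairing_fun_add cong_add\<close>)
qed

lemma is_coboundary_cmul:
  assumes "is_coboundary m G P X l \<phi>"
  shows "is_coboundary m G P X l (\<lambda>xs. k * \<phi> xs)"
proof -
  obtain a where a: "invariant_cochain m G P X a" "[a [] = 0] (mod m)"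
    "\<And>xs. \<lbrakk>xs \<in> lists X; length xs = l\<rbrakk> \<Longrightarrow> [\<phi> xs = pairing a (list_boundary xs)] (mod m)"
    using assms(1) by (rule is_coboundaryE) blast
  show ?thesis
  proof (rule is_coboundaryI)
    show "invariant_cochain m G P X (\<lambda>xs. k * a xs)" using a by (intro invariant_cochain_cmul)
    show "[k * a [] = 0] (mod m)" using cong_scalar_left [OF a(2), of k] by simp
  qed (use a in \<open>simp add: pairing_fun_cmul cong_scalar_left\<close>)
qed

lemma is_coboundary_diff:
  assumes "is_coboundary m G P X l \<phi>" "is_coboundary m G P X l \<psi>"
  shows "is_coboundary m G P X l (\<lambda>xs. \<phi> xs - \<psi> xs)"
  using is_coboundary_add [OF assms(1) is_coboundary_cmul [OF assms(2), of "- 1"]] by simp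

lemma is_coboundary_cong:
  assumes "is_coboundary m G P X l \<phi>"
    and "\<And>xs. \<lbrakk>xs \<in> lists X; length xs = l\<rbrakk> \<Longrightarrow> [\<psi> xs = \<phi> xs] (mod m)"
  shows "is_coboundary m G P X l \<psi>"
  using assms unfolding is_coboundary_def by (meson cong_trans)

lemma lists_list_boundary:
  "\<lbrakk>xs \<in> lists X; ys \<in> Poly_Mapping.keys (list_boundary xs)\<rbrakk> \<Longrightarrow> ys \<in> lists X \<and> length ys = length xs - 1"
  using list_boundary_closed [of xs X] by (auto simp: in_lists_conv_set subset_iff)

text \<open>Invariance is a condition on lists of every length, so it is not inherited through
  agreement in length \<open>l\<close> and is asked for separately.\<close>

lemma is_cocycle_cong:
  assumes "is_cocycle m G P X l \<phi>" "invariant_cochain m G P X \<psi>"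
    and "\<And>xs. \<lbrakk>xs \<in> lists X; length xs = l\<rbrakk> \<Longrightarrow> [\<psi> xs = \<phi> xs] (mod m)"
  shows "is_cocycle m G P X l \<psi>"
  unfolding is_cocycle_def
proof (intro conjI ballI impI)
  fix xs assume xs: "xs \<in> lists X" "length xs = Suc l"
  have "[pairing \<psi> (list_boundary xs) = pairing \<phi> (list_boundary xs)] (mod m)"
    by (rule pairing_cong) (use assms(3) lists_list_boundary [OF xs(1)] xs(2) in simp)
  also have "[pairing \<phi> (list_boundary xs) = 0] (mod m)"
    using is_cocycleD(2) [OF assms(1)] xs by blast
  finally show "[pairing \<psi> (list_boundary xs) = 0] (mod m)" .
qed (rule assms(2))

lemma pairing_list_boundary_map:
  "pairing (\<lambda>xs. \<phi> (map u xs)) (list_boundary xs) = pairing \<phi> (list_boundary (map u xs))"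
  by (simp add: list_boundary_map pairing_extend)

text \<open>The setting for all functoriality: a map \<open>u\<close> of vertices that is
  equivariant over a map \<open>f\<close> of the acting groups. Restrictions, conjugations and the
  transport along an isomorphism of Sylow subgroups are all of this form.\<close>

lemma invariant_cochain_pullback:
  assumes "invariant_cochain m H Q Y \<phi>" "f \<in> P \<rightarrow> Q" "u \<in> X \<rightarrow> Y"
    and "\<And>g x. g \<in> P \<Longrightarrow> x \<in> X \<Longrightarrow> u (g \<otimes>\<^bsub>G\<^esub> x) = f g \<otimes>\<^bsub>H\<^esub> u x"
  shows "invariant_cochain m G P X (\<lambda>xs. \<phi> (map u xs))"
  unfolding invariant_cochain_def
proof (intro ballI)
  fix g xs assume g: "g \<in> P" and xs: "xs \<in> lists X"
  have "map u (map (\<lambda>x. g \<otimes>\<^bsub>G\<^esub> x) xs) = map (\<lambda>y. f g \<otimes>\<^bsub>H\<^esub> y) (map u xs)"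
    using g xs assms(4) by auto
  moreover have "map u xs \<in> lists Y" "f g \<in> Q"
    using map_in_lists [OF assms(3) xs] g assms(2) by auto
  ultimately show "[\<phi> (map u (map (\<lambda>x. g \<otimes>\<^bsub>G\<^esub> x) xs)) = \<phi> (map u xs)] (mod m)"
    using invariant_cochainD [OF assms(1)] by metis
qed

lemma is_cocycle_pullback:
  assumes "is_cocycle m H Q Y l \<phi>" "f \<in> P \<rightarrow> Q" "u \<in> X \<rightarrow> Y"
    and "\<And>g x. g \<in> P \<Longrightarrow> x \<in> X \<Longrightarrow> u (g \<otimes>\<^bsub>G\<^esub> x) = f g \<otimes>\<^bsub>H\<^esub> u x"
  shows "is_cocycle m G P X l (\<lambda>xs. \<phi> (map u xs))"
  unfolding is_cocycle_def
proof (intro conjI ballI impI)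
  show "invariant_cochain m G P X (\<lambda>xs. \<phi> (map u xs))"
    by (rule invariant_cochain_pullback) (use assms is_cocycleD in auto)
next
  fix xs assume xs: "xs \<in> lists X" "length xs = Suc l"
  then have "map u xs \<in> lists Y" "length (map u xs) = Suc l" using map_in_lists [OF assms(3)] by auto
  from is_cocycleD(2) [OF assms(1) this]
  show "[pairing (\<lambda>xs. \<phi> (map u xs)) (list_boundary xs) = 0] (mod m)"
    by (simp add: pairing_list_boundary_map)
qed

lemma is_coboundary_pullback:
  assumes "is_coboundary m H Q Y l \<phi>" "f \<in> P \<rightarrow> Q" "u \<in> X \<rightarrow> Y"
    and "\<And>g x. g \<in> P \<Longrightarrow> x \<in> X \<Longrightarrow> u (g \<otimes>\<^bsub>G\<^esub> x) = f g \<otimes>\<^bsub>H\<^esub> u x"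
  shows "is_coboundary m G P X l (\<lambda>xs. \<phi> (map u xs))"
proof -
  obtain a where a: "invariant_cochain m H Q Y a" "[a [] = 0] (mod m)"
    "\<And>xs. \<lbrakk>xs \<in> lists Y; length xs = l\<rbrakk> \<Longrightarrow> [\<phi> xs = pairing a (list_boundary xs)] (mod m)"
    using assms(1) by (rule is_coboundaryE) blast
  show ?thesis
  proof (rule is_coboundaryI)
    show "invariant_cochain m G P X (\<lambda>xs. a (map u xs))"
      by (rule invariant_cochain_pullback) (use assms a in auto)
    fix xs assume "xs \<in> lists X" "length xs = l"
    then have "map u xs \<in> lists Y" "length (map u xs) = l" using map_in_lists [OF assms(3)] by auto
    from a(3) [OF this]
    show "[\<phi> (map u xs) = pairing (\<lambda>xs. a (map u xs)) (list_boundary xs)] (mod m)"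
      by (simp add: pairing_list_boundary_map)
  qed (use a in auto)
qed

lemma is_cocycle_mono:
  "\<lbrakk>is_cocycle m G Q Y l \<phi>; P \<subseteq> Q; X \<subseteq> Y\<rbrakk> \<Longrightarrow> is_cocycle m G P X l \<phi>"
  using is_cocycle_pullback [of m G Q Y l \<phi> "\<lambda>x. x" P "\<lambda>x. x" X G] by auto

lemma is_coboundary_mono:
  "\<lbrakk>is_coboundary m G Q Y l \<phi>; P \<subseteq> Q; X \<subseteq> Y\<rbrakk> \<Longrightarrow> is_coboundary m G P X l \<phi>"
  using is_coboundary_pullback [of m G Q Y l \<phi> "\<lambda>x. x" P "\<lambda>x. x" X G] by auto


subsection \<open>Homotopies\<close>

text \<open>
  The prism operator
  \<open>(x\<^sub>0,\<dots>,x\<^sub>n) \<mapsto> \<Sum>\<^sub>i (-1)\<^sup>i (u x\<^sub>0,\<dots>,u x\<^sub>i,v x\<^sub>i,\<dots>,v x\<^sub>n)\<close>.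
\<close>

fun prism :: "('a \<Rightarrow> 'b) \<Rightarrow> ('a \<Rightarrow> 'b) \<Rightarrow> 'a list \<Rightarrow> 'b list \<Rightarrow>\<^sub>0 int" where
  "prism u v [] = 0"
| "prism u v (x # xs) = frag_of (u x # v x # map v xs) - cone (u x) (prism u v xs)"

lemma frag_extend_prism_cone:
  "frag_extend (prism u v) (cone x c) =
   cone (u x) (cone (v x) (frag_extend (\<lambda>xs. frag_of (map v xs)) c)) - cone (u x) (frag_extend (prism u v) c)"
  by (induction c rule: frag_induction [OF subset_UNIV]) (simp_all add: frag_extend_diff)

text \<open>The chain homotopy identity in the augmented complex. The empty list is a simplex of
  degree -1, so the induction on the list starts there and degree 0 is no exception. The step
  removes the first vertex by the cone formulas.\<close>

lemma boundary_prism: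
  "frag_extend list_boundary (prism u v xs) =
   frag_of (map v xs) - frag_of (map u xs) - frag_extend (prism u v) (list_boundary xs)"
  by (induction xs)
     (simp_all add: frag_extend_diff boundary_cone list_boundary_Cons list_boundary_map
        frag_extend_prism_cone)

lemma keys_prism:
  assumes "u \<in> X \<rightarrow> Y" "v \<in> X \<rightarrow> Y" "xs \<in> lists X"
  shows "Poly_Mapping.keys (prism u v xs) \<subseteq> {ys. length ys = Suc (length xs) \<and> ys \<in> lists Y}"
  using assms(3)
proof (induction xs rule: lists.induct)
  case (Cons x xs)
  let ?Z = "{ys. length ys = Suc (length (x # xs)) \<and> ys \<in> lists Y}"
  have x: "u x \<in> Y" "v x \<in> Y" "xs \<in> lists X"
    using Cons.hyps assms(1,2) by (simp_all add: Pi_iff)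
  have "Poly_Mapping.keys (cone (u x) (prism u v xs)) \<subseteq> ?Z"
    by (rule keys_frag_extend_subset [OF Cons.IH]) (use x(1) in simp)
  moreover have "Poly_Mapping.keys (frag_of (u x # v x # map v xs)) \<subseteq> ?Z"
    using x(1,2) map_in_lists [OF assms(2) x(3)] by simp
  ultimately show ?case
    unfolding prism.simps by (intro order_trans [OF keys_diff] Un_least)
qed simp

text \<open>Naturality of the prism: the primitive it produces from an invariant cochain is
  invariant again.\<close>

lemma prism_map:
  assumes "\<And>x. x \<in> set xs \<Longrightarrow> u (g x) = h (u x)" "\<And>x. x \<in> set xs \<Longrightarrow> v (g x) = h (v x)"
  shows "prism u v (map g xs) = frag_extend (\<lambda>ys. frag_of (map h ys)) (prism u v xs)"
proof -
  have cone: "frag_extend (\<lambda>ys. frag_of (map h ys)) (cone a c) =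
      cone (h a) (frag_extend (\<lambda>ys. frag_of (map h ys)) c)" for a c
    by (induction c rule: frag_induction [OF subset_UNIV]) (simp_all add: frag_extend_diff)
  show ?thesis
    using assms
  proof (induction xs)
    case (Cons x xs)
    then have "map (v \<circ> g) xs = map (h \<circ> v) xs" by auto
    with Cons show ?case by (simp add: frag_extend_diff cone del: map_eq_conv)
  qed simp
qed

text \<open>Every tuple of vertices is a simplex, so the prism joins any two maps \<open>u\<close>
  and \<open>v\<close>; equivariance over the same \<open>f\<close> is all that links them. The
  primitive is the value of \<open>\<phi>\<close> on the prism.\<close>

lemma is_coboundary_homotopy:
  assumes "is_cocycle m H Q Y l \<phi>" "f \<in> P \<rightarrow> Q" "u \<in> X \<rightarrow> Y" "v \<in> X \<rightarrow> Y"
    and u: "\<And>g x. g \<in> P \<Longrightarrow> x \<in> X \<Longrightarrow> u (g \<otimes>\<^bsub>G\<^esub> x) = f g \<otimes>\<^bsub>H\<^esub> u x"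
    and v: "\<And>g x. g \<in> P \<Longrightarrow> x \<in> X \<Longrightarrow> v (g \<otimes>\<^bsub>G\<^esub> x) = f g \<otimes>\<^bsub>H\<^esub> v x"
  shows "is_coboundary m G P X l (\<lambda>xs. \<phi> (map v xs) - \<phi> (map u xs))"
proof (rule is_coboundaryI)
  note keys = keys_prism [OF assms(3,4)]
  show "invariant_cochain m G P X (\<lambda>xs. pairing \<phi> (prism u v xs))"
    unfolding invariant_cochain_def
  proof (intro ballI)
    fix g xs assume g: "g \<in> P" and xs: "xs \<in> lists X"
    have "prism u v (map (\<lambda>x. g \<otimes>\<^bsub>G\<^esub> x) xs) =
        frag_extend (\<lambda>ys. frag_of (map (\<lambda>y. f g \<otimes>\<^bsub>H\<^esub> y) ys)) (prism u v xs)"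
      by (rule prism_map) (use g xs u v in auto)
    then have "pairing \<phi> (prism u v (map (\<lambda>x. g \<otimes>\<^bsub>G\<^esub> x) xs)) =
        pairing (\<lambda>ys. \<phi> (map (\<lambda>y. f g \<otimes>\<^bsub>H\<^esub> y) ys)) (prism u v xs)"
      by (simp add: pairing_extend)
    also have "[\<dots> = pairing \<phi> (prism u v xs)] (mod m)"
    proof (rule pairing_cong)
      fix ys assume "ys \<in> Poly_Mapping.keys (prism u v xs)"
      then show "[\<phi> (map (\<lambda>y. f g \<otimes>\<^bsub>H\<^esub> y) ys) = \<phi> ys] (mod m)"
        using keys [OF xs] g assms(2) by (intro invariant_cochainD [OF is_cocycleD(1) [OF assms(1)]]) auto
    qed
    finally show "[pairing \<phi> (prism u v (map (\<lambda>x. g \<otimes>\<^bsub>G\<^esub> x) xs)) = pairing \<phi> (prism u v xs)] (mod m)" .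
  qed
next
  fix xs assume xs: "xs \<in> lists X" "length xs = l"
  have "pairing \<phi> (frag_extend list_boundary (prism u v xs)) =
      \<phi> (map v xs) - \<phi> (map u xs) - pairing (\<lambda>ys. pairing \<phi> (prism u v ys)) (list_boundary xs)"
    by (simp add: boundary_prism pairing_diff pairing_extend)
  \<comment> \<open>The lists of the prism have one entry more than \<open>xs\<close>, which is the
    length at which the cocycle condition of \<open>\<phi>\<close> applies.\<close>
  moreover have "[pairing (\<lambda>ys. pairing \<phi> (list_boundary ys)) (prism u v xs) = pairing (\<lambda>_. 0) (prism u v xs)] (mod m)"
  proof (rule pairing_cong)
    fix ys assume "ys \<in> Poly_Mapping.keys (prism u v xs)"
    then show "[pairing \<phi> (list_boundary ys) = 0] (mod m)"
      using keys_prism [OF assms(3,4) xs(1)] xs(2) by (intro is_cocycleD(2) [OF assms(1)]) auto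
  qed
  ultimately show "[\<phi> (map v xs) - \<phi> (map u xs) =
      pairing (\<lambda>ys. pairing \<phi> (prism u v ys)) (list_boundary xs)] (mod m)"
    by (simp add: pairing_extend cong_iff_dvd_diff)
qed simp


subsection \<open>Transfer\<close>

text \<open>\<open>C\<close> is meant to be a right coset \<open>S #> x\<close>. If
  \<open>\<phi>\<close> is left \<open>S\<close>-invariant modulo \<open>m\<close>, the choice of
  the representative is immaterial modulo \<open>m\<close>; see
  \<open>translate_cong\<close>.\<close>

definition translate :: "('a, 'x) monoid_scheme \<Rightarrow> ('a list \<Rightarrow> int) \<Rightarrow> 'a set \<Rightarrow> 'a list \<Rightarrow> int" where
  "translate G \<phi> C xs = \<phi> (map (\<lambda>x. (SOME y. y \<in> C) \<otimes>\<^bsub>G\<^esub> x) xs)"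

context group
begin

lemma lists_translate: "\<lbrakk>g \<in> carrier G; xs \<in> lists (carrier G)\<rbrakk> \<Longrightarrow> map (\<lambda>x. g \<otimes> x) xs \<in> lists (carrier G)"
  by (rule map_in_lists) auto

lemma translate_translate:
  "\<lbrakk>g \<in> carrier G; h \<in> carrier G; xs \<in> lists (carrier G)\<rbrakk> \<Longrightarrow>
   map (\<lambda>x. g \<otimes> x) (map (\<lambda>x. h \<otimes> x) xs) = map (\<lambda>x. (g \<otimes> h) \<otimes> x) xs"
  by (auto simp: m_assoc)

lemma rcosetE:
  assumes "C \<in> rcosets S" obtains x where "x \<in> carrier G" "C = S #> x"
  using assms by (auto simp: RCOSETS_def)

lemma rcoset_some:
  assumes "subgroup S G" "C \<in> rcosets S"
  shows "(SOME y. y \<in> C) \<in> carrier G" and "C = S #> (SOME y. y \<in> C)"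
proof -
  obtain x where x: "x \<in> carrier G" "C = S #> x" using assms(2) by (rule rcosetE)
  then have "x \<in> C" using rcos_self assms(1) by blast
  then have some: "(SOME y. y \<in> C) \<in> C" by (rule someI)
  then show "(SOME y. y \<in> C) \<in> carrier G"
    using x r_coset_subset_G [OF subgroup.subset [OF assms(1)] x(1)] by blast
  show "C = S #> (SOME y. y \<in> C)"
    using repr_independence [of "SOME y. y \<in> C" S x] some x assms(1) by simp
qed

lemma translate_cong:
  assumes "subgroup S G" "invariant_cochain m G S (carrier G) \<phi>" "x \<in> carrier G" "xs \<in> lists (carrier G)"
  shows "[translate G \<phi> (S #> x) xs = \<phi> (map (\<lambda>y. x \<otimes> y) xs)] (mod m)"
proof -
  let ?r = "SOME y. y \<in> S #> x"
  have "?r \<in> S #> x" by (rule someI [of _ x]) (rule rcos_self [OF assms(3,1)])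
  then obtain s where s: "s \<in> S" "?r = s \<otimes> x" by (auto simp: r_coset_def)
  have "map (\<lambda>y. ?r \<otimes> y) xs = map (\<lambda>y. s \<otimes> y) (map (\<lambda>y. x \<otimes> y) xs)"
    using translate_translate [of s x xs] assms s subgroup.mem_carrier by metis
  then show ?thesis
    unfolding translate_def
    using invariant_cochainD [OF assms(2) s(1) lists_translate [OF assms(3,4)]] by (simp del: map_map)
qed

lemma rcosets_translate:
  assumes "subgroup S G" "C \<in> rcosets S" "g \<in> carrier G"
  shows "C #> g \<in> rcosets S"
proof -
  obtain x where "x \<in> carrier G" "C = S #> x" using assms(2) by (rule rcosetE)
  then show ?thesis
    using assms coset_mult_assoc [of S x g] subgroup.subset [OF assms(1)] rcosetsI by simp
qed

lemma rcosets_translate_translate: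
  assumes "subgroup S G" "C \<in> rcosets S" "g \<in> carrier G" "h \<in> carrier G"
  shows "(C #> g) #> h = C #> (g \<otimes> h)"
  using subgroup.rcosets_carrier [OF assms(1) is_group assms(2)] assms(3,4)
  by (rule coset_mult_assoc)

lemma rcosets_translate_one:
  assumes "subgroup S G" "C \<in> rcosets S"
  shows "C #> \<one> = C"
  using subgroup.rcosets_carrier [OF assms(1) is_group assms(2)] by (rule coset_mult_one)

lemma bij_betw_rcosets_translate:
  assumes "subgroup S G" "g \<in> carrier G"
  shows "bij_betw (\<lambda>C. C #> g) (rcosets S) (rcosets S)"
  by (rule bij_betw_byWitness [where f' = "\<lambda>C. C #> inv g"])
     (use assms in \<open>auto simp: rcosets_translate rcosets_translate_translate rcosets_translate_one\<close>)

text \<open>Translating the argument by \<open>g\<close> permutes the summands through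
  \<open>C \<mapsto> C #> inv g\<close>. This serves both the transfer and the sum of primitives in
  \<open>ex_cocycle_restricting_to_stable\<close>.\<close>

lemma invariant_cochain_sum_rcosets:
  assumes "subgroup S G" "Q \<subseteq> carrier G"
    and "\<And>g C xs. \<lbrakk>g \<in> Q; C \<in> rcosets S; xs \<in> lists (carrier G)\<rbrakk> \<Longrightarrow>
      [\<chi> (C #> inv g) (map (\<lambda>x. g \<otimes> x) xs) = \<chi> C xs] (mod m)"
  shows "invariant_cochain m G Q (carrier G) (\<lambda>xs. \<Sum>C\<in>rcosets S. \<chi> C xs)"
  unfolding invariant_cochain_def
proof (intro ballI)
  fix g xs assume g: "g \<in> Q" and xs: "xs \<in> lists (carrier G)"
  have "(\<Sum>C\<in>rcosets S. \<chi> C (map (\<lambda>x. g \<otimes> x) xs)) =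
      (\<Sum>C\<in>rcosets S. \<chi> (C #> inv g) (map (\<lambda>x. g \<otimes> x) xs))"
    using sum.reindex_bij_betw [OF bij_betw_rcosets_translate [OF assms(1), of "inv g"],
        of "\<lambda>C. \<chi> C (map (\<lambda>x. g \<otimes> x) xs)"] g assms(2) by auto
  also have "[\<dots> = (\<Sum>C\<in>rcosets S. \<chi> C xs)] (mod m)"
    by (rule cong_sum) (use assms(3) g xs in auto)
  finally show "[(\<Sum>C\<in>rcosets S. \<chi> C (map (\<lambda>x. g \<otimes> x) xs)) = (\<Sum>C\<in>rcosets S. \<chi> C xs)] (mod m)" .
qed

text \<open>The representative of the moved coset absorbs the translation: \<open>(x \<otimes> inv
  g) \<otimes> (g \<otimes> y) = x \<otimes> y\<close>.\<close>

lemma translate_equivariant: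
  assumes "subgroup S G" "invariant_cochain m G S (carrier G) \<phi>"
    and "g \<in> carrier G" "C \<in> rcosets S" "xs \<in> lists (carrier G)"
  shows "[translate G \<phi> (C #> inv g) (map (\<lambda>x. g \<otimes> x) xs) = translate G \<phi> C xs] (mod m)"
proof -
  obtain x where x: "x \<in> carrier G" "C = S #> x" using assms(4) by (rule rcosetE)
  have C: "C #> inv g = S #> (x \<otimes> inv g)"
    using x assms(3) coset_mult_assoc [of S x "inv g"] subgroup.subset [OF assms(1)] by simp
  have "[translate G \<phi> (C #> inv g) (map (\<lambda>x. g \<otimes> x) xs) =
      \<phi> (map (\<lambda>y. (x \<otimes> inv g) \<otimes> y) (map (\<lambda>x. g \<otimes> x) xs))] (mod m)"
    unfolding C using x assms by (intro translate_cong lists_translate) auto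
  also have "map (\<lambda>y. (x \<otimes> inv g) \<otimes> y) (map (\<lambda>x. g \<otimes> x) xs) = map (\<lambda>y. x \<otimes> y) xs"
    using x assms by (simp add: translate_translate m_assoc del: map_map)
  also have "[\<phi> (map (\<lambda>y. x \<otimes> y) xs) = translate G \<phi> C xs] (mod m)"
    unfolding x(2) using translate_cong [OF assms(1,2) x(1) assms(5)] by (rule cong_sym)
  finally show ?thesis .
qed

lemma invariant_cochain_transfer:
  assumes "subgroup S G" "invariant_cochain m G S (carrier G) \<phi>"
  shows "invariant_cochain m G (carrier G) (carrier G) (\<lambda>xs. \<Sum>C\<in>rcosets S. translate G \<phi> C xs)"
  by (rule invariant_cochain_sum_rcosets) (use assms translate_equivariant in auto)

lemma pairing_translate:
  "pairing (translate G \<phi> C) (list_boundary xs) =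
   pairing \<phi> (list_boundary (map (\<lambda>x. (SOME y. y \<in> C) \<otimes> x) xs))"
  unfolding translate_def by (rule pairing_list_boundary_map)

lemma is_cocycle_transfer:
  assumes "subgroup S G" "is_cocycle m G S (carrier G) l \<phi>"
  shows "is_cocycle m G (carrier G) (carrier G) l (\<lambda>xs. \<Sum>C\<in>rcosets S. translate G \<phi> C xs)"
  unfolding is_cocycle_def
proof (intro conjI ballI impI)
  fix xs assume xs: "xs \<in> lists (carrier G)" "length xs = Suc l"
  have "[(\<Sum>C\<in>rcosets S. pairing (translate G \<phi> C) (list_boundary xs)) = (\<Sum>C\<in>rcosets S. 0)] (mod m)"
    unfolding pairing_translate
    by (intro cong_sum is_cocycleD(2) [OF assms(2)] lists_translate rcoset_some [OF assms(1)] xs(1))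
       (use xs in simp_all)
  then show "[pairing (\<lambda>xs. \<Sum>C\<in>rcosets S. translate G \<phi> C xs) (list_boundary xs) = 0] (mod m)"
    by (simp add: pairing_fun_sum)
qed (intro invariant_cochain_transfer assms(1) is_cocycleD(1) [OF assms(2)])

lemma is_coboundary_transfer:
  assumes "subgroup S G" "is_coboundary m G S (carrier G) l \<phi>"
  shows "is_coboundary m G (carrier G) (carrier G) l (\<lambda>xs. \<Sum>C\<in>rcosets S. translate G \<phi> C xs)"
proof -
  obtain \<psi> where \<psi>: "invariant_cochain m G S (carrier G) \<psi>" "[\<psi> [] = 0] (mod m)"
    "\<And>xs. \<lbrakk>xs \<in> lists (carrier G); length xs = l\<rbrakk> \<Longrightarrow> [\<phi> xs = pairing \<psi> (list_boundary xs)] (mod m)"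
    using assms(2) by (rule is_coboundaryE) blast
  show ?thesis
  proof (rule is_coboundaryI)
    show "invariant_cochain m G (carrier G) (carrier G) (\<lambda>xs. \<Sum>C\<in>rcosets S. translate G \<psi> C xs)"
      using assms(1) \<psi>(1) by (rule invariant_cochain_transfer)
    have "[(\<Sum>C\<in>rcosets S. \<psi> []) = (\<Sum>C\<in>rcosets S. 0)] (mod m)"
      using \<psi>(2) by (intro cong_sum)
    then show "[(\<Sum>C\<in>rcosets S. translate G \<psi> C []) = 0] (mod m)"
      by (simp add: translate_def)
    fix xs assume xs: "xs \<in> lists (carrier G)" "length xs = l"
    show "[(\<Sum>C\<in>rcosets S. translate G \<phi> C xs) =
        pairing (\<lambda>xs. \<Sum>C\<in>rcosets S. translate G \<psi> C xs) (list_boundary xs)] (mod m)"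
      unfolding pairing_fun_sum pairing_translate translate_def [of G \<phi>]
      by (intro cong_sum \<psi>(3) lists_translate rcoset_some [OF assms(1)] xs(1)) (use xs in simp_all)
  qed
qed


subsection \<open>Restriction to a subgroup of invertible index\<close>

text \<open>\<open>G\<close> is a free left \<open>P\<close>-set, so choosing one point in each
  coset \<open>P #> x\<close> splits off a \<open>P\<close>-component of \<open>x\<close>. Followed
  by the inclusion of \<open>P\<close> this is an equivariant self-map of \<open>G\<close>, and a
  prism joins it to the identity.\<close>

lemma ex_equivariant_retraction:
  assumes "subgroup P G"
  obtains r where "r \<in> carrier G \<rightarrow> P"
    "\<And>g x. \<lbrakk>g \<in> P; x \<in> carrier G\<rbrakk> \<Longrightarrow> r (g \<otimes> x) = g \<otimes> r x"
proof
  let ?r = "\<lambda>x. x \<otimes> inv (SOME y. y \<in> P #> x)"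
  have some: "(SOME y. y \<in> P #> x) \<in> P #> x" if "x \<in> carrier G" for x
    by (rule someI [of _ x]) (rule rcos_self [OF that assms])
  show "?r \<in> carrier G \<rightarrow> P"
  proof
    fix x assume x: "x \<in> carrier G"
    then obtain s where s: "s \<in> P" "(SOME y. y \<in> P #> x) = s \<otimes> x"
      using some [OF x] by (auto simp: r_coset_def)
    have "s \<in> carrier G" using s(1) assms by (rule subgroup.mem_carrier [rotated])
    \<comment> \<open>The chosen point of the coset is \<open>s \<otimes> x\<close>, so dividing by
      it on the right leaves the inverse of \<open>s\<close>.\<close>
    then have "?r x = inv s"
      using x unfolding s(2) by (simp add: inv_mult_group m_assoc [symmetric])
    then show "?r x \<in> P" using s(1) assms by (simp add: subgroup.m_inv_closed)
  qed
  fix g x assume g: "g \<in> P" and x: "x \<in> carrier G"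
  have gG: "g \<in> carrier G" using g assms by (rule subgroup.mem_carrier [rotated])
  have "P #> (g \<otimes> x) = P #> x"
    using coset_mult_assoc [of P g x] coset_join2 [OF gG assms g] subgroup.subset [OF assms] gG x by simp
  moreover have "(SOME y. y \<in> P #> x) \<in> carrier G"
    using some [OF x] r_coset_subset_G [OF subgroup.subset [OF assms] x] by blast
  ultimately show "?r (g \<otimes> x) = g \<otimes> ?r x"
    using gG x by (simp add: m_assoc)
qed

text \<open>Over \<open>P\<close>, the cocycle \<open>\<phi>\<close> is cohomologous to its pullback
  along an equivariant map \<open>G \<rightarrow> P\<close>, and that pullback sees only tuples in
  \<open>P\<close>, where a primitive is given.\<close>

lemma is_coboundary_extend:
  assumes "subgroup P G" "is_cocycle m G P (carrier G) l \<phi>" "is_coboundary m G P P l \<phi>"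
  shows "is_coboundary m G P (carrier G) l \<phi>"
proof -
  obtain r where r: "r \<in> carrier G \<rightarrow> P"
    "\<And>g x. \<lbrakk>g \<in> P; x \<in> carrier G\<rbrakk> \<Longrightarrow> r (g \<otimes> x) = g \<otimes> r x"
    using ex_equivariant_retraction [OF assms(1)] by blast
  have "r \<in> carrier G \<rightarrow> carrier G" using r(1) subgroup.subset [OF assms(1)] by auto
  then have "is_coboundary m G P (carrier G) l (\<lambda>xs. \<phi> (map (\<lambda>x. x) xs) - \<phi> (map r xs))"
    by (intro is_coboundary_homotopy [OF assms(2), of "\<lambda>g. g"]) (auto simp: r(2))
  moreover have "is_coboundary m G P (carrier G) l (\<lambda>xs. \<phi> (map r xs))"
    by (rule is_coboundary_pullback [OF assms(3), of "\<lambda>g. g"]) (auto simp: r)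
  ultimately show ?thesis
    using is_coboundary_add by fastforce
qed

text \<open>For a \<open>G\<close>-invariant \<open>\<phi>\<close> every translate is
  \<open>\<phi>\<close> again modulo \<open>m\<close>, so transfer after restriction multiplies by
  the index, and \<open>k\<close> below inverts the index modulo \<open>m\<close>.\<close>

theorem is_coboundary_restrict_iff:
  assumes "subgroup S G" "coprime (int (card (rcosets S))) m" "is_cocycle m G (carrier G) (carrier G) l \<phi>"
  shows "is_coboundary m G S S l \<phi> \<longleftrightarrow> is_coboundary m G (carrier G) (carrier G) l \<phi>"
proof
  let ?i = "int (card (rcosets S))"
  note S = subgroup.subset [OF assms(1)]
  assume "is_coboundary m G S S l \<phi>"
  then have "is_coboundary m G S (carrier G) l \<phi>"
    using is_coboundary_extend [OF assms(1) is_cocycle_mono [OF assms(3) S order_refl]] by blast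
  then have "is_coboundary m G (carrier G) (carrier G) l (\<lambda>xs. \<Sum>C\<in>rcosets S. translate G \<phi> C xs)"
    using is_coboundary_transfer assms(1) by blast
  moreover obtain k where k: "[?i * k = 1] (mod m)"
    using cong_solve_coprime_int [OF assms(2)] by blast
  ultimately have "is_coboundary m G (carrier G) (carrier G) l (\<lambda>xs. k * (\<Sum>C\<in>rcosets S. translate G \<phi> C xs))"
    by (intro is_coboundary_cmul)
  then show "is_coboundary m G (carrier G) (carrier G) l \<phi>"
  proof (rule is_coboundary_cong)
    fix xs assume xs: "xs \<in> lists (carrier G)"
    have "[(\<Sum>C\<in>rcosets S. translate G \<phi> C xs) = (\<Sum>C\<in>rcosets S. \<phi> xs)] (mod m)"
      unfolding translate_def
      by (intro cong_sum invariant_cochainD [OF is_cocycleD(1) [OF assms(3)]] rcoset_some [OF assms(1)] xs)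
    from cong_scalar_left [OF this, of k]
    have "[k * (\<Sum>C\<in>rcosets S. translate G \<phi> C xs) = (?i * k) * \<phi> xs] (mod m)"
      by (simp add: ac_simps)
    also have "[(?i * k) * \<phi> xs = 1 * \<phi> xs] (mod m)"
      using k by (rule cong_scalar_right)
    finally show "[\<phi> xs = k * (\<Sum>C\<in>rcosets S. translate G \<phi> C xs)] (mod m)"
      by (simp add: cong_sym_eq)
  qed
next
  assume "is_coboundary m G (carrier G) (carrier G) l \<phi>"
  then show "is_coboundary m G S S l \<phi>"
    using subgroup.subset [OF assms(1)] by (rule is_coboundary_mono) (rule subgroup.subset [OF assms(1)])
qed

text \<open>Here a subconjugation \<open>P \<rightarrow> S\<close> is given by the conjugating
  element \<open>x\<close>. Comparing each with the inclusion of \<open>P\<close> is enough: two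
  pullbacks that agree with the restriction to \<open>P\<close> agree with one another.\<close>

definition is_stable :: "int \<Rightarrow> 'a set \<Rightarrow> nat \<Rightarrow> ('a list \<Rightarrow> int) \<Rightarrow> bool" where
  "is_stable m S l \<phi> \<longleftrightarrow> (\<forall>P x. subgroup P G \<and> P \<subseteq> S \<and> x \<in> carrier G \<and> (\<forall>y\<in>P. x \<otimes> y \<otimes> inv x \<in> S) \<longrightarrow>
     is_coboundary m G P P l (\<lambda>ys. \<phi> (map (\<lambda>y. x \<otimes> y \<otimes> inv x) ys) - \<phi> ys))"

text \<open>
  Left translation by \<open>x\<close> leaves an invariant cocycle unchanged, so conjugation by \<open>x\<close> acts like
  right translation by \<open>inv x\<close>, which is homotopic to the identity.
\<close>

lemma is_stable_restriction:
  assumes "is_cocycle m G (carrier G) (carrier G) l \<phi>"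
  shows "is_stable m S l \<phi>"
  unfolding is_stable_def
proof (intro allI impI, elim conjE)
  fix P x assume P: "subgroup P G" and x: "x \<in> carrier G"
  note PG = subgroup.subset [OF P]
  have "is_coboundary m G P P l (\<lambda>ys. \<phi> (map (\<lambda>y. y \<otimes> inv x) ys) - \<phi> (map (\<lambda>y. y) ys))"
    by (rule is_coboundary_homotopy [OF assms, of "\<lambda>g. g"]) (use PG x in \<open>auto simp: subset_iff m_assoc\<close>)
  then show "is_coboundary m G P P l (\<lambda>ys. \<phi> (map (\<lambda>y. x \<otimes> y \<otimes> inv x) ys) - \<phi> ys)"
  proof (rule is_coboundary_cong)
    fix ys assume ys: "ys \<in> lists P"
    then have "map (\<lambda>y. x \<otimes> y \<otimes> inv x) ys = map (\<lambda>y. x \<otimes> y) (map (\<lambda>y. y \<otimes> inv x) ys)"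
      using PG x by (auto simp: m_assoc subset_iff)
    moreover have "map (\<lambda>y. y \<otimes> inv x) ys \<in> lists (carrier G)"
      by (rule map_in_lists [OF _ ys]) (use PG x in auto)
    ultimately show "[\<phi> (map (\<lambda>y. x \<otimes> y \<otimes> inv x) ys) - \<phi> ys =
        \<phi> (map (\<lambda>y. y \<otimes> inv x) ys) - \<phi> (map (\<lambda>y. y) ys)] (mod m)"
      using invariant_cochainD [OF is_cocycleD(1) [OF assms] x]
      by (simp del: map_map add: cong_diff)
  qed
qed

text \<open>
  The transfer of a stable class restricts to a sum over \<open>S \<setminus> G\<close> of translates. Each translate is
  cohomologous to the original class over the stabiliser of the coset, and the primitives can be
  chosen compatibly along the \<open>S\<close>-orbits.
\<close>

lemma translate_stable:
  assumes S: "subgroup S G" and \<phi>: "is_cocycle m G S S l \<phi>" "is_stable m S l \<phi>"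
    and r: "r \<in> carrier G \<rightarrow> S" "\<And>g x. \<lbrakk>g \<in> S; x \<in> carrier G\<rbrakk> \<Longrightarrow> r (g \<otimes> x) = g \<otimes> r x"
    and C: "C \<in> rcosets S"
  shows "is_coboundary m G {g \<in> S. C #> g = C} (carrier G) l
    (\<lambda>xs. translate G (\<lambda>xs. \<phi> (map r xs)) C xs - \<phi> (map r xs))"
proof -
  define x where "x = (SOME y. y \<in> C)"
  have x: "x \<in> carrier G" "C = S #> x"
    using rcoset_some [OF S C] by (simp_all add: x_def)
  note SG = subgroup.subset [OF S]
  define P where "P = {g \<in> S. C #> g = C}"
  have PS: "P \<subseteq> S" by (auto simp: P_def)
  then have PG: "P \<subseteq> carrier G" using SG by blast
  \<comment> \<open>That \<open>g\<close> fixes the coset \<open>S #> x\<close> says that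
    conjugation by \<open>x\<close> sends \<open>g\<close> into \<open>S\<close>. Hence stability
    can be applied to the stabiliser \<open>P\<close>.\<close>
  have conj: "x \<otimes> g \<otimes> inv x \<in> S" if "g \<in> P" for g
  proof -
    have g: "g \<in> carrier G" "S #> (x \<otimes> g) = S #> x"
      using that PG x coset_mult_assoc [OF SG x(1)] by (auto simp: P_def)
    then have "x \<otimes> g \<in> S #> x"
      using rcos_self [of "x \<otimes> g" S] S x(1) by simp
    then obtain s where "s \<in> S" "x \<otimes> g = s \<otimes> x" by (auto simp: r_coset_def)
    moreover from this have "s \<otimes> x \<otimes> inv x = s" using SG x(1) by (simp add: m_assoc subset_iff)
    ultimately show ?thesis by simp
  qed
  have P: "subgroup P G"
  proof (rule subgroupI)
    show "P \<noteq> {}" using subgroup.one_closed [OF S] rcosets_translate_one [OF S C] by (auto simp: P_def)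
    fix a assume a: "a \<in> P"
    then have "C #> inv a = (C #> a) #> inv a" by (simp add: P_def)
    also have "\<dots> = C"
      using a PG rcosets_translate_translate [OF S C, of a "inv a"] rcosets_translate_one [OF S C] by auto
    finally show "inv a \<in> P" using a subgroup.m_inv_closed [OF S] by (simp add: P_def)
    fix b assume b: "b \<in> P"
    have "C #> (a \<otimes> b) = C"
      using a b PG rcosets_translate_translate [OF S C, of a b] by (auto simp: P_def)
    then show "a \<otimes> b \<in> P" using a b subgroup.m_closed [OF S] by (simp add: P_def)
  qed (use PG in auto)
  \<comment> \<open>Left translation by \<open>x\<close> is equivariant over conjugation by
    \<open>x\<close>; composing it with \<open>r\<close> keeps this property and lands in
    \<open>S\<close>.\<close>
  have conj_mult: "x \<otimes> (g \<otimes> y) = (x \<otimes> g \<otimes> inv x) \<otimes> (x \<otimes> y)"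
    if "g \<in> carrier G" "y \<in> carrier G" for g y
    using that x(1) by (simp add: m_assoc [symmetric]) (simp add: m_assoc)
  have rx: "r (x \<otimes> (g \<otimes> y)) = (x \<otimes> g \<otimes> inv x) \<otimes> r (x \<otimes> y)" if "g \<in> P" "y \<in> carrier G" for g y
  proof -
    have "g \<in> carrier G" using that(1) PG by blast
    then show ?thesis
      using r(2) [OF conj [OF that(1)]] conj_mult [OF _ that(2)] x(1) that(2) by simp
  qed
  have translate: "translate G (\<lambda>xs. \<phi> (map r xs)) C xs = \<phi> (map (\<lambda>y. r (x \<otimes> y)) xs)" for xs
    by (simp add: translate_def x_def [symmetric] o_def)
  \<comment> \<open>On tuples in \<open>P\<close> the two cocycles are linked in three steps.
    \<open>c1\<close> and \<open>c3\<close> are homotopies between equivariant maps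
    \<open>P \<rightarrow> S\<close>, over conjugation by \<open>x\<close> and over the identity,
    and \<open>c2\<close> is stability for \<open>P\<close> and \<open>x\<close>.\<close>
  have c1: "is_coboundary m G P P l (\<lambda>ys. \<phi> (map (\<lambda>y. r (x \<otimes> y)) ys) - \<phi> (map (\<lambda>y. x \<otimes> y \<otimes> inv x) ys))"
  proof (rule is_coboundary_homotopy [OF \<phi>(1), of "\<lambda>g. x \<otimes> g \<otimes> inv x"])
    fix g y assume "g \<in> P" "y \<in> P"
    then have "g \<in> carrier G" "y \<in> carrier G" using PG by auto
    then show "x \<otimes> (g \<otimes> y) \<otimes> inv x = x \<otimes> g \<otimes> inv x \<otimes> (x \<otimes> y \<otimes> inv x)"
      unfolding conj_mult [OF \<open>g \<in> carrier G\<close> \<open>y \<in> carrier G\<close>] using x(1)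
      by (intro m_assoc) simp_all
  next
    fix g y assume "g \<in> P" "y \<in> P"
    then show "r (x \<otimes> (g \<otimes> y)) = x \<otimes> g \<otimes> inv x \<otimes> r (x \<otimes> y)"
      using PG rx by blast
  next
    show "(\<lambda>y. r (x \<otimes> y)) \<in> P \<rightarrow> S" using r(1) x(1) PG by (simp add: Pi_def subset_eq)
  qed (use conj in blast)+
  have c2: "is_coboundary m G P P l (\<lambda>ys. \<phi> (map (\<lambda>y. x \<otimes> y \<otimes> inv x) ys) - \<phi> ys)"
    using \<phi>(2) P PS x(1) conj unfolding is_stable_def by blast
  have c3: "is_coboundary m G P P l (\<lambda>ys. \<phi> (map r ys) - \<phi> (map (\<lambda>y. y) ys))"
  proof (rule is_coboundary_homotopy [OF \<phi>(1), of "\<lambda>g. g"])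
    show "r \<in> P \<rightarrow> S" using r(1) PG by auto
    show "r (g \<otimes> y) = g \<otimes> r y" if "g \<in> P" "y \<in> P" for g y using that PG PS r(2) by blast
  qed (use PS in auto)
  have "is_coboundary m G P P l (\<lambda>ys. \<phi> (map (\<lambda>y. r (x \<otimes> y)) ys) - \<phi> (map r ys))"
    by (rule is_coboundary_cong [OF is_coboundary_diff [OF is_coboundary_add [OF c1 c2] c3]]) simp
  \<comment> \<open>The comparison was made on tuples in \<open>P\<close>, while the claim concerns
    tuples in \<open>G\<close>. \<open>is_coboundary_extend\<close> bridges the two once the
    difference is known to be a cocycle there.\<close>
  moreover have "is_cocycle m G P (carrier G) l (\<lambda>ys. \<phi> (map (\<lambda>y. r (x \<otimes> y)) ys) - \<phi> (map r ys))"
  proof (rule is_cocycle_diff)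
    show "is_cocycle m G P (carrier G) l (\<lambda>ys. \<phi> (map (\<lambda>y. r (x \<otimes> y)) ys))"
    proof (rule is_cocycle_pullback [OF \<phi>(1), of "\<lambda>g. x \<otimes> g \<otimes> inv x"])
      show "(\<lambda>y. r (x \<otimes> y)) \<in> carrier G \<rightarrow> S" using r(1) x(1) by (simp add: Pi_def)
      show "(\<lambda>g. x \<otimes> g \<otimes> inv x) \<in> P \<rightarrow> S" using conj by blast
    qed (rule rx)
    show "is_cocycle m G P (carrier G) l (\<lambda>ys. \<phi> (map r ys))"
      by (rule is_cocycle_pullback [OF \<phi>(1), of "\<lambda>g. g"]) (use PS r in auto)
  qed
  ultimately show ?thesis
    unfolding translate P_def [symmetric] using is_coboundary_extend [OF P] by blast
qed

text \<open>\<open>b\<close> picks one coset in each \<open>Q\<close>-orbit and \<open>s C\<close>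
  records an element that carries \<open>C\<close> to it. Primitives chosen at the cosets
  \<open>b C\<close> alone can then be spread over the orbits.\<close>

lemma rcoset_orbit_base:
  assumes "subgroup S G" "subgroup Q G"
  obtains b s where
    "\<And>C. C \<in> rcosets S \<Longrightarrow> b C \<in> rcosets S \<and> s C \<in> Q \<and> b C #> inv (s C) = C"
    "\<And>C g. \<lbrakk>C \<in> rcosets S; g \<in> Q\<rbrakk> \<Longrightarrow> b (C #> g) = b C"
proof -
  note QG = subgroup.subset [OF assms(2)]
  define orb where "orb C = {C #> g | g. g \<in> Q}" for C
  define b where "b C = (SOME D. D \<in> orb C)" for C
  have "C \<in> orb C" if "C \<in> rcosets S" for C
    using rcosets_translate_one [OF assms(1) that] subgroup.one_closed [OF assms(2)]
    unfolding orb_def by force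
  then have b: "b C \<in> orb C" if "C \<in> rcosets S" for C
    using that unfolding b_def by (meson someI)
  have "\<exists>s. s \<in> Q \<and> b C #> inv s = C" if C: "C \<in> rcosets S" for C
  proof -
    obtain g where "g \<in> Q" "b C = C #> g" using b [OF C] by (auto simp: orb_def)
    then show ?thesis
      using QG C rcosets_translate_translate [OF assms(1) C, of g "inv g"] rcosets_translate_one [OF assms(1) C]
      by (intro exI [of _ g]) auto
  qed
  then obtain s where s: "\<And>C. C \<in> rcosets S \<Longrightarrow> s C \<in> Q \<and> b C #> inv (s C) = C" by metis
  \<comment> \<open>All cosets of an orbit have the same set \<open>orb C\<close>, so
    \<open>SOME\<close> makes the same choice for each of them.\<close>
  have "orb (C #> g) = orb C" if C: "C \<in> rcosets S" and g: "g \<in> Q" for C g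
  proof -
    have "(C #> g) #> h = C #> (g \<otimes> h)" "C #> h = (C #> g) #> (inv g \<otimes> h)" if "h \<in> Q" for h
      using that g C QG rcosets_translate_translate [OF assms(1) C]
      by (auto simp: subset_iff m_assoc [symmetric])
    moreover have "g \<otimes> h \<in> Q" "inv g \<otimes> h \<in> Q" if "h \<in> Q" for h
      using that g assms(2) by (auto intro: subgroup.m_closed subgroup.m_inv_closed)
    ultimately show ?thesis unfolding orb_def by blast
  qed
  then have "b (C #> g) = b C" if "C \<in> rcosets S" "g \<in> Q" for C g
    using that by (simp add: b_def)
  moreover have "b C \<in> rcosets S" if "C \<in> rcosets S" for C
    using b [OF that] that QG rcosets_translate [OF assms(1)] by (auto simp: orb_def)
  ultimately show thesis
    using s by (intro that [of b s]) simp_all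
qed

text \<open>With \<open>k\<close> inverse to the index, \<open>k\<close> times the transfer is the
  required \<open>\<theta>\<close>. Over \<open>S\<close> the sum of the translates differs by a
  coboundary from as many copies of \<open>\<psi>\<close> as there are cosets, and
  \<open>\<psi>\<close>, the pullback of \<open>\<phi>\<close> to tuples in \<open>G\<close>,
  restricts to the class of \<open>\<phi>\<close>.\<close>

theorem ex_cocycle_restricting_to_stable:
  assumes S: "subgroup S G" and i: "coprime (int (card (rcosets S))) m"
    and \<phi>: "is_cocycle m G S S l \<phi>" "is_stable m S l \<phi>"
  obtains \<theta> where "is_cocycle m G (carrier G) (carrier G) l \<theta>" "is_coboundary m G S S l (\<lambda>xs. \<theta> xs - \<phi> xs)"
proof -
  note SG = subgroup.subset [OF S]
  obtain r where r: "r \<in> carrier G \<rightarrow> S"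
    "\<And>g x. \<lbrakk>g \<in> S; x \<in> carrier G\<rbrakk> \<Longrightarrow> r (g \<otimes> x) = g \<otimes> r x"
    using ex_equivariant_retraction [OF S] by blast
  define \<psi> where "\<psi> xs = \<phi> (map r xs)" for xs
  have \<psi>: "is_cocycle m G S (carrier G) l \<psi>"
    unfolding \<psi>_def by (rule is_cocycle_pullback [OF \<phi>(1), of "\<lambda>g. g"]) (use r in auto)
  note inv\<psi> = is_cocycleD(1) [OF \<psi>]
  have "\<exists>\<chi>. invariant_cochain m G {g \<in> S. C #> g = C} (carrier G) \<chi> \<and> [\<chi> [] = 0] (mod m) \<and>
     (\<forall>xs\<in>lists (carrier G). length xs = l \<longrightarrow>
       [translate G \<psi> C xs - \<psi> xs = pairing \<chi> (list_boundary xs)] (mod m))" if "C \<in> rcosets S" for C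
    using translate_stable [OF S \<phi> r that] unfolding \<psi>_def [abs_def] is_coboundary_def .
  then have "\<forall>C\<in>rcosets S. \<exists>\<chi>. invariant_cochain m G {g \<in> S. C #> g = C} (carrier G) \<chi> \<and> [\<chi> [] = 0] (mod m) \<and>
     (\<forall>xs\<in>lists (carrier G). length xs = l \<longrightarrow>
       [translate G \<psi> C xs - \<psi> xs = pairing \<chi> (list_boundary xs)] (mod m))" by blast
  from bchoice [OF this] obtain X where X: "\<And>C. C \<in> rcosets S \<Longrightarrow> invariant_cochain m G {g \<in> S. C #> g = C} (carrier G) (X C)"
    "\<And>C. C \<in> rcosets S \<Longrightarrow> [X C [] = 0] (mod m)"
    "\<And>C xs. \<lbrakk>C \<in> rcosets S; xs \<in> lists (carrier G); length xs = l\<rbrakk> \<Longrightarrow>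
       [translate G \<psi> C xs - \<psi> xs = pairing (X C) (list_boundary xs)] (mod m)"
    by blast
  obtain b s where b: "\<And>C. C \<in> rcosets S \<Longrightarrow> b C \<in> rcosets S \<and> s C \<in> S \<and> b C #> inv (s C) = C"
    "\<And>C g. \<lbrakk>C \<in> rcosets S; g \<in> S\<rbrakk> \<Longrightarrow> b (C #> g) = b C"
    using rcoset_orbit_base [OF S S] by blast
  \<comment> \<open>The primitive at the base coset, transported to \<open>C\<close>. Because it is
    invariant under the stabiliser of the base coset, the result does not depend, modulo
    \<open>m\<close>, on the choice of \<open>s C\<close>.\<close>
  define \<chi> where "\<chi> C xs = X (b C) (map (\<lambda>x. inv (s C) \<otimes> x) xs)" for C xs
  have coboundary: "is_coboundary m G S (carrier G) l (\<lambda>xs. \<Sum>C\<in>rcosets S. translate G \<psi> C xs - \<psi> xs)"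
  proof (rule is_coboundaryI)
    show "invariant_cochain m G S (carrier G) (\<lambda>xs. \<Sum>C\<in>rcosets S. \<chi> C xs)"
    proof (rule invariant_cochain_sum_rcosets [OF S SG])
      fix g C xs assume g: "g \<in> S" and C: "C \<in> rcosets S" and xs: "xs \<in> lists (carrier G)"
      define t where "t = s (C #> inv g)"
      \<comment> \<open>A closed route based at \<open>b C\<close>: \<open>inv t\<close> leads to
        \<open>C #> inv g\<close>, then \<open>g\<close> leads to \<open>C\<close>, and
        \<open>s C\<close> leads back. Hence \<open>h\<close> stabilises the base coset, and
        invariance of its primitive under \<open>h\<close> is the required compatibility.\<close>
      define h where "h = inv t \<otimes> g \<otimes> s C"
      have gG: "g \<in> carrier G" and Cg: "C #> inv g \<in> rcosets S"
        using g SG C rcosets_translate [OF S C] by auto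
      have bCg: "b (C #> inv g) = b C" using b(2) [OF C] g S by (simp add: subgroup.m_inv_closed)
      note bC = b(1) [OF C]
      have t: "t \<in> S" "C #> inv g = b C #> inv t" using b(1) [OF Cg] by (simp_all add: bCg t_def)
      have G: "t \<in> carrier G" "s C \<in> carrier G" using t(1) bC SG by auto
      have hS: "h \<in> S"
        unfolding h_def using t(1) g bC S by (intro subgroup.m_closed subgroup.m_inv_closed) auto
      have "b C #> h = ((b C #> inv t) #> g) #> s C"
        using bC G gG rcosets_translate [OF S] by (simp add: h_def rcosets_translate_translate [OF S])
      also have "\<dots> = C #> s C"
        unfolding t(2) [symmetric] using C gG
        by (simp add: rcosets_translate_translate [OF S] rcosets_translate_one [OF S])
      also have "\<dots> = b C"
        using rcosets_translate_translate [OF S, of "b C" "inv (s C)" "s C"]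
          rcosets_translate_one [OF S, of "b C"] bC G by simp
      finally have h: "h \<in> {g \<in> S. b C #> g = b C}" using hS by blast
      have "[X (b C) (map (\<lambda>x. h \<otimes> x) (map (\<lambda>x. inv (s C) \<otimes> x) xs)) = \<chi> C xs] (mod m)"
        unfolding \<chi>_def using bC G xs by (intro invariant_cochainD [OF X(1) h] lists_translate) simp_all
      also have "map (\<lambda>x. h \<otimes> x) (map (\<lambda>x. inv (s C) \<otimes> x) xs) =
          map (\<lambda>x. inv t \<otimes> x) (map (\<lambda>x. g \<otimes> x) xs)"
        using G gG xs by (simp add: translate_translate h_def m_assoc del: map_map)
      finally show "[\<chi> (C #> inv g) (map (\<lambda>x. g \<otimes> x) xs) = \<chi> C xs] (mod m)"
        by (simp add: \<chi>_def bCg t_def [symmetric] del: map_map)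
    qed
    have "[(\<Sum>C\<in>rcosets S. \<chi> C []) = (\<Sum>C\<in>rcosets S. 0)] (mod m)"
      using X(2) b(1) by (intro cong_sum) (simp add: \<chi>_def)
    then show "[(\<Sum>C\<in>rcosets S. \<chi> C []) = 0] (mod m)" by simp
    fix xs assume xs: "xs \<in> lists (carrier G)" "length xs = l"
    show "[(\<Sum>C\<in>rcosets S. translate G \<psi> C xs - \<psi> xs) =
        pairing (\<lambda>xs. \<Sum>C\<in>rcosets S. \<chi> C xs) (list_boundary xs)] (mod m)"
      unfolding pairing_fun_sum
    proof (rule cong_sum)
      fix C assume C: "C \<in> rcosets S"
      note bC = b(1) [OF C]
      have sG: "s C \<in> carrier G" and sS: "inv (s C) \<in> S"
        using bC SG subgroup.m_inv_closed [OF S] by auto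
      let ?ys = "map (\<lambda>x. inv (s C) \<otimes> x) xs"
      have ys: "?ys \<in> lists (carrier G)" "length ?ys = l" using lists_translate sG xs by auto
      have "C #> s C = b C"
        using rcosets_translate_translate [OF S, of "b C" "inv (s C)" "s C"]
          rcosets_translate_one [OF S, of "b C"] bC sG by simp
      then have Cs: "C #> inv (inv (s C)) = b C" using sG by simp
      have "[translate G \<psi> (b C) ?ys = translate G \<psi> C xs] (mod m)"
        using translate_equivariant [OF S inv\<psi> _ C xs(1), of "inv (s C)"] sG unfolding Cs by simp
      moreover have "[\<psi> ?ys = \<psi> xs] (mod m)"
        by (rule invariant_cochainD [OF inv\<psi> sS xs(1)])
      ultimately have "[translate G \<psi> C xs - \<psi> xs = translate G \<psi> (b C) ?ys - \<psi> ?ys] (mod m)"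
        by (intro cong_sym [OF cong_diff])
      also have "[translate G \<psi> (b C) ?ys - \<psi> ?ys = pairing (X (b C)) (list_boundary ?ys)] (mod m)"
        using bC ys by (intro X(3)) auto
      also have "pairing (X (b C)) (list_boundary ?ys) = pairing (\<chi> C) (list_boundary xs)"
        unfolding \<chi>_def by (rule pairing_list_boundary_map [symmetric])
      finally show "[translate G \<psi> C xs - \<psi> xs = pairing (\<chi> C) (list_boundary xs)] (mod m)" .
    qed
  qed
  obtain k where k: "[int (card (rcosets S)) * k = 1] (mod m)"
    using cong_solve_coprime_int [OF i] by blast
  define \<theta> where "\<theta> xs = k * (\<Sum>C\<in>rcosets S. translate G \<psi> C xs)" for xs
  have "is_coboundary m G S S l (\<lambda>xs. k * (\<Sum>C\<in>rcosets S. translate G \<psi> C xs - \<psi> xs))"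
    by (intro is_coboundary_cmul is_coboundary_mono [OF coboundary] SG order_refl)
  \<comment> \<open>On tuples in \<open>S\<close> both \<open>r\<close> and the identity are
    \<open>S\<close>-equivariant maps into \<open>S\<close>, so \<open>\<psi>\<close> has the class
    of \<open>\<phi>\<close> there.\<close>
  moreover have "is_coboundary m G S S l (\<lambda>xs. \<phi> (map r xs) - \<phi> (map (\<lambda>x. x) xs))"
    by (rule is_coboundary_homotopy [OF \<phi>(1), of "\<lambda>g. g"]) (use SG r in auto)
  ultimately have "is_coboundary m G S S l (\<lambda>xs. k * (\<Sum>C\<in>rcosets S. translate G \<psi> C xs - \<psi> xs) +
      (\<phi> (map r xs) - \<phi> (map (\<lambda>x. x) xs)))"
    by (rule is_coboundary_add)
  then have "is_coboundary m G S S l (\<lambda>xs. \<theta> xs - \<phi> xs)"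
  proof (rule is_coboundary_cong)
    fix xs
    have "[(int (card (rcosets S)) * k) * \<psi> xs = 1 * \<psi> xs] (mod m)"
      using k by (rule cong_scalar_right)
    moreover have "\<theta> xs - \<phi> xs - (k * (\<Sum>C\<in>rcosets S. translate G \<psi> C xs - \<psi> xs) +
        (\<phi> (map r xs) - \<phi> (map (\<lambda>x. x) xs))) = (int (card (rcosets S)) * k) * \<psi> xs - 1 * \<psi> xs"
      by (simp add: \<theta>_def \<psi>_def [symmetric] sum_subtractf right_diff_distrib)
    ultimately show "[\<theta> xs - \<phi> xs = k * (\<Sum>C\<in>rcosets S. translate G \<psi> C xs - \<psi> xs) +
        (\<phi> (map r xs) - \<phi> (map (\<lambda>x. x) xs))] (mod m)"
      by (simp only: cong_iff_dvd_diff)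
  qed
  moreover have "is_cocycle m G (carrier G) (carrier G) l \<theta>"
    unfolding \<theta>_def by (intro is_cocycle_cmul is_cocycle_transfer S \<psi>)
  ultimately show thesis using that by blast
qed

end


subsection \<open>Cup products\<close>

definition cup :: "nat \<Rightarrow> ('a list \<Rightarrow> int) \<Rightarrow> ('a list \<Rightarrow> int) \<Rightarrow> 'a list \<Rightarrow> int" where
  "cup m f g xs = f (take (Suc m) xs) * g (drop m xs)"

text \<open>The Leibniz rule, \<open>m\<close> being the degree of \<open>f\<close>. On the right
  the term of \<open>f\<close> that omits its last vertex cancels the term of \<open>g\<close> that
  omits its first one, and what remains are the faces of \<open>xs\<close>. The induction strips the
  first vertex, which turns \<open>f\<close> into a cochain of one degree less.\<close>

lemma pairing_cup_boundary:
  "m + 2 \<le> length xs \<Longrightarrow>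
   pairing (cup m f g) (list_boundary xs) =
     pairing f (list_boundary (take (m + 2) xs)) * g (drop (Suc m) xs) +
     (-1) ^ m * f (take (Suc m) xs) * pairing g (list_boundary (drop m xs))"
proof (induction m arbitrary: f xs)
  case 0
  then obtain x y zs where xs: "xs = x # y # zs"
    by (cases xs; cases "tl xs") auto
  have b: "pairing f (list_boundary [x, y]) = f [y] - f [x]"
    by (simp add: list_boundary_Cons pairing_diff)
  have "cup 0 f g (x # ws) = f [x] * g (x # ws)" for ws
    by (simp add: cup_def)
  moreover have "cup 0 f g (y # zs) = f [y] * g (y # zs)"
    by (simp add: cup_def)
  ultimately show ?case
    by (simp add: xs b left_diff_distrib list_boundary_Cons [of x "y # zs"] pairing_diff pairing_extend pairing_fun_cmul algebra_simps)
next
  case (Suc m)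
  then obtain x ys where xs: "xs = x # ys" "m + 2 \<le> length ys"
    by (cases xs) auto
  have "cup (Suc m) f g (x # ws) = cup m (\<lambda>zs. f (x # zs)) g ws" for ws
    by (simp add: cup_def)
  moreover have "cup (Suc m) f g ys = f (take (m + 2) ys) * g (drop (Suc m) ys)"
    by (simp add: cup_def)
  ultimately show ?case
    unfolding xs
    by (simp add: list_boundary_Cons pairing_diff pairing_extend Suc.IH [OF xs(2)] algebra_simps)
qed

lemma take_in_lists: "xs \<in> lists X \<Longrightarrow> take n xs \<in> lists X"
  by (auto dest: in_set_takeD)

lemma drop_in_lists: "xs \<in> lists X \<Longrightarrow> drop n xs \<in> lists X"
  by (auto dest: in_set_dropD)

lemma invariant_cochain_cup:
  assumes "invariant_cochain q G P X f" "invariant_cochain q G P X g"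
  shows "invariant_cochain q G P X (cup m f g)"
  unfolding invariant_cochain_def
proof (intro ballI)
  fix x xs assume x: "x \<in> P" and xs: "xs \<in> lists X"
  show "[cup m f g (map (\<lambda>y. x \<otimes>\<^bsub>G\<^esub> y) xs) = cup m f g xs] (mod q)"
    unfolding cup_def take_map drop_map
    by (intro cong_mult invariant_cochainD [OF assms(1) x] invariant_cochainD [OF assms(2) x]
        take_in_lists drop_in_lists xs)
qed

lemma is_cocycle_cup:
  assumes f: "is_cocycle q G P X (Suc m) f" and g: "is_cocycle q G P X (Suc n) g"
  shows "is_cocycle q G P X (Suc (m + n)) (cup m f g)"
  unfolding is_cocycle_def
proof (intro conjI ballI impI)
  fix xs assume xs: "xs \<in> lists X" "length xs = Suc (Suc (m + n))"
  have "[pairing f (list_boundary (take (m + 2) xs)) = 0] (mod q)"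
    using xs by (intro is_cocycleD(2) [OF f] take_in_lists) auto
  moreover have "[pairing g (list_boundary (drop m xs)) = 0] (mod q)"
    using xs by (intro is_cocycleD(2) [OF g] drop_in_lists) auto
  ultimately show "[pairing (cup m f g) (list_boundary xs) = 0] (mod q)"
    using xs(2) by (simp add: pairing_cup_boundary cong_0_iff)
qed (intro invariant_cochain_cup is_cocycleD(1) [OF f] is_cocycleD(1) [OF g])

lemma is_coboundary_zero:
  assumes "\<And>xs. \<lbrakk>xs \<in> lists X; length xs = l\<rbrakk> \<Longrightarrow> [\<phi> xs = 0] (mod q)"
  shows "is_coboundary q G P X l \<phi>"
  by (rule is_coboundaryI [of _ _ _ _ "\<lambda>_. 0"]) (use assms in \<open>auto simp: invariant_cochain_def\<close>)

text \<open>The boundary of a list of length one is the empty list, where a primitive vanishes. This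
  is the effect of the condition \<open>\<psi> [] = 0\<close>.\<close>

lemma is_coboundary_length_1:
  assumes "is_coboundary q G P X (Suc 0) \<phi>" "xs \<in> lists X" "length xs = Suc 0"
  shows "[\<phi> xs = 0] (mod q)"
proof -
  obtain \<psi> where \<psi>: "[\<psi> [] = 0] (mod q)" "[\<phi> xs = pairing \<psi> (list_boundary xs)] (mod q)"
    using assms(1) by (rule is_coboundaryE) (use assms in blast)
  moreover obtain x where "xs = [x]" using assms(3) by (cases xs) auto
  ultimately show ?thesis by (auto simp: list_boundary_Cons dest: cong_trans)
qed

text \<open>If \<open>\<psi>\<close> is a primitive of \<open>f\<close>, the Leibniz rule makes
  \<open>cup k \<psi> g\<close> with \<open>k = m - 1\<close> a primitive of the product. For
  \<open>m = 0\<close> there is no such degree, but then \<open>f\<close> itself vanishes modulo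
  \<open>q\<close>.\<close>

lemma is_coboundary_cup_left:
  assumes f: "is_coboundary q G P X (Suc m) f" and g: "is_cocycle q G P X (Suc n) g"
  shows "is_coboundary q G P X (Suc (m + n)) (cup m f g)"
proof (cases m)
  case 0
  show ?thesis
  proof (rule is_coboundary_zero)
    fix xs assume "xs \<in> lists X" "length xs = Suc (m + n)"
    then have "[f (take (Suc m) xs) = 0] (mod q)"
      using f 0 by (intro is_coboundary_length_1 [of q G P X f] take_in_lists) auto
    then show "[cup m f g xs = 0] (mod q)" by (simp add: cup_def cong_0_iff)
  qed
next
  case (Suc k)
  obtain \<psi> where \<psi>: "invariant_cochain q G P X \<psi>" "[\<psi> [] = 0] (mod q)"
    "\<And>xs. \<lbrakk>xs \<in> lists X; length xs = Suc m\<rbrakk> \<Longrightarrow> [f xs = pairing \<psi> (list_boundary xs)] (mod q)"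
    using f by (rule is_coboundaryE) blast
  show ?thesis
  proof (rule is_coboundaryI)
    show "invariant_cochain q G P X (cup k \<psi> g)"
      by (intro invariant_cochain_cup \<psi>(1) is_cocycleD(1) [OF g])
    show "[cup k \<psi> g [] = 0] (mod q)" using \<psi>(2) by (simp add: cup_def cong_0_iff)
    fix xs assume xs: "xs \<in> lists X" "length xs = Suc (m + n)"
    have *: "[pairing g (list_boundary (drop k xs)) = 0] (mod q)"
      using xs Suc by (intro is_cocycleD(2) [OF g] drop_in_lists) auto
    have "[f (take (Suc m) xs) = pairing \<psi> (list_boundary (take (Suc m) xs))] (mod q)"
      using xs by (intro \<psi>(3) take_in_lists) auto
    from cong_add [OF cong_scalar_right [OF this, of "g (drop m xs)"]
        cong_scalar_left [OF cong_sym [OF *], of "(-1) ^ k * \<psi> (take (Suc k) xs)"]]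
    show "[cup m f g xs = pairing (cup k \<psi> g) (list_boundary xs)] (mod q)"
      using xs(2) Suc by (simp add: pairing_cup_boundary cup_def)
  qed
qed

lemma is_coboundary_cup_right:
  assumes f: "is_cocycle q G P X (Suc m) f" and g: "is_coboundary q G P X (Suc n) g"
  shows "is_coboundary q G P X (Suc (m + n)) (cup m f g)"
proof (cases n)
  case 0
  show ?thesis
  proof (rule is_coboundary_zero)
    fix xs assume "xs \<in> lists X" "length xs = Suc (m + n)"
    then have "[g (drop m xs) = 0] (mod q)"
      using g 0 by (intro is_coboundary_length_1 [of q G P X g] drop_in_lists) auto
    then show "[cup m f g xs = 0] (mod q)" by (simp add: cup_def cong_0_iff)
  qed
next
  case (Suc k)
  obtain \<psi> where \<psi>: "invariant_cochain q G P X \<psi>" "[\<psi> [] = 0] (mod q)"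
    "\<And>xs. \<lbrakk>xs \<in> lists X; length xs = Suc n\<rbrakk> \<Longrightarrow> [g xs = pairing \<psi> (list_boundary xs)] (mod q)"
    using g by (rule is_coboundaryE) blast
  show ?thesis
  proof (rule is_coboundaryI)
    \<comment> \<open>The sign cancels the factor \<open>(-1) ^ m\<close> with which the Leibniz
      rule moves the coboundary past \<open>f\<close>.\<close>
    show "invariant_cochain q G P X (\<lambda>xs. (-1) ^ m * cup m f \<psi> xs)"
      by (intro invariant_cochain_cmul invariant_cochain_cup \<psi>(1) is_cocycleD(1) [OF f])
    show "[(-1) ^ m * cup m f \<psi> [] = 0] (mod q)" using \<psi>(2) by (simp add: cup_def cong_0_iff)
    fix xs assume xs: "xs \<in> lists X" "length xs = Suc (m + n)"
    have *: "[pairing f (list_boundary (take (m + 2) xs)) = 0] (mod q)"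
      using xs Suc by (intro is_cocycleD(2) [OF f] take_in_lists) auto
    have "[g (drop m xs) = pairing \<psi> (list_boundary (drop m xs))] (mod q)"
      using xs by (intro \<psi>(3) drop_in_lists) auto
    from cong_add [OF cong_scalar_left [OF this, of "f (take (Suc m) xs)"]
        cong_scalar_left [OF cong_sym [OF *], of "(-1) ^ m * \<psi> (drop (Suc m) xs)"]]
    have "[cup m f g xs = f (take (Suc m) xs) * pairing \<psi> (list_boundary (drop m xs)) +
       (-1) ^ m * \<psi> (drop (Suc m) xs) * pairing f (list_boundary (take (m + 2) xs))] (mod q)"
      by (simp add: cup_def)
    moreover have "(-1) ^ m * ((-1) ^ m * a) = a" for a :: int
      by (simp add: mult.assoc [symmetric] power_mult_distrib [symmetric])
    ultimately show "[cup m f g xs = pairing (\<lambda>xs. (-1) ^ m * cup m f \<psi> xs) (list_boundary xs)] (mod q)"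
      using xs(2) Suc by (simp add: pairing_fun_cmul pairing_cup_boundary algebra_simps)
  qed
qed


subsection \<open>Cohomology classes of groups with equivalent fusion\<close>

text \<open>The inverse \<open>\<beta>\<close> and both directions of the fusion condition are part
  of the data, so the locale is symmetric (\<open>swap\<close>) and one half of an argument yields
  the other. The maps considered end in all of \<open>S\<close> or \<open>R\<close>, since a
  subconjugation stays one when its target is enlarged.\<close>

locale fusion_equivalence = G: group G + H: group H
  for G :: "('a, 'x) monoid_scheme" (structure) and H :: "('b, 'y) monoid_scheme" (structure) +
  fixes S :: "'a set" and R :: "'b set" and \<alpha> :: "'a \<Rightarrow> 'b" and \<beta> :: "'b \<Rightarrow> 'a" and m :: int
  assumes S: "subgroup S G" and R: "subgroup R H"
    and index_G: "coprime (int (card (rcosets\<^bsub>G\<^esub> S))) m"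
    and index_H: "coprime (int (card (rcosets\<^bsub>H\<^esub> R))) m"
    and \<alpha>: "\<alpha> \<in> S \<rightarrow> R" and \<alpha>_mult: "\<And>x y. \<lbrakk>x \<in> S; y \<in> S\<rbrakk> \<Longrightarrow> \<alpha> (x \<otimes>\<^bsub>G\<^esub> y) = \<alpha> x \<otimes>\<^bsub>H\<^esub> \<alpha> y"
    and \<beta>: "\<beta> \<in> R \<rightarrow> S" and \<beta>_mult: "\<And>x y. \<lbrakk>x \<in> R; y \<in> R\<rbrakk> \<Longrightarrow> \<beta> (x \<otimes>\<^bsub>H\<^esub> y) = \<beta> x \<otimes>\<^bsub>G\<^esub> \<beta> y"
    and \<beta>_\<alpha>: "\<And>x. x \<in> S \<Longrightarrow> \<beta> (\<alpha> x) = x" and \<alpha>_\<beta>: "\<And>y. y \<in> R \<Longrightarrow> \<alpha> (\<beta> y) = y"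
    and fusion_\<alpha>: "\<And>P x. \<lbrakk>subgroup P G; P \<subseteq> S; x \<in> carrier G; \<And>y. y \<in> P \<Longrightarrow> x \<otimes>\<^bsub>G\<^esub> y \<otimes>\<^bsub>G\<^esub> inv\<^bsub>G\<^esub> x \<in> S\<rbrakk> \<Longrightarrow>
      \<exists>z\<in>carrier H. \<forall>y\<in>P. \<alpha> (x \<otimes>\<^bsub>G\<^esub> y \<otimes>\<^bsub>G\<^esub> inv\<^bsub>G\<^esub> x) = z \<otimes>\<^bsub>H\<^esub> \<alpha> y \<otimes>\<^bsub>H\<^esub> inv\<^bsub>H\<^esub> z"
    and fusion_\<beta>: "\<And>P x. \<lbrakk>subgroup P H; P \<subseteq> R; x \<in> carrier H; \<And>y. y \<in> P \<Longrightarrow> x \<otimes>\<^bsub>H\<^esub> y \<otimes>\<^bsub>H\<^esub> inv\<^bsub>H\<^esub> x \<in> R\<rbrakk> \<Longrightarrow>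
      \<exists>z\<in>carrier G. \<forall>y\<in>P. \<beta> (x \<otimes>\<^bsub>H\<^esub> y \<otimes>\<^bsub>H\<^esub> inv\<^bsub>H\<^esub> x) = z \<otimes>\<^bsub>G\<^esub> \<beta> y \<otimes>\<^bsub>G\<^esub> inv\<^bsub>G\<^esub> z"
begin

lemma swap: "fusion_equivalence H G R S \<beta> \<alpha> m"
  by (rule fusion_equivalence.intro [OF H.is_group G.is_group], rule fusion_equivalence_axioms.intro;
      fact S R index_G index_H \<alpha> \<alpha>_mult \<beta> \<beta>_mult \<beta>_\<alpha> \<alpha>_\<beta> fusion_\<alpha> fusion_\<beta>)

definition corresponding :: "nat \<Rightarrow> ('a list \<Rightarrow> int) \<Rightarrow> ('b list \<Rightarrow> int) \<Rightarrow> bool" where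
  "corresponding l f h \<longleftrightarrow> is_coboundary m G S S l (\<lambda>xs. f xs - h (map \<alpha> xs))"

lemma \<alpha>_one: "\<alpha> \<one>\<^bsub>G\<^esub> = \<one>\<^bsub>H\<^esub>"
proof -
  have one: "\<one>\<^bsub>G\<^esub> \<in> S" using S by (rule subgroup.one_closed)
  then have "\<alpha> \<one>\<^bsub>G\<^esub> \<otimes>\<^bsub>H\<^esub> \<alpha> \<one>\<^bsub>G\<^esub> = \<alpha> \<one>\<^bsub>G\<^esub>" using \<alpha>_mult [of "\<one>\<^bsub>G\<^esub>" "\<one>\<^bsub>G\<^esub>"] by simp
  moreover have "\<alpha> \<one>\<^bsub>G\<^esub> \<in> carrier H" using one \<alpha> subgroup.subset [OF R] by auto
  ultimately show ?thesis by simp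
qed

lemma \<alpha>_inv: assumes "x \<in> S" shows "\<alpha> (inv\<^bsub>G\<^esub> x) = inv\<^bsub>H\<^esub> (\<alpha> x)"
proof -
  have x: "x \<in> carrier G" "inv\<^bsub>G\<^esub> x \<in> S"
    using assms S by (auto simp: subgroup.m_inv_closed subgroup.mem_carrier)
  then have "\<alpha> (inv\<^bsub>G\<^esub> x) \<otimes>\<^bsub>H\<^esub> \<alpha> x = \<one>\<^bsub>H\<^esub>"
    using \<alpha>_mult [of "inv\<^bsub>G\<^esub> x" x] assms by (simp add: \<alpha>_one)
  moreover have "\<alpha> x \<in> carrier H" "\<alpha> (inv\<^bsub>G\<^esub> x) \<in> carrier H"
    using assms x \<alpha> subgroup.subset [OF R] by auto
  ultimately show ?thesis by (metis H.inv_equality)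
qed

lemma subgroup_image:
  assumes "subgroup P G" "P \<subseteq> S" shows "subgroup (\<alpha> ` P) H"
proof (rule H.subgroupI)
  show "\<alpha> ` P \<subseteq> carrier H" using assms \<alpha> subgroup.subset [OF R] by auto
  show "\<alpha> ` P \<noteq> {}" using subgroup.one_closed [OF assms(1)] by blast
  fix a assume "a \<in> \<alpha> ` P"
  then obtain x where x: "x \<in> P" "a = \<alpha> x" by blast
  then have "inv\<^bsub>H\<^esub> a = \<alpha> (inv\<^bsub>G\<^esub> x)" using \<alpha>_inv assms(2) by auto
  then show "inv\<^bsub>H\<^esub> a \<in> \<alpha> ` P" using x assms(1) by (simp add: subgroup.m_inv_closed)
  fix b assume "b \<in> \<alpha> ` P"
  then obtain y where y: "y \<in> P" "b = \<alpha> y" by blast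
  then have "a \<otimes>\<^bsub>H\<^esub> b = \<alpha> (x \<otimes>\<^bsub>G\<^esub> y)" using \<alpha>_mult [of x y] x y assms(2) by (simp add: subset_iff)
  then show "a \<otimes>\<^bsub>H\<^esub> b \<in> \<alpha> ` P" using x y assms(1) by (simp add: subgroup.m_closed)
qed

lemma is_cocycle_pullback_\<alpha>:
  assumes "is_cocycle m H (carrier H) (carrier H) l h"
  shows "is_cocycle m G S S l (\<lambda>xs. h (map \<alpha> xs))"
  by (rule is_cocycle_pullback [OF assms, of \<alpha>]) (use \<alpha> \<alpha>_mult subgroup.subset [OF R] in auto)

text \<open>By the fusion condition \<open>\<alpha>\<close> turns conjugation by \<open>x\<close> on
  \<open>P\<close> into conjugation by some \<open>z\<close> of \<open>H\<close> on the image of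
  \<open>P\<close>. There \<open>h\<close> is stable, being a cocycle on all of \<open>H\<close>,
  and the primitive is pulled back along \<open>\<alpha>\<close>.\<close>

lemma is_stable_pullback:
  assumes "is_cocycle m H (carrier H) (carrier H) l h"
  shows "G.is_stable m S l (\<lambda>xs. h (map \<alpha> xs))"
  unfolding G.is_stable_def
proof (intro allI impI, elim conjE)
  fix P x assume P: "subgroup P G" "P \<subseteq> S" and x: "x \<in> carrier G" "\<forall>y\<in>P. x \<otimes>\<^bsub>G\<^esub> y \<otimes>\<^bsub>G\<^esub> inv\<^bsub>G\<^esub> x \<in> S"
  then obtain z where z: "z \<in> carrier H"
    "\<And>y. y \<in> P \<Longrightarrow> \<alpha> (x \<otimes>\<^bsub>G\<^esub> y \<otimes>\<^bsub>G\<^esub> inv\<^bsub>G\<^esub> x) = z \<otimes>\<^bsub>H\<^esub> \<alpha> y \<otimes>\<^bsub>H\<^esub> inv\<^bsub>H\<^esub> z"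
    using fusion_\<alpha> by metis
  have \<alpha>P: "\<alpha> ` P \<subseteq> R" using P \<alpha> by auto
  have "z \<otimes>\<^bsub>H\<^esub> w \<otimes>\<^bsub>H\<^esub> inv\<^bsub>H\<^esub> z \<in> R" if "w \<in> \<alpha> ` P" for w
  proof -
    obtain y where y: "y \<in> P" "w = \<alpha> y" using \<open>w \<in> \<alpha> ` P\<close> by blast
    have "\<alpha> (x \<otimes>\<^bsub>G\<^esub> y \<otimes>\<^bsub>G\<^esub> inv\<^bsub>G\<^esub> x) \<in> R" using x(2) y(1) \<alpha> by blast
    then show ?thesis using z(2) [OF y(1)] y(2) by simp
  qed
  then have "is_coboundary m H (\<alpha> ` P) (\<alpha> ` P) l (\<lambda>ys. h (map (\<lambda>w. z \<otimes>\<^bsub>H\<^esub> w \<otimes>\<^bsub>H\<^esub> inv\<^bsub>H\<^esub> z) ys) - h ys)"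
    using H.is_stable_restriction [OF assms, of R] subgroup_image [OF P] z(1) \<alpha>P
    unfolding H.is_stable_def by blast
  then have "is_coboundary m G P P l
      (\<lambda>xs. h (map (\<lambda>w. z \<otimes>\<^bsub>H\<^esub> w \<otimes>\<^bsub>H\<^esub> inv\<^bsub>H\<^esub> z) (map \<alpha> xs)) - h (map \<alpha> xs))"
    by (rule is_coboundary_pullback [where f = \<alpha>]) (use P(2) \<alpha>_mult in auto)
  then show "is_coboundary m G P P l
      (\<lambda>ys. h (map \<alpha> (map (\<lambda>y. x \<otimes>\<^bsub>G\<^esub> y \<otimes>\<^bsub>G\<^esub> inv\<^bsub>G\<^esub> x) ys)) - h (map \<alpha> ys))"
  proof (rule is_coboundary_cong)
    fix ys assume "ys \<in> lists P"
    then have "map \<alpha> (map (\<lambda>y. x \<otimes>\<^bsub>G\<^esub> y \<otimes>\<^bsub>G\<^esub> inv\<^bsub>G\<^esub> x) ys) =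
        map (\<lambda>w. z \<otimes>\<^bsub>H\<^esub> w \<otimes>\<^bsub>H\<^esub> inv\<^bsub>H\<^esub> z) (map \<alpha> ys)"
      using z(2) by auto
    then show "[h (map \<alpha> (map (\<lambda>y. x \<otimes>\<^bsub>G\<^esub> y \<otimes>\<^bsub>G\<^esub> inv\<^bsub>G\<^esub> x) ys)) - h (map \<alpha> ys) =
        h (map (\<lambda>w. z \<otimes>\<^bsub>H\<^esub> w \<otimes>\<^bsub>H\<^esub> inv\<^bsub>H\<^esub> z) (map \<alpha> ys)) - h (map \<alpha> ys)] (mod m)"
      by (simp del: map_map)
  qed
qed

lemma ex_corresponding_left:
  assumes "is_cocycle m H (carrier H) (carrier H) l h"
  shows "\<exists>f. is_cocycle m G (carrier G) (carrier G) l f \<and> corresponding l f h"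
  using G.ex_cocycle_restricting_to_stable [OF S index_G is_cocycle_pullback_\<alpha> [OF assms] is_stable_pullback [OF assms]]
  unfolding corresponding_def by blast

text \<open>Symmetry produces an \<open>h\<close> that agrees with \<open>f\<close> over
  \<open>R\<close>. Pulling the agreement back along \<open>\<alpha>\<close> moves it to
  \<open>S\<close>, where \<open>\<beta>\<close> after \<open>\<alpha>\<close> is the identity; the
  factor -1 exchanges the two terms.\<close>

lemma ex_corresponding_right:
  assumes "is_cocycle m G (carrier G) (carrier G) l f"
  shows "\<exists>h. is_cocycle m H (carrier H) (carrier H) l h \<and> corresponding l f h"
proof -
  interpret swap: fusion_equivalence H G R S \<beta> \<alpha> m by (rule swap)
  obtain h where h: "is_cocycle m H (carrier H) (carrier H) l h"
    "is_coboundary m H R R l (\<lambda>xs. h xs - f (map \<beta> xs))"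
    using swap.ex_corresponding_left [OF assms] unfolding swap.corresponding_def by blast
  have "is_coboundary m G S S l (\<lambda>xs. h (map \<alpha> xs) - f (map \<beta> (map \<alpha> xs)))"
    by (rule is_coboundary_pullback [OF h(2), where f = \<alpha>]) (use \<alpha> \<alpha>_mult in auto)
  from is_coboundary_cmul [OF this, of "- 1"] have "corresponding l f h"
    unfolding corresponding_def
  proof (rule is_coboundary_cong)
    fix xs assume "xs \<in> lists S"
    then have "map \<beta> (map \<alpha> xs) = xs" by (auto simp: \<beta>_\<alpha> intro: map_idI)
    then show "[f xs - h (map \<alpha> xs) = - 1 * (h (map \<alpha> xs) - f (map \<beta> (map \<alpha> xs)))] (mod m)"
      by (simp del: map_map)
  qed
  with h(1) show ?thesis by blast
qed

text \<open>Restriction to \<open>S\<close> and to \<open>R\<close> detects coboundaries by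
  \<open>is_coboundary_restrict_iff\<close>, and pullbacks along \<open>\<alpha>\<close> and
  \<open>\<beta>\<close> link the two subgroups.\<close>

lemma corresponding_coboundary:
  assumes "is_cocycle m G (carrier G) (carrier G) l f" "is_cocycle m H (carrier H) (carrier H) l h"
    and "corresponding l f h"
  shows "is_coboundary m G (carrier G) (carrier G) l f \<longleftrightarrow> is_coboundary m H (carrier H) (carrier H) l h"
proof -
  have "is_coboundary m G (carrier G) (carrier G) l f \<longleftrightarrow> is_coboundary m G S S l f"
    using G.is_coboundary_restrict_iff [OF S index_G assms(1)] by simp
  also have "\<dots> \<longleftrightarrow> is_coboundary m G S S l (\<lambda>xs. h (map \<alpha> xs))"
    using is_coboundary_diff [of m G S S l f "\<lambda>xs. f xs - h (map \<alpha> xs)"]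
      is_coboundary_add [of m G S S l "\<lambda>xs. f xs - h (map \<alpha> xs)" "\<lambda>xs. h (map \<alpha> xs)"] assms(3)
    unfolding corresponding_def by auto
  also have "\<dots> \<longleftrightarrow> is_coboundary m H R R l h"
  proof
    assume "is_coboundary m G S S l (\<lambda>xs. h (map \<alpha> xs))"
    then have "is_coboundary m H R R l (\<lambda>xs. h (map \<alpha> (map \<beta> xs)))"
      by (rule is_coboundary_pullback [where f = \<beta>]) (use \<beta> \<beta>_mult in auto)
    then show "is_coboundary m H R R l h"
    proof (rule is_coboundary_cong)
      fix xs assume "xs \<in> lists R"
      then have "map \<alpha> (map \<beta> xs) = xs" by (auto simp: \<alpha>_\<beta> intro: map_idI)
      then show "[h xs = h (map \<alpha> (map \<beta> xs))] (mod m)" by simp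
    qed
  next
    assume "is_coboundary m H R R l h"
    then show "is_coboundary m G S S l (\<lambda>xs. h (map \<alpha> xs))"
      by (rule is_coboundary_pullback [where f = \<alpha>]) (use \<alpha> \<alpha>_mult in auto)
  qed
  also have "\<dots> \<longleftrightarrow> is_coboundary m H (carrier H) (carrier H) l h"
    using H.is_coboundary_restrict_iff [OF R index_H assms(2)] by simp
  finally show ?thesis .
qed

lemma corresponding_add:
  assumes "corresponding l f h" "corresponding l f' h'"
  shows "corresponding l (\<lambda>xs. f xs + f' xs) (\<lambda>xs. h xs + h' xs)"
  unfolding corresponding_def
  by (rule is_coboundary_cong [OF is_coboundary_add [OF assms [unfolded corresponding_def]]])
     (simp add: algebra_simps)

lemma corresponding_cmul:
  assumes "corresponding l f h"
  shows "corresponding l (\<lambda>xs. k * f xs) (\<lambda>xs. k * h xs)"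
  unfolding corresponding_def
  by (rule is_coboundary_cong [OF is_coboundary_cmul [OF assms [unfolded corresponding_def], of k]])
     (simp add: algebra_simps)

text \<open>The difference of the products splits as \<open>(f - h) f' + h (f' - h')\<close>, with
  \<open>h\<close> and \<open>h'\<close> read on \<open>S\<close> through \<open>\<alpha>\<close>,
  and in each summand one factor is a coboundary.\<close>

lemma corresponding_cup:
  assumes "is_cocycle m G (carrier G) (carrier G) (Suc i) f" "is_cocycle m H (carrier H) (carrier H) (Suc i) h"
    and "is_cocycle m G (carrier G) (carrier G) (Suc j) f'" "is_cocycle m H (carrier H) (carrier H) (Suc j) h'"
    and "corresponding (Suc i) f h" "corresponding (Suc j) f' h'"
  shows "corresponding (Suc (i + j)) (cup i f f') (cup i h h')"
proof -
  note SG = subgroup.subset [OF S]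
  have "is_coboundary m G S S (Suc (i + j)) (cup i (\<lambda>xs. f xs - h (map \<alpha> xs)) f')"
    using assms(5) unfolding corresponding_def
    by (rule is_coboundary_cup_left) (intro is_cocycle_mono [OF assms(3)] SG)
  moreover have "is_coboundary m G S S (Suc (i + j)) (cup i (\<lambda>xs. h (map \<alpha> xs)) (\<lambda>xs. f' xs - h' (map \<alpha> xs)))"
    using assms(6) unfolding corresponding_def
    by (intro is_coboundary_cup_right is_cocycle_pullback_\<alpha> assms(2))
  ultimately have "is_coboundary m G S S (Suc (i + j)) (\<lambda>xs. cup i (\<lambda>xs. f xs - h (map \<alpha> xs)) f' xs +
      cup i (\<lambda>xs. h (map \<alpha> xs)) (\<lambda>xs. f' xs - h' (map \<alpha> xs)) xs)"
    by (rule is_coboundary_add)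
  then show ?thesis
    unfolding corresponding_def
    by (rule is_coboundary_cong) (simp add: cup_def take_map drop_map algebra_simps)
qed

end

section \<open>From \<open>p\<close>-local equivalence to the symmetric fusion condition\<close>

context group
begin

lemma coprime_index_sylow:
  assumes p: "prime p" and "finite (carrier G)" "sylow_subgroup p G T"
  shows "coprime (int (card (rcosets T))) (int p)"
proof -
  have T: "subgroup T G" "card T = p ^ multiplicity p (order G)"
    using assms(3) by (auto simp: sylow_subgroup_def)
  have ord: "order G = card (rcosets T) * p ^ multiplicity p (order G)" "order G \<noteq> 0"
    using lagrange [OF T(1)] T(2) order_gt_0_iff_finite assms(2) by auto
  have "\<not> p dvd card (rcosets T)"
  proof
    assume "p dvd card (rcosets T)"
    then have "p ^ Suc (multiplicity p (order G)) dvd order G"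
      by (subst ord(1)) (simp add: mult_dvd_mono)
    moreover have "\<not> is_unit p" using p by auto
    ultimately show False using ord(2) multiplicity_geI [of "order G" p "Suc (multiplicity p (order G))"] by simp
  qed
  then show ?thesis
    using p by (simp add: coprime_commute prime_imp_coprime)
qed

lemma conjugate_mult:
  assumes "x \<in> carrier G" "y \<in> carrier G" "z \<in> carrier G"
  shows "x \<otimes> (y \<otimes> z) \<otimes> inv x = (x \<otimes> y \<otimes> inv x) \<otimes> (x \<otimes> z \<otimes> inv x)"
proof -
  have "inv x \<otimes> (x \<otimes> w) = w" if "w \<in> carrier G" for w
    using that assms(1) by (simp add: m_assoc [symmetric])
  then show ?thesis using assms by (simp add: m_assoc)
qed

end

lemma p_locally_equivalent_imp_fusion_equivalence:
  assumes p: "prime p" and G: "group G" "finite (carrier G)" and H: "group H" "finite (carrier H)"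
    and equiv: "p_locally_equivalent p G H"
  obtains S R \<alpha> \<beta> where "fusion_equivalence G H S R \<alpha> \<beta> (int p)"
proof -
  obtain S R \<alpha> where S: "sylow_subgroup p G S" and R: "sylow_subgroup p H R"
    and \<alpha>: "\<alpha> \<in> iso (G\<lparr>carrier := S\<rparr>) (H\<lparr>carrier := R\<rparr>)"
    and fusion: "\<And>P Q f. \<lbrakk>subgroup P (G\<lparr>carrier := S\<rparr>); subgroup Q (G\<lparr>carrier := S\<rparr>);
                 f \<in> hom (G\<lparr>carrier := P\<rparr>) (G\<lparr>carrier := Q\<rparr>)\<rbrakk> \<Longrightarrow>
           subconjugation G P Q f \<longleftrightarrow>
            subconjugation H (\<alpha> ` P) (\<alpha> ` Q) (\<lambda>y. \<alpha> (f (inv_into S \<alpha> y)))"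
    using equiv unfolding p_locally_equivalent_def by blast
  interpret G: group G by (rule G)
  interpret H: group H by (rule H)
  define \<beta> where "\<beta> = inv_into S \<alpha>"
  have SG: "subgroup S G" and RH: "subgroup R H"
    using S R by (auto simp: sylow_subgroup_def)
  have bij: "bij_betw \<alpha> S R" and \<alpha>_mult: "\<And>x y. \<lbrakk>x \<in> S; y \<in> S\<rbrakk> \<Longrightarrow> \<alpha> (x \<otimes>\<^bsub>G\<^esub> y) = \<alpha> x \<otimes>\<^bsub>H\<^esub> \<alpha> y"
    using \<alpha> by (auto simp: iso_def hom_def)
  have \<alpha>R: "\<alpha> x \<in> R" if "x \<in> S" for x using bij that by (auto simp: bij_betw_def)
  have \<beta>S: "\<beta> y \<in> S" and \<alpha>_\<beta>: "\<alpha> (\<beta> y) = y" if "y \<in> R" for y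
    using bij that by (auto simp: \<beta>_def bij_betw_def inv_into_into f_inv_into_f)
  have \<beta>_\<alpha>: "\<beta> (\<alpha> x) = x" if "x \<in> S" for x
    using bij that by (auto simp: \<beta>_def bij_betw_def)
  have \<beta>_mult: "\<beta> (x \<otimes>\<^bsub>H\<^esub> y) = \<beta> x \<otimes>\<^bsub>G\<^esub> \<beta> y" if "x \<in> R" "y \<in> R" for x y
  proof -
    have "\<alpha> (\<beta> x \<otimes>\<^bsub>G\<^esub> \<beta> y) = x \<otimes>\<^bsub>H\<^esub> y" using that \<beta>S \<alpha>_\<beta> \<alpha>_mult by simp
    moreover have "\<beta> x \<otimes>\<^bsub>G\<^esub> \<beta> y \<in> S" using that \<beta>S SG by (simp add: subgroup.m_closed)
    ultimately show ?thesis using \<beta>_\<alpha> by metis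
  qed
  have "fusion_equivalence G H S R \<alpha> \<beta> (int p)"
  proof (rule fusion_equivalence.intro [OF G(1) H(1)], rule fusion_equivalence_axioms.intro)
    show "coprime (int (card (rcosets\<^bsub>G\<^esub> S))) (int p)" using p G(2) S by (rule G.coprime_index_sylow)
    show "coprime (int (card (rcosets\<^bsub>H\<^esub> R))) (int p)" using p H(2) R by (rule H.coprime_index_sylow)
  next
    fix P x assume P: "subgroup P G" "P \<subseteq> S" and x: "x \<in> carrier G" "\<And>y. y \<in> P \<Longrightarrow> x \<otimes>\<^bsub>G\<^esub> y \<otimes>\<^bsub>G\<^esub> inv\<^bsub>G\<^esub> x \<in> S"
    let ?f = "\<lambda>y. x \<otimes>\<^bsub>G\<^esub> y \<otimes>\<^bsub>G\<^esub> inv\<^bsub>G\<^esub> x"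
    have f: "?f \<in> hom (G\<lparr>carrier := P\<rparr>) (G\<lparr>carrier := S\<rparr>)"
      using x subgroup.subset [OF P(1)] G.conjugate_mult [OF x(1)] by (auto simp: hom_def subset_iff)
    then have "subconjugation G P S ?f"
      using x(1) by (auto simp: subconjugation_def)
    moreover have "subgroup P (G\<lparr>carrier := S\<rparr>)" "subgroup S (G\<lparr>carrier := S\<rparr>)"
      using P SG by (auto intro: G.subgroup_incl)
    ultimately have "subconjugation H (\<alpha> ` P) (\<alpha> ` S) (\<lambda>y. \<alpha> (?f (\<beta> y)))"
      using fusion f unfolding \<beta>_def by blast
    then obtain z where "z \<in> carrier H" "\<And>y. y \<in> P \<Longrightarrow> \<alpha> (?f (\<beta> (\<alpha> y))) = z \<otimes>\<^bsub>H\<^esub> \<alpha> y \<otimes>\<^bsub>H\<^esub> inv\<^bsub>H\<^esub> z"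
      unfolding subconjugation_def by blast
    then show "\<exists>z\<in>carrier H. \<forall>y\<in>P. \<alpha> (?f y) = z \<otimes>\<^bsub>H\<^esub> \<alpha> y \<otimes>\<^bsub>H\<^esub> inv\<^bsub>H\<^esub> z"
      using \<beta>_\<alpha> P(2) by (metis subsetD)
  next
    fix P z assume P: "subgroup P H" "P \<subseteq> R" and z: "z \<in> carrier H" "\<And>y. y \<in> P \<Longrightarrow> z \<otimes>\<^bsub>H\<^esub> y \<otimes>\<^bsub>H\<^esub> inv\<^bsub>H\<^esub> z \<in> R"
    let ?c = "\<lambda>y. z \<otimes>\<^bsub>H\<^esub> y \<otimes>\<^bsub>H\<^esub> inv\<^bsub>H\<^esub> z"
    \<comment> \<open>For this direction conjugation by \<open>z\<close> in \<open>H\<close> is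
      carried over to \<open>S\<close>, and the equivalence is read from right to left: the
      transport of \<open>?f\<close> to \<open>H\<close> is a subconjugation by construction, so
      \<open>?f\<close> is conjugation by some \<open>x\<close> of \<open>G\<close>.\<close>
    let ?f = "\<lambda>x. \<beta> (?c (\<alpha> x))"
    have \<alpha>_im: "\<alpha> ` \<beta> ` P = P" "\<alpha> ` S = R"
      using P(2) \<alpha>_\<beta> bij by (force simp: image_image bij_betw_def)+
    have c: "?c (x \<otimes>\<^bsub>H\<^esub> y) = ?c x \<otimes>\<^bsub>H\<^esub> ?c y" if "x \<in> P" "y \<in> P" for x y
      using that subgroup.subset [OF P(1)] H.conjugate_mult [OF z(1)] by blast
    have \<beta>P: "\<beta> y \<in> S" "\<alpha> (\<beta> y) = y" if "y \<in> P" for y using that P(2) \<beta>S \<alpha>_\<beta> by auto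
    have mult: "\<beta> x \<otimes>\<^bsub>G\<^esub> \<beta> y = \<beta> (x \<otimes>\<^bsub>H\<^esub> y)" if "x \<in> P" "y \<in> P" for x y
      using \<beta>_mult [of x y] that P(2) by (simp add: subset_iff)
    have f: "?f \<in> hom (G\<lparr>carrier := \<beta> ` P\<rparr>) (G\<lparr>carrier := S\<rparr>)"
      using z \<beta>P mult subgroup.m_closed [OF P(1)] c \<beta>_mult \<beta>S by (auto simp: hom_def)
    have "subgroup (\<beta> ` P) G"
    proof (rule G.subgroupI)
      show "\<beta> ` P \<subseteq> carrier G" using \<beta>P subgroup.subset [OF SG] by auto
      show "\<beta> ` P \<noteq> {}" using subgroup.one_closed [OF P(1)] by blast
      have "\<beta> \<one>\<^bsub>H\<^esub> \<in> carrier G" "\<beta> \<one>\<^bsub>H\<^esub> \<otimes>\<^bsub>G\<^esub> \<beta> \<one>\<^bsub>H\<^esub> = \<beta> \<one>\<^bsub>H\<^esub>"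
        using mult [of "\<one>\<^bsub>H\<^esub>" "\<one>\<^bsub>H\<^esub>"] subgroup.one_closed [OF P(1)] \<beta>P subgroup.subset [OF SG] by auto
      then have one: "\<beta> \<one>\<^bsub>H\<^esub> = \<one>\<^bsub>G\<^esub>" by simp
      fix a assume "a \<in> \<beta> ` P"
      then obtain x where x: "x \<in> P" "a = \<beta> x" by blast
      have xi: "inv\<^bsub>H\<^esub> x \<in> P" using x P(1) by (simp add: subgroup.m_inv_closed)
      have "\<beta> (inv\<^bsub>H\<^esub> x) \<otimes>\<^bsub>G\<^esub> \<beta> x = \<one>\<^bsub>G\<^esub>"
        using x xi mult subgroup.subset [OF P(1)] one by auto
      moreover have "\<beta> x \<in> carrier G" "\<beta> (inv\<^bsub>H\<^esub> x) \<in> carrier G"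
        using x(1) xi \<beta>P(1) subgroup.subset [OF SG] by blast+
      ultimately have "inv\<^bsub>G\<^esub> a = \<beta> (inv\<^bsub>H\<^esub> x)"
        unfolding x(2) by (rule G.inv_equality)
      then show "inv\<^bsub>G\<^esub> a \<in> \<beta> ` P" using xi by simp
      fix b assume "b \<in> \<beta> ` P"
      then show "a \<otimes>\<^bsub>G\<^esub> b \<in> \<beta> ` P" using x mult subgroup.m_closed [OF P(1)] by auto
    qed
    then have sub: "subgroup (\<beta> ` P) (G\<lparr>carrier := S\<rparr>)" "subgroup S (G\<lparr>carrier := S\<rparr>)"
      using SG \<beta>P(1) by (auto intro!: G.subgroup_incl)
    have "\<alpha> (?f (\<beta> y)) = ?c y" if "y \<in> P" for y
      using that \<beta>P \<alpha>_\<beta> z(2) by simp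
    then have "subconjugation H P R (\<lambda>y. \<alpha> (?f (\<beta> y)))"
      unfolding subconjugation_def using z c subgroup.m_closed [OF P(1)] by (auto simp: hom_def)
    then have "subconjugation G (\<beta> ` P) S ?f"
      using fusion [OF sub f] \<alpha>_im unfolding \<beta>_def by simp
    then obtain x where "x \<in> carrier G" "\<And>y. y \<in> P \<Longrightarrow> ?f (\<beta> y) = x \<otimes>\<^bsub>G\<^esub> \<beta> y \<otimes>\<^bsub>G\<^esub> inv\<^bsub>G\<^esub> x"
      unfolding subconjugation_def by blast
    then show "\<exists>x\<in>carrier G. \<forall>y\<in>P. \<beta> (?c y) = x \<otimes>\<^bsub>G\<^esub> \<beta> y \<otimes>\<^bsub>G\<^esub> inv\<^bsub>G\<^esub> x"
      using \<beta>P(2) by metis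
  qed (use SG RH \<alpha>R \<alpha>_mult \<beta>S \<beta>_mult \<beta>_\<alpha> \<alpha>_\<beta> in auto)
  then show thesis by (rule that)
qed


subsection \<open>The cochain complex computing cohomology\<close>

lemma residue_ring_simps [simp]:
  "carrier (residue_ring m) = {0..m - 1}" "x \<oplus>\<^bsub>residue_ring m\<^esub> y = (x + y) mod m"
  "x \<otimes>\<^bsub>residue_ring m\<^esub> y = (x * y) mod m" "\<zero>\<^bsub>residue_ring m\<^esub> = 0" "\<one>\<^bsub>residue_ring m\<^esub> = 1"
  by (simp_all add: residue_ring_def)

lemma mod_eq_iff_cong:
  assumes "0 \<le> x" "x < (m::int)" shows "x = y mod m \<longleftrightarrow> [x = y] (mod m)"
  using assms by (simp add: cong_def)

lemma residue_ring_int_add_pow: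
  assumes "1 < m" "x \<in> {0..m - 1}"
  shows "[(k::int)] \<cdot>\<^bsub>residue_ring m\<^esub> x = (k * x) mod m"
proof -
  interpret residues m "residue_ring m" using assms(1) by unfold_locales
  have x: "x \<in> carrier (add_monoid (residue_ring m))" using assms(2) by simp
  have add: "[(a + b)] \<cdot>\<^bsub>residue_ring m\<^esub> x = ([a] \<cdot>\<^bsub>residue_ring m\<^esub> x + [b] \<cdot>\<^bsub>residue_ring m\<^esub> x) mod m" for a b :: int
    using group.int_pow_mult [OF a_group x, of a b] by (simp add: add_pow_def)
  have one: "[(1::int)] \<cdot>\<^bsub>residue_ring m\<^esub> x = x"
    using group.int_pow_1 [OF a_group x] by (simp add: add_pow_def)
  have zero: "[(0::int)] \<cdot>\<^bsub>residue_ring m\<^esub> x = 0"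
    using int_pow_0 [of "add_monoid (residue_ring m)" x] by (simp add: add_pow_def)
  have minus: "[(- 1::int)] \<cdot>\<^bsub>residue_ring m\<^esub> x = (- x) mod m"
  proof -
    have "[(- 1::int)] \<cdot>\<^bsub>residue_ring m\<^esub> x \<in> {0..m - 1}"
      using group.int_pow_closed [OF a_group x, of "- 1"] by (simp add: add_pow_def)
    moreover have "([(- 1::int)] \<cdot>\<^bsub>residue_ring m\<^esub> x + x) mod m = 0"
      using add [of "- 1" 1] by (simp add: one zero)
    ultimately show ?thesis
      by (simp add: mod_eq_iff_cong cong_iff_dvd_diff mod_eq_0_iff_dvd)
  qed
  show ?thesis
  proof (induction k rule: int_induct [where k = 0])
    case base
    show ?case by (simp add: zero)
  next
    case (step1 i)
    then show ?case using add [of i 1] one by (simp add: mod_simps algebra_simps)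
  next
    case (step2 i)
    then show ?case using add [of i "- 1"] minus by (simp add: mod_simps algebra_simps)
  qed
qed

lemma residue_ring_finsum:
  assumes "1 < m" "finite A" "\<And>i. i \<in> A \<Longrightarrow> h i \<in> {0..m - 1}"
  shows "finsum (residue_ring m) h A = (\<Sum>i\<in>A. h i) mod m"
proof -
  interpret residues m "residue_ring m" using assms(1) by unfold_locales
  show ?thesis
    using assms(2,3)
  proof (induction A)
    case (insert i A)
    then have "finsum (residue_ring m) h (insert i A) = h i \<oplus>\<^bsub>residue_ring m\<^esub> finsum (residue_ring m) h A"
      by (intro finsum_insert) auto
    with insert show ?case by (simp add: mod_simps)
  qed simp
qed

lemma augmentation_eq_pairing: "augmentation c = pairing (\<lambda>_. 1) c"
  by (simp add: augmentation_def pairing_def)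

text \<open>Links integer functions on tuples, taken modulo \<open>p\<close>, with the additive
  functions that form the complex in \<open>Ext_module\<close>. By
  \<open>cochain_of_on_basis\<close> and \<open>cochain_of_eq_iff\<close> nothing is lost in passing
  between them.\<close>

definition cochain_of :: "nat \<Rightarrow> ('a, 'x) monoid_scheme \<Rightarrow> nat \<Rightarrow> ('a list \<Rightarrow> int) \<Rightarrow> ('a list \<Rightarrow>\<^sub>0 int) \<Rightarrow> int" where
  "cochain_of p G n \<phi> = (\<lambda>c\<in>carrier (std_left G n). pairing \<phi> c mod int p)"

abbreviation on_basis :: "(('a list \<Rightarrow>\<^sub>0 int) \<Rightarrow> int) \<Rightarrow> 'a list \<Rightarrow> int" where
  "on_basis f \<equiv> \<lambda>xs. f (frag_of xs)"

abbreviation group_cocycles ::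
    "nat \<Rightarrow> ('a, 'x) monoid_scheme \<Rightarrow> nat \<Rightarrow> (('a list \<Rightarrow>\<^sub>0 int) \<Rightarrow> int) set" where
  "group_cocycles p G \<equiv> cocycles (group_cochains p G) (hom_differential (std_left G) std_diff)"

locale group_mod = group G for G :: "('a, 'x) monoid_scheme" (structure) +
  fixes p :: nat
  assumes p: "1 < p"
begin

abbreviation invariant where "invariant \<equiv> invariant_cochain (int p) G (carrier G) (carrier G)"
abbreviation cocycle where "cocycle \<equiv> is_cocycle (int p) G (carrier G) (carrier G)"
abbreviation coboundary where "coboundary \<equiv> is_coboundary (int p) G (carrier G) (carrier G)"

lemma simplices_iff: "xs \<in> simplices n \<longleftrightarrow> xs \<in> lists (carrier G) \<and> length xs = Suc n"
  by (auto simp: simplices_def)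

lemma std_left_simps: "x \<oplus>\<^bsub>std_left G n\<^esub> y = x + y" "\<zero>\<^bsub>std_left G n\<^esub> = 0"
  "a \<odot>\<^bsub>std_left G n\<^esub> c = frag_extend (\<lambda>g. frag_extend (\<lambda>xs. frag_of (map (\<lambda>x. g \<otimes> x) xs)) c) a"
  by (simp_all add: std_left_def)

lemma frag_of_std_left: "frag_of xs \<in> carrier (std_left G n) \<longleftrightarrow> xs \<in> simplices n"
  by (simp add: carrier_std_left)

lemma std_left_closed:
  "a \<in> carrier (std_left G n) \<Longrightarrow> b \<in> carrier (std_left G n) \<Longrightarrow> a + b \<in> carrier (std_left G n)"
  "a \<in> carrier (std_left G n) \<Longrightarrow> b \<in> carrier (std_left G n) \<Longrightarrow> a - b \<in> carrier (std_left G n)"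
  using Poly_Mapping.keys_add [of a b] keys_diff [of a b] by (auto simp: carrier_std_left)

lemma std_left_smult_closed:
  "a \<in> carrier (group_ring G) \<Longrightarrow> c \<in> carrier (std_left G n) \<Longrightarrow> a \<odot>\<^bsub>std_left G n\<^esub> c \<in> carrier (std_left G n)"
  using lmodule.lsmult_closed [OF lmodule_std_left] .

lemma std_diff_closed:
  assumes "c \<in> carrier (std_left G (Suc n))"
  shows "std_diff n c \<in> carrier (std_left G n)" "std_diff n c = frag_extend list_boundary c"
proof -
  have c: "Poly_Mapping.keys c \<subseteq> {xs. length xs = Suc (Suc n) \<and> set xs \<subseteq> carrier G}"
    using assms by (simp add: carrier_std_left simplices_def)
  then show "std_diff n c = frag_extend list_boundary c" by (rule std_diff_eq)
  with boundary_closed [OF c] show "std_diff n c \<in> carrier (std_left G n)"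
    by (simp add: carrier_std_left simplices_def)
qed

lemma cochains_iff:
  "f \<in> carrier (group_cochains p G n) \<longleftrightarrow> f \<in> extensional (carrier (std_left G n)) \<and>
     (\<forall>c\<in>carrier (std_left G n). 0 \<le> f c \<and> f c < int p) \<and>
     (\<forall>c\<in>carrier (std_left G n). \<forall>d\<in>carrier (std_left G n). f (c + d) = (f c + f d) mod int p) \<and>
     (\<forall>a\<in>carrier (group_ring G). \<forall>c\<in>carrier (std_left G n).
        f (a \<odot>\<^bsub>std_left G n\<^esub> c) = (augmentation a * f c) mod int p)"
proof -
  have "f c \<in> carrier (trivial_module (Fp p) :: ('a \<Rightarrow>\<^sub>0 int, int) module) \<longleftrightarrow> 0 \<le> f c \<and> f c < int p" for c
    by (auto simp: trivial_module_def)
  moreover have "a \<odot>\<^bsub>trivial_module (Fp p)\<^esub> x = (augmentation a * x) mod int p" if "0 \<le> x \<and> x < int p" for a :: "'a \<Rightarrow>\<^sub>0 int" and x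
    using that p residue_ring_int_add_pow [of "int p" x "augmentation a"] by (simp add: trivial_module_def)
  moreover have "x \<oplus>\<^bsub>(trivial_module (Fp p) :: ('a \<Rightarrow>\<^sub>0 int, int) module)\<^esub> y = (x + y) mod int p" for x y
    by (simp add: trivial_module_def)
  ultimately show ?thesis
    by (auto simp: hom_complex_def hom_module_def lmod_hom_def std_left_simps(1) Pi_iff)
qed

lemma cochains_simps:
  "f \<oplus>\<^bsub>group_cochains p G n\<^esub> g = (\<lambda>c\<in>carrier (std_left G n). (f c + g c) mod int p)"
  "\<zero>\<^bsub>group_cochains p G n\<^esub> = (\<lambda>c\<in>carrier (std_left G n). 0)"
  "k \<odot>\<^bsub>group_cochains p G n\<^esub> f = (\<lambda>c\<in>carrier (std_left G n). (k * f c) mod int p)"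
  by (simp_all add: hom_complex_def hom_module_def trivial_module_def)

lemma pairing_smult:
  assumes "invariant \<phi>" "a \<in> carrier (group_ring G)" "c \<in> carrier (std_left G n)"
  shows "[pairing \<phi> (a \<odot>\<^bsub>std_left G n\<^esub> c) = augmentation a * pairing \<phi> c] (mod int p)"
proof -
  have "pairing \<phi> (a \<odot>\<^bsub>std_left G n\<^esub> c) = pairing (\<lambda>g. pairing (\<lambda>xs. \<phi> (map (\<lambda>x. g \<otimes> x) xs)) c) a"
    by (simp add: std_left_simps pairing_extend)
  also have "[\<dots> = pairing (\<lambda>g. pairing \<phi> c) a] (mod int p)"
    using assms(2,3) by (intro pairing_cong invariant_cochainD [OF assms(1)])
      (auto simp: group_ring_def carrier_std_left simplices_def)
  also have "pairing (\<lambda>g. pairing \<phi> c) a = augmentation a * pairing \<phi> c"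
    using pairing_fun_cmul' [of "\<lambda>_. 1" "pairing \<phi> c" a] by (simp add: augmentation_eq_pairing)
  finally show ?thesis .
qed

lemma cochain_of_closed:
  assumes "invariant \<phi>" shows "cochain_of p G n \<phi> \<in> carrier (group_cochains p G n)"
  unfolding cochains_iff
proof (intro conjI ballI)
  fix a c assume "a \<in> carrier (group_ring G)" "c \<in> carrier (std_left G n)"
  then show "cochain_of p G n \<phi> (a \<odot>\<^bsub>std_left G n\<^esub> c) = (augmentation a * cochain_of p G n \<phi> c) mod int p"
    using pairing_smult [OF assms, of a c n] std_left_smult_closed [of a c n]
    by (simp add: cochain_of_def mod_simps cong_def)
qed (use p in \<open>auto simp: cochain_of_def std_left_closed pairing_add mod_simps\<close>)

lemma cochain_of_eq_iff:
  "cochain_of p G n \<phi> = cochain_of p G n \<psi> \<longleftrightarrow> (\<forall>xs\<in>simplices n. [\<phi> xs = \<psi> xs] (mod int p))"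
proof
  assume eq: "cochain_of p G n \<phi> = cochain_of p G n \<psi>"
  show "\<forall>xs\<in>simplices n. [\<phi> xs = \<psi> xs] (mod int p)"
  proof
    fix xs assume "xs \<in> simplices n"
    then show "[\<phi> xs = \<psi> xs] (mod int p)"
      using fun_cong [OF eq, of "frag_of xs"] by (simp add: cochain_of_def frag_of_std_left cong_def)
  qed
next
  assume *: "\<forall>xs\<in>simplices n. [\<phi> xs = \<psi> xs] (mod int p)"
  have "[pairing \<phi> c = pairing \<psi> c] (mod int p)" if "c \<in> carrier (std_left G n)" for c
    using that * by (intro pairing_cong) (auto simp: carrier_std_left)
  then show "cochain_of p G n \<phi> = cochain_of p G n \<psi>"
    by (auto simp: cochain_of_def cong_def)
qed

text \<open>A cochain is additive modulo \<open>p\<close>, hence determined by its values on tuples.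
  These congruences become equalities because all values lie between 0 and \<open>p - 1\<close>; in
  particular \<open>0 + 0 = 0\<close> forces the value 0 at 0.\<close>

lemma cochain_of_on_basis:
  assumes "f \<in> carrier (group_cochains p G n)"
  shows "cochain_of p G n (on_basis f) = f"
proof (rule extensionalityI [of _ "carrier (std_left G n)"])
  note f = assms [unfolded cochains_iff]
  show "f \<in> extensional (carrier (std_left G n))" using f by blast
  show "cochain_of p G n (on_basis f) \<in> extensional (carrier (std_left G n))" by (simp add: cochain_of_def)
  fix c assume c: "c \<in> carrier (std_left G n)"
  have "Poly_Mapping.keys c \<subseteq> simplices n" using c by (simp add: carrier_std_left)
  then have "c \<in> carrier (std_left G n) \<and> f c = pairing (on_basis f) c mod int p"
  proof (induction c rule: frag_induction)
    case zero
    have z: "0 \<in> carrier (std_left G n)" by (simp add: carrier_std_left)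
    with f have "f (0 + 0) = (f 0 + f 0) mod int p" "0 \<le> f 0" "f 0 < int p" by blast+
    then have "[f 0 = f 0 + f 0] (mod int p)" by (simp add: cong_def)
    then have "int p dvd f 0" by (simp add: cong_iff_dvd_diff)
    then have "f 0 = 0" using \<open>0 \<le> f 0\<close> \<open>f 0 < int p\<close> zdvd_imp_le [of "int p" "f 0"] by linarith
    with z show ?case by simp
  next
    case (one xs)
    then have "frag_of xs \<in> carrier (std_left G n)" by (simp add: frag_of_std_left)
    with f show ?case by simp
  next
    case (diff a b)
    then have a: "a \<in> carrier (std_left G n)" "b \<in> carrier (std_left G n)" "a - b \<in> carrier (std_left G n)"
      by (simp_all add: std_left_closed)
    with f have "f ((a - b) + b) = (f (a - b) + f b) mod int p" "0 \<le> f (a - b)" "f (a - b) < int p" by blast+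
    then have "[f (a - b) + f b = f a] (mod int p)" by (simp add: cong_def)
    then have "[f (a - b) = f a - f b] (mod int p)"
      using cong_diff [of "f (a - b) + f b" "f a" "int p" "f b" "f b"] by simp
    then have "f (a - b) = (f a - f b) mod int p"
      using \<open>0 \<le> f (a - b)\<close> \<open>f (a - b) < int p\<close> by (simp add: mod_eq_iff_cong)
    with a diff show ?case by (simp add: pairing_diff mod_simps)
  qed
  then show "cochain_of p G n (on_basis f) c = f c" using c by (simp add: cochain_of_def)
qed

lemma on_basis_cochain_of:
  "xs \<in> simplices n \<Longrightarrow> [on_basis (cochain_of p G n \<phi>) xs = \<phi> xs] (mod int p)"
  by (simp add: cochain_of_def frag_of_std_left)

lemma invariant_on_basis:
  assumes "f \<in> carrier (group_cochains p G n)" shows "invariant (on_basis f)"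
  unfolding invariant_cochain_def
proof (intro ballI)
  note f = assms [unfolded cochains_iff]
  fix g xs assume g: "g \<in> carrier G" and xs: "xs \<in> lists (carrier G)"
  show "[on_basis f (map (\<lambda>x. g \<otimes> x) xs) = on_basis f xs] (mod int p)"
  proof (cases "length xs = Suc n")
    case True
    then have xs: "frag_of xs \<in> carrier (std_left G n)" using xs by (simp add: frag_of_std_left simplices_iff)
    have "frag_of g \<in> carrier (group_ring G)" using g by (simp add: group_ring_def)
    with xs f have "f (frag_of g \<odot>\<^bsub>std_left G n\<^esub> frag_of xs) = (augmentation (frag_of g) * f (frag_of xs)) mod int p"
      by blast
    then show ?thesis by (simp add: std_left_simps cong_def)
  next
    \<comment> \<open>Lists of another length give elements outside the domain, where the
      extensional \<open>f\<close> always takes the value \<open>undefined\<close>.\<close>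
    case False
    then have "frag_of xs \<notin> carrier (std_left G n)" "frag_of (map (\<lambda>x. g \<otimes> x) xs) \<notin> carrier (std_left G n)"
      by (auto simp: frag_of_std_left simplices_iff)
    with f show ?thesis by (simp add: extensional_def)
  qed
qed

lemma hom_differential_eq:
  assumes "f \<in> carrier (group_cochains p G n)"
  shows "hom_differential (std_left G) std_diff n f =
    cochain_of p G (Suc n) (\<lambda>xs. pairing (on_basis f) (list_boundary xs))"
proof (rule extensionalityI [of _ "carrier (std_left G (Suc n))"])
  fix c assume c: "c \<in> carrier (std_left G (Suc n))"
  have "f (std_diff n c) = pairing (on_basis f) (std_diff n c) mod int p"
    using fun_cong [OF cochain_of_on_basis [OF assms], of "std_diff n c"] std_diff_closed(1) [OF c]
    by (simp add: cochain_of_def)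
  then show "hom_differential (std_left G) std_diff n f c =
      cochain_of p G (Suc n) (\<lambda>xs. pairing (on_basis f) (list_boundary xs)) c"
    using c by (simp add: hom_differential_def cochain_of_def std_diff_closed(2) pairing_extend)
qed (simp_all add: hom_differential_def cochain_of_def)

lemma cochain_of_zero: "cochain_of p G n (\<lambda>_. 0) = \<zero>\<^bsub>group_cochains p G n\<^esub>"
  by (simp add: cochain_of_def cochains_simps)

lemma cocycles_iff:
  "f \<in> group_cocycles p G n \<longleftrightarrow> f \<in> carrier (group_cochains p G n) \<and> cocycle (Suc n) (on_basis f)"
proof -
  have "hom_differential (std_left G) std_diff n f = \<zero>\<^bsub>group_cochains p G (Suc n)\<^esub> \<longleftrightarrow> cocycle (Suc n) (on_basis f)"
    if f: "f \<in> carrier (group_cochains p G n)"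
    using invariant_on_basis [OF f]
    by (auto simp: hom_differential_eq [OF f] cochain_of_zero [symmetric] cochain_of_eq_iff is_cocycle_def simplices_iff)
  then show ?thesis by (auto simp: cocycles_def)
qed

text \<open>In degree 0 \<open>coboundaries\<close> consists of the zero cochain by definition, and
  \<open>is_coboundary_length_1\<close> shows the same for \<open>is_coboundary\<close>. In higher
  degrees primitives are translated between the two descriptions.\<close>

lemma coboundaries_iff:
  "f \<in> group_coboundaries p G n \<longleftrightarrow> f \<in> carrier (group_cochains p G n) \<and> coboundary (Suc n) (on_basis f)"
proof (cases n)
  case 0
  have inv0: "invariant (\<lambda>_. 0)" by (simp add: invariant_cochain_def)
  show ?thesis
  proof (intro iffI conjI)
    assume "f \<in> group_coboundaries p G n"
    then have f: "f = cochain_of p G n (\<lambda>_. 0)" by (simp add: coboundaries_def 0 cochain_of_zero)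
    then show "f \<in> carrier (group_cochains p G n)" using cochain_of_closed [OF inv0] by simp
    show "coboundary (Suc n) (on_basis f)"
      unfolding f by (rule is_coboundary_zero) (use on_basis_cochain_of simplices_iff in blast)
  next
    assume f: "f \<in> carrier (group_cochains p G n) \<and> coboundary (Suc n) (on_basis f)"
    then have "cochain_of p G n (on_basis f) = cochain_of p G n (\<lambda>_. 0)"
      unfolding cochain_of_eq_iff
      using is_coboundary_length_1 [of "int p" G "carrier G" "carrier G" "on_basis f"]
      by (simp add: 0 simplices_iff del: in_lists_conv_set)
    then show "f \<in> group_coboundaries p G n"
      using f cochain_of_on_basis by (simp add: coboundaries_def 0 cochain_of_zero)
  qed
next
  case (Suc k)
  show ?thesis
  proof (intro iffI conjI)
    assume "f \<in> group_coboundaries p G n"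
    then obtain h where h: "h \<in> carrier (group_cochains p G k)" "f = hom_differential (std_left G) std_diff k h"
      by (auto simp: coboundaries_def Suc)
    \<comment> \<open>\<open>on_basis h []\<close> is \<open>undefined\<close>, but a primitive has
      to vanish at the empty list. The lists of interest have length at least two and so no empty
      face, hence the change does not affect the coboundary.\<close>
    define \<psi> where "\<psi> xs = (if xs = [] then 0 else on_basis h xs)" for xs
    have \<psi>: "invariant \<psi>"
      using invariant_on_basis [OF h(1)] by (auto simp: invariant_cochain_def \<psi>_def)
    have f: "f = cochain_of p G n (\<lambda>xs. pairing \<psi> (list_boundary xs))"
      unfolding h(2) hom_differential_eq [OF h(1)] Suc cochain_of_eq_iff
    proof
      fix xs assume "xs \<in> simplices (Suc k)"
      then have xs: "length xs = Suc (Suc k)" "xs \<in> lists (carrier G)" by (simp_all add: simplices_iff)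
      have "pairing (on_basis h) (list_boundary xs) = pairing \<psi> (list_boundary xs)"
        using lists_list_boundary [OF xs(2)] xs(1) by (intro pairing_fun_cong) (force simp: \<psi>_def)
      then show "[pairing (on_basis h) (list_boundary xs) = pairing \<psi> (list_boundary xs)] (mod int p)"
        by simp
    qed
    have "invariant (\<lambda>xs. pairing \<psi> (list_boundary xs))"
      unfolding invariant_cochain_def
    proof (intro ballI)
      fix g xs assume g: "g \<in> carrier G" and xs: "xs \<in> lists (carrier G)"
      show "[pairing \<psi> (list_boundary (map (\<lambda>x. g \<otimes> x) xs)) = pairing \<psi> (list_boundary xs)] (mod int p)"
        unfolding pairing_list_boundary_map [symmetric]
        using lists_list_boundary [OF xs] by (intro pairing_cong invariant_cochainD [OF \<psi> g]) blast
    qed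
    then show "f \<in> carrier (group_cochains p G n)"
      unfolding f by (rule cochain_of_closed)
    show "coboundary (Suc n) (on_basis f)"
    proof (rule is_coboundaryI [OF \<psi>])
      show "[on_basis f xs = pairing \<psi> (list_boundary xs)] (mod int p)"
        if "xs \<in> lists (carrier G)" "length xs = Suc n" for xs
        unfolding f using that by (intro on_basis_cochain_of) (simp add: simplices_iff)
    qed (simp add: \<psi>_def)
  next
    assume f: "f \<in> carrier (group_cochains p G n) \<and> coboundary (Suc n) (on_basis f)"
    then obtain \<psi> where \<psi>: "invariant \<psi>"
      "\<And>xs. \<lbrakk>xs \<in> lists (carrier G); length xs = Suc n\<rbrakk> \<Longrightarrow> [on_basis f xs = pairing \<psi> (list_boundary xs)] (mod int p)"
      unfolding is_coboundary_def by blast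
    let ?h = "cochain_of p G k \<psi>"
    have h: "?h \<in> carrier (group_cochains p G k)" using \<psi>(1) by (rule cochain_of_closed)
    have "cochain_of p G n (on_basis f) = cochain_of p G n (\<lambda>xs. pairing (on_basis ?h) (list_boundary xs))"
      unfolding cochain_of_eq_iff
    proof
      fix xs assume "xs \<in> simplices n"
      then have xs: "xs \<in> lists (carrier G)" "length xs = Suc n" by (auto simp: simplices_iff)
      have "[on_basis f xs = pairing \<psi> (list_boundary xs)] (mod int p)" using xs by (rule \<psi>(2))
      also have "[pairing \<psi> (list_boundary xs) = pairing (on_basis ?h) (list_boundary xs)] (mod int p)"
        using lists_list_boundary [OF xs(1)] xs(2) Suc
        by (intro pairing_cong cong_sym [OF on_basis_cochain_of]) (simp add: simplices_iff)
      finally show "[on_basis f xs = pairing (on_basis ?h) (list_boundary xs)] (mod int p)" .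
    qed
    then have "f = hom_differential (std_left G) std_diff k ?h"
      using f cochain_of_on_basis by (simp add: hom_differential_eq [OF h] Suc)
    then show "f \<in> group_coboundaries p G n"
      using h by (auto simp: coboundaries_def Suc)
  qed
qed

lemma cochain_of_cocycle:
  assumes "cocycle (Suc n) \<phi>" shows "cochain_of p G n \<phi> \<in> group_cocycles p G n"
proof -
  note closed = cochain_of_closed [OF is_cocycleD(1) [OF assms], of n]
  have "cocycle (Suc n) (on_basis (cochain_of p G n \<phi>))"
    using assms invariant_on_basis [OF closed] on_basis_cochain_of simplices_iff
    by (intro is_cocycle_cong [OF assms]) blast+
  then show ?thesis using closed by (simp add: cocycles_iff)
qed

lemma group_cocyclesE:
  assumes "f \<in> group_cocycles p G n"
  obtains \<phi> where "cocycle (Suc n) \<phi>" "f = cochain_of p G n \<phi>"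
  using assms cochain_of_on_basis [of f n] that [of "on_basis f"] unfolding cocycles_iff by simp

lemma cochain_of_coboundary_iff:
  assumes "cocycle (Suc n) \<phi>"
  shows "cochain_of p G n \<phi> \<in> group_coboundaries p G n \<longleftrightarrow> coboundary (Suc n) \<phi>"
proof -
  note closed = cochain_of_closed [OF is_cocycleD(1) [OF assms], of n]
  have "coboundary (Suc n) (on_basis (cochain_of p G n \<phi>)) \<longleftrightarrow> coboundary (Suc n) \<phi>"
  proof
    assume "coboundary (Suc n) (on_basis (cochain_of p G n \<phi>))"
    then show "coboundary (Suc n) \<phi>"
      by (rule is_coboundary_cong) (rule cong_sym [OF on_basis_cochain_of], simp add: simplices_iff)
  next
    assume "coboundary (Suc n) \<phi>"
    then show "coboundary (Suc n) (on_basis (cochain_of p G n \<phi>))"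
      by (rule is_coboundary_cong) (rule on_basis_cochain_of, simp add: simplices_iff)
  qed
  then show ?thesis using closed by (simp add: coboundaries_iff)
qed

lemma cochain_of_add:
  "cochain_of p G n \<phi> \<oplus>\<^bsub>group_cochains p G n\<^esub> cochain_of p G n \<psi> = cochain_of p G n (\<lambda>xs. \<phi> xs + \<psi> xs)"
  by (auto simp: cochains_simps cochain_of_def pairing_fun_add mod_simps)

lemma cochain_of_smult:
  "k \<odot>\<^bsub>group_cochains p G n\<^esub> cochain_of p G n \<phi> = cochain_of p G n (\<lambda>xs. k * \<phi> xs)"
  by (auto simp: cochains_simps cochain_of_def pairing_fun_cmul mod_simps)

lemma coboundary_imp_cocycle: "f \<in> group_coboundaries p G n \<Longrightarrow> f \<in> group_cocycles p G n"
proof -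
  assume f: "f \<in> group_coboundaries p G n"
  then obtain \<psi> where \<psi>: "\<And>xs. \<lbrakk>xs \<in> lists (carrier G); length xs = Suc n\<rbrakk> \<Longrightarrow>
      [on_basis f xs = pairing \<psi> (list_boundary xs)] (mod int p)"
    unfolding coboundaries_iff is_coboundary_def by blast
  have "cocycle (Suc n) (on_basis f)"
    unfolding is_cocycle_def
  proof (intro conjI ballI impI)
    show "invariant (on_basis f)" using f by (auto simp: coboundaries_iff intro: invariant_on_basis)
    fix xs assume xs: "xs \<in> lists (carrier G)" "length xs = Suc (Suc n)"
    have "[pairing (on_basis f) (list_boundary xs) = pairing (\<lambda>xs. pairing \<psi> (list_boundary xs)) (list_boundary xs)] (mod int p)"
      using lists_list_boundary [OF xs(1)] xs(2) by (intro pairing_cong \<psi>) simp_all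
    also have "pairing (\<lambda>xs. pairing \<psi> (list_boundary xs)) (list_boundary xs) = 0"
      using boundary_boundary [of "frag_of xs"] by (simp add: pairing_extend [symmetric])
    finally show "[pairing (on_basis f) (list_boundary xs) = 0] (mod int p)" .
  qed
  then show ?thesis using f by (auto simp: coboundaries_iff cocycles_iff)
qed

abbreviation cocycle_module where
  "cocycle_module n \<equiv> (group_cochains p G n)\<lparr>carrier := group_cocycles p G n\<rparr>"

lemma group_cohomology_eq: "group_cohomology p G n = quotient_module (cocycle_module n) (group_coboundaries p G n)"
  by (simp add: group_cohomology_def Ext_module_def cochain_cohomology_def)

lemma module_quotient_cohomology:
  "module_quotient (cocycle_module n) (group_coboundaries p G n) (carrier (Fp p))"
proof -
  have zero: "cocycle (Suc n) (\<lambda>_. 0)" "coboundary (Suc n) (\<lambda>_. 0)"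
    by (simp_all add: is_cocycle_def invariant_cochain_def is_coboundary_zero)
  interpret abelian_group "cocycle_module n"
  proof (rule abelian_groupI)
    show "\<zero>\<^bsub>cocycle_module n\<^esub> \<in> carrier (cocycle_module n)"
      using cochain_of_cocycle [OF zero(1)] by (simp add: cochain_of_zero)
  next
    fix f assume "f \<in> carrier (cocycle_module n)"
    then obtain \<phi> where \<phi>: "cocycle (Suc n) \<phi>" "f = cochain_of p G n \<phi>"
      by (auto elim: group_cocyclesE)
    show "\<zero>\<^bsub>cocycle_module n\<^esub> \<oplus>\<^bsub>cocycle_module n\<^esub> f = f"
      by (simp add: \<phi>(2) cochain_of_zero [symmetric] cochain_of_add)
    have "cochain_of p G n (\<lambda>xs. - 1 * \<phi> xs) \<oplus>\<^bsub>cocycle_module n\<^esub> f = \<zero>\<^bsub>cocycle_module n\<^esub>"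
      by (simp add: \<phi>(2) cochain_of_add cochain_of_zero [symmetric])
    moreover have "cochain_of p G n (\<lambda>xs. - 1 * \<phi> xs) \<in> carrier (cocycle_module n)"
      using cochain_of_cocycle [OF is_cocycle_cmul [OF \<phi>(1), of "- 1"]] by simp
    ultimately show "\<exists>g\<in>carrier (cocycle_module n). g \<oplus>\<^bsub>cocycle_module n\<^esub> f = \<zero>\<^bsub>cocycle_module n\<^esub>"
      by blast
  next
    fix f g assume "f \<in> carrier (cocycle_module n)" "g \<in> carrier (cocycle_module n)"
    then obtain \<phi> \<psi> where \<phi>: "cocycle (Suc n) \<phi>" "f = cochain_of p G n \<phi>" "cocycle (Suc n) \<psi>" "g = cochain_of p G n \<psi>"
      by (auto elim!: group_cocyclesE)
    then show "f \<oplus>\<^bsub>cocycle_module n\<^esub> g \<in> carrier (cocycle_module n)"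
      using cochain_of_cocycle [OF is_cocycle_add] by (simp add: cochain_of_add)
    show "f \<oplus>\<^bsub>cocycle_module n\<^esub> g = g \<oplus>\<^bsub>cocycle_module n\<^esub> f"
      by (simp add: cochains_simps add.commute)
  qed (auto simp: cochains_simps mod_simps add.assoc)
  show ?thesis
  proof (rule module_quotient.intro [OF abelian_group_axioms], rule module_quotient_axioms.intro)
    show "additive_subgroup (group_coboundaries p G n) (cocycle_module n)"
    proof (rule additive_subgroup.intro, rule add.subgroupI)
      show "group_coboundaries p G n \<subseteq> carrier (cocycle_module n)"
        using coboundary_imp_cocycle by auto
      show "group_coboundaries p G n \<noteq> {}"
        using cochain_of_coboundary_iff [OF zero(1)] zero(2) by blast
      fix f assume f: "f \<in> group_coboundaries p G n"
      obtain \<phi> where \<phi>: "cocycle (Suc n) \<phi>" "f = cochain_of p G n \<phi>"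
        using coboundary_imp_cocycle [OF f] by (rule group_cocyclesE)
      have \<phi>': "coboundary (Suc n) \<phi>" using f \<phi> cochain_of_coboundary_iff by simp
      let ?g = "cochain_of p G n (\<lambda>xs. - 1 * \<phi> xs)"
      have "?g \<in> carrier (cocycle_module n)"
        using cochain_of_cocycle [OF is_cocycle_cmul [OF \<phi>(1), of "- 1"]] by simp
      moreover have "?g \<oplus>\<^bsub>cocycle_module n\<^esub> f = \<zero>\<^bsub>cocycle_module n\<^esub>"
        by (simp add: \<phi>(2) cochain_of_add cochain_of_zero [symmetric])
      ultimately have "\<ominus>\<^bsub>cocycle_module n\<^esub> f = ?g"
        using coboundary_imp_cocycle [OF f] by (intro minus_equality) simp_all
      then show "\<ominus>\<^bsub>cocycle_module n\<^esub> f \<in> group_coboundaries p G n"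
        using cochain_of_coboundary_iff [OF is_cocycle_cmul [OF \<phi>(1), of "- 1"]]
          is_coboundary_cmul [OF \<phi>', of "- 1"] by simp
      fix g assume g: "g \<in> group_coboundaries p G n"
      obtain \<psi> where \<psi>: "cocycle (Suc n) \<psi>" "g = cochain_of p G n \<psi>"
        using coboundary_imp_cocycle [OF g] by (rule group_cocyclesE)
      have \<psi>': "coboundary (Suc n) \<psi>" using g \<psi> cochain_of_coboundary_iff by simp
      show "f \<oplus>\<^bsub>cocycle_module n\<^esub> g \<in> group_coboundaries p G n"
        using cochain_of_coboundary_iff [OF is_cocycle_add [OF \<phi>(1) \<psi>(1)]] is_coboundary_add [OF \<phi>' \<psi>']
        by (simp add: \<phi>(2) \<psi>(2) cochain_of_add)
    qed
  next
    fix k f assume "f \<in> carrier (cocycle_module n)"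
    then obtain \<phi> where \<phi>: "cocycle (Suc n) \<phi>" "f = cochain_of p G n \<phi>"
      by (auto elim: group_cocyclesE)
    then show "k \<odot>\<^bsub>cocycle_module n\<^esub> f \<in> carrier (cocycle_module n)"
      using cochain_of_cocycle [OF is_cocycle_cmul] by (simp add: cochain_of_smult)
  next
    fix k f g
    show "k \<odot>\<^bsub>cocycle_module n\<^esub> (f \<oplus>\<^bsub>cocycle_module n\<^esub> g) =
        k \<odot>\<^bsub>cocycle_module n\<^esub> f \<oplus>\<^bsub>cocycle_module n\<^esub> k \<odot>\<^bsub>cocycle_module n\<^esub> g"
      by (auto simp: cochains_simps mod_simps distrib_left)
  next
    fix k f assume f: "f \<in> group_coboundaries p G n"
    obtain \<phi> where \<phi>: "cocycle (Suc n) \<phi>" "f = cochain_of p G n \<phi>"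
      using coboundary_imp_cocycle [OF f] by (rule group_cocyclesE)
    with f show "k \<odot>\<^bsub>cocycle_module n\<^esub> f \<in> group_coboundaries p G n"
      using cochain_of_coboundary_iff [OF is_cocycle_cmul [OF \<phi>(1)]] is_coboundary_cmul f cochain_of_coboundary_iff
      by (simp add: cochain_of_smult)
  qed
qed

definition cocycle_class :: "nat \<Rightarrow> ('a list \<Rightarrow> int) \<Rightarrow> (('a list \<Rightarrow>\<^sub>0 int) \<Rightarrow> int) set" where
  "cocycle_class n \<phi> = group_coboundaries p G n +>\<^bsub>group_cochains p G n\<^esub> cochain_of p G n \<phi>"

lemma coset_cocycle_module: "U +>\<^bsub>cocycle_module n\<^esub> f = U +>\<^bsub>group_cochains p G n\<^esub> f"
  by (simp add: a_r_coset_def')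

lemma cocycle_class_eq_iff:
  assumes "cocycle (Suc n) \<phi>" "cocycle (Suc n) \<psi>"
  shows "cocycle_class n \<phi> = cocycle_class n \<psi> \<longleftrightarrow> coboundary (Suc n) (\<lambda>xs. \<phi> xs - \<psi> xs)"
proof -
  interpret Q: module_quotient "cocycle_module n" "group_coboundaries p G n" "carrier (Fp p)"
    by (rule module_quotient_cohomology)
  have closed: "cochain_of p G n \<phi> \<in> carrier (cocycle_module n)" "cochain_of p G n \<psi> \<in> carrier (cocycle_module n)"
    using assms cochain_of_cocycle by simp_all
  have d: "cocycle (Suc n) (\<lambda>xs. \<phi> xs - \<psi> xs)" using assms by (rule is_cocycle_diff)
  have "cochain_of p G n \<phi> = cochain_of p G n (\<lambda>xs. \<phi> xs - \<psi> xs) \<oplus>\<^bsub>cocycle_module n\<^esub> cochain_of p G n \<psi>"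
    by (simp add: cochain_of_add)
  then have "cochain_of p G n (\<lambda>xs. \<phi> xs - \<psi> xs) = cochain_of p G n \<phi> \<ominus>\<^bsub>cocycle_module n\<^esub> cochain_of p G n \<psi>"
    using closed cochain_of_cocycle [OF d] Q.add.inv_solve_right unfolding a_minus_def by simp
  then show ?thesis
    using Q.coset_eq_iff [OF closed] cochain_of_coboundary_iff [OF d]
    by (simp add: cocycle_class_def coset_cocycle_module)
qed

lemma group_cohomologyE:
  assumes "U \<in> carrier (group_cohomology p G n)"
  obtains \<phi> where "cocycle (Suc n) \<phi>" "U = cocycle_class n \<phi>"
proof -
  interpret Q: module_quotient "cocycle_module n" "group_coboundaries p G n" "carrier (Fp p)"
    by (rule module_quotient_cohomology)
  obtain f where "f \<in> carrier (cocycle_module n)" "U = group_coboundaries p G n +>\<^bsub>cocycle_module n\<^esub> f"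
    using assms unfolding group_cohomology_eq Q.carrier_quotient by blast
  moreover then obtain \<phi> where "cocycle (Suc n) \<phi>" "f = cochain_of p G n \<phi>"
    by (auto elim: group_cocyclesE)
  ultimately show thesis
    using that by (simp add: cocycle_class_def coset_cocycle_module)
qed

lemma cocycle_class_closed: "cocycle (Suc n) \<phi> \<Longrightarrow> cocycle_class n \<phi> \<in> carrier (group_cohomology p G n)"
  using module_quotient.coset_in_quotient [OF module_quotient_cohomology, of "cochain_of p G n \<phi>" n]
  by (simp add: group_cohomology_eq cocycle_class_def coset_cocycle_module cochain_of_cocycle)

lemma cohomology_unit_eq: "cohomology_unit p G = cocycle_class 0 (\<lambda>_. 1)"
proof -
  have "(\<lambda>c\<in>carrier (std_left G 0). [augmentation c] \<cdot>\<^bsub>Fp p\<^esub> \<one>\<^bsub>Fp p\<^esub>) = cochain_of p G 0 (\<lambda>_. 1)"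
    using p residue_ring_int_add_pow [of "int p" 1]
    by (simp add: cochain_of_def augmentation_eq_pairing)
  then show ?thesis by (simp add: cohomology_unit_def cocycle_class_def)
qed

lemma cup_cochain_eq:
  assumes f: "f \<in> group_cocycles p G m" and g: "g \<in> group_cocycles p G n"
  shows "cup_cochain p G m n f g = cochain_of p G (m + n) (cup m (on_basis f) (on_basis g))"
proof (rule extensionalityI [of _ "carrier (std_left G (m + n))"])
  fix c assume c: "c \<in> carrier (std_left G (m + n))"
  have range: "on_basis f (take (Suc m) xs) \<in> {0..int p - 1}" "on_basis g (drop m xs) \<in> {0..int p - 1}"
    if "xs \<in> Poly_Mapping.keys c" for xs
  proof -
    have xs: "xs \<in> lists (carrier G)" "length xs = Suc (m + n)"
      using that c simplices_iff unfolding carrier_std_left by blast+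
    then have "frag_of (take (Suc m) xs) \<in> carrier (std_left G m)" "frag_of (drop m xs) \<in> carrier (std_left G n)"
      by (simp_all add: frag_of_std_left simplices_iff take_in_lists drop_in_lists del: in_lists_conv_set)
    then show "on_basis f (take (Suc m) xs) \<in> {0..int p - 1}" "on_basis g (drop m xs) \<in> {0..int p - 1}"
      using f g unfolding cocycles_iff cochains_iff by simp_all
  qed
  have "cup_cochain p G m n f g c =
      (\<Oplus>\<^bsub>Fp p\<^esub>xs\<in>Poly_Mapping.keys c. (Poly_Mapping.lookup c xs * cup m (on_basis f) (on_basis g) xs) mod int p)"
    using c p residue_ring_int_add_pow [of "int p"]
    by (simp add: cup_cochain_def cup_def mod_simps)
  also have "\<dots> = (\<Sum>xs\<in>Poly_Mapping.keys c. (Poly_Mapping.lookup c xs * cup m (on_basis f) (on_basis g) xs) mod int p) mod int p"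
    using p by (intro residue_ring_finsum) simp_all
  also have "\<dots> = cochain_of p G (m + n) (cup m (on_basis f) (on_basis g)) c"
    using c by (simp add: cochain_of_def pairing_def mod_sum_eq)
  finally show "cup_cochain p G m n f g c = cochain_of p G (m + n) (cup m (on_basis f) (on_basis g)) c" .
qed (simp_all add: cup_cochain_def cochain_of_def)

end


section \<open>Cup products of cohomology classes\<close>

context group_mod
begin

text \<open>\<open>cup_product\<close> ranges over all members of two cosets, so an arbitrary member
  has to be recognised as a cocycle cohomologous to the given one.\<close>

lemma cocycle_class_memberD:
  assumes "cocycle (Suc n) \<phi>" "f \<in> cocycle_class n \<phi>"
  shows "f \<in> group_cocycles p G n" "coboundary (Suc n) (\<lambda>xs. on_basis f xs - \<phi> xs)"
proof -
  interpret Q: module_quotient "cocycle_module n" "group_coboundaries p G n" "carrier (Fp p)"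
    by (rule module_quotient_cohomology)
  have \<phi>: "cochain_of p G n \<phi> \<in> carrier (cocycle_module n)" using assms(1) cochain_of_cocycle by simp
  have f: "f \<in> group_coboundaries p G n +>\<^bsub>cocycle_module n\<^esub> cochain_of p G n \<phi>"
    using assms(2) by (simp add: cocycle_class_def coset_cocycle_module)
  have "group_coboundaries p G n +>\<^bsub>cocycle_module n\<^esub> cochain_of p G n \<phi> \<subseteq> carrier (cocycle_module n)"
    using Q.a_rcosets_carrier Q.a_rcosetsI [OF Q.a_subset \<phi>] by blast
  with f show fZ: "f \<in> group_cocycles p G n" by auto
  then have f': "cocycle (Suc n) (on_basis f)" "cochain_of p G n (on_basis f) = f"
    using cochain_of_on_basis by (auto simp: cocycles_iff)
  have "group_coboundaries p G n +>\<^bsub>cocycle_module n\<^esub> cochain_of p G n \<phi> =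
      group_coboundaries p G n +>\<^bsub>cocycle_module n\<^esub> f"
    using f \<phi> by (rule Q.a_repr_independence')
  then have "cocycle_class n (on_basis f) = cocycle_class n \<phi>"
    by (simp add: cocycle_class_def coset_cocycle_module f'(2))
  then show "coboundary (Suc n) (\<lambda>xs. on_basis f xs - \<phi> xs)"
    using cocycle_class_eq_iff [OF f'(1) assms(1)] by simp
qed

lemma cochain_of_in_cocycle_class:
  assumes "cocycle (Suc n) \<phi>" shows "cochain_of p G n \<phi> \<in> cocycle_class n \<phi>"
proof -
  interpret Q: module_quotient "cocycle_module n" "group_coboundaries p G n" "carrier (Fp p)"
    by (rule module_quotient_cohomology)
  show ?thesis
    using Q.a_rcos_self [of "cochain_of p G n \<phi>"] assms cochain_of_cocycle
    by (simp add: cocycle_class_def coset_cocycle_module)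
qed

text \<open>All pairs of representatives give the same coset: the difference of two products splits
  as \<open>(f - \<phi>) g + \<phi> (g - \<psi>)\<close>, where each summand has a coboundary as a
  factor. Since the cosets are nonempty, the union is that coset.\<close>

lemma cup_product_class:
  assumes \<phi>: "cocycle (Suc i) \<phi>" and \<psi>: "cocycle (Suc j) \<psi>"
  shows "cup_product p G i j (cocycle_class i \<phi>) (cocycle_class j \<psi>) = cocycle_class (i + j) (cup i \<phi> \<psi>)"
proof -
  have "group_coboundaries p G (i + j) +>\<^bsub>group_cochains p G (i + j)\<^esub> cup_cochain p G i j f g =
      cocycle_class (i + j) (cup i \<phi> \<psi>)"
    if f: "f \<in> cocycle_class i \<phi>" and g: "g \<in> cocycle_class j \<psi>" for f g
  proof -
    note f = cocycle_class_memberD [OF \<phi> f] and g = cocycle_class_memberD [OF \<psi> g]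
    have Z: "cocycle (Suc i) (on_basis f)" "cocycle (Suc j) (on_basis g)"
      using f(1) g(1) by (simp_all add: cocycles_iff)
    have "coboundary (Suc (i + j)) (\<lambda>xs. cup i (\<lambda>xs. on_basis f xs - \<phi> xs) (on_basis g) xs +
        cup i \<phi> (\<lambda>xs. on_basis g xs - \<psi> xs) xs)"
      by (intro is_coboundary_add is_coboundary_cup_left [OF f(2) Z(2)] is_coboundary_cup_right [OF \<phi> g(2)])
    then have "coboundary (Suc (i + j)) (\<lambda>xs. cup i (on_basis f) (on_basis g) xs - cup i \<phi> \<psi> xs)"
      by (rule is_coboundary_cong) (simp add: cup_def algebra_simps)
    then have "cocycle_class (i + j) (cup i (on_basis f) (on_basis g)) = cocycle_class (i + j) (cup i \<phi> \<psi>)"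
      by (simp only: cocycle_class_eq_iff [OF is_cocycle_cup [OF Z] is_cocycle_cup [OF \<phi> \<psi>]])
    then show ?thesis
      by (simp add: cocycle_class_def cup_cochain_eq [OF f(1) g(1)])
  qed
  then have "cup_product p G i j (cocycle_class i \<phi>) (cocycle_class j \<psi>) =
      (\<Union>f\<in>cocycle_class i \<phi>. \<Union>g\<in>cocycle_class j \<psi>. cocycle_class (i + j) (cup i \<phi> \<psi>))"
    unfolding cup_product_def by (intro SUP_cong refl) blast
  then show ?thesis
    using cochain_of_in_cocycle_class [OF \<phi>] cochain_of_in_cocycle_class [OF \<psi>] by auto
qed

lemma cup_product_closed:
  assumes "U \<in> carrier (group_cohomology p G i)" "V \<in> carrier (group_cohomology p G j)"
  shows "cup_product p G i j U V \<in> carrier (group_cohomology p G (i + j))"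
proof -
  obtain \<phi> where \<phi>: "cocycle (Suc i) \<phi>" "U = cocycle_class i \<phi>" using assms(1) by (rule group_cohomologyE)
  obtain \<psi> where \<psi>: "cocycle (Suc j) \<psi>" "V = cocycle_class j \<psi>" using assms(2) by (rule group_cohomologyE)
  show ?thesis
    using cocycle_class_closed [OF is_cocycle_cup [OF \<phi>(1) \<psi>(1)]] cup_product_class [OF \<phi>(1) \<psi>(1)] \<phi>(2) \<psi>(2)
    by simp
qed

lemma abelian_group_cohomology: "abelian_group (group_cohomology p G n)"
  unfolding group_cohomology_eq by (rule module_quotient.abelian_group_quotient [OF module_quotient_cohomology])

lemma cocycle_one: "cocycle (Suc 0) (\<lambda>_. 1)"
proof -
  have "pairing (\<lambda>_. 1) (list_boundary xs) = 0" if "length xs = Suc (Suc 0)" for xs :: "'a list"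
    using that by (cases xs; cases "tl xs") (auto simp: list_boundary_Cons pairing_diff)
  then show ?thesis by (simp add: is_cocycle_def invariant_cochain_def)
qed

end

lemma additive_map_zero:
  assumes "abelian_group A" "abelian_group B" "f \<in> carrier A \<rightarrow> carrier B"
    and "\<And>x y. \<lbrakk>x \<in> carrier A; y \<in> carrier A\<rbrakk> \<Longrightarrow> f (x \<oplus>\<^bsub>A\<^esub> y) = f x \<oplus>\<^bsub>B\<^esub> f y"
  shows "f \<zero>\<^bsub>A\<^esub> = \<zero>\<^bsub>B\<^esub>"
proof -
  interpret A: abelian_group A by (rule assms)
  interpret B: abelian_group B by (rule assms)
  have "f \<zero>\<^bsub>A\<^esub> \<oplus>\<^bsub>B\<^esub> f \<zero>\<^bsub>A\<^esub> = f \<zero>\<^bsub>A\<^esub>" using assms(4) [of "\<zero>\<^bsub>A\<^esub>" "\<zero>\<^bsub>A\<^esub>"] by simp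
  moreover have "f \<zero>\<^bsub>A\<^esub> \<in> carrier B" using assms(3) by auto
  ultimately show ?thesis using B.add.l_cancel_one' [of "f \<zero>\<^bsub>A\<^esub>" "f \<zero>\<^bsub>A\<^esub>"] by simp
qed

lemma additive_map_finsum:
  assumes "abelian_group A" "abelian_group B" "f \<in> carrier A \<rightarrow> carrier B"
    and "\<And>x y. \<lbrakk>x \<in> carrier A; y \<in> carrier A\<rbrakk> \<Longrightarrow> f (x \<oplus>\<^bsub>A\<^esub> y) = f x \<oplus>\<^bsub>B\<^esub> f y"
    and "finite I" "h \<in> I \<rightarrow> carrier A"
  shows "f (finsum A h I) = finsum B (\<lambda>i. f (h i)) I"
proof -
  interpret A: abelian_group A by (rule assms)
  interpret B: abelian_group B by (rule assms)
  show ?thesis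
    using assms(5,6)
  proof (induction I)
    case empty
    show ?case using additive_map_zero [OF assms(1-4)] by simp
  next
    case (insert i I)
    have "h \<in> I \<rightarrow> carrier A" "h i \<in> carrier A" using insert.prems by auto
    moreover then have "(\<lambda>i. f (h i)) \<in> I \<rightarrow> carrier B" "f (h i) \<in> carrier B" using assms(3) by auto
    moreover have "finsum A h I \<in> carrier A" using \<open>h \<in> I \<rightarrow> carrier A\<close> by (rule A.finsum_closed)
    ultimately show ?case using insert assms(4) by simp
  qed
qed

context fusion_equivalence
begin

lemma corresponding_cong:
  assumes "corresponding l f h"
    and "\<And>xs. \<lbrakk>xs \<in> lists (carrier G); length xs = l\<rbrakk> \<Longrightarrow> [f' xs = f xs] (mod m)"
    and "\<And>xs. \<lbrakk>xs \<in> lists (carrier H); length xs = l\<rbrakk> \<Longrightarrow> [h' xs = h xs] (mod m)"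
  shows "corresponding l f' h'"
  using assms(1) unfolding corresponding_def
proof (rule is_coboundary_cong)
  fix xs assume xs: "xs \<in> lists S" "length xs = l"
  have "xs \<in> lists (carrier G)" using xs subgroup.subset [OF S] by auto
  moreover have "\<alpha> \<in> S \<rightarrow> carrier H" using \<alpha> subgroup.subset [OF R] by auto
  then have "map \<alpha> xs \<in> lists (carrier H)" using xs(1) by (rule map_in_lists)
  ultimately show "[f' xs - h' (map \<alpha> xs) = f xs - h (map \<alpha> xs)] (mod m)"
    using xs(2) by (intro cong_diff assms(2,3)) auto
qed

end

section \<open>Isomorphisms of cohomology groups and cohomology algebras\<close>

locale fusion_equivalence_mod = fusion_equivalence G H S R \<alpha> \<beta> "int p"
  for G :: "('a, 'x) monoid_scheme" (structure) and H :: "('b, 'y) monoid_scheme" (structure)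
    and S R \<alpha> \<beta> and p :: nat +
  assumes p: "1 < p"
begin

sublocale G: group_mod G p using p by unfold_locales
sublocale H: group_mod H p using p by unfold_locales

text \<open>The last conjunct pins the isomorphism down on every pair of corresponding cocycles.
  Multiplicativity follows from it, because corresponding cocycles have corresponding products, and
  so does preservation of the unit.\<close>

lemma ex_cohomology_iso:
  "\<exists>\<Phi>. \<Phi> \<in> lmod_hom (Fp p) (group_cohomology p G n) (group_cohomology p H n) \<and>
     bij_betw \<Phi> (carrier (group_cohomology p G n)) (carrier (group_cohomology p H n)) \<and>
     (\<forall>\<phi> \<psi>. G.cocycle (Suc n) \<phi> \<and> H.cocycle (Suc n) \<psi> \<and> corresponding (Suc n) \<phi> \<psi> \<longrightarrow>
        \<Phi> (G.cocycle_class n \<phi>) = H.cocycle_class n \<psi>)"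
proof -
  let ?T = "\<lambda>f h. corresponding (Suc n) (on_basis f) (on_basis h)"
  \<comment> \<open>\<open>on_basis\<close> undoes \<open>cochain_of\<close> only modulo
    \<open>p\<close> and in length \<open>Suc n\<close>, which is all that
    \<open>corresponding\<close> sees.\<close>
  have basis: "corresponding (Suc n) (on_basis (cochain_of p G n \<phi>)) (on_basis (cochain_of p H n \<psi>)) \<longleftrightarrow>
      corresponding (Suc n) \<phi> \<psi>" for \<phi> \<psi>
  proof
    assume "corresponding (Suc n) \<phi> \<psi>"
    then show "corresponding (Suc n) (on_basis (cochain_of p G n \<phi>)) (on_basis (cochain_of p H n \<psi>))"
      by (rule corresponding_cong)
         (simp_all only: G.on_basis_cochain_of H.on_basis_cochain_of G.simplices_iff H.simplices_iff)
  next
    assume "corresponding (Suc n) (on_basis (cochain_of p G n \<phi>)) (on_basis (cochain_of p H n \<psi>))"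
    then show "corresponding (Suc n) \<phi> \<psi>"
      by (rule corresponding_cong)
         (rule cong_sym, simp only: G.on_basis_cochain_of H.on_basis_cochain_of G.simplices_iff H.simplices_iff)+
  qed
  have T1: "\<exists>h\<in>carrier (H.cocycle_module n). ?T f h" if "f \<in> carrier (G.cocycle_module n)" for f
  proof -
    have f: "f \<in> group_cocycles p G n" using that by simp
    obtain \<phi> where \<phi>: "G.cocycle (Suc n) \<phi>" "f = cochain_of p G n \<phi>" using f by (rule G.group_cocyclesE)
    obtain \<psi> where "H.cocycle (Suc n) \<psi>" "corresponding (Suc n) \<phi> \<psi>" using ex_corresponding_right [OF \<phi>(1)] by blast
    then show ?thesis
      using H.cochain_of_cocycle \<phi>(2) basis by (intro bexI [of _ "cochain_of p H n \<psi>"]) simp_all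
  qed
  have T2: "\<exists>f\<in>carrier (G.cocycle_module n). ?T f h" if "h \<in> carrier (H.cocycle_module n)" for h
  proof -
    have h: "h \<in> group_cocycles p H n" using that by simp
    obtain \<psi> where \<psi>: "H.cocycle (Suc n) \<psi>" "h = cochain_of p H n \<psi>" using h by (rule H.group_cocyclesE)
    obtain \<phi> where "G.cocycle (Suc n) \<phi>" "corresponding (Suc n) \<phi> \<psi>" using ex_corresponding_left [OF \<psi>(1)] by blast
    then show ?thesis
      using G.cochain_of_cocycle \<psi>(2) basis by (intro bexI [of _ "cochain_of p G n \<phi>"]) simp_all
  qed
  have add: "?T (f \<oplus>\<^bsub>G.cocycle_module n\<^esub> f') (h \<oplus>\<^bsub>H.cocycle_module n\<^esub> h')"
    if "f \<in> carrier (G.cocycle_module n)" "f' \<in> carrier (G.cocycle_module n)"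
      "h \<in> carrier (H.cocycle_module n)" "h' \<in> carrier (H.cocycle_module n)" "?T f h" "?T f' h'" for f f' h h'
  proof -
    have f: "f \<in> group_cocycles p G n" "f' \<in> group_cocycles p G n" "h \<in> group_cocycles p H n" "h' \<in> group_cocycles p H n"
      using that by simp_all
    obtain \<phi> where \<phi>: "f = cochain_of p G n \<phi>" using f(1) by (rule G.group_cocyclesE)
    obtain \<phi>' where \<phi>': "f' = cochain_of p G n \<phi>'" using f(2) by (rule G.group_cocyclesE)
    obtain \<psi> where \<psi>: "h = cochain_of p H n \<psi>" using f(3) by (rule H.group_cocyclesE)
    obtain \<psi>' where \<psi>': "h' = cochain_of p H n \<psi>'" using f(4) by (rule H.group_cocyclesE)
    show ?thesis
      using that(5,6) corresponding_add unfolding \<phi> \<phi>' \<psi> \<psi>'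
      by (simp add: G.cochain_of_add H.cochain_of_add basis)
  qed
  have smult: "?T (k \<odot>\<^bsub>G.cocycle_module n\<^esub> f) (k \<odot>\<^bsub>H.cocycle_module n\<^esub> h)"
    if "f \<in> carrier (G.cocycle_module n)" "h \<in> carrier (H.cocycle_module n)" "?T f h" for k f h
  proof -
    have f: "f \<in> group_cocycles p G n" "h \<in> group_cocycles p H n" using that by simp_all
    obtain \<phi> where \<phi>: "f = cochain_of p G n \<phi>" using f(1) by (rule G.group_cocyclesE)
    obtain \<psi> where \<psi>: "h = cochain_of p H n \<psi>" using f(2) by (rule H.group_cocyclesE)
    show ?thesis
      using that(3) corresponding_cmul unfolding \<phi> \<psi>
      by (simp add: G.cochain_of_smult H.cochain_of_smult basis)
  qed
  have zero: "f \<in> group_coboundaries p G n \<longleftrightarrow> h \<in> group_coboundaries p H n"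
    if "f \<in> carrier (G.cocycle_module n)" "h \<in> carrier (H.cocycle_module n)" "?T f h" for f h
    using that corresponding_coboundary [of "Suc n" "on_basis f" "on_basis h"]
    by (simp add: G.cocycles_iff H.cocycles_iff G.coboundaries_iff H.coboundaries_iff)
  obtain \<Phi> where \<Phi>: "\<Phi> \<in> lmod_hom (Fp p) (group_cohomology p G n) (group_cohomology p H n)"
    "bij_betw \<Phi> (carrier (group_cohomology p G n)) (carrier (group_cohomology p H n))"
    "\<forall>f\<in>carrier (G.cocycle_module n). \<forall>h\<in>carrier (H.cocycle_module n). ?T f h \<longrightarrow>
      \<Phi> (group_coboundaries p G n +>\<^bsub>G.cocycle_module n\<^esub> f) = group_coboundaries p H n +>\<^bsub>H.cocycle_module n\<^esub> h"
    unfolding G.group_cohomology_eq H.group_cohomology_eq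
    by (rule quotient_correspondence [OF G.module_quotient_cohomology [of n] H.module_quotient_cohomology [of n],
          where T = ?T])
       (rule T1, assumption, rule T2, assumption, rule add, assumption+, rule smult, assumption+,
        rule zero, assumption+)
  have "\<Phi> (G.cocycle_class n \<phi>) = H.cocycle_class n \<psi>"
    if "G.cocycle (Suc n) \<phi>" "H.cocycle (Suc n) \<psi>" "corresponding (Suc n) \<phi> \<psi>" for \<phi> \<psi>
    using \<Phi>(3) [rule_format, of "cochain_of p G n \<phi>" "cochain_of p H n \<psi>"] that G.cochain_of_cocycle H.cochain_of_cocycle basis
    by (simp add: G.cocycle_class_def H.cocycle_class_def G.coset_cocycle_module H.coset_cocycle_module)
  with \<Phi>(1,2) show ?thesis by blast
qed

theorem isomorphic_cohomology:
  "isomorphic_modules (Fp p) (group_cohomology p G n) (group_cohomology p H n)"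
  using ex_cohomology_iso unfolding isomorphic_modules_def by blast

theorem isomorphic_cohomology_algebras:
  "isomorphic_graded_algebras (Fp p) (cohomology_algebra p G) (cohomology_algebra p H)"
proof -
  obtain \<Phi> where \<Phi>: "\<And>n. \<Phi> n \<in> lmod_hom (Fp p) (group_cohomology p G n) (group_cohomology p H n)"
    "\<And>n. bij_betw (\<Phi> n) (carrier (group_cohomology p G n)) (carrier (group_cohomology p H n))"
    "\<And>n \<phi> \<psi>. \<lbrakk>G.cocycle (Suc n) \<phi>; H.cocycle (Suc n) \<psi>; corresponding (Suc n) \<phi> \<psi>\<rbrakk> \<Longrightarrow>
        \<Phi> n (G.cocycle_class n \<phi>) = H.cocycle_class n \<psi>"
    using ex_cohomology_iso by metis
  let ?A = "cohomology_algebra p G" and ?B = "cohomology_algebra p H"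
  have closed: "\<Phi> n \<in> carrier (group_cohomology p G n) \<rightarrow> carrier (group_cohomology p H n)" for n
    using \<Phi>(1) [of n] unfolding lmod_hom_def by blast
  have add: "\<Phi> n (U \<oplus>\<^bsub>group_cohomology p G n\<^esub> V) = \<Phi> n U \<oplus>\<^bsub>group_cohomology p H n\<^esub> \<Phi> n V"
    if "U \<in> carrier (group_cohomology p G n)" "V \<in> carrier (group_cohomology p G n)" for n U V
    using \<Phi>(1) [of n] that unfolding lmod_hom_def by blast
  have smult: "\<Phi> n (k \<odot>\<^bsub>group_cohomology p G n\<^esub> U) = k \<odot>\<^bsub>group_cohomology p H n\<^esub> \<Phi> n U"
    if "k \<in> carrier (Fp p)" "U \<in> carrier (group_cohomology p G n)" for n k U
    using \<Phi>(1) [of n] that unfolding lmod_hom_def by blast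
  have zero: "\<Phi> n \<zero>\<^bsub>group_cohomology p G n\<^esub> = \<zero>\<^bsub>group_cohomology p H n\<^esub>" for n
    by (rule additive_map_zero [OF G.abelian_group_cohomology H.abelian_group_cohomology closed add])
  have zero_closed: "\<zero>\<^bsub>group_cohomology p G n\<^esub> \<in> carrier (group_cohomology p G n)"
      "\<zero>\<^bsub>group_cohomology p H n\<^esub> \<in> carrier (group_cohomology p H n)" for n
    using abelian_group.axioms(1) [OF G.abelian_group_cohomology] abelian_group.axioms(1) [OF H.abelian_group_cohomology]
    by (simp_all add: abelian_monoid.zero_closed)
  \<comment> \<open>A family and its image vanish in the same degrees. This keeps supports finite
    and gives the zero pattern used for homogeneous elements.\<close>
  have zero_iff: "\<Phi> n U = \<zero>\<^bsub>group_cohomology p H n\<^esub> \<longleftrightarrow> U = \<zero>\<^bsub>group_cohomology p G n\<^esub>"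
    if "U \<in> carrier (group_cohomology p G n)" for n U
    using zero \<Phi>(2) [of n] that zero_closed by (metis bij_betw_def inj_onD)
  have cup: "\<Phi> (i + j) (cup_product p G i j U V) = cup_product p H i j (\<Phi> i U) (\<Phi> j V)"
    if U: "U \<in> carrier (group_cohomology p G i)" and V: "V \<in> carrier (group_cohomology p G j)" for i j U V
  proof -
    obtain \<phi> where \<phi>: "G.cocycle (Suc i) \<phi>" "U = G.cocycle_class i \<phi>" using U by (rule G.group_cohomologyE)
    obtain \<psi> where \<psi>: "G.cocycle (Suc j) \<psi>" "V = G.cocycle_class j \<psi>" using V by (rule G.group_cohomologyE)
    obtain \<phi>' where \<phi>': "H.cocycle (Suc i) \<phi>'" "corresponding (Suc i) \<phi> \<phi>'" using ex_corresponding_right [OF \<phi>(1)] by blast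
    obtain \<psi>' where \<psi>': "H.cocycle (Suc j) \<psi>'" "corresponding (Suc j) \<psi> \<psi>'" using ex_corresponding_right [OF \<psi>(1)] by blast
    have "\<Phi> (i + j) (G.cocycle_class (i + j) (cup i \<phi> \<psi>)) = H.cocycle_class (i + j) (cup i \<phi>' \<psi>')"
      using \<phi> \<psi> \<phi>' \<psi>' by (intro \<Phi>(3) is_cocycle_cup corresponding_cup)
    then show ?thesis
      using \<Phi>(3) \<phi> \<psi> \<phi>' \<psi>' by (simp add: G.cup_product_class H.cup_product_class)
  qed
  \<comment> \<open>Both units are classes of the constant cochain 1, and the difference of the
    constants on \<open>S\<close> is zero.\<close>
  have one: "\<Phi> 0 (cohomology_unit p G) = cohomology_unit p H"
    unfolding G.cohomology_unit_eq H.cohomology_unit_eq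
    by (rule \<Phi>(3) [OF G.cocycle_one H.cocycle_one])
       (simp add: corresponding_def is_coboundary_zero)
  define \<Psi> where "\<Psi> x = (\<lambda>n. \<Phi> n (x n))" for x
  have A: "x \<in> carrier ?A \<longleftrightarrow> (\<forall>n. x n \<in> carrier (group_cohomology p G n)) \<and>
      finite {n. x n \<noteq> \<zero>\<^bsub>group_cohomology p G n\<^esub>}" for x
    by (simp add: cohomology_algebra_def)
  have B: "x \<in> carrier ?B \<longleftrightarrow> (\<forall>n. x n \<in> carrier (group_cohomology p H n)) \<and>
      finite {n. x n \<noteq> \<zero>\<^bsub>group_cohomology p H n\<^esub>}" for x
    by (simp add: cohomology_algebra_def)
  have \<Psi>_closed: "\<Psi> x \<in> carrier ?B" if "x \<in> carrier ?A" for x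
    using that closed zero_iff unfolding A B \<Psi>_def by (auto simp: Pi_iff)
  have inj: "inj_on \<Psi> (carrier ?A)"
  proof (rule inj_onI)
    fix x y assume x: "x \<in> carrier ?A" and y: "y \<in> carrier ?A" and eq: "\<Psi> x = \<Psi> y"
    show "x = y"
    proof
      fix n
      have "\<Phi> n (x n) = \<Phi> n (y n)" using fun_cong [OF eq, of n] by (simp add: \<Psi>_def)
      then show "x n = y n"
        using \<Phi>(2) [of n] x y unfolding A bij_betw_def by (meson inj_onD)
    qed
  qed
  have surj: "\<exists>x\<in>carrier ?A. \<Psi> x = y \<and> (\<forall>n. y n = \<zero>\<^bsub>group_cohomology p H n\<^esub> \<longrightarrow> x n = \<zero>\<^bsub>group_cohomology p G n\<^esub>)"
    if y: "y \<in> carrier ?B" for y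
  proof -
    define x where "x n = inv_into (carrier (group_cohomology p G n)) (\<Phi> n) (y n)" for n
    have "y n \<in> \<Phi> n ` carrier (group_cohomology p G n)" for n
      using \<Phi>(2) [of n] y unfolding B bij_betw_def by simp
    then have x: "\<And>n. x n \<in> carrier (group_cohomology p G n)" "\<And>n. \<Phi> n (x n) = y n"
      unfolding x_def by (rule inv_into_into, rule f_inv_into_f)
    have z: "x n = \<zero>\<^bsub>group_cohomology p G n\<^esub> \<longleftrightarrow> y n = \<zero>\<^bsub>group_cohomology p H n\<^esub>" for n
      using zero_iff [OF x(1), of n] x(2) by simp
    then have "x \<in> carrier ?A" using x y unfolding A B by simp
    moreover have "\<Psi> x = y" using x(2) by (simp add: \<Psi>_def)
    ultimately show ?thesis using z by blast
  qed
  have "\<Psi> \<in> ring_iso ?A ?B"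
  proof (rule ring_iso_memI)
    show "bij_betw \<Psi> (carrier ?A) (carrier ?B)"
      unfolding bij_betw_def using inj \<Psi>_closed surj by blast
    fix x y assume x: "x \<in> carrier ?A" and y: "y \<in> carrier ?A"
    then have xy: "\<And>n. x n \<in> carrier (group_cohomology p G n)" "\<And>n. y n \<in> carrier (group_cohomology p G n)"
      unfolding A by auto
    show "\<Psi> (x \<oplus>\<^bsub>?A\<^esub> y) = \<Psi> x \<oplus>\<^bsub>?B\<^esub> \<Psi> y"
      using xy by (simp add: \<Psi>_def cohomology_algebra_def add)
    show "\<Psi> (x \<otimes>\<^bsub>?A\<^esub> y) = \<Psi> x \<otimes>\<^bsub>?B\<^esub> \<Psi> y"
    proof
      fix n
      have c: "cup_product p G i (n - i) (x i) (y (n - i)) \<in> carrier (group_cohomology p G n)"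
          "\<Phi> n (cup_product p G i (n - i) (x i) (y (n - i))) =
           cup_product p H i (n - i) (\<Phi> i (x i)) (\<Phi> (n - i) (y (n - i)))" if "i \<le> n" for i
        using G.cup_product_closed [OF xy(1) xy(2), of i "n - i"] cup [OF xy(1) xy(2), of i "n - i"] that by simp_all
      have "\<Phi> n (\<Oplus>\<^bsub>group_cohomology p G n\<^esub>i\<in>{..n}. cup_product p G i (n - i) (x i) (y (n - i))) =
          (\<Oplus>\<^bsub>group_cohomology p H n\<^esub>i\<in>{..n}. \<Phi> n (cup_product p G i (n - i) (x i) (y (n - i))))"
        using c(1)
        by (intro additive_map_finsum [OF G.abelian_group_cohomology H.abelian_group_cohomology closed add]) auto
      also have "\<dots> = (\<Oplus>\<^bsub>group_cohomology p H n\<^esub>i\<in>{..n}. cup_product p H i (n - i) (\<Phi> i (x i)) (\<Phi> (n - i) (y (n - i))))"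
      proof (rule abelian_monoid.finsum_cong' [OF abelian_group.axioms(1) [OF H.abelian_group_cohomology] refl])
        show "(\<lambda>i. cup_product p H i (n - i) (\<Phi> i (x i)) (\<Phi> (n - i) (y (n - i)))) \<in> {..n} \<rightarrow> carrier (group_cohomology p H n)"
          using funcset_mem [OF closed c(1)] c(2) by simp
      qed (use c(2) in simp)
      finally show "\<Psi> (x \<otimes>\<^bsub>?A\<^esub> y) n = (\<Psi> x \<otimes>\<^bsub>?B\<^esub> \<Psi> y) n"
        by (simp add: \<Psi>_def cohomology_algebra_def)
    qed
  next
    show "\<Psi> \<one>\<^bsub>?A\<^esub> = \<one>\<^bsub>?B\<^esub>"
      by (rule ext) (simp add: \<Psi>_def cohomology_algebra_def one zero)
  qed (rule \<Psi>_closed)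
  moreover have "\<Psi> (k \<odot>\<^bsub>?A\<^esub> x) = k \<odot>\<^bsub>?B\<^esub> \<Psi> x" if "k \<in> carrier (Fp p)" "x \<in> carrier ?A" for k x
    using that smult unfolding A by (simp add: \<Psi>_def cohomology_algebra_def)
  moreover have "\<Psi> ` homogeneous ?A n = homogeneous ?B n" for n
  proof -
    have zA: "\<zero>\<^bsub>?A\<^esub> k = \<zero>\<^bsub>group_cohomology p G k\<^esub>" "\<zero>\<^bsub>?B\<^esub> k = \<zero>\<^bsub>group_cohomology p H k\<^esub>" for k
      by (simp_all add: cohomology_algebra_def)
    show ?thesis
    proof (intro equalityI subsetI)
      fix y assume "y \<in> \<Psi> ` homogeneous ?A n"
      then show "y \<in> homogeneous ?B n"
        using \<Psi>_closed zero by (auto simp: homogeneous_def zA \<Psi>_def)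
    next
      fix y assume "y \<in> homogeneous ?B n"
      then have y: "y \<in> carrier ?B" "\<And>k. k \<noteq> n \<Longrightarrow> y k = \<zero>\<^bsub>group_cohomology p H k\<^esub>"
        by (auto simp: homogeneous_def zA)
      obtain x where x: "x \<in> carrier ?A" "\<Psi> x = y"
        "\<forall>k. y k = \<zero>\<^bsub>group_cohomology p H k\<^esub> \<longrightarrow> x k = \<zero>\<^bsub>group_cohomology p G k\<^esub>"
        using surj [OF y(1)] by blast
      then have "x \<in> homogeneous ?A n"
        using y(2) by (simp add: homogeneous_def zA)
      then show "y \<in> \<Psi> ` homogeneous ?A n" using x(2) by blast
    qed
  qed
  ultimately show ?thesis
    unfolding isomorphic_graded_algebras_def by blast
qed

end


subsection \<open>Finite vector spaces over the prime field\<close>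

definition is_submodule :: "('r, 'x) ring_scheme \<Rightarrow> ('r, 'm) module \<Rightarrow> 'm set \<Rightarrow> bool" where
  "is_submodule R M U \<longleftrightarrow> U \<subseteq> carrier M \<and> \<zero>\<^bsub>M\<^esub> \<in> U \<and> (\<forall>x\<in>U. \<forall>y\<in>U. x \<oplus>\<^bsub>M\<^esub> y \<in> U) \<and>
     (\<forall>k\<in>carrier R. \<forall>x\<in>U. k \<odot>\<^bsub>M\<^esub> x \<in> U)"

locale fp_module = lmodule "Fp p" M for p :: nat and M :: "(int, 'm) module" (structure) +
  assumes prime: "prime p"
begin

lemma p_gt_1: "1 < p" using prime by (rule prime_gt_1_nat)

text \<open>The scalars in \<open>Fp p\<close> are integers between 0 and \<open>p - 1\<close>.
  Writing them as residues lets all integers act, so that calculations with scalars can be done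
  before reduction.\<close>

lemma smult_mod_add:
  assumes "x \<in> carrier M"
  shows "((a + b) mod int p) \<odot>\<^bsub>M\<^esub> x = (a mod int p) \<odot>\<^bsub>M\<^esub> x \<oplus>\<^bsub>M\<^esub> (b mod int p) \<odot>\<^bsub>M\<^esub> x"
  using lsmult_l_distr [of "a mod int p" "b mod int p" x] assms p_gt_1 by (simp add: mod_simps)

lemma smult_mod_mult:
  assumes "x \<in> carrier M"
  shows "((a * b) mod int p) \<odot>\<^bsub>M\<^esub> x = (a mod int p) \<odot>\<^bsub>M\<^esub> ((b mod int p) \<odot>\<^bsub>M\<^esub> x)"
  using lsmult_assoc [of "a mod int p" "b mod int p" x] assms p_gt_1 by (simp add: mod_simps)

lemma smult_mod_closed: "x \<in> carrier M \<Longrightarrow> (a mod int p) \<odot>\<^bsub>M\<^esub> x \<in> carrier M"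
  using lsmult_closed [of "a mod int p" x] p_gt_1 by simp

lemma smult_zero: assumes "x \<in> carrier M" shows "0 \<odot>\<^bsub>M\<^esub> x = \<zero>\<^bsub>M\<^esub>"
proof -
  have "0 \<odot>\<^bsub>M\<^esub> x \<oplus>\<^bsub>M\<^esub> 0 \<odot>\<^bsub>M\<^esub> x = 0 \<odot>\<^bsub>M\<^esub> x"
    using smult_mod_add [OF assms, of 0 0] by simp
  then show ?thesis using smult_mod_closed [OF assms, of 0] by simp
qed

lemma smult_minus_one: assumes "x \<in> carrier M" shows "(- 1 mod int p) \<odot>\<^bsub>M\<^esub> x = \<ominus>\<^bsub>M\<^esub> x"
proof -
  have "(- 1 mod int p) \<odot>\<^bsub>M\<^esub> x \<oplus>\<^bsub>M\<^esub> x = \<zero>\<^bsub>M\<^esub>"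
    using smult_mod_add [OF assms, of "- 1" 1] assms p_gt_1 smult_zero lsmult_one [of x] by simp
  then show ?thesis using assms smult_mod_closed by (simp add: M.minus_equality)
qed

lemma submodule_minus:
  assumes "is_submodule (Fp p) M U" "x \<in> U" shows "\<ominus>\<^bsub>M\<^esub> x \<in> U"
proof -
  have "- 1 mod int p \<in> carrier (Fp p)" using p_gt_1 by simp
  then have "(- 1 mod int p) \<odot>\<^bsub>M\<^esub> x \<in> U" using assms unfolding is_submodule_def by blast
  then show ?thesis using assms smult_minus_one unfolding is_submodule_def by auto
qed

lemma submodule_smult_mod:
  "\<lbrakk>is_submodule (Fp p) M U; x \<in> U\<rbrakk> \<Longrightarrow> (a mod int p) \<odot>\<^bsub>M\<^esub> x \<in> U"
  using p_gt_1 unfolding is_submodule_def by simp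

definition adjoin :: "'m set \<Rightarrow> 'm \<Rightarrow> 'm set" where
  "adjoin W v = {w \<oplus>\<^bsub>M\<^esub> k \<odot>\<^bsub>M\<^esub> v | w k. w \<in> W \<and> k \<in> carrier (Fp p)}"

text \<open>If the scalars differed, their difference would be invertible modulo \<open>p\<close>,
  and dividing by it would put \<open>v\<close> into \<open>W\<close>.\<close>

lemma adjoin_unique:
  assumes W: "is_submodule (Fp p) M W" and v: "v \<in> carrier M" "v \<notin> W"
    and w: "w \<in> W" "w' \<in> W" and k: "k \<in> carrier (Fp p)" "k' \<in> carrier (Fp p)"
    and eq: "w \<oplus>\<^bsub>M\<^esub> k \<odot>\<^bsub>M\<^esub> v = w' \<oplus>\<^bsub>M\<^esub> k' \<odot>\<^bsub>M\<^esub> v"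
  shows "w = w' \<and> k = k'"
proof -
  have c: "w \<in> carrier M" "w' \<in> carrier M" "k \<odot>\<^bsub>M\<^esub> v \<in> carrier M" "k' \<odot>\<^bsub>M\<^esub> v \<in> carrier M"
    using W w k v unfolding is_submodule_def by auto
  have "k = k'"
  proof (rule ccontr)
    assume "k \<noteq> k'"
    moreover have kk: "0 \<le> k" "k < int p" "0 \<le> k'" "k' < int p" using k by auto
    ultimately have "\<not> int p dvd k - k'"
      using zdvd_imp_le [of "int p" "k - k'"] zdvd_imp_le [of "int p" "k' - k"]
      by (metis cong_iff_dvd_diff cong_less_imp_eq_int)
    then have "coprime (k - k') (int p)"
      using prime by (simp add: coprime_commute prime_imp_coprime)
    then obtain j where j: "[(k - k') * j = 1] (mod int p)" using cong_solve_coprime_int by blast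
    have "k \<odot>\<^bsub>M\<^esub> v = ((k - k') mod int p) \<odot>\<^bsub>M\<^esub> v \<oplus>\<^bsub>M\<^esub> k' \<odot>\<^bsub>M\<^esub> v"
      using smult_mod_add [OF v(1), of "k - k'" k'] kk by simp
    then have "(w \<oplus>\<^bsub>M\<^esub> ((k - k') mod int p) \<odot>\<^bsub>M\<^esub> v) \<oplus>\<^bsub>M\<^esub> k' \<odot>\<^bsub>M\<^esub> v = w' \<oplus>\<^bsub>M\<^esub> k' \<odot>\<^bsub>M\<^esub> v"
      using eq c v smult_mod_closed by (simp add: M.a_assoc)
    then have "w \<oplus>\<^bsub>M\<^esub> ((k - k') mod int p) \<odot>\<^bsub>M\<^esub> v = w'"
      using c v smult_mod_closed by simp
    then have "((k - k') mod int p) \<odot>\<^bsub>M\<^esub> v = \<ominus>\<^bsub>M\<^esub> w \<oplus>\<^bsub>M\<^esub> w'"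
      using c v smult_mod_closed by (metis M.r_neg1)
    then have "((k - k') mod int p) \<odot>\<^bsub>M\<^esub> v \<in> W"
      using W w submodule_minus [OF W w(1)] unfolding is_submodule_def by simp
    then have "(j mod int p) \<odot>\<^bsub>M\<^esub> (((k - k') mod int p) \<odot>\<^bsub>M\<^esub> v) \<in> W"
      using submodule_smult_mod [OF W] by blast
    moreover have "(j mod int p) \<odot>\<^bsub>M\<^esub> (((k - k') mod int p) \<odot>\<^bsub>M\<^esub> v) = v"
      using smult_mod_mult [OF v(1), of j "k - k'"] j p_gt_1 v(1) lsmult_one [of v]
      by (simp add: cong_def mult.commute)
    ultimately show False using v(2) by simp
  qed
  then show ?thesis using eq c by simp
qed

lemma submodule_adjoin:
  assumes W: "is_submodule (Fp p) M W" and v: "v \<in> carrier M"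
  shows "is_submodule (Fp p) M (adjoin W v)" "W \<subseteq> adjoin W v" "v \<in> adjoin W v"
proof -
  have c: "w \<in> carrier M" if "w \<in> W" for w using that W unfolding is_submodule_def by auto
  have adjI: "w \<oplus>\<^bsub>M\<^esub> (k mod int p) \<odot>\<^bsub>M\<^esub> v \<in> adjoin W v" if "w \<in> W" for w k
    using that p_gt_1 unfolding adjoin_def by force
  have zero: "\<zero>\<^bsub>M\<^esub> \<in> W" using W unfolding is_submodule_def by blast
  show "W \<subseteq> adjoin W v"
    using adjI [of _ 0] smult_zero [OF v] c by auto
  show "v \<in> adjoin W v"
    using adjI [OF zero, of 1] v p_gt_1 lsmult_one [of v] by simp
  show "is_submodule (Fp p) M (adjoin W v)"
    unfolding is_submodule_def
  proof (intro conjI ballI)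
    show "adjoin W v \<subseteq> carrier M" using c v by (auto simp: adjoin_def)
    show "\<zero>\<^bsub>M\<^esub> \<in> adjoin W v" using \<open>W \<subseteq> adjoin W v\<close> zero by blast
    fix x assume "x \<in> adjoin W v"
    then obtain w k where x: "x = w \<oplus>\<^bsub>M\<^esub> k \<odot>\<^bsub>M\<^esub> v" "w \<in> W" "k \<in> carrier (Fp p)" by (auto simp: adjoin_def)
    { fix y assume "y \<in> adjoin W v"
      then obtain w' k' where y: "y = w' \<oplus>\<^bsub>M\<^esub> k' \<odot>\<^bsub>M\<^esub> v" "w' \<in> W" "k' \<in> carrier (Fp p)" by (auto simp: adjoin_def)
      have "x \<oplus>\<^bsub>M\<^esub> y = (w \<oplus>\<^bsub>M\<^esub> w') \<oplus>\<^bsub>M\<^esub> ((k + k') mod int p) \<odot>\<^bsub>M\<^esub> v"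
        using x y c v smult_mod_add [OF v, of k k'] smult_mod_closed [OF v, of k] smult_mod_closed [OF v, of k']
        by (simp add: M.a_ac)
      then show "x \<oplus>\<^bsub>M\<^esub> y \<in> adjoin W v"
        using adjI x(2) y(2) W unfolding is_submodule_def by simp }
    fix l assume l: "l \<in> carrier (Fp p)"
    have "l \<odot>\<^bsub>M\<^esub> x = l \<odot>\<^bsub>M\<^esub> w \<oplus>\<^bsub>M\<^esub> ((l * k) mod int p) \<odot>\<^bsub>M\<^esub> v"
      using x c v l smult_mod_mult [OF v, of l k] smult_mod_closed [OF v, of k] lsmult_r_distr [of l w "k \<odot>\<^bsub>M\<^esub> v"]
      by simp
    moreover have "l \<odot>\<^bsub>M\<^esub> w \<in> W" using l x(2) W unfolding is_submodule_def by blast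
    ultimately show "l \<odot>\<^bsub>M\<^esub> x \<in> adjoin W v" using adjI by simp
  qed
qed

lemma card_adjoin:
  assumes W: "is_submodule (Fp p) M W" and v: "v \<in> carrier M" "v \<notin> W"
  shows "card (adjoin W v) = card W * p"
proof -
  have "bij_betw (\<lambda>(w, k). w \<oplus>\<^bsub>M\<^esub> k \<odot>\<^bsub>M\<^esub> v) (W \<times> carrier (Fp p)) (adjoin W v)"
  proof (rule bij_betw_imageI)
    show "inj_on (\<lambda>(w, k). w \<oplus>\<^bsub>M\<^esub> k \<odot>\<^bsub>M\<^esub> v) (W \<times> carrier (Fp p))"
    proof (rule inj_onI, clarify)
      fix w k w' k' assume "w \<in> W" "w' \<in> W" "k \<in> carrier (Fp p)" "k' \<in> carrier (Fp p)"
        "w \<oplus>\<^bsub>M\<^esub> k \<odot>\<^bsub>M\<^esub> v = w' \<oplus>\<^bsub>M\<^esub> k' \<odot>\<^bsub>M\<^esub> v"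
      then show "w = w' \<and> k = k'" using adjoin_unique [OF W v] by blast
    qed
    show "(\<lambda>(w, k). w \<oplus>\<^bsub>M\<^esub> k \<odot>\<^bsub>M\<^esub> v) ` (W \<times> carrier (Fp p)) = adjoin W v"
      by (force simp: adjoin_def)
  qed
  from bij_betw_same_card [OF this] show ?thesis
    by (simp add: card_cartesian_product)
qed

text \<open>Stands in for bases and dimension: \<open>U\<close> is enlarged by one vector at a time,
  and finiteness of the module ends the process. \<open>ex_extension_adjoin\<close> and
  \<open>card_adjoin\<close> carry maps and cardinalities along the chain.\<close>

lemma submodule_induct [consumes 2, case_names base step]:
  assumes U: "is_submodule (Fp p) M U" and fin: "finite (carrier M)"
    and base: "P U"
    and step: "\<And>W v. \<lbrakk>is_submodule (Fp p) M W; U \<subseteq> W; P W; v \<in> carrier M; v \<notin> W\<rbrakk> \<Longrightarrow> P (adjoin W v)"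
  shows "P (carrier M)"
proof -
  have "P (carrier M)" if "is_submodule (Fp p) M W \<and> U \<subseteq> W \<and> P W" for W
    using that
  proof (induction "card (carrier M) - card W" arbitrary: W rule: less_induct)
    case less
    have sub: "W \<subseteq> carrier M" using less.prems by (simp add: is_submodule_def)
    show ?case
    proof (cases "W = carrier M")
      case True
      then show ?thesis using less.prems by simp
    next
      case False
      then obtain v where v: "v \<in> carrier M" "v \<notin> W" using sub by blast
      let ?W = "adjoin W v"
      have W': "is_submodule (Fp p) M ?W" "W \<subseteq> ?W" "v \<in> ?W"
        using submodule_adjoin less.prems v(1) by auto
      have "?W \<subseteq> carrier M" using W'(1) by (simp add: is_submodule_def)
      then have "card W < card ?W" "card ?W \<le> card (carrier M)"
        using W' v fin by (auto intro!: psubset_card_mono card_mono intro: finite_subset)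
      then have "card (carrier M) - card ?W < card (carrier M) - card W" by simp
      then show ?thesis
        by (rule less.hyps) (use W' step v less.prems in auto)
    qed
  qed
  then show ?thesis using U base by blast
qed

lemma submodule_zero: "is_submodule (Fp p) M {\<zero>\<^bsub>M\<^esub>}"
proof -
  have "k \<odot>\<^bsub>M\<^esub> \<zero>\<^bsub>M\<^esub> = \<zero>\<^bsub>M\<^esub>" if "k \<in> carrier (Fp p)" for k
  proof -
    have "k \<odot>\<^bsub>M\<^esub> \<zero>\<^bsub>M\<^esub> \<oplus>\<^bsub>M\<^esub> k \<odot>\<^bsub>M\<^esub> \<zero>\<^bsub>M\<^esub> = k \<odot>\<^bsub>M\<^esub> \<zero>\<^bsub>M\<^esub>" "k \<odot>\<^bsub>M\<^esub> \<zero>\<^bsub>M\<^esub> \<in> carrier M"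
      using lsmult_r_distr [OF that, of "\<zero>\<^bsub>M\<^esub>" "\<zero>\<^bsub>M\<^esub>"] that by auto
    then show ?thesis by simp
  qed
  then show ?thesis unfolding is_submodule_def by simp
qed

end

lemma lmod_hom_iff:
  "f \<in> lmod_hom R (M\<lparr>carrier := W\<rparr>) A \<longleftrightarrow> f \<in> W \<rightarrow> carrier A \<and>
     (\<forall>x\<in>W. \<forall>y\<in>W. f (x \<oplus>\<^bsub>M\<^esub> y) = f x \<oplus>\<^bsub>A\<^esub> f y) \<and>
     (\<forall>k\<in>carrier R. \<forall>x\<in>W. f (k \<odot>\<^bsub>M\<^esub> x) = k \<odot>\<^bsub>A\<^esub> f x)"
  by (simp add: lmod_hom_def)

text \<open>Since \<open>w\<close> and \<open>k\<close> are determined by their combination with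
  \<open>v\<close>, the value at \<open>v\<close> can be prescribed freely. This yields both the
  injective extensions in \<open>isomorphic_modules_of_card_eq\<close> and the count of functionals
  in \<open>card_annihilator\<close>.\<close>

lemma ex_extension_adjoin:
  assumes M: "fp_module p M" and A: "fp_module p A" and W: "is_submodule (Fp p) M W"
    and v: "v \<in> carrier M" "v \<notin> W"
    and f: "f \<in> lmod_hom (Fp p) (M\<lparr>carrier := W\<rparr>) A" and a: "a \<in> carrier A"
  obtains f' where "f' \<in> lmod_hom (Fp p) (M\<lparr>carrier := fp_module.adjoin p M W v\<rparr>) A"
    "\<And>w k. \<lbrakk>w \<in> W; k \<in> carrier (Fp p)\<rbrakk> \<Longrightarrow> f' (w \<oplus>\<^bsub>M\<^esub> k \<odot>\<^bsub>M\<^esub> v) = f w \<oplus>\<^bsub>A\<^esub> k \<odot>\<^bsub>A\<^esub> a"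
proof -
  interpret M: fp_module p M by (rule M)
  interpret A: fp_module p A by (rule A)
  note f = f [unfolded lmod_hom_iff]
  have c: "w \<in> carrier M" "f w \<in> carrier A" if "w \<in> W" for w
    using that W f unfolding is_submodule_def by auto
  define f' where "f' u = (THE z. \<exists>w\<in>W. \<exists>k\<in>carrier (Fp p). u = w \<oplus>\<^bsub>M\<^esub> k \<odot>\<^bsub>M\<^esub> v \<and> z = f w \<oplus>\<^bsub>A\<^esub> k \<odot>\<^bsub>A\<^esub> a)" for u
  have f': "f' (w \<oplus>\<^bsub>M\<^esub> k \<odot>\<^bsub>M\<^esub> v) = f w \<oplus>\<^bsub>A\<^esub> k \<odot>\<^bsub>A\<^esub> a" if "w \<in> W" "k \<in> carrier (Fp p)" for w k
    unfolding f'_def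
  proof (rule the_equality)
    fix z assume "\<exists>w'\<in>W. \<exists>k'\<in>carrier (Fp p). w \<oplus>\<^bsub>M\<^esub> k \<odot>\<^bsub>M\<^esub> v = w' \<oplus>\<^bsub>M\<^esub> k' \<odot>\<^bsub>M\<^esub> v \<and> z = f w' \<oplus>\<^bsub>A\<^esub> k' \<odot>\<^bsub>A\<^esub> a"
    then show "z = f w \<oplus>\<^bsub>A\<^esub> k \<odot>\<^bsub>A\<^esub> a" using M.adjoin_unique [OF W v] that by blast
  qed (use that in blast)
  have "f' \<in> lmod_hom (Fp p) (M\<lparr>carrier := M.adjoin W v\<rparr>) A"
    unfolding lmod_hom_iff
  proof (intro conjI ballI funcsetI)
    fix x assume "x \<in> M.adjoin W v"
    then obtain w k where x: "x = w \<oplus>\<^bsub>M\<^esub> k \<odot>\<^bsub>M\<^esub> v" "w \<in> W" "k \<in> carrier (Fp p)" by (auto simp: M.adjoin_def)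
    then show "f' x \<in> carrier A" using f' c a by simp
    { fix y assume "y \<in> M.adjoin W v"
      then obtain w' k' where y: "y = w' \<oplus>\<^bsub>M\<^esub> k' \<odot>\<^bsub>M\<^esub> v" "w' \<in> W" "k' \<in> carrier (Fp p)" by (auto simp: M.adjoin_def)
      have "x \<oplus>\<^bsub>M\<^esub> y = (w \<oplus>\<^bsub>M\<^esub> w') \<oplus>\<^bsub>M\<^esub> ((k + k') mod int p) \<odot>\<^bsub>M\<^esub> v"
        using x y c v M.smult_mod_add [OF v(1), of k k'] M.smult_mod_closed [OF v(1), of k]
          M.smult_mod_closed [OF v(1), of k'] by (simp add: M.M.a_ac)
      moreover have "w \<oplus>\<^bsub>M\<^esub> w' \<in> W" "(k + k') mod int p \<in> carrier (Fp p)"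
        using x y W M.p_gt_1 unfolding is_submodule_def by auto
      ultimately have "f' (x \<oplus>\<^bsub>M\<^esub> y) = f (w \<oplus>\<^bsub>M\<^esub> w') \<oplus>\<^bsub>A\<^esub> ((k + k') mod int p) \<odot>\<^bsub>A\<^esub> a"
        using f' by simp
      also have "\<dots> = f' x \<oplus>\<^bsub>A\<^esub> f' y"
        using x y f' f c a A.smult_mod_add [OF a, of k k'] A.smult_mod_closed [OF a, of k]
          A.smult_mod_closed [OF a, of k'] by (simp add: A.M.a_ac)
      finally show "f' (x \<oplus>\<^bsub>M\<^esub> y) = f' x \<oplus>\<^bsub>A\<^esub> f' y" . }
    fix l assume l: "l \<in> carrier (Fp p)"
    have "l \<odot>\<^bsub>M\<^esub> x = l \<odot>\<^bsub>M\<^esub> w \<oplus>\<^bsub>M\<^esub> ((l * k) mod int p) \<odot>\<^bsub>M\<^esub> v"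
      using x c v l M.smult_mod_mult [OF v(1), of l k] M.smult_mod_closed [OF v(1), of k]
        M.lsmult_r_distr [of l w "k \<odot>\<^bsub>M\<^esub> v"] by simp
    moreover have "l \<odot>\<^bsub>M\<^esub> w \<in> W" "(l * k) mod int p \<in> carrier (Fp p)"
      using l x W M.p_gt_1 unfolding is_submodule_def by auto
    ultimately have "f' (l \<odot>\<^bsub>M\<^esub> x) = f (l \<odot>\<^bsub>M\<^esub> w) \<oplus>\<^bsub>A\<^esub> ((l * k) mod int p) \<odot>\<^bsub>A\<^esub> a"
      using f' by simp
    also have "\<dots> = l \<odot>\<^bsub>A\<^esub> f' x"
      using x l f' f c a A.smult_mod_mult [OF a, of l k] A.smult_mod_closed [OF a, of k]
        A.lsmult_r_distr [of l "f w" "k \<odot>\<^bsub>A\<^esub> a"] by simp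
    finally show "f' (l \<odot>\<^bsub>M\<^esub> x) = l \<odot>\<^bsub>A\<^esub> f' x" .
  qed
  then show thesis using f' by (rule that)
qed

text \<open>An injective map is extended by one vector at a time. As long as \<open>W\<close> is a
  proper submodule its image is too small to fill \<open>A\<close>, so the new vector can be sent
  outside the image, and uniqueness of coordinates in \<open>A\<close> keeps the map injective.
  Equal cardinalities make the final map onto.\<close>

theorem isomorphic_modules_of_card_eq:
  assumes M: "fp_module p M" "finite (carrier M)" and A: "fp_module p A" "finite (carrier A)"
    and card: "card (carrier M) = card (carrier A)"
  shows "isomorphic_modules (Fp p) M A"
proof -
  interpret M: fp_module p M by (rule M)
  interpret A: fp_module p A by (rule A)
  let ?P = "\<lambda>W. \<exists>f. f \<in> lmod_hom (Fp p) (M\<lparr>carrier := W\<rparr>) A \<and> inj_on f W"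
  from M.submodule_zero M(2) have "?P (carrier M)"
  proof (induction rule: M.submodule_induct)
    case base
    have "k \<odot>\<^bsub>M\<^esub> \<zero>\<^bsub>M\<^esub> = \<zero>\<^bsub>M\<^esub>" "k \<odot>\<^bsub>A\<^esub> \<zero>\<^bsub>A\<^esub> = \<zero>\<^bsub>A\<^esub>" if "k \<in> carrier (Fp p)" for k
      using that M.submodule_zero A.submodule_zero unfolding is_submodule_def by blast+
    then have "(\<lambda>_. \<zero>\<^bsub>A\<^esub>) \<in> lmod_hom (Fp p) (M\<lparr>carrier := {\<zero>\<^bsub>M\<^esub>}\<rparr>) A"
      unfolding lmod_hom_iff by auto
    then show ?case by (intro exI [of _ "\<lambda>_. \<zero>\<^bsub>A\<^esub>"]) simp
  next
    case (step W v)
    then obtain f where f: "f \<in> lmod_hom (Fp p) (M\<lparr>carrier := W\<rparr>) A" "inj_on f W" by blast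
    note f' = f(1) [unfolded lmod_hom_iff]
    have sub: "W \<subseteq> carrier M" using step.hyps(1) by (simp add: is_submodule_def)
    then have "card (f ` W) < card (carrier A)"
      using step.hyps card M(2) card_image [OF f(2)] by (metis psubset_card_mono psubsetI)
    moreover have "f ` W \<subseteq> carrier A" using f' by auto
    ultimately obtain a where a: "a \<in> carrier A" "a \<notin> f ` W"
      by (metis less_irrefl subset_antisym subsetI)
    have im: "is_submodule (Fp p) A (f ` W)"
      unfolding is_submodule_def
    proof (intro conjI ballI)
      show "f ` W \<subseteq> carrier A" by fact
      have "\<zero>\<^bsub>M\<^esub> \<in> W" using step.hyps(1) by (simp add: is_submodule_def)
      then have "f \<zero>\<^bsub>M\<^esub> \<oplus>\<^bsub>A\<^esub> f \<zero>\<^bsub>M\<^esub> = f \<zero>\<^bsub>M\<^esub>" "f \<zero>\<^bsub>M\<^esub> \<in> carrier A" "f \<zero>\<^bsub>M\<^esub> \<in> f ` W"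
        using f' M.M.l_zero [OF M.M.zero_closed] by (metis, auto)
      then show "\<zero>\<^bsub>A\<^esub> \<in> f ` W" by simp
      fix x assume x: "x \<in> f ` W"
      show "x \<oplus>\<^bsub>A\<^esub> y \<in> f ` W" if "y \<in> f ` W" for y
        using x that f' step.hyps(1) unfolding is_submodule_def by (smt (verit) image_iff)
      show "k \<odot>\<^bsub>A\<^esub> x \<in> f ` W" if "k \<in> carrier (Fp p)" for k
        using x that f' step.hyps(1) unfolding is_submodule_def by (smt (verit) image_iff)
    qed
    obtain h where h: "h \<in> lmod_hom (Fp p) (M\<lparr>carrier := M.adjoin W v\<rparr>) A"
      "\<And>w k. \<lbrakk>w \<in> W; k \<in> carrier (Fp p)\<rbrakk> \<Longrightarrow> h (w \<oplus>\<^bsub>M\<^esub> k \<odot>\<^bsub>M\<^esub> v) = f w \<oplus>\<^bsub>A\<^esub> k \<odot>\<^bsub>A\<^esub> a"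
      using ex_extension_adjoin [OF M(1) A(1) step.hyps(1) step.hyps(3,4) f(1) a(1)] by blast
    have "inj_on h (M.adjoin W v)"
    proof (rule inj_onI)
      fix x y assume "x \<in> M.adjoin W v" "y \<in> M.adjoin W v" and eq: "h x = h y"
      then obtain w k w' k' where x: "x = w \<oplus>\<^bsub>M\<^esub> k \<odot>\<^bsub>M\<^esub> v" "w \<in> W" "k \<in> carrier (Fp p)"
        and y: "y = w' \<oplus>\<^bsub>M\<^esub> k' \<odot>\<^bsub>M\<^esub> v" "w' \<in> W" "k' \<in> carrier (Fp p)" unfolding M.adjoin_def by blast
      have "f w \<oplus>\<^bsub>A\<^esub> k \<odot>\<^bsub>A\<^esub> a = f w' \<oplus>\<^bsub>A\<^esub> k' \<odot>\<^bsub>A\<^esub> a" using eq x y h(2) by simp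
      then have "f w = f w' \<and> k = k'"
        using A.adjoin_unique [OF im a _ _ x(3) y(3)] x(2) y(2) by blast
      then show "x = y" using f(2) x y by (auto dest: inj_onD)
    qed
    with h(1) show ?case by blast
  qed
  then obtain f where f: "f \<in> lmod_hom (Fp p) M A" "inj_on f (carrier M)" by auto
  moreover have "f ` carrier M = carrier A"
    using f card_image [OF f(2)] card A(2) by (intro card_subset_eq) (auto simp: lmod_hom_def)
  ultimately show ?thesis unfolding isomorphic_modules_def bij_betw_def by blast
qed

definition Fp_module :: "nat \<Rightarrow> (int, int) module" where
  "Fp_module p = \<lparr>carrier = {0..int p - 1}, monoid.mult = undefined, one = undefined,
     zero = 0, add = (\<lambda>x y. (x + y) mod int p), smult = (\<lambda>k x. (k * x) mod int p)\<rparr>"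

lemma fp_module_Fp_module:
  assumes "prime p" shows "fp_module p (Fp_module p)"
proof -
  have p: "1 < int p" using prime_gt_1_nat [OF assms] by simp
  interpret residues "int p" "Fp p" using p by unfold_locales simp_all
  interpret A: abelian_group "Fp_module p"
  proof (rule abelian_groupI)
    fix x assume "x \<in> carrier (Fp_module p)"
    then show "\<exists>y\<in>carrier (Fp_module p). y \<oplus>\<^bsub>Fp_module p\<^esub> x = \<zero>\<^bsub>Fp_module p\<^esub>"
      using p by (intro bexI [of _ "(- x) mod int p"]) (simp_all add: Fp_module_def mod_simps)
  qed (use p in \<open>simp_all add: Fp_module_def mod_simps add_ac\<close>)
  show ?thesis
  proof (rule fp_module.intro, rule lmodule.intro)
    show "ring (Fp p)" by (rule ring_axioms)
    show "abelian_group (Fp_module p)" by (rule A.abelian_group_axioms)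
    show "fp_module_axioms p" using assms by (rule fp_module_axioms.intro)
    show "lmodule_axioms (Fp p) (Fp_module p)"
    proof (rule lmodule_axioms.intro)
      fix a b x y
      show "a \<in> carrier (Fp p) \<Longrightarrow> x \<in> carrier (Fp_module p) \<Longrightarrow>
          a \<odot>\<^bsub>Fp_module p\<^esub> x \<in> carrier (Fp_module p)"
        using p by (simp add: Fp_module_def)
      show "(a \<oplus>\<^bsub>Fp p\<^esub> b) \<odot>\<^bsub>Fp_module p\<^esub> x =
          a \<odot>\<^bsub>Fp_module p\<^esub> x \<oplus>\<^bsub>Fp_module p\<^esub> b \<odot>\<^bsub>Fp_module p\<^esub> x"
        by (simp add: Fp_module_def mod_simps distrib_right)
      show "a \<odot>\<^bsub>Fp_module p\<^esub> (x \<oplus>\<^bsub>Fp_module p\<^esub> y) =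
          a \<odot>\<^bsub>Fp_module p\<^esub> x \<oplus>\<^bsub>Fp_module p\<^esub> a \<odot>\<^bsub>Fp_module p\<^esub> y"
        by (simp add: Fp_module_def mod_simps distrib_left)
      show "(a \<otimes>\<^bsub>Fp p\<^esub> b) \<odot>\<^bsub>Fp_module p\<^esub> x = a \<odot>\<^bsub>Fp_module p\<^esub> (b \<odot>\<^bsub>Fp_module p\<^esub> x)"
        by (simp add: Fp_module_def mod_simps mult.assoc)
      show "x \<in> carrier (Fp_module p) \<Longrightarrow> \<one>\<^bsub>Fp p\<^esub> \<odot>\<^bsub>Fp_module p\<^esub> x = x"
        by (simp add: Fp_module_def)
    qed
  qed
qed

text \<open>The dimension formula for annihilators, with cardinalities in place of dimensions. Along
  a chain from \<open>U\<close> up to \<open>M\<close> each new vector multiplies the size of the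
  submodule by \<open>p\<close>, and also the number of functionals vanishing on \<open>U\<close>,
  since the value at the new vector is free.\<close>

theorem card_annihilator:
  assumes M: "fp_module p M" "finite (carrier M)" and U: "is_submodule (Fp p) M U"
  shows "card {f \<in> lmod_hom (Fp p) M (Fp_module p) \<inter> extensional (carrier M). \<forall>u\<in>U. f u = 0} * card U =
    card (carrier M)"
proof -
  interpret M: fp_module p M by (rule M)
  let ?A = "Fp_module p"
  interpret A: fp_module p ?A using M.prime by (rule fp_module_Fp_module)
  \<comment> \<open>The functionals on an intermediate \<open>W\<close> that vanish on
    \<open>U\<close>, taken extensional so that each is counted once.\<close>
  define F where "F W = {f \<in> lmod_hom (Fp p) (M\<lparr>carrier := W\<rparr>) ?A \<inter> extensional W. \<forall>u\<in>U. f u = 0}" for W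
  have A: "carrier ?A = carrier (Fp p)" "x \<oplus>\<^bsub>?A\<^esub> y = (x + y) mod int p" "k \<odot>\<^bsub>?A\<^esub> x = (k * x) mod int p" for x y k
    by (simp_all add: Fp_module_def)
  have hom_iff: "f \<in> lmod_hom (Fp p) (M\<lparr>carrier := W\<rparr>) ?A \<longleftrightarrow> (\<forall>x\<in>W. 0 \<le> f x \<and> f x < int p) \<and>
      (\<forall>x\<in>W. \<forall>y\<in>W. f (x \<oplus>\<^bsub>M\<^esub> y) = (f x + f y) mod int p) \<and>
      (\<forall>k\<in>{0..int p - 1}. \<forall>x\<in>W. f (k \<odot>\<^bsub>M\<^esub> x) = (k * f x) mod int p)" for f W
    unfolding lmod_hom_iff by (simp add: A Pi_def conj_assoc) auto
  have F_iff: "f \<in> F W \<longleftrightarrow> f \<in> lmod_hom (Fp p) (M\<lparr>carrier := W\<rparr>) ?A \<and> f \<in> extensional W \<and> (\<forall>u\<in>U. f u = 0)" for f W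
    by (simp add: F_def conj_assoc)
  from U M(2) have "card (F (carrier M)) * card U = card (carrier M)"
  proof (induction rule: M.submodule_induct)
    case base
    have "(\<lambda>u\<in>U. 0) \<in> F U"
      using U M.p_gt_1 unfolding F_iff hom_iff is_submodule_def by simp
    moreover have "f = (\<lambda>u\<in>U. 0)" if "f \<in> F U" for f
      by (rule extensionalityI [of _ U]) (use that in \<open>simp_all add: F_iff\<close>)
    ultimately have "F U = {\<lambda>u\<in>U. 0}" by blast
    then show ?case by simp
  next
    case (step W v)
    note W = step.hyps(1)
    have Wc: "w \<in> carrier M" if "w \<in> W" for w using that W unfolding is_submodule_def by auto
    let ?W = "M.adjoin W v"
    note W' = M.submodule_adjoin [OF W step.hyps(3)]
    have kv: "(k mod int p) \<odot>\<^bsub>M\<^esub> v \<in> ?W" for k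
      using M.submodule_smult_mod [OF W'(1) W'(3)] .
    have val: "f (w \<oplus>\<^bsub>M\<^esub> k \<odot>\<^bsub>M\<^esub> v) = (f w + k * f v) mod int p"
      if "f \<in> F ?W" "w \<in> W" "k \<in> carrier (Fp p)" for f w k
    proof -
      have "k mod int p = k" using that(3) by simp
      then have "k \<odot>\<^bsub>M\<^esub> v \<in> ?W" "w \<in> ?W" "k \<in> {0..int p - 1}" using kv [of k] that(2,3) W'(2) by auto
      then have "f (w \<oplus>\<^bsub>M\<^esub> k \<odot>\<^bsub>M\<^esub> v) = (f w + f (k \<odot>\<^bsub>M\<^esub> v)) mod int p" "f (k \<odot>\<^bsub>M\<^esub> v) = (k * f v) mod int p"
        using that(1) W'(3) unfolding F_iff hom_iff by blast+
      then show ?thesis by (simp add: mod_simps)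
    qed
    have "bij_betw (\<lambda>f. (restrict f W, f v)) (F ?W) (F W \<times> carrier (Fp p))"
    proof (rule bij_betw_imageI)
      show "inj_on (\<lambda>f. (restrict f W, f v)) (F ?W)"
      proof (rule inj_onI)
        fix f g assume f: "f \<in> F ?W" and g: "g \<in> F ?W" and eq: "(restrict f W, f v) = (restrict g W, g v)"
        then have eqW: "f w = g w" if "w \<in> W" for w
          using that by (metis Pair_inject restrict_apply')
        show "f = g"
        proof (rule extensionalityI [of _ ?W])
          fix x assume "x \<in> ?W"
          then obtain w k where "x = w \<oplus>\<^bsub>M\<^esub> k \<odot>\<^bsub>M\<^esub> v" "w \<in> W" "k \<in> carrier (Fp p)"
            unfolding M.adjoin_def by blast
          then show "f x = g x" using val [OF f] val [OF g] eq eqW by simp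
        qed (use f g in \<open>simp_all add: F_iff\<close>)
      qed
      show "(\<lambda>f. (restrict f W, f v)) ` F ?W = F W \<times> carrier (Fp p)"
      proof (intro equalityI subsetI)
        fix z assume "z \<in> (\<lambda>f. (restrict f W, f v)) ` F ?W"
        then obtain f where f': "z = (restrict f W, f v)" "f \<in> F ?W" by (rule imageE)
        note f = f'(2,1)
        have "restrict f W \<in> F W"
        proof -
          have "\<forall>x\<in>W. x \<in> ?W" "\<forall>u\<in>U. u \<in> W" using W'(2) step.hyps(2) by blast+
          then show ?thesis using f(1) W unfolding F_iff hom_iff is_submodule_def by simp
        qed
        moreover have "f v \<in> carrier (Fp p)" using f(1) W'(3) unfolding F_iff hom_iff by simp
        ultimately show "z \<in> F W \<times> carrier (Fp p)" using f(2) by simp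
      next
        fix z assume "z \<in> F W \<times> carrier (Fp p)"
        then obtain f a where f: "f \<in> F W" "a \<in> carrier ?A" "z = (f, a)" by (auto simp: A)
        then have fW: "f \<in> lmod_hom (Fp p) (M\<lparr>carrier := W\<rparr>) ?A" by (simp add: F_iff)
        obtain h where h: "h \<in> lmod_hom (Fp p) (M\<lparr>carrier := ?W\<rparr>) ?A"
          "\<And>w k. \<lbrakk>w \<in> W; k \<in> carrier (Fp p)\<rbrakk> \<Longrightarrow> h (w \<oplus>\<^bsub>M\<^esub> k \<odot>\<^bsub>M\<^esub> v) = f w \<oplus>\<^bsub>?A\<^esub> k \<odot>\<^bsub>?A\<^esub> a"
          using ex_extension_adjoin [OF M(1) A.fp_module_axioms W step.hyps(3,4) fW f(2)] by blast
        have range: "0 \<le> f w \<and> f w < int p" if "w \<in> W" for w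
          using that fW unfolding hom_iff by blast
        have hW: "h w = f w" if "w \<in> W" for w
          using h(2) [OF that, of 0] M.p_gt_1 M.smult_zero [OF step.hyps(3)] Wc [OF that] range [OF that]
          by (simp add: A)
        have f0: "f \<zero>\<^bsub>M\<^esub> = 0"
        proof -
          have "\<zero>\<^bsub>M\<^esub> \<in> W" using W by (simp add: is_submodule_def)
          then have "f (0 \<odot>\<^bsub>M\<^esub> \<zero>\<^bsub>M\<^esub>) = (0 * f \<zero>\<^bsub>M\<^esub>) mod int p"
            using fW M.p_gt_1 unfolding hom_iff by simp
          then show ?thesis using M.smult_zero [of "\<zero>\<^bsub>M\<^esub>"] by simp
        qed
        have hv: "h v = a"
          using h(2) [of "\<zero>\<^bsub>M\<^esub>" 1] W M.p_gt_1 step.hyps(3) M.lsmult_one [of v] f(2) f0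
          by (simp add: A is_submodule_def)
        have e: "restrict h ?W \<in> F ?W"
        proof -
          have "\<forall>u\<in>U. u \<in> ?W \<and> u \<in> W" using W'(2) step.hyps(2) by blast
          then show ?thesis
            using h(1) W'(1) hW f(1) unfolding F_iff hom_iff is_submodule_def by simp
        qed
        have z: "z = (restrict (restrict h ?W) W, restrict h ?W v)"
        proof -
          have "restrict (restrict h ?W) W = f"
          proof (rule extensionalityI [of _ W])
            show "restrict (restrict h ?W) W w = f w" if "w \<in> W" for w using that hW [OF that] W'(2) by (simp add: subset_iff)
            show "restrict (restrict h ?W) W \<in> extensional W" by (rule restrict_extensional)
            show "f \<in> extensional W" using f(1) by (simp add: F_iff)
          qed
          then show ?thesis using f(3) hv W'(3) by simp
        qed
        show "z \<in> (\<lambda>f. (restrict f W, f v)) ` F ?W" 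
          by (rule image_eqI [where f = "\<lambda>f. (restrict f W, f v)" and x = "restrict h ?W", OF z e])
      qed
    qed
    from bij_betw_same_card [OF this] have "card (F ?W) = card (F W) * p"
      by (simp add: card_cartesian_product)
    then have "card (F ?W) * card U = (card (F W) * card U) * p" by simp
    also have "\<dots> = card ?W"
      by (simp only: step.IH M.card_adjoin [OF W step.hyps(3,4)])
    finally show ?case .
  qed
  then show ?thesis by (simp add: F_def)
qed


subsection \<open>Counting\<close>

text \<open>Every nonempty fibre is a translate of the kernel.\<close>

lemma card_kernel_image:
  assumes A: "abelian_group A" and B: "abelian_group B" and fin: "finite (carrier A)"
    and f: "f \<in> carrier A \<rightarrow> carrier B"
    and add: "\<And>x y. \<lbrakk>x \<in> carrier A; y \<in> carrier A\<rbrakk> \<Longrightarrow> f (x \<oplus>\<^bsub>A\<^esub> y) = f x \<oplus>\<^bsub>B\<^esub> f y"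
  shows "card {x \<in> carrier A. f x = \<zero>\<^bsub>B\<^esub>} * card (f ` carrier A) = card (carrier A)"
proof -
  interpret A: abelian_group A by (rule A)
  interpret B: abelian_group B by (rule B)
  have zero: "f \<zero>\<^bsub>A\<^esub> = \<zero>\<^bsub>B\<^esub>"
    using A B f by (rule additive_map_zero) (rule add)
  have fibre: "card {x \<in> carrier A. f x = y} = card {x \<in> carrier A. f x = \<zero>\<^bsub>B\<^esub>}" if "y \<in> f ` carrier A" for y
  proof -
    from \<open>y \<in> f ` carrier A\<close> obtain a where a: "y = f a" "a \<in> carrier A" by (rule imageE)
    have fa: "f a \<in> carrier B" "f (\<ominus>\<^bsub>A\<^esub> a) \<in> carrier B" 
      using funcset_mem [OF f a(2)] funcset_mem [OF f A.a_inv_closed [OF a(2)]] by simp_all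
    have "f (\<ominus>\<^bsub>A\<^esub> a) \<oplus>\<^bsub>B\<^esub> f a = \<zero>\<^bsub>B\<^esub>"
      using add [of "\<ominus>\<^bsub>A\<^esub> a" a] a(2) zero by (simp add: A.l_neg)
    then have neg: "f (\<ominus>\<^bsub>A\<^esub> a) = \<ominus>\<^bsub>B\<^esub> f a"
      using B.minus_equality [OF _ fa] by simp
    have "bij_betw (\<lambda>x. a \<oplus>\<^bsub>A\<^esub> x) {x \<in> carrier A. f x = \<zero>\<^bsub>B\<^esub>} {x \<in> carrier A. f x = y}"
      by (rule bij_betw_byWitness [where f' = "\<lambda>x. \<ominus>\<^bsub>A\<^esub> a \<oplus>\<^bsub>A\<^esub> x"])
         (use a fa neg in \<open>auto simp: add A.r_neg1 A.r_neg2 B.l_neg\<close>)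
    then show ?thesis by (simp add: bij_betw_same_card)
  qed
  have "card (carrier A) = (\<Sum>y\<in>f ` carrier A. card {x \<in> carrier A. f x = y})"
    using sum.image_gen [OF fin, of "\<lambda>_. 1::nat" f] by simp
  also have "\<dots> = card (f ` carrier A) * card {x \<in> carrier A. f x = \<zero>\<^bsub>B\<^esub>}"
    using fibre by simp
  finally show ?thesis by simp
qed

context module_quotient
begin

lemma card_quotient: "card (carrier (quotient_module M N)) * card N = card (carrier M)"
  using add.lagrange [OF a_subgroup]
  by (simp add: quotient_module_def A_RCOSETS_def order_def)

end

lemma fp_module_quotient:
  assumes M: "fp_module p M" and N: "is_submodule (Fp p) M N"
  shows "module_quotient M N (carrier (Fp p))" and "fp_module p (quotient_module M N)"
proof -
  interpret M: fp_module p M by (rule M)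
  show Q: "module_quotient M N (carrier (Fp p))"
  proof (rule module_quotient.intro [OF M.M.abelian_group_axioms], rule module_quotient_axioms.intro)
    show "additive_subgroup N M"
    proof (rule additive_subgroup.intro, rule M.add.subgroupI)
      show "N \<subseteq> carrier M" "N \<noteq> {}" using N by (auto simp: is_submodule_def)
      show "\<ominus>\<^bsub>M\<^esub> x \<in> N" if "x \<in> N" for x using M.submodule_minus [OF N that] .
      show "x \<oplus>\<^bsub>M\<^esub> y \<in> N" if "x \<in> N" "y \<in> N" for x y using N that by (simp add: is_submodule_def)
    qed
  qed (use N in \<open>simp_all add: is_submodule_def M.lsmult_r_distr\<close>)
  interpret Q: module_quotient M N "carrier (Fp p)" by (rule Q)
  show "fp_module p (quotient_module M N)"
  proof (rule fp_module.intro, rule lmodule.intro)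
    show "ring (Fp p)" by (rule M.ring_axioms)
    show "abelian_group (quotient_module M N)" by (rule Q.abelian_group_quotient)
    show "fp_module_axioms p" using M.prime by (rule fp_module_axioms.intro)
    show "lmodule_axioms (Fp p) (quotient_module M N)"
    proof (rule lmodule_axioms.intro)
      fix a U assume a: "a \<in> carrier (Fp p)" and "U \<in> carrier (quotient_module M N)"
      then obtain x where x: "x \<in> carrier M" "U = N +>\<^bsub>M\<^esub> x" by (auto simp: Q.carrier_quotient)
      have ax: "a \<odot>\<^bsub>M\<^esub> x \<in> carrier M" using a x M.lsmult_closed by blast
      then show "a \<odot>\<^bsub>quotient_module M N\<^esub> U \<in> carrier (quotient_module M N)"
        using a x Q.smult_quotient Q.coset_in_quotient by metis
      { fix b assume b: "b \<in> carrier (Fp p)"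
        have bx: "b \<odot>\<^bsub>M\<^esub> x \<in> carrier M" using b x M.lsmult_closed by blast
        have ab: "a \<oplus>\<^bsub>Fp p\<^esub> b \<in> carrier (Fp p)" "a \<otimes>\<^bsub>Fp p\<^esub> b \<in> carrier (Fp p)"
          using a b M.R.a_closed M.R.m_closed by blast+
        show "(a \<oplus>\<^bsub>Fp p\<^esub> b) \<odot>\<^bsub>quotient_module M N\<^esub> U =
            a \<odot>\<^bsub>quotient_module M N\<^esub> U \<oplus>\<^bsub>quotient_module M N\<^esub> b \<odot>\<^bsub>quotient_module M N\<^esub> U"
          unfolding x(2) Q.smult_quotient [OF a x(1)] Q.smult_quotient [OF b x(1)] Q.smult_quotient [OF ab(1) x(1)]
            Q.add_quotient [OF ax bx] M.lsmult_l_distr [OF a b x(1)] ..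
        show "(a \<otimes>\<^bsub>Fp p\<^esub> b) \<odot>\<^bsub>quotient_module M N\<^esub> U =
            a \<odot>\<^bsub>quotient_module M N\<^esub> (b \<odot>\<^bsub>quotient_module M N\<^esub> U)"
          unfolding x(2) Q.smult_quotient [OF b x(1)] Q.smult_quotient [OF a bx] Q.smult_quotient [OF ab(2) x(1)]
            M.lsmult_assoc [OF a b x(1)] .. }
      { fix V assume "V \<in> carrier (quotient_module M N)"
        then obtain y where y: "y \<in> carrier M" "V = N +>\<^bsub>M\<^esub> y" by (auto simp: Q.carrier_quotient)
        have ay: "a \<odot>\<^bsub>M\<^esub> y \<in> carrier M" using a y M.lsmult_closed by blast
        show "a \<odot>\<^bsub>quotient_module M N\<^esub> (U \<oplus>\<^bsub>quotient_module M N\<^esub> V) =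
            a \<odot>\<^bsub>quotient_module M N\<^esub> U \<oplus>\<^bsub>quotient_module M N\<^esub> a \<odot>\<^bsub>quotient_module M N\<^esub> V"
          unfolding x(2) y(2) Q.add_quotient [OF x(1) y(1)] Q.smult_quotient [OF a x(1)] Q.smult_quotient [OF a y(1)]
            Q.smult_quotient [OF a M.M.a_closed [OF x(1) y(1)]] Q.add_quotient [OF ax ay]
            M.lsmult_r_distr [OF a x(1) y(1)] .. }
    next
      fix U assume "U \<in> carrier (quotient_module M N)"
      then obtain x where x: "x \<in> carrier M" "U = N +>\<^bsub>M\<^esub> x" by (auto simp: Q.carrier_quotient)
      show "\<one>\<^bsub>Fp p\<^esub> \<odot>\<^bsub>quotient_module M N\<^esub> U = U"
        unfolding x(2) Q.smult_quotient [OF M.R.one_closed x(1)] M.lsmult_one [OF x(1)] ..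
    qed
  qed
qed

lemma fp_module_submodule:
  assumes M: "fp_module p M" and W: "is_submodule (Fp p) M W"
  shows "fp_module p (M\<lparr>carrier := W\<rparr>)"
proof -
  interpret M: fp_module p M by (rule M)
  have c: "x \<in> carrier M" if "x \<in> W" for x using that W by (auto simp: is_submodule_def)
  note W' = W [unfolded is_submodule_def]
  have "abelian_group (M\<lparr>carrier := W\<rparr>)"
  proof (rule abelian_groupI)
    fix x assume "x \<in> carrier (M\<lparr>carrier := W\<rparr>)"
    then show "\<exists>y\<in>carrier (M\<lparr>carrier := W\<rparr>). y \<oplus>\<^bsub>M\<lparr>carrier := W\<rparr>\<^esub> x = \<zero>\<^bsub>M\<lparr>carrier := W\<rparr>\<^esub>"
      using M.submodule_minus [OF W, of x] c by (intro bexI [of _ "\<ominus>\<^bsub>M\<^esub> x"]) (simp_all add: M.M.l_neg)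
  qed (use W' c in \<open>simp_all add: M.M.a_ac\<close>)
  then show ?thesis
    using M.ring_axioms W' c M.prime M.lsmult_l_distr M.lsmult_r_distr M.lsmult_assoc M.lsmult_one
    by (intro fp_module.intro lmodule.intro lmodule_axioms.intro fp_module_axioms.intro)
       (simp_all del: residue_ring_simps)
qed


subsection \<open>The chain complex computing homology\<close>

text \<open>Lets a property of all tensor relations be tested on generators, provided it is
  preserved by differences. The keys of a generator have to lie in \<open>S\<close>, where the
  inverse in \<open>free_Abelian_group S\<close> is the negative.\<close>

lemma generate_frag_subset:
  assumes X: "X \<subseteq> {c. Poly_Mapping.keys c \<subseteq> S}" "X \<subseteq> T"
    and T: "0 \<in> T" "\<And>x y. \<lbrakk>x \<in> T; y \<in> T\<rbrakk> \<Longrightarrow> x - y \<in> T"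
  shows "generate (free_Abelian_group S) X \<subseteq> T"
proof
  have minus: "- x \<in> T" if "x \<in> T" for x using T(2) [OF T(1) that] by simp
  have plus: "x + y \<in> T" if "x \<in> T" "y \<in> T" for x y using T(2) [OF that(1) minus [OF that(2)]] by simp
  fix c assume "c \<in> generate (free_Abelian_group S) X"
  then show "c \<in> T"
  proof induction
    case (inv h)
    then have "Poly_Mapping.keys h \<subseteq> S" "h \<in> T" using X by auto
    then show ?case by (simp add: minus)
  qed (use X T(1) plus in auto)
qed

section \<open>The tensor product with \<open>Fp p\<close> in terms of pure tensors\<close>

context group_mod
begin

abbreviation TM :: "('a \<Rightarrow>\<^sub>0 int, int) module" where
  "TM \<equiv> trivial_module (Fp p)"

abbreviation tensor_rel where
  "tensor_rel n \<equiv> tensor_relations (group_ring G) (std_left G n) TM"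

abbreviation tensor_pre where
  "tensor_pre n \<equiv> tensor_pairs (std_left G n) TM (monoid.mult (Fp p))"

abbreviation tensor where
  "tensor n \<equiv> tensor_module (group_ring G) (std_left G n) TM (monoid.mult (Fp p))"

abbreviation tensor_keys where
  "tensor_keys n \<equiv> carrier (std_left G n) \<times> {0..int p - 1}"

lemma TM_simps: "carrier TM = {0..int p - 1}" "x \<oplus>\<^bsub>TM\<^esub> y = (x + y) mod int p"
  "x \<in> {0..int p - 1} \<Longrightarrow> a \<odot>\<^bsub>TM\<^esub> x = (augmentation a * x) mod int p"
  using p residue_ring_int_add_pow [of "int p" x "augmentation a"] by (simp_all add: trivial_module_def)

lemma tensor_pre_simps: "carrier (tensor_pre n) = {c. Poly_Mapping.keys c \<subseteq> tensor_keys n}"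
  "\<zero>\<^bsub>tensor_pre n\<^esub> = 0" "c \<oplus>\<^bsub>tensor_pre n\<^esub> d = c + d"
  "k \<odot>\<^bsub>tensor_pre n\<^esub> c = frag_extend (\<lambda>(x, y). frag_of (x, (k * y) mod int p)) c"
  by (simp_all add: tensor_pairs_def TM_simps(1))

definition tensor_gens :: "nat \<Rightarrow> ((('a list \<Rightarrow>\<^sub>0 int) \<times> int) \<Rightarrow>\<^sub>0 int) set" where
  "tensor_gens n =
     {frag_of (x + x', y) - frag_of (x, y) - frag_of (x', y) | x x' y.
         x \<in> carrier (std_left G n) \<and> x' \<in> carrier (std_left G n) \<and> y \<in> {0..int p - 1}} \<union>
     {frag_of (x, (y + y') mod int p) - frag_of (x, y) - frag_of (x, y') | x y y'.
         x \<in> carrier (std_left G n) \<and> y \<in> {0..int p - 1} \<and> y' \<in> {0..int p - 1}} \<union>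
     {frag_of (r \<odot>\<^bsub>std_left G n\<^esub> x, y) - frag_of (x, (augmentation r * y) mod int p) | r x y.
         r \<in> carrier (group_ring G) \<and> x \<in> carrier (std_left G n) \<and> y \<in> {0..int p - 1}}"

lemma tensor_gens_cases [consumes 1, case_names left right balanced]:
  assumes "c \<in> tensor_gens n"
  obtains x x' y where "x \<in> carrier (std_left G n)" "x' \<in> carrier (std_left G n)" "y \<in> {0..int p - 1}"
      "c = frag_of (x + x', y) - frag_of (x, y) - frag_of (x', y)"
    | x y y' where "x \<in> carrier (std_left G n)" "y \<in> {0..int p - 1}" "y' \<in> {0..int p - 1}"
      "c = frag_of (x, (y + y') mod int p) - frag_of (x, y) - frag_of (x, y')"
    | r x y where "r \<in> carrier (group_ring G)" "x \<in> carrier (std_left G n)" "y \<in> {0..int p - 1}"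
      "c = frag_of (r \<odot>\<^bsub>std_left G n\<^esub> x, y) - frag_of (x, (augmentation r * y) mod int p)"
  using assms unfolding tensor_gens_def by blast

lemma tensor_rel_eq: "tensor_rel n = generate (free_Abelian_group (tensor_keys n)) (tensor_gens n)"
proof -
  have "{frag_of (r \<odot>\<^bsub>std_left G n\<^esub> x, y) - frag_of (x, r \<odot>\<^bsub>TM\<^esub> y) | r x y.
         r \<in> carrier (group_ring G) \<and> x \<in> carrier (std_left G n) \<and> y \<in> carrier TM} =
     {frag_of (r \<odot>\<^bsub>std_left G n\<^esub> x, y) - frag_of (x, (augmentation r * y) mod int p) | r x y.
         r \<in> carrier (group_ring G) \<and> x \<in> carrier (std_left G n) \<and> y \<in> {0..int p - 1}}"
    using TM_simps by (intro Collect_cong) metis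
  then show ?thesis
    unfolding tensor_relations_def tensor_gens_def std_left_simps(1) TM_simps(1,2) by simp
qed

lemma tensor_gens_keys: "tensor_gens n \<subseteq> {c. Poly_Mapping.keys c \<subseteq> tensor_keys n}"
proof -
  have diff: "Poly_Mapping.keys (a - b) \<subseteq> T" if "Poly_Mapping.keys a \<subseteq> T" "Poly_Mapping.keys b \<subseteq> T"
    for a b :: "(('a list \<Rightarrow>\<^sub>0 int) \<times> int) \<Rightarrow>\<^sub>0 int" and T
    using keys_diff [of a b] that by blast
  have r: "k mod int p \<in> {0..int p - 1}" for k using p by simp
  show ?thesis
  proof
    fix c assume "c \<in> tensor_gens n"
    then show "c \<in> {c. Poly_Mapping.keys c \<subseteq> tensor_keys n}"
    proof (cases rule: tensor_gens_cases)
      case (left x x' y)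
      then show ?thesis
        unfolding left(4) mem_Collect_eq by (intro diff) (simp_all add: std_left_closed)
    next
      case (right x y y')
      then show ?thesis
        using r [of "y + y'"] unfolding right(4) mem_Collect_eq by (intro diff) simp_all
    next
      case (balanced s x y)
      then show ?thesis
        using r [of "augmentation s * y"] unfolding balanced(4) mem_Collect_eq
        by (intro diff) (simp_all add: std_left_smult_closed)
    qed
  qed
qed

lemma subgroup_tensor_rel: "subgroup (tensor_rel n) (free_Abelian_group (tensor_keys n))"
  unfolding tensor_rel_eq using tensor_gens_keys
  by (intro group.generate_is_subgroup group_free_Abelian_group) (auto simp: free_Abelian_group_def)

lemma tensor_rel_keys: "c \<in> tensor_rel n \<Longrightarrow> Poly_Mapping.keys c \<subseteq> tensor_keys n"
  using subgroup.subset [OF subgroup_tensor_rel] by (auto simp: free_Abelian_group_def)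

lemma tensor_rel_closed:
  "0 \<in> tensor_rel n" "\<lbrakk>c \<in> tensor_rel n; d \<in> tensor_rel n\<rbrakk> \<Longrightarrow> c + d \<in> tensor_rel n"
  "c \<in> tensor_rel n \<Longrightarrow> - c \<in> tensor_rel n" "\<lbrakk>c \<in> tensor_rel n; d \<in> tensor_rel n\<rbrakk> \<Longrightarrow> c - d \<in> tensor_rel n"
proof -
  show plus: "c + d \<in> tensor_rel n" if "c \<in> tensor_rel n" "d \<in> tensor_rel n" for c d
    using subgroup.m_closed [OF subgroup_tensor_rel that] by simp
  show minus: "- c \<in> tensor_rel n" if "c \<in> tensor_rel n" for c
    using subgroup.m_inv_closed [OF subgroup_tensor_rel that] tensor_rel_keys [OF that] by simp
  show "0 \<in> tensor_rel n"
    using subgroup.one_closed [OF subgroup_tensor_rel] by simp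
  show "c - d \<in> tensor_rel n" if "c \<in> tensor_rel n" "d \<in> tensor_rel n"
    using plus [OF that(1) minus [OF that(2)]] by simp
qed

lemma tensor_gens_rel: "c \<in> tensor_gens n \<Longrightarrow> c \<in> tensor_rel n"
  unfolding tensor_rel_eq by (rule generate.incl)

lemma tensor_rel_subset:
  assumes "tensor_gens n \<subseteq> T" "0 \<in> T" "\<And>x y. \<lbrakk>x \<in> T; y \<in> T\<rbrakk> \<Longrightarrow> x - y \<in> T"
  shows "tensor_rel n \<subseteq> T"
  unfolding tensor_rel_eq using tensor_gens_keys assms by (rule generate_frag_subset)

definition tensor_eq :: "nat \<Rightarrow> ((('a list \<Rightarrow>\<^sub>0 int) \<times> int) \<Rightarrow>\<^sub>0 int) \<Rightarrow> ((('a list \<Rightarrow>\<^sub>0 int) \<times> int) \<Rightarrow>\<^sub>0 int) \<Rightarrow> bool" where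
  "tensor_eq n c d \<longleftrightarrow> c - d \<in> tensor_rel n"

lemma tensor_eq_refl: "tensor_eq n c c"
  by (simp add: tensor_eq_def tensor_rel_closed)

lemma tensor_eq_sym: "tensor_eq n c d \<Longrightarrow> tensor_eq n d c"
  using tensor_rel_closed(3) [of "c - d" n] by (simp add: tensor_eq_def)

lemma tensor_eq_trans [trans]: "tensor_eq n c d \<Longrightarrow> tensor_eq n d e \<Longrightarrow> tensor_eq n c e"
  using tensor_rel_closed(2) [of "c - d" n "d - e"] by (simp add: tensor_eq_def)

lemma tensor_eq_add: "tensor_eq n c d \<Longrightarrow> tensor_eq n c' d' \<Longrightarrow> tensor_eq n (c + c') (d + d')"
  using tensor_rel_closed(2) [of "c - d" n "c' - d'"] by (simp add: tensor_eq_def algebra_simps)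

lemma tensor_eq_diff: "tensor_eq n c d \<Longrightarrow> tensor_eq n c' d' \<Longrightarrow> tensor_eq n (c - c') (d - d')"
  using tensor_rel_closed(4) [of "c - d" n "c' - d'"] by (simp add: tensor_eq_def algebra_simps)

lemma tensor_eq_left:
  assumes "x \<in> carrier (std_left G n)" "x' \<in> carrier (std_left G n)" "y \<in> {0..int p - 1}"
  shows "tensor_eq n (frag_of (x + x', y)) (frag_of (x, y) + frag_of (x', y))"
proof -
  have "frag_of (x + x', y) - frag_of (x, y) - frag_of (x', y) \<in> tensor_gens n"
    unfolding tensor_gens_def using assms by blast
  from tensor_gens_rel [OF this] show ?thesis by (simp add: tensor_eq_def diff_diff_eq)
qed

lemma tensor_eq_right:
  assumes "x \<in> carrier (std_left G n)" "y \<in> {0..int p - 1}" "y' \<in> {0..int p - 1}"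
  shows "tensor_eq n (frag_of (x, (y + y') mod int p)) (frag_of (x, y) + frag_of (x, y'))"
proof -
  have "frag_of (x, (y + y') mod int p) - frag_of (x, y) - frag_of (x, y') \<in> tensor_gens n"
    unfolding tensor_gens_def using assms by blast
  from tensor_gens_rel [OF this] show ?thesis by (simp add: tensor_eq_def diff_diff_eq)
qed

lemma tensor_eq_balanced:
  assumes "r \<in> carrier (group_ring G)" "x \<in> carrier (std_left G n)" "y \<in> {0..int p - 1}"
  shows "tensor_eq n (frag_of (r \<odot>\<^bsub>std_left G n\<^esub> x, y)) (frag_of (x, (augmentation r * y) mod int p))"
proof -
  have "frag_of (r \<odot>\<^bsub>std_left G n\<^esub> x, y) - frag_of (x, (augmentation r * y) mod int p) \<in> tensor_gens n"
    unfolding tensor_gens_def using assms by blast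
  from tensor_gens_rel [OF this] show ?thesis by (simp add: tensor_eq_def)
qed

lemma std_left_zero: "0 \<in> carrier (std_left G n)"
  by (simp add: carrier_std_left)

lemma std_left_cmul: "x \<in> carrier (std_left G n) \<Longrightarrow> frag_cmul k x \<in> carrier (std_left G n)"
  using keys_cmul [of k x] by (auto simp: carrier_std_left)

text \<open>The tensor \<open>x \<otimes> 1\<close>. Since
  \<open>x \<otimes> k = (k x) \<otimes> 1\<close>, every element of the tensor product has this
  form (\<open>ex_pure\<close>), and formal sums of pairs can be replaced by chains.\<close>

abbreviation pure :: "('a list \<Rightarrow>\<^sub>0 int) \<Rightarrow> (('a list \<Rightarrow>\<^sub>0 int) \<times> int) \<Rightarrow>\<^sub>0 int" where
  "pure x \<equiv> frag_of (x, 1)"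

lemma tensor_eq_zero_right:
  assumes "x \<in> carrier (std_left G n)" shows "tensor_eq n (frag_of (x, 0)) 0"
  using tensor_eq_sym [OF tensor_eq_right [OF assms, of 0 0]] p by (simp add: tensor_eq_def)

lemma pure_add:
  "\<lbrakk>x \<in> carrier (std_left G n); x' \<in> carrier (std_left G n)\<rbrakk> \<Longrightarrow> tensor_eq n (pure (x + x')) (pure x + pure x')"
  using tensor_eq_left [of x n x' 1] p by simp

lemma pure_zero: "tensor_eq n (pure 0) 0"
  using tensor_eq_sym [OF pure_add [OF std_left_zero std_left_zero]] by (simp add: tensor_eq_def)

lemma pure_diff:
  assumes "x \<in> carrier (std_left G n)" "x' \<in> carrier (std_left G n)"
  shows "tensor_eq n (pure (x - x')) (pure x - pure x')"
  using tensor_eq_diff [OF tensor_eq_sym [OF pure_add [of "x - x'" n x']] tensor_eq_refl [of n "pure x'"]]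
    assms std_left_closed(2) [OF assms] by simp

text \<open>The scalar crosses the tensor sign one unit at a time. The partial sums have to be
  residues themselves, which is why the induction stays below \<open>p\<close>.\<close>

lemma tensor_eq_pure:
  assumes x: "x \<in> carrier (std_left G n)" and y: "k < p"
  shows "tensor_eq n (frag_of (x, int k)) (pure (frag_cmul (int k) x))"
  using y
proof (induction k)
  case 0
  show ?case using tensor_eq_trans [OF tensor_eq_zero_right [OF x] tensor_eq_sym [OF pure_zero]] by simp
next
  case (Suc k)
  have "tensor_eq n (frag_of (x, int (Suc k))) (frag_of (x, int k) + pure x)"
    using tensor_eq_right [OF x, of "int k" 1] Suc.prems by (simp add: add.commute)
  also have "tensor_eq n (frag_of (x, int k) + pure x) (pure (frag_cmul (int k) x) + pure x)"
    using Suc by (intro tensor_eq_add tensor_eq_refl) simp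
  also have "tensor_eq n (pure (frag_cmul (int k) x) + pure x) (pure (frag_cmul (int k) x + x))"
    by (rule tensor_eq_sym [OF pure_add [OF std_left_cmul [OF x] x]])
  also have "frag_cmul (int k) x + x = frag_cmul (int (Suc k)) x"
    by (simp add: frag_cmul_distrib add.commute)
  finally show ?case .
qed

lemma tensor_eq_pure_int:
  "\<lbrakk>x \<in> carrier (std_left G n); y \<in> {0..int p - 1}\<rbrakk> \<Longrightarrow> tensor_eq n (frag_of (x, y)) (pure (frag_cmul y x))"
  using tensor_eq_pure [of x n "nat y"] by (simp add: nat_less_iff)

lemma pure_p_multiple:
  assumes x: "x \<in> carrier (std_left G n)" shows "tensor_eq n (pure (frag_cmul (int p) x)) 0"
proof -
  \<comment> \<open>\<open>p\<close> is not a residue, so it is split as \<open>p - 1\<close> plus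
    1. Once the summand \<open>p - 1\<close> has moved to the second factor, adding 1 there gives
    0.\<close>
  have e: "frag_cmul (int p) x = frag_cmul (int (p - 1)) x + x"
    using p by (simp add: frag_cmul_distrib [symmetric] of_nat_diff flip: frag_cmul_one)
       (metis add.commute frag_cmul_distrib frag_cmul_one diff_add_cancel)
  have "tensor_eq n (pure (frag_cmul (int p) x)) (pure (frag_cmul (int (p - 1)) x) + pure x)"
    unfolding e by (rule pure_add [OF std_left_cmul [OF x] x])
  also have "tensor_eq n (pure (frag_cmul (int (p - 1)) x) + pure x) (frag_of (x, int (p - 1)) + pure x)"
    using p by (intro tensor_eq_add tensor_eq_refl tensor_eq_sym [OF tensor_eq_pure] x) simp
  also have "tensor_eq n (frag_of (x, int (p - 1)) + pure x) (frag_of (x, 0))"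
    using tensor_eq_sym [OF tensor_eq_right [OF x, of "int (p - 1)" 1]] p by (simp add: of_nat_diff)
  also have "tensor_eq n (frag_of (x, 0)) 0" by (rule tensor_eq_zero_right [OF x])
  finally show ?thesis .
qed

lemma ex_pure:
  assumes "Poly_Mapping.keys c \<subseteq> tensor_keys n"
  shows "\<exists>x\<in>carrier (std_left G n). tensor_eq n c (pure x)"
  using assms
proof (induction c rule: frag_induction)
  case zero
  show ?case using tensor_eq_sym [OF pure_zero] std_left_zero by blast
next
  case (one z)
  then obtain x y where "z = (x, y)" "x \<in> carrier (std_left G n)" "y \<in> {0..int p - 1}" by blast
  then show ?case using tensor_eq_pure_int std_left_cmul by blast
next
  case (diff a b)
  then obtain x y where x: "x \<in> carrier (std_left G n)" "tensor_eq n a (pure x)"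
    and y: "y \<in> carrier (std_left G n)" "tensor_eq n b (pure y)" by blast
  have "tensor_eq n (a - b) (pure (x - y))"
    using tensor_eq_trans [OF tensor_eq_diff [OF x(2) y(2)] tensor_eq_sym [OF pure_diff [OF x(1) y(1)]]] .
  then show ?case using std_left_closed(2) [OF x(1) y(1)] by blast
qed

lemma tensor_smult_rel:
  assumes "c \<in> tensor_rel n"
  shows "frag_extend (\<lambda>(x, y). frag_of (x, (k * y) mod int p)) c \<in> tensor_rel n"
proof -
  let ?h = "frag_extend (\<lambda>(x, y). frag_of (x, (k * y) mod int p))"
  have r: "(k * y) mod int p \<in> {0..int p - 1}" for y using p by simp
  have "tensor_rel n \<subseteq> {c. ?h c \<in> tensor_rel n}"
  proof (rule tensor_rel_subset)
    show "tensor_gens n \<subseteq> {c. ?h c \<in> tensor_rel n}"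
    proof
      fix c assume "c \<in> tensor_gens n"
      then have "?h c \<in> tensor_rel n"
      proof (cases rule: tensor_gens_cases)
        case (left x x' y)
        then show ?thesis
          using tensor_eq_left [OF left(1,2) r [of y]] by (simp add: frag_extend_diff frag_extend_add tensor_eq_def diff_diff_eq)
      next
        case (right x y y')
        have "(k * ((y + y') mod int p)) mod int p = ((k * y) mod int p + (k * y') mod int p) mod int p"
          by (simp add: mod_simps distrib_left)
        then show ?thesis
          using tensor_eq_right [OF right(1) r [of y] r [of y']] right(4) by (simp add: frag_extend_diff frag_extend_add tensor_eq_def diff_diff_eq)
      next
        case (balanced s x y)
        have "(k * ((augmentation s * y) mod int p)) mod int p = (augmentation s * ((k * y) mod int p)) mod int p"
          by (simp add: mod_simps mult.left_commute)
        then show ?thesis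
          using tensor_eq_balanced [OF balanced(1,2) r [of y]] balanced(4) by (simp add: frag_extend_diff tensor_eq_def)
      qed
      then show "c \<in> {c. ?h c \<in> tensor_rel n}" by simp
    qed
  qed (simp_all add: tensor_rel_closed frag_extend_diff)
  with assms show ?thesis by blast
qed

lemma module_quotient_tensor: "module_quotient (tensor_pre n) (tensor_rel n) (carrier (Fp p))"
proof (rule module_quotient.intro)
  show ab: "abelian_group (tensor_pre n)"
    by (rule abelian_group_frag [of _ "tensor_keys n"]) (simp_all add: tensor_pre_simps fun_eq_iff)
  interpret abelian_group "tensor_pre n" by (rule ab)
  show "module_quotient_axioms (tensor_pre n) (tensor_rel n) (carrier (Fp p))"
  proof (rule module_quotient_axioms.intro)
    show "additive_subgroup (tensor_rel n) (tensor_pre n)"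
    proof (rule additive_subgroup.intro, rule add.subgroupI)
      show "tensor_rel n \<subseteq> carrier (tensor_pre n)" using tensor_rel_keys by (auto simp: tensor_pre_simps)
      show "tensor_rel n \<noteq> {}" using tensor_rel_closed(1) by blast
      fix c assume c: "c \<in> tensor_rel n"
      have "\<ominus>\<^bsub>tensor_pre n\<^esub> c = - c"
        using tensor_rel_keys [OF c] by (intro minus_equality) (simp_all add: tensor_pre_simps)
      then show "\<ominus>\<^bsub>tensor_pre n\<^esub> c \<in> tensor_rel n" using tensor_rel_closed(3) [OF c] by simp
      show "c \<oplus>\<^bsub>tensor_pre n\<^esub> d \<in> tensor_rel n" if "d \<in> tensor_rel n" for d
        using tensor_rel_closed(2) [OF c that] by (simp add: tensor_pre_simps)
    qed
  next
    fix k c assume "c \<in> carrier (tensor_pre n)"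
    then have c: "Poly_Mapping.keys c \<subseteq> tensor_keys n" by (simp add: tensor_pre_simps)
    show "k \<odot>\<^bsub>tensor_pre n\<^esub> c \<in> carrier (tensor_pre n)"
      unfolding tensor_pre_simps mem_Collect_eq
      by (rule keys_frag_extend_subset [OF c]) (use p in auto)
  qed (simp_all add: tensor_pre_simps frag_extend_add tensor_smult_rel)
qed

definition tclass :: "nat \<Rightarrow> ((('a list \<Rightarrow>\<^sub>0 int) \<times> int) \<Rightarrow>\<^sub>0 int) \<Rightarrow> ((('a list \<Rightarrow>\<^sub>0 int) \<times> int) \<Rightarrow>\<^sub>0 int) set" where
  "tclass n c = tensor_rel n +>\<^bsub>tensor_pre n\<^esub> c"

abbreviation pclass where "pclass n x \<equiv> tclass n (pure x)"

lemma tensor_quotient: "tensor n = quotient_module (tensor_pre n) (tensor_rel n)"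
  by (simp add: tensor_module_def)

lemma pure_keys: "x \<in> carrier (std_left G n) \<Longrightarrow> Poly_Mapping.keys (pure x) \<subseteq> tensor_keys n"
  using p by simp

lemma tclass_eq_iff:
  assumes "Poly_Mapping.keys c \<subseteq> tensor_keys n" "Poly_Mapping.keys d \<subseteq> tensor_keys n"
  shows "tclass n c = tclass n d \<longleftrightarrow> tensor_eq n c d"
proof -
  interpret Q: module_quotient "tensor_pre n" "tensor_rel n" "carrier (Fp p)" by (rule module_quotient_tensor)
  have "\<ominus>\<^bsub>tensor_pre n\<^esub> d = - d"
    using assms(2) by (intro Q.minus_equality) (simp_all add: tensor_pre_simps)
  then show ?thesis
    using Q.coset_eq_iff [of c d] assms
    by (simp add: tclass_def tensor_eq_def tensor_pre_simps a_minus_def)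
qed

lemma pclass_eq_iff:
  "\<lbrakk>x \<in> carrier (std_left G n); y \<in> carrier (std_left G n)\<rbrakk> \<Longrightarrow> pclass n x = pclass n y \<longleftrightarrow> tensor_eq n (pure x) (pure y)"
  by (intro tclass_eq_iff pure_keys)

lemma carrier_tensor: "carrier (tensor n) = pclass n ` carrier (std_left G n)"
proof -
  interpret Q: module_quotient "tensor_pre n" "tensor_rel n" "carrier (Fp p)" by (rule module_quotient_tensor)
  have "carrier (tensor n) = tclass n ` {c. Poly_Mapping.keys c \<subseteq> tensor_keys n}"
    unfolding tensor_quotient Q.carrier_quotient tclass_def tensor_pre_simps by blast
  also have "\<dots> = pclass n ` carrier (std_left G n)"
  proof (intro equalityI subsetI)
    fix U assume "U \<in> tclass n ` {c. Poly_Mapping.keys c \<subseteq> tensor_keys n}"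
    then obtain c where c: "Poly_Mapping.keys c \<subseteq> tensor_keys n" "U = tclass n c" by blast
    obtain x where x: "x \<in> carrier (std_left G n)" "tensor_eq n c (pure x)" using ex_pure [OF c(1)] by blast
    then have "U = pclass n x" using tclass_eq_iff [OF c(1) pure_keys [OF x(1)]] c(2) by simp
    then show "U \<in> pclass n ` carrier (std_left G n)" using x(1) by blast
  qed (use pure_keys in blast)
  finally show ?thesis .
qed

lemma tclass_add:
  "\<lbrakk>Poly_Mapping.keys c \<subseteq> tensor_keys n; Poly_Mapping.keys d \<subseteq> tensor_keys n\<rbrakk> \<Longrightarrow>
   tclass n c \<oplus>\<^bsub>tensor n\<^esub> tclass n d = tclass n (c + d)"
  using module_quotient.add_quotient [OF module_quotient_tensor, of c n d]
  by (simp add: tclass_def tensor_quotient tensor_pre_simps)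

lemma pclass_add:
  assumes "x \<in> carrier (std_left G n)" "y \<in> carrier (std_left G n)"
  shows "pclass n x \<oplus>\<^bsub>tensor n\<^esub> pclass n y = pclass n (x + y)"
proof -
  have "Poly_Mapping.keys (pure x + pure y) \<subseteq> tensor_keys n"
    using Poly_Mapping.keys_add [of "pure x" "pure y"] pure_keys [OF assms(1)] pure_keys [OF assms(2)] by blast
  then show ?thesis
    using tclass_add [OF pure_keys [OF assms(1)] pure_keys [OF assms(2)]] tensor_eq_sym [OF pure_add [OF assms]]
      tclass_eq_iff pure_keys [OF std_left_closed(1) [OF assms]] by simp
qed

lemma pclass_smult:
  assumes "k \<in> carrier (Fp p)" "x \<in> carrier (std_left G n)"
  shows "k \<odot>\<^bsub>tensor n\<^esub> pclass n x = pclass n (frag_cmul k x)"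
proof -
  have k: "0 \<le> k" "k < int p" using assms(1) by auto
  have "k \<odot>\<^bsub>tensor n\<^esub> pclass n x = tclass n (frag_of (x, k))"
    using module_quotient.smult_quotient [OF module_quotient_tensor assms(1), of "pure x" n] pure_keys [OF assms(2)] k
    by (simp add: tclass_def tensor_quotient tensor_pre_simps)
  also have "\<dots> = pclass n (frag_cmul k x)"
    using tensor_eq_pure_int [OF assms(2), of k] k assms(2) p
    by (subst tclass_eq_iff) (simp_all add: pure_keys std_left_cmul)
  finally show ?thesis .
qed

lemma pclass_zero: "pclass n 0 = \<zero>\<^bsub>tensor n\<^esub>"
proof -
  interpret Q: module_quotient "tensor_pre n" "tensor_rel n" "carrier (Fp p)" by (rule module_quotient_tensor)
  have "pclass n 0 = tclass n 0"
    using pure_zero p by (subst tclass_eq_iff) (simp_all add: pure_keys std_left_zero)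
  then show ?thesis using Q.zero_quotient by (simp add: tensor_quotient tclass_def tensor_pre_simps)
qed

lemma pclass_eq_mod_p:
  assumes "x \<in> carrier (std_left G n)" "y \<in> carrier (std_left G n)" "x = y + frag_cmul (int p) z" "z \<in> carrier (std_left G n)"
  shows "pclass n x = pclass n y"
proof -
  have "tensor_eq n (pure x) (pure y + pure (frag_cmul (int p) z))"
    unfolding assms(3) by (rule pure_add [OF assms(2) std_left_cmul [OF assms(4)]])
  also have "tensor_eq n (pure y + pure (frag_cmul (int p) z)) (pure y + 0)"
    by (intro tensor_eq_add tensor_eq_refl pure_p_multiple assms(4))
  finally show ?thesis using pclass_eq_iff [OF assms(1,2)] by simp
qed

lemma pclass_cmul_mod:
  assumes "x \<in> carrier (std_left G n)"
  shows "pclass n (frag_cmul (k mod int p) x) = pclass n (frag_cmul k x)"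
proof (rule sym, rule pclass_eq_mod_p)
  show "frag_cmul k x = frag_cmul (k mod int p) x + frag_cmul (int p) (frag_cmul (k div int p) x)"
    by (simp add: frag_cmul_distrib [symmetric])
qed (use assms in \<open>simp_all add: std_left_cmul\<close>)

lemma fp_module_tensor:
  assumes "prime p" shows "fp_module p (tensor n)"
proof (rule fp_module.intro, rule lmodule.intro)
  interpret residues "int p" "Fp p" using p by unfold_locales simp_all
  show "ring (Fp p)" by (rule ring_axioms)
  show "abelian_group (tensor n)"
    unfolding tensor_quotient by (rule module_quotient.abelian_group_quotient [OF module_quotient_tensor])
  show "fp_module_axioms p" using assms by (rule fp_module_axioms.intro)
  show "lmodule_axioms (Fp p) (tensor n)"
  proof (rule lmodule_axioms.intro)
    fix a U assume a: "a \<in> carrier (Fp p)" and "U \<in> carrier (tensor n)"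
    then obtain x where x: "x \<in> carrier (std_left G n)" "U = pclass n x" by (auto simp: carrier_tensor)
    show "a \<odot>\<^bsub>tensor n\<^esub> U \<in> carrier (tensor n)"
      unfolding x(2) pclass_smult [OF a x(1)] carrier_tensor using std_left_cmul [OF x(1)] by blast
    { fix b assume b: "b \<in> carrier (Fp p)"
      have ab: "(a + b) mod int p \<in> carrier (Fp p)" "(a * b) mod int p \<in> carrier (Fp p)" using p by simp_all
      show "(a \<oplus>\<^bsub>Fp p\<^esub> b) \<odot>\<^bsub>tensor n\<^esub> U = a \<odot>\<^bsub>tensor n\<^esub> U \<oplus>\<^bsub>tensor n\<^esub> b \<odot>\<^bsub>tensor n\<^esub> U"
        using pclass_cmul_mod [OF x(1), of "a + b"]
        by (simp only: x(2) residue_ring_simps pclass_smult [OF a x(1)] pclass_smult [OF b x(1)] pclass_smult [OF ab(1) x(1)]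
            pclass_add [OF std_left_cmul [OF x(1)] std_left_cmul [OF x(1)]] frag_cmul_distrib)
      show "(a \<otimes>\<^bsub>Fp p\<^esub> b) \<odot>\<^bsub>tensor n\<^esub> U = a \<odot>\<^bsub>tensor n\<^esub> (b \<odot>\<^bsub>tensor n\<^esub> U)"
        using pclass_cmul_mod [OF x(1), of "a * b"]
        by (simp only: x(2) residue_ring_simps pclass_smult [OF b x(1)] pclass_smult [OF a std_left_cmul [OF x(1)]]
            pclass_smult [OF ab(2) x(1)] frag_cmul_cmul) }
    { fix V assume "V \<in> carrier (tensor n)"
      then obtain y where y: "y \<in> carrier (std_left G n)" "V = pclass n y" by (auto simp: carrier_tensor)
      show "a \<odot>\<^bsub>tensor n\<^esub> (U \<oplus>\<^bsub>tensor n\<^esub> V) = a \<odot>\<^bsub>tensor n\<^esub> U \<oplus>\<^bsub>tensor n\<^esub> a \<odot>\<^bsub>tensor n\<^esub> V"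
        by (simp only: x(2) y(2) pclass_add [OF x(1) y(1)] pclass_smult [OF a x(1)] pclass_smult [OF a y(1)]
            pclass_smult [OF a std_left_closed(1) [OF x(1) y(1)]] frag_cmul_distrib2
            pclass_add [OF std_left_cmul [OF x(1)] std_left_cmul [OF y(1)]]) }
  next
    fix U assume "U \<in> carrier (tensor n)"
    then obtain x where x: "x \<in> carrier (std_left G n)" "U = pclass n x" by (auto simp: carrier_tensor)
    have one: "(1::int) \<in> carrier (Fp p)" using p by simp
    show "\<one>\<^bsub>Fp p\<^esub> \<odot>\<^bsub>tensor n\<^esub> U = U"
      using pclass_smult [OF one x(1)] by (simp add: x(2))
  qed
qed

end


lemma is_submodule_kernel_image:
  assumes M: "fp_module p M" and A: "fp_module p A" and f: "f \<in> lmod_hom (Fp p) M A"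
  shows "is_submodule (Fp p) M {x \<in> carrier M. f x = \<zero>\<^bsub>A\<^esub>}" and "is_submodule (Fp p) A (f ` carrier M)"
proof -
  interpret M: fp_module p M by (rule M)
  interpret A: fp_module p A by (rule A)
  have f': "f \<in> carrier M \<rightarrow> carrier A"
    "\<And>x y. \<lbrakk>x \<in> carrier M; y \<in> carrier M\<rbrakk> \<Longrightarrow> f (x \<oplus>\<^bsub>M\<^esub> y) = f x \<oplus>\<^bsub>A\<^esub> f y"
    "\<And>k x. \<lbrakk>k \<in> carrier (Fp p); x \<in> carrier M\<rbrakk> \<Longrightarrow> f (k \<odot>\<^bsub>M\<^esub> x) = k \<odot>\<^bsub>A\<^esub> f x"
    using f unfolding lmod_hom_def by blast+
  have zero: "f \<zero>\<^bsub>M\<^esub> = \<zero>\<^bsub>A\<^esub>"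
    by (rule additive_map_zero [OF M.M.abelian_group_axioms A.M.abelian_group_axioms f'(1,2)])
  have k0: "k \<odot>\<^bsub>A\<^esub> \<zero>\<^bsub>A\<^esub> = \<zero>\<^bsub>A\<^esub>" if "k \<in> carrier (Fp p)" for k
    using A.submodule_zero that unfolding is_submodule_def by blast
  show "is_submodule (Fp p) M {x \<in> carrier M. f x = \<zero>\<^bsub>A\<^esub>}"
    using zero f' k0 unfolding is_submodule_def by (auto simp del: residue_ring_simps)
  show "is_submodule (Fp p) A (f ` carrier M)"
    unfolding is_submodule_def
  proof (intro conjI ballI)
    show "f ` carrier M \<subseteq> carrier A" using f'(1) by blast
    show "\<zero>\<^bsub>A\<^esub> \<in> f ` carrier M" using zero M.M.zero_closed by (metis image_eqI)
    fix x assume "x \<in> f ` carrier M"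
    then obtain a where a: "x = f a" "a \<in> carrier M" by (rule imageE)
    { fix y assume "y \<in> f ` carrier M"
      then obtain b where b: "y = f b" "b \<in> carrier M" by (rule imageE)
      show "x \<oplus>\<^bsub>A\<^esub> y \<in> f ` carrier M"
        using f'(2) [OF a(2) b(2)] a b M.M.a_closed by (metis image_eqI) }
    fix k assume k: "k \<in> carrier (Fp p)"
    show "k \<odot>\<^bsub>A\<^esub> x \<in> f ` carrier M"
      using f'(3) [OF k a(2)] a M.lsmult_closed [OF k a(2)] by (metis image_eqI)
  qed
qed

section \<open>The differential of the tensor complex and its duality with cochains\<close>

context group_mod
begin

abbreviation tmap where
  "tmap n \<equiv> tensor_map (group_ring G) (std_left G n) TM (monoid.mult (Fp p)) (std_diff n)"

lemma std_diff_hom: "std_diff n \<in> lmod_hom (group_ring G) (std_left G (Suc n)) (std_left G n)"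
  using free_resolution_std_left unfolding free_resolution_def by blast

lemma std_diff_add:
  "\<lbrakk>x \<in> carrier (std_left G (Suc n)); y \<in> carrier (std_left G (Suc n))\<rbrakk> \<Longrightarrow> std_diff n (x + y) = std_diff n x + std_diff n y"
  by (simp add: std_diff_def frag_extend_add)

lemma std_diff_cmul: "std_diff n (frag_cmul k x) = frag_cmul k (std_diff n x)"
  by (simp add: std_diff_def frag_extend_cmul)

lemma std_diff_smult:
  "\<lbrakk>r \<in> carrier (group_ring G); x \<in> carrier (std_left G (Suc n))\<rbrakk> \<Longrightarrow>
   std_diff n (r \<odot>\<^bsub>std_left G (Suc n)\<^esub> x) = r \<odot>\<^bsub>std_left G n\<^esub> std_diff n x"
  using std_diff_hom unfolding lmod_hom_def by blast

lemma std_diff_std_diff: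
  assumes "x \<in> carrier (std_left G (Suc (Suc n)))" shows "std_diff n (std_diff (Suc n) x) = 0"
  using std_diff_closed [OF assms] std_diff_closed(2) [OF std_diff_closed(1) [OF assms]]
  by (simp add: boundary_boundary)

lemma tensor_diff_rel:
  assumes "c \<in> tensor_rel (Suc n)"
  shows "frag_extend (\<lambda>(x, y). frag_of (std_diff n x, y)) c \<in> tensor_rel n"
proof -
  let ?h = "frag_extend (\<lambda>(x, y). frag_of (std_diff n x, y))"
  have "tensor_rel (Suc n) \<subseteq> {c. ?h c \<in> tensor_rel n}"
  proof (rule tensor_rel_subset)
    show "tensor_gens (Suc n) \<subseteq> {c. ?h c \<in> tensor_rel n}"
    proof
      fix c assume "c \<in> tensor_gens (Suc n)"
      then have "?h c \<in> tensor_rel n"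
      proof (cases rule: tensor_gens_cases)
        case (left x x' y)
        then show ?thesis
          using tensor_eq_left [OF std_diff_closed(1) [OF left(1)] std_diff_closed(1) [OF left(2)] left(3)]
          by (simp add: frag_extend_diff frag_extend_add tensor_eq_def diff_diff_eq std_diff_add)
      next
        case (right x y y')
        then show ?thesis
          using tensor_eq_right [OF std_diff_closed(1) [OF right(1)] right(2,3)]
          by (simp add: frag_extend_diff frag_extend_add tensor_eq_def diff_diff_eq)
      next
        case (balanced r x y)
        then show ?thesis
          using tensor_eq_balanced [OF balanced(1) std_diff_closed(1) [OF balanced(2)] balanced(3)]
          by (simp add: frag_extend_diff tensor_eq_def std_diff_smult)
      qed
      then show "c \<in> {c. ?h c \<in> tensor_rel n}" by simp
    qed
  qed (simp_all add: tensor_rel_closed frag_extend_diff)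
  with assms show ?thesis by blast
qed

text \<open>\<open>tensor_map\<close> is a union over all representatives of a class. Two of them
  differ by a relation, which the differential maps to a relation, so the union is a single
  coset.\<close>

lemma tmap_pclass:
  assumes x: "x \<in> carrier (std_left G (Suc n))"
  shows "tmap n (pclass (Suc n) x) = pclass n (std_diff n x)"
proof -
  let ?h = "frag_extend (\<lambda>(x, y). frag_of (std_diff n x, y))"
  note dx = std_diff_closed(1) [OF x]
  have "tclass n (?h c) = pclass n (std_diff n x)" if c: "c \<in> pclass (Suc n) x" for c
  proof -
    obtain r where r: "r \<in> tensor_rel (Suc n)" "c = r + pure x"
      using c by (auto simp: tclass_def a_r_coset_def' tensor_pre_simps)
    have hr: "?h r \<in> tensor_rel n" by (rule tensor_diff_rel [OF r(1)])
    have hc: "?h c = ?h r + pure (std_diff n x)" by (simp add: r(2) frag_extend_add)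
    have "Poly_Mapping.keys (?h c) \<subseteq> tensor_keys n"
      unfolding hc using Poly_Mapping.keys_add [of "?h r" "pure (std_diff n x)"] tensor_rel_keys [OF hr] pure_keys [OF dx]
      by blast
    moreover have "tensor_eq n (?h c) (pure (std_diff n x))"
      using hr by (simp add: hc tensor_eq_def)
    ultimately show ?thesis
      using tclass_eq_iff [OF _ pure_keys [OF dx]] by blast
  qed
  moreover have "pure x \<in> pclass (Suc n) x"
    using tensor_rel_closed(1) [of "Suc n"] by (force simp: tclass_def a_r_coset_def' tensor_pre_simps)
  moreover have "tmap n (pclass (Suc n) x) = (\<Union>c\<in>pclass (Suc n) x. tclass n (?h c))"
    by (simp add: tensor_map_def tclass_def)
  ultimately show ?thesis by auto
qed

lemma tmap_hom: "tmap n \<in> lmod_hom (Fp p) (tensor (Suc n)) (tensor n)"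
  unfolding lmod_hom_def
proof (intro CollectI conjI ballI funcsetI)
  fix U assume "U \<in> carrier (tensor (Suc n))"
  then obtain x where x: "U = pclass (Suc n) x" "x \<in> carrier (std_left G (Suc n))"
    unfolding carrier_tensor by (rule imageE)
  note dx = std_diff_closed(1) [OF x(2)]
  show "tmap n U \<in> carrier (tensor n)"
    unfolding x(1) tmap_pclass [OF x(2)] carrier_tensor using dx by blast
  { fix V assume "V \<in> carrier (tensor (Suc n))"
    then obtain y where y: "V = pclass (Suc n) y" "y \<in> carrier (std_left G (Suc n))"
      unfolding carrier_tensor by (rule imageE)
    show "tmap n (U \<oplus>\<^bsub>tensor (Suc n)\<^esub> V) = tmap n U \<oplus>\<^bsub>tensor n\<^esub> tmap n V"
      by (simp only: x(1) y(1) pclass_add [OF x(2) y(2)] tmap_pclass [OF x(2)] tmap_pclass [OF y(2)]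
          tmap_pclass [OF std_left_closed(1) [OF x(2) y(2)]] std_diff_add [OF x(2) y(2)]
          pclass_add [OF dx std_diff_closed(1) [OF y(2)]]) }
  fix k assume k: "k \<in> carrier (Fp p)"
  show "tmap n (k \<odot>\<^bsub>tensor (Suc n)\<^esub> U) = k \<odot>\<^bsub>tensor n\<^esub> tmap n U"
    by (simp only: x(1) pclass_smult [OF k x(2)] tmap_pclass [OF x(2)] tmap_pclass [OF std_left_cmul [OF x(2)]]
        pclass_smult [OF k dx] std_diff_cmul)
qed

lemma finite_simplices: assumes "finite (carrier G)" shows "finite (simplices n)"
proof -
  have "simplices n = {xs. set xs \<subseteq> carrier G \<and> length xs = Suc n}" by (auto simp: simplices_def)
  then show ?thesis using finite_lists_length_eq [OF assms] by simp
qed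

text \<open>Multiples of \<open>p\<close> vanish after tensoring, so only the residues of the
  coefficients matter, and there are finitely many simplices to carry them.\<close>

lemma finite_tensor:
  assumes "finite (carrier G)" shows "finite (carrier (tensor n))"
proof -
  note fin = finite_simplices [OF assms, of n]
  let ?s = "\<lambda>a. \<Sum>xs\<in>simplices n. frag_cmul (a xs) (frag_of xs)"
  have closed: "?s a \<in> carrier (std_left G n)" for a
  proof -
    have "Poly_Mapping.keys (?s a) \<subseteq> (\<Union>xs\<in>simplices n. Poly_Mapping.keys (frag_cmul (a xs) (frag_of xs)))"
      by (rule Poly_Mapping.keys_sum)
    also have "\<dots> \<subseteq> simplices n" by auto
    finally show ?thesis by (simp add: carrier_std_left)
  qed
  have "carrier (tensor n) \<subseteq> (\<lambda>a. pclass n (?s a)) ` (simplices n \<rightarrow>\<^sub>E {0..<int p})"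
  proof
    fix U assume "U \<in> carrier (tensor n)"
    then obtain x where x: "U = pclass n x" "x \<in> carrier (std_left G n)"
      unfolding carrier_tensor by (rule imageE)
    let ?a = "\<lambda>xs\<in>simplices n. Poly_Mapping.lookup x xs mod int p"
    have keys: "Poly_Mapping.keys x \<subseteq> simplices n" using x(2) by (simp add: carrier_std_left)
    have "x = ?s (Poly_Mapping.lookup x)"
    proof -
      have "x = frag_extend frag_of x" by (simp add: frag_extend_id)
      also have "\<dots> = ?s (Poly_Mapping.lookup x)"
        unfolding frag_extend_def using keys fin
        by (intro sum.mono_neutral_left) (auto simp: in_keys_iff)
      finally show ?thesis .
    qed
    also have "\<dots> = ?s ?a + frag_cmul (int p) (?s (\<lambda>xs. Poly_Mapping.lookup x xs div int p))"
      using fin by (simp add: frag_cmul_sum sum.distrib [symmetric] frag_cmul_distrib [symmetric] o_def)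
    finally have "pclass n x = pclass n (?s ?a)"
      by (rule pclass_eq_mod_p [OF x(2) closed _ closed])
    moreover have "?a \<in> simplices n \<rightarrow>\<^sub>E {0..<int p}" using p by auto
    ultimately show "U \<in> (\<lambda>a. pclass n (?s a)) ` (simplices n \<rightarrow>\<^sub>E {0..<int p})"
      using x(1) by blast
  qed
  then show ?thesis
    by (rule finite_subset) (intro finite_imageI finite_PiE fin, simp)
qed

lemma finite_cochains:
  assumes "finite (carrier G)" shows "finite (carrier (group_cochains p G n))"
proof -
  let ?r = "\<lambda>f. restrict (on_basis f) (simplices n)"
  have "?r ` carrier (group_cochains p G n) \<subseteq> simplices n \<rightarrow>\<^sub>E {0..<int p}"
    by (auto simp: cochains_iff frag_of_std_left)
  moreover have "finite (simplices n \<rightarrow>\<^sub>E {0..<int p})"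
    by (intro finite_PiE finite_simplices assms) simp
  moreover have "inj_on ?r (carrier (group_cochains p G n))"
  proof (rule inj_onI)
    fix f g assume f: "f \<in> carrier (group_cochains p G n)" and g: "g \<in> carrier (group_cochains p G n)"
      and eq: "?r f = ?r g"
    have "on_basis f xs = on_basis g xs" if "xs \<in> simplices n" for xs
      using fun_cong [OF eq, of xs] that by simp
    then have "cochain_of p G n (on_basis f) = cochain_of p G n (on_basis g)"
      by (simp add: cochain_of_eq_iff)
    then show "f = g" using cochain_of_on_basis f g by simp
  qed
  ultimately show ?thesis using inj_on_finite by blast
qed

text \<open>The bilinear pairing \<open>(x, y) \<mapsto> f x * y\<close>, extended to formal sums,
  is divisible by \<open>p\<close> on each kind of generator of the relations; for the balanced ones
  this is the equivariance of \<open>f\<close>. Hence \<open>f x\<close> and \<open>f y\<close> are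
  congruent, and equal because both lie between 0 and \<open>p - 1\<close>.\<close>

lemma cochain_respects_pclass:
  assumes f: "f \<in> carrier (group_cochains p G n)" and x: "x \<in> carrier (std_left G n)" "y \<in> carrier (std_left G n)"
    and eq: "pclass n x = pclass n y"
  shows "f x = f y"
proof -
  note f' = f [unfolded cochains_iff]
  let ?L = "pairing (\<lambda>(x, y). f x * y)"
  have cong: "int p dvd (a mod int p) * y - a * y" for a y
    by (metis cong_iff_dvd_diff cong_mod_left cong_refl cong_scalar_right)
  have "tensor_rel n \<subseteq> {c. int p dvd ?L c}"
  proof (rule tensor_rel_subset)
    show "tensor_gens n \<subseteq> {c. int p dvd ?L c}"
    proof
      fix c assume "c \<in> tensor_gens n"
      then have "int p dvd ?L c"
      proof (cases rule: tensor_gens_cases)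
        case (left x x' y)
        then have "f (x + x') = (f x + f x') mod int p" using f' by blast
        then show ?thesis
          using cong [of "f x + f x'" y] left(4) by (simp add: pairing_diff pairing_add diff_diff_eq distrib_right)
      next
        case (right x y y')
        then show ?thesis
          using cong [of "y + y'" "f x"] by (simp add: right(4) pairing_diff pairing_add diff_diff_eq distrib_left mult.commute)
      next
        case (balanced r x y)
        then have "f (r \<odot>\<^bsub>std_left G n\<^esub> x) = (augmentation r * f x) mod int p" using f' by blast
        moreover have "int p dvd ((augmentation r * f x) mod int p) * y - augmentation r * f x * y"
          "int p dvd ((augmentation r * y) mod int p) * f x - augmentation r * y * f x"
          by (rule cong)+
        ultimately show ?thesis
          using dvd_diff [of "int p" "((augmentation r * f x) mod int p) * y - augmentation r * f x * y"
              "((augmentation r * y) mod int p) * f x - augmentation r * y * f x"] balanced(4)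
          by (simp add: pairing_diff mult_ac)
      qed
      then show "c \<in> {c. int p dvd ?L c}" by simp
    qed
  qed (simp_all add: pairing_diff)
  moreover have "pure x - pure y \<in> tensor_rel n"
    using eq pclass_eq_iff [OF x] by (simp add: tensor_eq_def)
  ultimately have "int p dvd f x - f y" by (auto simp: pairing_diff)
  then have "[f x = f y] (mod int p)" by (simp add: cong_iff_dvd_diff)
  moreover have "0 \<le> f x" "f x < int p" "0 \<le> f y" "f y < int p" using f' x by blast+
  ultimately show ?thesis by (simp add: cong_less_imp_eq_int)
qed

text \<open>The adjunction between tensor product and homomorphisms: a functional
  \<open>\<eta>\<close> corresponds to the cochain
  \<open>x \<mapsto> \<eta> (x \<otimes> 1)\<close>. The vanishing condition on \<open>U\<close> is
  carried along so that cochains and cocycles are counted by the same statement.\<close>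

lemma card_functionals:
  "card {\<eta> \<in> lmod_hom (Fp p) (tensor n) (Fp_module p) \<inter> extensional (carrier (tensor n)). \<forall>u\<in>U. \<eta> u = 0} =
   card {f \<in> carrier (group_cochains p G n). \<forall>x\<in>carrier (std_left G n). pclass n x \<in> U \<longrightarrow> f x = 0}"
  if U: "U \<subseteq> carrier (tensor n)"
proof -
  let ?L = "{\<eta> \<in> lmod_hom (Fp p) (tensor n) (Fp_module p) \<inter> extensional (carrier (tensor n)). \<forall>u\<in>U. \<eta> u = 0}"
  let ?C = "{f \<in> carrier (group_cochains p G n). \<forall>x\<in>carrier (std_left G n). pclass n x \<in> U \<longrightarrow> f x = 0}"
  let ?F = "carrier (std_left G n)"
  let ?\<Theta> = "\<lambda>\<eta>. \<lambda>x\<in>?F. \<eta> (pclass n x)"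
  have pc: "pclass n x \<in> carrier (tensor n)" if "x \<in> ?F" for x using that by (simp add: carrier_tensor)
  have "bij_betw ?\<Theta> ?L ?C"
  proof (rule bij_betw_imageI)
    show "inj_on ?\<Theta> ?L"
    proof (rule inj_onI)
      fix \<eta> \<mu> assume l: "\<eta> \<in> ?L" "\<mu> \<in> ?L" and eq: "?\<Theta> \<eta> = ?\<Theta> \<mu>"
      show "\<eta> = \<mu>"
      proof (rule extensionalityI [of _ "carrier (tensor n)"])
        fix V assume "V \<in> carrier (tensor n)"
        then obtain x where "V = pclass n x" "x \<in> ?F" unfolding carrier_tensor by (rule imageE)
        then show "\<eta> V = \<mu> V" using fun_cong [OF eq, of x] by simp
      qed (use l in blast)+
    qed
    show "?\<Theta> ` ?L = ?C"
    proof (intro equalityI subsetI)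
      fix f assume "f \<in> ?\<Theta> ` ?L"
      then obtain \<eta> where f: "f = ?\<Theta> \<eta>" and "\<eta> \<in> ?L" by (rule imageE)
      then have l: "\<eta> \<in> lmod_hom (Fp p) (tensor n) (Fp_module p)" "\<forall>u\<in>U. \<eta> u = 0" by blast+
      have range: "0 \<le> \<eta> V \<and> \<eta> V < int p" if "V \<in> carrier (tensor n)" for V
      proof -
        have "\<eta> V \<in> carrier (Fp_module p)" using l(1) that unfolding lmod_hom_def by blast
        then show ?thesis by (auto simp: Fp_module_def)
      qed
      have add: "\<eta> (pclass n (x + y)) = (\<eta> (pclass n x) + \<eta> (pclass n y)) mod int p" if "x \<in> ?F" "y \<in> ?F" for x y
      proof -
        have "\<eta> (pclass n x \<oplus>\<^bsub>tensor n\<^esub> pclass n y) = \<eta> (pclass n x) \<oplus>\<^bsub>Fp_module p\<^esub> \<eta> (pclass n y)"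
          using l(1) pc that unfolding lmod_hom_def by blast
        then show ?thesis by (simp add: pclass_add that Fp_module_def)
      qed
      have smult: "\<eta> (pclass n (frag_cmul k x)) = (k * \<eta> (pclass n x)) mod int p" if "x \<in> ?F" for k x
      proof -
        have k: "k mod int p \<in> carrier (Fp p)" using p by simp
        have "\<eta> ((k mod int p) \<odot>\<^bsub>tensor n\<^esub> pclass n x) = (k mod int p) \<odot>\<^bsub>Fp_module p\<^esub> \<eta> (pclass n x)"
          using l(1) pc [OF that] k unfolding lmod_hom_def by blast
        then show ?thesis
          by (simp add: pclass_smult [OF k that] pclass_cmul_mod [OF that] Fp_module_def mod_simps)
      qed
      have "f \<in> carrier (group_cochains p G n)"
        unfolding cochains_iff
      proof (intro conjI ballI)
        fix a c assume a: "a \<in> carrier (group_ring G)" and c: "c \<in> ?F"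
        have ac: "a \<odot>\<^bsub>std_left G n\<^esub> c \<in> ?F" using a c by (rule std_left_smult_closed)
        have r: "augmentation a mod int p \<in> {0..int p - 1}" using p by simp
        \<comment> \<open>Equivariance of the cochain: \<open>a\<close> moves across the tensor
          sign, acts there on 1 by its augmentation, and the resulting scalar moves back.\<close>
        have "tensor_eq n (pure (a \<odot>\<^bsub>std_left G n\<^esub> c)) (frag_of (c, augmentation a mod int p))"
          using tensor_eq_balanced [OF a c, of 1] p by simp
        also have "tensor_eq n (frag_of (c, augmentation a mod int p)) (pure (frag_cmul (augmentation a mod int p) c))"
          by (rule tensor_eq_pure_int [OF c r])
        finally have "pclass n (a \<odot>\<^bsub>std_left G n\<^esub> c) = pclass n (frag_cmul (augmentation a mod int p) c)"
          using pclass_eq_iff [OF ac std_left_cmul [OF c]] by blast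
        then show "f (a \<odot>\<^bsub>std_left G n\<^esub> c) = (augmentation a * f c) mod int p"
          using c ac smult [OF c] by (simp add: f mod_simps)
      qed (use range pc add in \<open>auto simp: f std_left_closed\<close>)
      then show "f \<in> ?C" using l(2) by (simp add: f)
    next
      fix f assume "f \<in> ?C"
      then have f: "f \<in> carrier (group_cochains p G n)" "\<forall>x\<in>?F. pclass n x \<in> U \<longrightarrow> f x = 0" by blast+
      note f' = f(1) [unfolded cochains_iff]
      define \<eta> where "\<eta> = (\<lambda>V\<in>carrier (tensor n). f (SOME x. x \<in> ?F \<and> V = pclass n x))"
      have l: "\<eta> (pclass n x) = f x" if "x \<in> ?F" for x
      proof -
        define z where "z = (SOME z. z \<in> ?F \<and> pclass n x = pclass n z)"
        have "z \<in> ?F \<and> pclass n x = pclass n z"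
          unfolding z_def by (rule someI [of _ x]) (simp add: \<open>x \<in> ?F\<close>)
        then have "f z = f x"
          using cochain_respects_pclass [OF f(1) _ \<open>x \<in> ?F\<close>, of z] by simp
        then show ?thesis
          by (simp add: \<eta>_def pc [OF \<open>x \<in> ?F\<close>] z_def)
      qed
      have "\<eta> \<in> lmod_hom (Fp p) (tensor n) (Fp_module p)"
        unfolding lmod_hom_def
      proof (intro CollectI conjI ballI funcsetI)
        fix V assume "V \<in> carrier (tensor n)"
        then obtain x where x: "V = pclass n x" "x \<in> ?F" unfolding carrier_tensor by (rule imageE)
        then show "\<eta> V \<in> carrier (Fp_module p)" using f' l by (simp add: Fp_module_def)
        { fix W assume "W \<in> carrier (tensor n)"
          then obtain y where y: "W = pclass n y" "y \<in> ?F" unfolding carrier_tensor by (rule imageE)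
          show "\<eta> (V \<oplus>\<^bsub>tensor n\<^esub> W) = \<eta> V \<oplus>\<^bsub>Fp_module p\<^esub> \<eta> W"
            using x y f' l by (simp add: pclass_add std_left_closed Fp_module_def) }
        fix k assume k: "k \<in> carrier (Fp p)"
        have "f (frag_cmul k x) = (k * f x) mod int p"
        proof -
          have "f c = pairing (on_basis f) c mod int p" if "c \<in> ?F" for c
            using fun_cong [OF cochain_of_on_basis [OF f(1)], of c] that by (simp add: cochain_of_def)
          then show ?thesis using x(2) std_left_cmul [OF x(2)] by (simp add: pairing_cmul mod_simps)
        qed
        then show "\<eta> (k \<odot>\<^bsub>tensor n\<^esub> V) = k \<odot>\<^bsub>Fp_module p\<^esub> \<eta> V"
          using x l pclass_smult [OF k x(2)] std_left_cmul [OF x(2)] by (simp add: Fp_module_def)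
      qed
      moreover have "\<eta> u = 0" if "u \<in> U" for u
      proof -
        have "u \<in> carrier (tensor n)" using U \<open>u \<in> U\<close> by blast
        then obtain x where "u = pclass n x" "x \<in> ?F" unfolding carrier_tensor by (rule imageE)
        then show ?thesis using f(2) l \<open>u \<in> U\<close> by simp
      qed
      moreover have "\<eta> \<in> extensional (carrier (tensor n))" by (simp add: \<eta>_def)
      ultimately have "\<eta> \<in> ?L" by blast
      moreover have "f = ?\<Theta> \<eta>"
        by (rule extensionalityI [of _ ?F]) (use f' l in auto)
      ultimately show "f \<in> ?\<Theta> ` ?L" by blast
    qed
  qed
  then show ?thesis by (rule bij_betw_same_card)
qed

end


section \<open>Cardinalities of homology and cohomology\<close>

context group_mod
begin

lemma tmap_tmap:
  assumes "U \<in> carrier (tensor (Suc (Suc n)))"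
  shows "tmap n (tmap (Suc n) U) = \<zero>\<^bsub>tensor n\<^esub>"
proof -
  obtain x where x: "U = pclass (Suc (Suc n)) x" "x \<in> carrier (std_left G (Suc (Suc n)))"
    using assms unfolding carrier_tensor by (rule imageE)
  show ?thesis
    by (simp only: x(1) tmap_pclass [OF x(2)] tmap_pclass [OF std_diff_closed(1) [OF x(2)]]
        std_diff_std_diff [OF x(2)] pclass_zero)
qed

abbreviation tensor_cycles where "tensor_cycles n \<equiv> cycles tensor tmap n"
abbreviation tensor_boundaries where "tensor_boundaries n \<equiv> tmap n ` carrier (tensor (Suc n))"

context
  assumes prime: "prime p"
begin

lemma submodule_boundaries: "is_submodule (Fp p) (tensor n) (tensor_boundaries n)"
  by (rule is_submodule_kernel_image(2) [OF fp_module_tensor [OF prime] fp_module_tensor [OF prime] tmap_hom])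

lemma submodule_cycles: "is_submodule (Fp p) (tensor n) (tensor_cycles n)"
proof (cases n)
  case 0
  interpret fp_module p "tensor 0" by (rule fp_module_tensor [OF prime])
  show ?thesis unfolding 0 by (simp add: cycles_def is_submodule_def del: residue_ring_simps)
next
  case (Suc k)
  then show ?thesis
    using is_submodule_kernel_image(1) [OF fp_module_tensor [OF prime] fp_module_tensor [OF prime] tmap_hom [of k]]
    by (simp add: cycles_def)
qed

lemma boundaries_subset_cycles: "tensor_boundaries n \<subseteq> tensor_cycles n"
proof (cases n)
  case 0
  then show ?thesis using submodule_boundaries [of 0] by (simp add: cycles_def is_submodule_def)
next
  case (Suc k)
  then show ?thesis
    using submodule_boundaries [of n] tmap_tmap [of _ k] by (auto simp: cycles_def is_submodule_def)
qed

lemma submodule_boundaries_cycles: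
  "is_submodule (Fp p) ((tensor n)\<lparr>carrier := tensor_cycles n\<rparr>) (tensor_boundaries n)"
  using submodule_boundaries [of n] boundaries_subset_cycles [of n] by (simp add: is_submodule_def)

lemma fp_module_chain_homology: "fp_module p (chain_homology tensor tmap n)"
  unfolding chain_homology_def
  by (rule fp_module_quotient(2) [OF fp_module_submodule [OF fp_module_tensor [OF prime] submodule_cycles]
      submodule_boundaries_cycles])

lemma card_chain_homology:
  "card (carrier (chain_homology tensor tmap n)) * card (tensor_boundaries n) = card (tensor_cycles n)"
  unfolding chain_homology_def
  using module_quotient.card_quotient [OF fp_module_quotient(1)
      [OF fp_module_submodule [OF fp_module_tensor [OF prime] submodule_cycles] submodule_boundaries_cycles]]
  by simp

lemma abelian_group_tensor: "abelian_group (tensor n)"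
  by (rule lmodule.axioms(2) [OF fp_module.axioms(1) [OF fp_module_tensor [OF prime]]])

lemma abelian_group_cochains: "abelian_group (group_cochains p G n)"
proof (rule abelian_groupI)
  have inv0: "invariant (\<lambda>_. 0)" by (simp add: invariant_cochain_def)
  show "\<zero>\<^bsub>group_cochains p G n\<^esub> \<in> carrier (group_cochains p G n)"
    using cochain_of_closed [OF inv0] by (simp only: cochain_of_zero)
next
  fix f assume f: "f \<in> carrier (group_cochains p G n)"
  note f' = cochain_of_on_basis [OF f] invariant_on_basis [OF f]
  show "\<zero>\<^bsub>group_cochains p G n\<^esub> \<oplus>\<^bsub>group_cochains p G n\<^esub> f = f"
    using cochain_of_add [of n "\<lambda>_. 0" "on_basis f"] f'(1) by (simp add: cochain_of_zero)
  have "cochain_of p G n (\<lambda>xs. - 1 * on_basis f xs) \<oplus>\<^bsub>group_cochains p G n\<^esub> f = \<zero>\<^bsub>group_cochains p G n\<^esub>"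
    using cochain_of_add [of n "\<lambda>xs. - 1 * on_basis f xs" "on_basis f"] f'(1) by (simp add: cochain_of_zero)
  then show "\<exists>g\<in>carrier (group_cochains p G n). g \<oplus>\<^bsub>group_cochains p G n\<^esub> f = \<zero>\<^bsub>group_cochains p G n\<^esub>"
    using cochain_of_closed [OF invariant_cochain_cmul [OF f'(2), of "- 1"]] by blast
  fix g assume g: "g \<in> carrier (group_cochains p G n)"
  note g' = cochain_of_on_basis [OF g] invariant_on_basis [OF g]
  show "f \<oplus>\<^bsub>group_cochains p G n\<^esub> g \<in> carrier (group_cochains p G n)"
    using cochain_of_add [of n "on_basis f" "on_basis g"] f' g' cochain_of_closed [OF invariant_cochain_add [OF f'(2) g'(2)]]
    by simp
  show "f \<oplus>\<^bsub>group_cochains p G n\<^esub> g = g \<oplus>\<^bsub>group_cochains p G n\<^esub> f"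
    by (simp add: cochains_simps add.commute)
qed (auto simp: cochains_simps mod_simps add.assoc)

context
  assumes fin: "finite (carrier G)"
begin

text \<open>A cochain is a cocycle exactly when the functional it defines on the tensor complex
  kills the boundaries, so \<open>card_annihilator\<close> applies to the submodule of
  boundaries.\<close>

lemma card_cocycles: "card (group_cocycles p G n) * card (tensor_boundaries n) = card (carrier (tensor n))"
proof -
  have "{f \<in> carrier (group_cochains p G n). \<forall>x\<in>carrier (std_left G n). pclass n x \<in> tensor_boundaries n \<longrightarrow> f x = 0} =
      group_cocycles p G n"
  proof -
    have "(\<forall>x\<in>carrier (std_left G n). pclass n x \<in> tensor_boundaries n \<longrightarrow> f x = 0) \<longleftrightarrow>
        hom_differential (std_left G) std_diff n f = \<zero>\<^bsub>group_cochains p G (Suc n)\<^esub>"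
      if f: "f \<in> carrier (group_cochains p G n)" for f
    proof
      assume *: "\<forall>x\<in>carrier (std_left G n). pclass n x \<in> tensor_boundaries n \<longrightarrow> f x = 0"
      have "f (std_diff n z) = 0" if z: "z \<in> carrier (std_left G (Suc n))" for z
      proof -
        have "pclass (Suc n) z \<in> carrier (tensor (Suc n))" using z by (simp add: carrier_tensor)
        then have "pclass n (std_diff n z) \<in> tensor_boundaries n"
          using tmap_pclass [OF z] by (metis image_eqI)
        then show ?thesis using * std_diff_closed(1) [OF z] by blast
      qed
      then show "hom_differential (std_left G) std_diff n f = \<zero>\<^bsub>group_cochains p G (Suc n)\<^esub>"
        by (auto simp: hom_differential_def cochains_simps)
    next
      assume *: "hom_differential (std_left G) std_diff n f = \<zero>\<^bsub>group_cochains p G (Suc n)\<^esub>"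
      show "\<forall>x\<in>carrier (std_left G n). pclass n x \<in> tensor_boundaries n \<longrightarrow> f x = 0"
      proof (intro ballI impI)
        fix x assume x: "x \<in> carrier (std_left G n)" and "pclass n x \<in> tensor_boundaries n"
        then obtain U where U: "pclass n x = tmap n U" "U \<in> carrier (tensor (Suc n))" by blast
        obtain z where z: "U = pclass (Suc n) z" "z \<in> carrier (std_left G (Suc n))"
          using U(2) unfolding carrier_tensor by (rule imageE)
        have "f x = f (std_diff n z)"
          using cochain_respects_pclass [OF f x std_diff_closed(1) [OF z(2)]] U(1) z(1) tmap_pclass [OF z(2)] by simp
        also have "\<dots> = 0" using fun_cong [OF *, of z] z(2) by (simp add: hom_differential_def cochains_simps)
        finally show "f x = 0" .
      qed
    qed
    then show ?thesis unfolding cocycles_def by blast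
  qed
  then show ?thesis
    using card_annihilator [OF fp_module_tensor [OF prime] finite_tensor [OF fin] submodule_boundaries [of n]]
      card_functionals [of "tensor_boundaries n" n] submodule_boundaries [of n] by (simp add: is_submodule_def)
qed

text \<open>The same count for the zero submodule, on which every cochain vanishes.\<close>

lemma card_cochains: "card (carrier (group_cochains p G n)) = card (carrier (tensor n))"
proof -
  interpret fp_module p "tensor n" by (rule fp_module_tensor [OF prime])
  have "f x = 0" if f: "f \<in> carrier (group_cochains p G n)" and x: "x \<in> carrier (std_left G n)"
    and eq: "pclass n x \<in> {\<zero>\<^bsub>tensor n\<^esub>}" for f x
  proof -
    have "f x = f 0"
      using cochain_respects_pclass [OF f x std_left_zero] eq pclass_zero by simp
    also have "\<dots> = 0"
      using fun_cong [OF cochain_of_on_basis [OF f], of 0] std_left_zero by (simp add: cochain_of_def)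
    finally show ?thesis .
  qed
  then have "{f \<in> carrier (group_cochains p G n). \<forall>x\<in>carrier (std_left G n). pclass n x \<in> {\<zero>\<^bsub>tensor n\<^esub>} \<longrightarrow> f x = 0} =
      carrier (group_cochains p G n)" by blast
  then show ?thesis
    using card_annihilator [OF fp_module_tensor [OF prime] finite_tensor [OF fin] submodule_zero]
      card_functionals [of "{\<zero>\<^bsub>tensor n\<^esub>}" n] by simp
qed

lemma card_cycles: "card (tensor_cycles (Suc n)) * card (tensor_boundaries n) = card (carrier (tensor (Suc n)))"
proof -
  have tmap: "tmap n \<in> carrier (tensor (Suc n)) \<rightarrow> carrier (tensor n)"
    "\<And>U V. \<lbrakk>U \<in> carrier (tensor (Suc n)); V \<in> carrier (tensor (Suc n))\<rbrakk> \<Longrightarrow>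
      tmap n (U \<oplus>\<^bsub>tensor (Suc n)\<^esub> V) = tmap n U \<oplus>\<^bsub>tensor n\<^esub> tmap n V"
    using tmap_hom [of n] unfolding lmod_hom_def by blast+
  have "tensor_cycles (Suc n) = {U \<in> carrier (tensor (Suc n)). tmap n U = \<zero>\<^bsub>tensor n\<^esub>}"
    by (simp add: cycles_def)
  then show ?thesis
    by (simp only:) (rule card_kernel_image [OF abelian_group_tensor abelian_group_tensor finite_tensor [OF fin] tmap(1)],
      rule tmap(2))
qed

lemma card_coboundaries:
  "card (group_cocycles p G n) * card (group_coboundaries p G (Suc n)) = card (carrier (group_cochains p G n))"
proof -
  let ?d = "hom_differential (std_left G) std_diff n"
  have closed: "?d \<in> carrier (group_cochains p G n) \<rightarrow> carrier (group_cochains p G (Suc n))"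
  proof
    fix f assume "f \<in> carrier (group_cochains p G n)"
    then have "?d f \<in> group_coboundaries p G (Suc n)" by (simp add: coboundaries_def)
    then show "?d f \<in> carrier (group_cochains p G (Suc n))" by (simp add: coboundaries_iff)
  qed
  have add: "?d (f \<oplus>\<^bsub>group_cochains p G n\<^esub> g) = ?d f \<oplus>\<^bsub>group_cochains p G (Suc n)\<^esub> ?d g" for f g
    using std_diff_closed(1) by (auto simp: hom_differential_def cochains_simps)
  have "group_cocycles p G n = {f \<in> carrier (group_cochains p G n). ?d f = \<zero>\<^bsub>group_cochains p G (Suc n)\<^esub>}"
    "group_coboundaries p G (Suc n) = ?d ` carrier (group_cochains p G n)"
    by (simp_all add: cocycles_def coboundaries_def)
  then show ?thesis
    by (simp only:) (rule card_kernel_image [OF abelian_group_cochains abelian_group_cochains finite_cochains [OF fin] closed],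
      rule add)
qed

lemma finite_chain_homology: "finite (carrier (chain_homology tensor tmap n))"
proof -
  have "finite (tensor_cycles n)"
    using submodule_cycles [of n] finite_tensor [OF fin, of n] by (auto simp: is_submodule_def intro: finite_subset)
  then show ?thesis
    unfolding chain_homology_def
    using module_quotient.carrier_quotient [OF fp_module_quotient(1)
        [OF fp_module_submodule [OF fp_module_tensor [OF prime] submodule_cycles] submodule_boundaries_cycles]]
    by simp
qed

lemma card_cohomology:
  "card (carrier (group_cohomology p G n)) * card (group_coboundaries p G n) = card (group_cocycles p G n)"
  using module_quotient.card_quotient [OF module_quotient_cohomology] by (simp add: group_cohomology_eq)

text \<open>For \<open>n > 0\<close> both sides are the size of \<open>tensor n\<close> divided by
  the numbers of boundaries in degrees \<open>n\<close> and \<open>n - 1\<close>. On the cohomology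
  side this uses that there are as many coboundaries in degree \<open>n\<close> as boundaries in
  degree \<open>n - 1\<close>. In degree 0 all chains are cycles and only zero is a
  coboundary.\<close>

theorem card_homology_eq_cohomology:
  "card (carrier (chain_homology tensor tmap n)) = card (carrier (group_cohomology p G n))"
proof -
  \<comment> \<open>The quotients are handled by cancelling products, which needs finite nonempty
    sets of boundaries.\<close>
  have pos: "card (tensor_boundaries k) > 0" for k
    using finite_tensor [OF fin, of "Suc k"] abelian_group_tensor [of "Suc k"]
    by (auto simp: card_gt_0_iff dest: abelian_monoid.zero_closed [OF abelian_group.axioms(1)])
  show ?thesis
  proof (cases n)
    case 0
    have "card (carrier (chain_homology tensor tmap 0)) * card (tensor_boundaries 0) =
        card (group_cocycles p G 0) * card (tensor_boundaries 0)"
      using card_chain_homology [of 0] card_cocycles [of 0] by (simp add: cycles_def)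
    moreover have "card (carrier (group_cohomology p G 0)) = card (group_cocycles p G 0)"
      using card_cohomology [of 0] by (simp add: coboundaries_def)
    ultimately show ?thesis using pos [of 0] 0 by simp
  next
    case (Suc k)
    have "card (group_cocycles p G k) > 0"
      using card_cocycles [of k] finite_tensor [OF fin, of k] abelian_group_tensor [of k]
      by (metis abelian_group.axioms(1) abelian_monoid.zero_closed card_gt_0_iff empty_iff mult_is_0 neq0_conv)
    moreover have "card (group_cocycles p G k) * card (tensor_boundaries k) =
        card (group_cocycles p G k) * card (group_coboundaries p G (Suc k))"
      using card_cocycles [of k] card_cochains [of k] card_coboundaries [of k] by simp
    ultimately have b: "card (group_coboundaries p G (Suc k)) = card (tensor_boundaries k)" by simp
    let ?h = "card (carrier (chain_homology tensor tmap n))" and ?c = "card (carrier (group_cohomology p G n))"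
    have "(?h * card (tensor_boundaries n)) * card (tensor_boundaries k) =
        (?c * card (group_coboundaries p G n)) * card (tensor_boundaries n)"
      using card_chain_homology [of n] card_cycles [of k] card_cocycles [of n] card_cohomology [of n] Suc by simp
    then have "?h * (card (tensor_boundaries n) * card (tensor_boundaries k)) =
        ?c * (card (tensor_boundaries n) * card (tensor_boundaries k))"
      using b Suc by (simp add: mult_ac)
    then show ?thesis using pos [of n] pos [of k] by simp
  qed
qed

end

end

end


subsection \<open>The opposite group\<close>

definition opposite :: "('a, 'x) monoid_scheme \<Rightarrow> ('a, 'x) monoid_scheme" where
  "opposite G = G\<lparr>monoid.mult := \<lambda>x y. y \<otimes>\<^bsub>G\<^esub> x\<rparr>"

lemma opposite_simps [simp]:
  "carrier (opposite G) = carrier G" "\<one>\<^bsub>opposite G\<^esub> = \<one>\<^bsub>G\<^esub>" "x \<otimes>\<^bsub>opposite G\<^esub> y = y \<otimes>\<^bsub>G\<^esub> x"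
  by (simp_all add: opposite_def)

lemma inv_opposite [simp]: "inv\<^bsub>opposite G\<^esub> x = inv\<^bsub>G\<^esub> x"
  by (simp add: m_inv_def conj_commute)

lemma opposite_carrier: "(opposite G)\<lparr>carrier := S\<rparr> = opposite (G\<lparr>carrier := S\<rparr>)"
  by (simp add: opposite_def)

lemma group_opposite: assumes "group G" shows "group (opposite G)"
proof -
  interpret G: group G by (rule assms)
  show ?thesis
  proof (rule groupI)
    fix x assume "x \<in> carrier (opposite G)"
    then have "inv\<^bsub>G\<^esub> x \<in> carrier (opposite G)" "inv\<^bsub>G\<^esub> x \<otimes>\<^bsub>opposite G\<^esub> x = \<one>\<^bsub>opposite G\<^esub>" by simp_all
    then show "\<exists>y\<in>carrier (opposite G). y \<otimes>\<^bsub>opposite G\<^esub> x = \<one>\<^bsub>opposite G\<^esub>" by blast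
  qed (simp_all add: G.m_assoc)
qed

lemma subgroup_opposite [simp]: "subgroup P (opposite G) \<longleftrightarrow> subgroup P G"
  by (auto simp: subgroup_def)

lemma hom_opposite [simp]: "hom (opposite A) (opposite B) = hom A B"
  by (auto simp: hom_def)

text \<open>Conjugation by \<open>g\<close> in the opposite group is conjugation by
  \<open>inv g\<close> in \<open>G\<close>.\<close>

lemma subconjugation_opposite:
  assumes "group G" "P \<subseteq> carrier G"
  shows "subconjugation (opposite G) P Q f \<longleftrightarrow> subconjugation G P Q f"
proof -
  interpret G: group G by (rule assms)
  have "(\<exists>g\<in>carrier G. \<forall>x\<in>P. f x = inv\<^bsub>G\<^esub> g \<otimes>\<^bsub>G\<^esub> (x \<otimes>\<^bsub>G\<^esub> g)) \<longleftrightarrow> (\<exists>g\<in>carrier G. \<forall>x\<in>P. f x = g \<otimes>\<^bsub>G\<^esub> x \<otimes>\<^bsub>G\<^esub> inv\<^bsub>G\<^esub> g)"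
  proof (intro iffI; elim bexE)
    fix g assume g: "g \<in> carrier G" "\<forall>x\<in>P. f x = inv\<^bsub>G\<^esub> g \<otimes>\<^bsub>G\<^esub> (x \<otimes>\<^bsub>G\<^esub> g)"
    then show "\<exists>g\<in>carrier G. \<forall>x\<in>P. f x = g \<otimes>\<^bsub>G\<^esub> x \<otimes>\<^bsub>G\<^esub> inv\<^bsub>G\<^esub> g"
      using assms(2) by (intro bexI [of _ "inv\<^bsub>G\<^esub> g"]) (auto simp: G.m_assoc)
  next
    fix g assume g: "g \<in> carrier G" "\<forall>x\<in>P. f x = g \<otimes>\<^bsub>G\<^esub> x \<otimes>\<^bsub>G\<^esub> inv\<^bsub>G\<^esub> g"
    then show "\<exists>g\<in>carrier G. \<forall>x\<in>P. f x = inv\<^bsub>G\<^esub> g \<otimes>\<^bsub>G\<^esub> (x \<otimes>\<^bsub>G\<^esub> g)"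
      using assms(2) by (intro bexI [of _ "inv\<^bsub>G\<^esub> g"]) (auto simp: G.m_assoc)
  qed
  then show ?thesis by (simp add: subconjugation_def opposite_carrier)
qed

text \<open>Subgroups, homomorphisms between them and subconjugations are the same for a group and
  its opposite, so the same \<open>\<alpha>\<close> serves.\<close>

lemma p_locally_equivalent_opposite:
  assumes "group G" "group H" "p_locally_equivalent p G H"
  shows "p_locally_equivalent p (opposite G) (opposite H)"
proof -
  obtain S R \<alpha> where S: "sylow_subgroup p G S" and R: "sylow_subgroup p H R"
    and \<alpha>: "\<alpha> \<in> iso (G\<lparr>carrier := S\<rparr>) (H\<lparr>carrier := R\<rparr>)"
    and fusion: "\<forall>P Q f. subgroup P (G\<lparr>carrier := S\<rparr>) \<and> subgroup Q (G\<lparr>carrier := S\<rparr>) \<and>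
                 f \<in> hom (G\<lparr>carrier := P\<rparr>) (G\<lparr>carrier := Q\<rparr>) \<longrightarrow>
           (subconjugation G P Q f \<longleftrightarrow>
            subconjugation H (\<alpha> ` P) (\<alpha> ` Q) (\<lambda>y. \<alpha> (f (inv_into S \<alpha> y))))"
    using assms(3) unfolding p_locally_equivalent_def by blast
  have "\<alpha> ` S = R" using \<alpha> by (simp add: iso_def bij_betw_def)
  have sub: "P \<subseteq> carrier G" "\<alpha> ` P \<subseteq> carrier H" if "subgroup P (G\<lparr>carrier := S\<rparr>)" for P
  proof -
    have PS: "P \<subseteq> S" using subgroup.subset [OF that] by simp
    moreover have "S \<subseteq> carrier G" "R \<subseteq> carrier H"
      using S R by (auto simp: sylow_subgroup_def dest: subgroup.subset)
    ultimately show "P \<subseteq> carrier G" "\<alpha> ` P \<subseteq> carrier H" using \<open>\<alpha> ` S = R\<close> by blast+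
  qed
  show ?thesis
    unfolding p_locally_equivalent_def
  proof (intro exI conjI allI impI)
    show "sylow_subgroup p (opposite G) S" "sylow_subgroup p (opposite H) R"
      using S R by (simp_all add: sylow_subgroup_def order_def)
    show "\<alpha> \<in> iso ((opposite G)\<lparr>carrier := S\<rparr>) ((opposite H)\<lparr>carrier := R\<rparr>)"
      using \<alpha> by (simp add: iso_def opposite_carrier)
  next
    fix P Q f
    assume "subgroup P ((opposite G)\<lparr>carrier := S\<rparr>) \<and> subgroup Q ((opposite G)\<lparr>carrier := S\<rparr>) \<and>
      f \<in> hom ((opposite G)\<lparr>carrier := P\<rparr>) ((opposite G)\<lparr>carrier := Q\<rparr>)"
    then have P: "subgroup P (G\<lparr>carrier := S\<rparr>)" "subgroup Q (G\<lparr>carrier := S\<rparr>)"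
      "f \<in> hom (G\<lparr>carrier := P\<rparr>) (G\<lparr>carrier := Q\<rparr>)" by (simp_all add: opposite_carrier)
    then show "subconjugation (opposite G) P Q f \<longleftrightarrow>
        subconjugation (opposite H) (\<alpha> ` P) (\<alpha> ` Q) (\<lambda>y. \<alpha> (f (inv_into S \<alpha> y)))"
      using fusion subconjugation_opposite [OF assms(1) sub(1) [OF P(1)]]
        subconjugation_opposite [OF assms(2) sub(2) [OF P(1)]] by simp
  qed
qed

text \<open>The relations refer to the group ring through its carrier only; the order of
  multiplication enters through the modules \<open>M\<close> and \<open>N\<close>.\<close>

lemma tensor_relations_opposite:
  "tensor_relations (group_ring (opposite G)) M N = tensor_relations (group_ring G) M N"
  by (simp add: tensor_relations_def group_ring_def)

text \<open>Right multiplication on tuples of \<open>G\<close> is left multiplication in the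
  opposite group, so the resolution by right modules over \<open>G\<close> is the resolution by left
  modules over \<open>opposite G\<close>, to which the count above applies.\<close>

lemma group_homology_eq_opposite:
  "group_homology p G n = chain_homology
     (\<lambda>n. tensor_module (group_ring (opposite G)) (std_left (opposite G) n) (trivial_module (Fp p)) (monoid.mult (Fp p)))
     (\<lambda>n. tensor_map (group_ring (opposite G)) (std_left (opposite G) n) (trivial_module (Fp p)) (monoid.mult (Fp p)) (std_diff n)) n"
proof -
  have "std_right G = std_left (opposite G)"
    by (simp add: fun_eq_iff std_right_def std_left_def)
  then show ?thesis
    by (simp add: group_homology_def Tor_module_def tensor_module_def [abs_def] tensor_map_def [abs_def]
        tensor_relations_opposite)
qed

lemma isomorphic_group_cohomology:
  assumes "prime p" "group G" "finite (carrier G)" "group H" "finite (carrier H)" "p_locally_equivalent p G H"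
  shows "isomorphic_modules (Fp p) (group_cohomology p G n) (group_cohomology p H n)"
    and "isomorphic_graded_algebras (Fp p) (cohomology_algebra p G) (cohomology_algebra p H)"
proof -
  have p: "1 < p" using assms(1) by (rule prime_gt_1_nat)
  obtain S R \<alpha> \<beta> where "fusion_equivalence G H S R \<alpha> \<beta> (int p)"
    using p_locally_equivalent_imp_fusion_equivalence [OF assms] by blast
  then interpret fusion_equivalence_mod G H S R \<alpha> \<beta> p
    using p by (intro fusion_equivalence_mod.intro fusion_equivalence_mod_axioms.intro)
  show "isomorphic_modules (Fp p) (group_cohomology p G n) (group_cohomology p H n)"
    by (rule isomorphic_cohomology)
  show "isomorphic_graded_algebras (Fp p) (cohomology_algebra p G) (cohomology_algebra p H)"
    by (rule isomorphic_cohomology_algebras)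
qed

lemma group_homology_card:
  assumes "prime p" "group G" "finite (carrier G)"
  shows "fp_module p (group_homology p G n)" and "finite (carrier (group_homology p G n))"
    and "card (carrier (group_homology p G n)) = card (carrier (group_cohomology p (opposite G) n))"
proof -
  have p: "1 < p" using assms(1) by (rule prime_gt_1_nat)
  interpret O: group_mod "opposite G" p
    using group_opposite [OF assms(2)] p by (intro group_mod.intro group_mod_axioms.intro)
  have fin: "finite (carrier (opposite G))" using assms(3) by simp
  show "fp_module p (group_homology p G n)"
    unfolding group_homology_eq_opposite by (rule O.fp_module_chain_homology [OF assms(1)])
  show "finite (carrier (group_homology p G n))"
    unfolding group_homology_eq_opposite by (rule O.finite_chain_homology [OF assms(1) fin])
  show "card (carrier (group_homology p G n)) = card (carrier (group_cohomology p (opposite G) n))"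
    unfolding group_homology_eq_opposite by (rule O.card_homology_eq_cohomology [OF assms(1) fin])
qed

theorem mainTheorem3:
  fixes p :: nat
    and G :: "('a, 'x) monoid_scheme"
    and H :: "('b, 'y) monoid_scheme"
  assumes "prime p"
    and "group G" and "finite (carrier G)"
    and "group H" and "finite (carrier H)"
    and "p_locally_equivalent p G H"
  shows "(\<forall>n. isomorphic_modules (Fp p) (group_homology p G n) (group_homology p H n)) \<and>
         (\<forall>n. isomorphic_modules (Fp p) (group_cohomology p G n) (group_cohomology p H n)) \<and>
         isomorphic_graded_algebras (Fp p) (cohomology_algebra p G) (cohomology_algebra p H)"
proof (intro conjI allI)
  fix n
  show "isomorphic_modules (Fp p) (group_cohomology p G n) (group_cohomology p H n)"
    using assms by (rule isomorphic_group_cohomology)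
  \<comment> \<open>The opposite groups are again \<open>p\<close>-locally equivalent, so the
    cohomological statement already proved can be used for them.\<close>
  have "isomorphic_modules (Fp p) (group_cohomology p (opposite G) n) (group_cohomology p (opposite H) n)"
    using assms by (intro isomorphic_group_cohomology group_opposite p_locally_equivalent_opposite) simp_all
  then have "card (carrier (group_cohomology p (opposite G) n)) = card (carrier (group_cohomology p (opposite H) n))"
    unfolding isomorphic_modules_def by (blast dest: bij_betw_same_card)
  then have "card (carrier (group_homology p G n)) = card (carrier (group_homology p H n))"
    by (simp only: group_homology_card(3) [OF assms(1-3)] group_homology_card(3) [OF assms(1,4,5)])
  then show "isomorphic_modules (Fp p) (group_homology p G n) (group_homology p H n)"
    by (rule isomorphic_modules_of_card_eq [OF group_homology_card(1,2) [OF assms(1-3)]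
        group_homology_card(1,2) [OF assms(1,4,5)]])
next
  show "isomorphic_graded_algebras (Fp p) (cohomology_algebra p G) (cohomology_algebra p H)"
    using assms by (rule isomorphic_group_cohomology)
qed

end
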